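(* Let $n\ge2$ and let $u:\mathbb{R}_+\times S^1\to\mathbb{R}^n$ with $u(t,x)\in S^{n-1}$ for a.e. $(t,x)$ satisfy $$u\in L^\infty(\mathbb{R}_+;H^{1/2}(S^1)),\qquad u_t\in L^2(\mathbb{R}_+;L^2(S^1)).$$ Assume that $u$ solves the half-harmonic gradient flow equation $u_t+(-\Delta)^{1/2}u=u\,|d_{1/2}u|^2$. Then for almost every $t>0$ we have $u(t)\in H^1(S^1)$.
   Context: $S^1\simeq\mathbb{R}/2\pi\mathbb{Z}$ carries the distance $|x-y|=2|\sin(\frac{x-y}{2})|$. For $\sigma\ge 0$, $(-\Delta)^\sigma$ acts (in the space variable) as the Fourier multiplier $|k|^{2\sigma}$, $k\in\mathbb{Z}$. For $u\in H^{1/2}(S^1;\mathbb{R}^n)$, $$|d_{1/2}u|^2(x)=\frac1{2\pi}\int_{S^1}\frac{|u(x)-u(y)|^2}{|x-y|^2}\,dy,$$ normalised so that $\int_{S^1}|d_{1/2}u|^2\,dx=\int_{S^1}|(-\Delta)^{1/4}u|^2\,dx$; for time-dependent $u$ it is taken at each fixed time. The equation is meant in the distributional sense: for all $\varphi\in C_c^\infty(]0,\infty[\times S^1;\mathbb{R}^n)$, $$\int_0^\infty\!\!\int_{S^1}\big(u_t\cdot\varphi+(-\Delta)^{1/4}u\cdot(-\Delta)^{1/4}\varphi\big)dx\,dt=\int_0^\infty\!\!\int_{S^1}|d_{1/2}u|^2\,u\cdot\varphi\,dx\,dt .$$ *)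

theory Defs
  imports "HOL-Analysis.Analysis"
begin

(* A function on the circle is given by an angular variable, and its values on
   [0, 2 pi) are the only ones that matter (for test functions, which have to be smooth
   on the circle, periodicity is demanded explicitly). All notions below are invariant
   under modification on a Lebesgue null set. *)

definition circle :: "real measure" where
  "circle = lebesgue_on {0..<2 * pi}"

definition half_line :: "real measure" where
  "half_line = lebesgue_on {0<..}"

(* Lebesgue measure on the product; the product sigma-algebra of the two
   measures above would not be complete. *)
definition space_time :: "(real \<times> real) measure" where
  "space_time = lebesgue_on ({0<..} \<times> {0..<2 * pi})"

definition circle_dist :: "real \<Rightarrow> real \<Rightarrow> real" where
  "circle_dist x y = 2 * \<bar>sin ((x - y) / 2)\<bar>"

definition L2_circle :: "(real \<Rightarrow> real ^ 'n) set" where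
  "L2_circle = {f. f \<in> borel_measurable circle \<and> integrable circle (\<lambda>x. (norm (f x))\<^sup>2)}"

definition fourier_coeff :: "(real \<Rightarrow> real ^ 'n) \<Rightarrow> int \<Rightarrow> complex ^ 'n" where
  "fourier_coeff f k =
     (\<chi> j. (LINT x|circle. complex_of_real (f x $ j) * cis (- (of_int k * x))) / (2 * pi))"

definition sobolev :: "real \<Rightarrow> (real \<Rightarrow> real ^ 'n) set" where
  "sobolev s = {f \<in> L2_circle.
     (\<lambda>k::int. (1 + (of_int k)\<^sup>2) powr s * (norm (fourier_coeff f k))\<^sup>2) summable_on UNIV}"

definition sobolev_norm :: "real \<Rightarrow> (real \<Rightarrow> real ^ 'n) \<Rightarrow> real" where
  "sobolev_norm s f =
     sqrt (\<Sum>\<^sub>\<infinity>k::int. (1 + (of_int k)\<^sup>2) powr s * (norm (fourier_coeff f k))\<^sup>2)"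

(* The symbol |k|^(2 sigma) of (-Laplacian)^sigma. For sigma = 0 the operator is the
   identity, whereas 0 powr 0 = 0. *)
definition frac_symbol :: "real \<Rightarrow> int \<Rightarrow> real" where
  "frac_symbol \<sigma> k = (if \<sigma> = 0 then 1 else \<bar>of_int k\<bar> powr (2 * \<sigma>))"

(* (-Laplacian)^sigma f for f in H^(2 sigma): the function in L^2, unique up to null
   sets, with the prescribed Fourier coefficients. Since a representative is chosen at
   each fixed time separately, joint measurability in (t, x) is not guaranteed for a
   time-dependent f; only integrals in x at fixed time should be formed from it. *)
definition frac_laplacian :: "real \<Rightarrow> (real \<Rightarrow> real ^ 'n) \<Rightarrow> real \<Rightarrow> real ^ 'n" where
  "frac_laplacian \<sigma> f =
     (SOME g. g \<in> L2_circle \<and>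
        (\<forall>k. fourier_coeff g k = frac_symbol \<sigma> k *\<^sub>R fourier_coeff f k))"

(* |d_{1/2} f|^2 (x) *)
definition half_gradient_sq :: "(real \<Rightarrow> real ^ 'n) \<Rightarrow> real \<Rightarrow> real" where
  "half_gradient_sq f x =
     (LINT y|circle. (norm (f x - f y))\<^sup>2 / (circle_dist x y)\<^sup>2) / (2 * pi)"

(* L^infinity(R_+; H^s) and L^2(R_+; L^2). As these target spaces are separable, strong
   measurability in t amounts to measurability in (t, x). *)
definition Linf_sobolev :: "real \<Rightarrow> (real \<Rightarrow> real \<Rightarrow> real ^ 'n) set" where
  "Linf_sobolev s = {u. case_prod u \<in> borel_measurable space_time \<and>
     (\<exists>C. AE t in half_line. u t \<in> sobolev s \<and> sobolev_norm s (u t) \<le> C)}"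

definition L2_L2 :: "(real \<Rightarrow> real \<Rightarrow> real ^ 'n) set" where
  "L2_L2 = {v. case_prod v \<in> borel_measurable space_time \<and>
     (AE t in half_line. v t \<in> L2_circle) \<and>
     integrable half_line (\<lambda>t. LINT x|circle. (norm (v t x))\<^sup>2)}"

fun Ck :: "nat \<Rightarrow> (real \<Rightarrow> real \<Rightarrow> real ^ 'n) \<Rightarrow> bool" where
  "Ck 0 f \<longleftrightarrow> continuous_on UNIV (\<lambda>(t, x). f t x)"
| "Ck (Suc k) f \<longleftrightarrow> continuous_on UNIV (\<lambda>(t, x). f t x) \<and>
     (\<exists>ft fx. Ck k ft \<and> Ck k fx \<and>
        (\<forall>t x. ((\<lambda>s. f s x) has_vector_derivative ft t x) (at t)) \<and>
        (\<forall>t x. (f t has_vector_derivative fx t x) (at x)))"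

(* C_c^infinity(]0, infinity[ x S^1; R^n), the functions being extended by 0 to t \<le> 0. *)
definition test_function :: "(real \<Rightarrow> real \<Rightarrow> real ^ 'n) \<Rightarrow> bool" where
  "test_function \<phi> \<longleftrightarrow>
     (\<forall>k. Ck k \<phi>) \<and>
     (\<forall>t x. \<phi> t (x + 2 * pi) = \<phi> t x) \<and>
     (\<exists>a b. 0 < a \<and> a \<le> b \<and> (\<forall>t x. t \<notin> {a..b} \<longrightarrow> \<phi> t x = 0))"

(* ut is the distributional derivative of u in time; both functions are meant to be
   locally integrable on ]0, infinity[ x S^1. *)
definition weak_time_derivative ::
    "(real \<Rightarrow> real \<Rightarrow> real ^ 'n) \<Rightarrow> (real \<Rightarrow> real \<Rightarrow> real ^ 'n) \<Rightarrow> bool" where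
  "weak_time_derivative u ut \<longleftrightarrow>
     (\<forall>\<phi>. test_function \<phi> \<longrightarrow>
        (LINT t|half_line. LINT x|circle. u t x \<bullet> vector_derivative (\<lambda>s. \<phi> s x) (at t)) =
        - (LINT t|half_line. LINT x|circle. ut t x \<bullet> \<phi> t x))"

definition half_harmonic_flow ::
    "(real \<Rightarrow> real \<Rightarrow> real ^ 'n) \<Rightarrow> (real \<Rightarrow> real \<Rightarrow> real ^ 'n) \<Rightarrow> bool" where
  "half_harmonic_flow u ut \<longleftrightarrow>
     (\<forall>\<phi>. test_function \<phi> \<longrightarrow>
        (LINT t|half_line. LINT x|circle.
           ut t x \<bullet> \<phi> t x + frac_laplacian (1/4) (u t) x \<bullet> frac_laplacian (1/4) (\<phi> t) x) =
        (LINT t|half_line. LINT x|circle.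
           half_gradient_sq (u t) x *\<^sub>R u t x \<bullet> \<phi> t x))"

end

theory Submission
  imports Defs
begin

text \<open>
  Only the equation at almost every fixed time is used. There \<open>\<Lambda> u = u \<Gamma>(u) + f\<close> with \<open>|u| = 1\<close>,
  \<open>\<Lambda> = (-\<Delta>)\<^sup>1\<^sup>/\<^sup>2\<close>, \<open>\<Gamma>(u) = |d\<^bsub>1/2\<^esub> u|\<^sup>2\<close> and \<open>f = - u\<^sub>t\<close> square integrable. With
  \<open>\<delta>u = u(x) - u(y)\<close> and the antisymmetric potential
  \<open>\<Omega>\<^bsub>ij\<^esub> = u\<^sub>i(x) \<delta>u\<^sub>j - u\<^sub>j(x) \<delta>u\<^sub>i\<close>, the constraint \<open>|u| = 1\<close> turns the equation into the linear one
  \<open>\<Lambda> u = A u + f\<close>, where \<open>A\<close> pairs \<open>\<delta>v\<close> with \<open>\<Omega>\<close>, up to a term with the weight \<open>|\<delta>u|\<^sup>2\<close>.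
  As the divergence of \<open>\<Omega>\<close> is \<open>f\<^sub>j u\<^sub>i - f\<^sub>i u\<^sub>j\<close>, one can integrate by parts in \<open>A\<close>. Hence the bilinear
  form of \<open>A\<close> is bounded on \<open>H\<^sup>3\<^sup>/\<^sup>4 \<times> H\<^sup>1\<^sup>/\<^sup>4\<close> and on \<open>H\<^sup>1\<^sup>/\<^sup>4 \<times> H\<^sup>3\<^sup>/\<^sup>4\<close>, in both cases by Sobolev embedding
  alone, without any compensated compactness at the critical exponent \<open>1/2\<close>. The two bounds become
  small on high frequencies because \<open>\<delta>u\<close> is square integrable for \<open>dx dy / |x - y|\<^sup>2\<close>. So the
  high-frequency part of \<open>u\<close> is the fixed point of a map that contracts both \<open>H\<^sup>1\<^sup>/\<^sup>4\<close> and \<open>H\<^sup>3\<^sup>/\<^sup>4\<close>; as it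
  lies in \<open>H\<^sup>1\<^sup>/\<^sup>4\<close>, it lies in \<open>H\<^sup>3\<^sup>/\<^sup>4\<close>. Then \<open>\<Gamma>(u)\<close> is square integrable, and so is \<open>\<Lambda> u\<close>.\<close>


section \<open>Square integrable functions\<close>

text \<open>The exponent 1/2 is the obstacle: \<Gamma>(u) is a priori only integrable, and L^1 does
  not embed into the dual of H^(1/2), so reading the right side as a given function gains nothing.
  The exponents 1/4 and 3/4 come from Hoelder's inequality: |\<delta>u| / |x - y| takes the L^2 norm
  on the torus, which leaves L^4 for \<open>\<phi>\<close> (hence H^(1/4)) and L^4 for the half
  gradient of \<open>v\<close> (hence H^(3/4)). They add up to 1, the order of \<Lambda>, so each is
  dual to the other and each bound is a contraction. Both norms occur because a contraction in
  H^(3/4) says nothing about \<open>u\<close> before \<open>u\<close> is known to lie there; the one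
  in H^(1/4), where \<open>u\<close> does lie, identifies it with the regular solution. The
  potential is paired with the average of \<open>\<phi>\<close> over the two points, because then
  the product rule exchanges \<open>v\<close> and \<open>\<phi>\<close> exactly: the second bound is
  the first with the roles exchanged, plus a term in \<open>f\<close>. The weight |\<delta>u|^2 is
  the price of this averaging.\<close>

definition sq_integrable :: "'a measure \<Rightarrow> ('a \<Rightarrow> complex) \<Rightarrow> bool" where
  "sq_integrable M f \<longleftrightarrow> f \<in> borel_measurable M \<and> integrable M (\<lambda>x. (cmod (f x))\<^sup>2)"

definition L2_norm :: "'a measure \<Rightarrow> ('a \<Rightarrow> complex) \<Rightarrow> real" where
  "L2_norm M f = sqrt (LINT x|M. (cmod (f x))\<^sup>2)"

lemma L2_norm_nonneg [simp]: "0 \<le> L2_norm M f"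
  by (simp add: L2_norm_def)

lemma L2_norm_power2: "(L2_norm M f)\<^sup>2 = (LINT x|M. (cmod (f x))\<^sup>2)"
  by (simp add: L2_norm_def)

lemma sq_integrable_measurable: "sq_integrable M f \<Longrightarrow> f \<in> borel_measurable M"
  by (simp add: sq_integrable_def)

lemma sq_integrable_bound:
  assumes "g \<in> borel_measurable M" "sq_integrable M f"
    and "AE x in M. cmod (g x) \<le> B * cmod (f x)"
  shows "sq_integrable M g"
  unfolding sq_integrable_def
proof
  show "integrable M (\<lambda>x. (cmod (g x))\<^sup>2)"
  proof (rule Bochner_Integration.integrable_bound)
    show "integrable M (\<lambda>x. B\<^sup>2 * (cmod (f x))\<^sup>2)"
      using assms(2) by (auto simp: sq_integrable_def)
    show "(\<lambda>x. (cmod (g x))\<^sup>2) \<in> borel_measurable M"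
      using assms(1) by measurable
    show "AE x in M. norm ((cmod (g x))\<^sup>2) \<le> norm (B\<^sup>2 * (cmod (f x))\<^sup>2)"
      using assms(3)
    proof eventually_elim
      case (elim x)
      have "(cmod (g x))\<^sup>2 \<le> (B * cmod (f x))\<^sup>2"
        by (rule power_mono) (use elim in auto)
      then show ?case by (simp add: power_mult_distrib abs_mult)
    qed
  qed
qed (use assms in simp)

lemma sq_integrable_add:
  assumes "sq_integrable M f" "sq_integrable M g"
  shows "sq_integrable M (\<lambda>x. f x + g x)"
  unfolding sq_integrable_def
proof
  have m: "f \<in> borel_measurable M" "g \<in> borel_measurable M"
    using assms by (auto simp: sq_integrable_def)
  show "(\<lambda>x. f x + g x) \<in> borel_measurable M" using m by measurable
  show "integrable M (\<lambda>x. (cmod (f x + g x))\<^sup>2)"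
  proof (rule Bochner_Integration.integrable_bound)
    show "integrable M (\<lambda>x. 2 * (cmod (f x))\<^sup>2 + 2 * (cmod (g x))\<^sup>2)"
      using assms by (auto simp: sq_integrable_def)
    show "(\<lambda>x. (cmod (f x + g x))\<^sup>2) \<in> borel_measurable M" using m by measurable
    show "AE x in M. norm ((cmod (f x + g x))\<^sup>2) \<le> norm (2 * (cmod (f x))\<^sup>2 + 2 * (cmod (g x))\<^sup>2)"
    proof (rule AE_I2)
      fix x
      have "(cmod (f x + g x))\<^sup>2 \<le> (cmod (f x) + cmod (g x))\<^sup>2"
        by (intro power_mono norm_triangle_ineq) auto
      also have "\<dots> \<le> 2 * (cmod (f x))\<^sup>2 + 2 * (cmod (g x))\<^sup>2"
        using sum_squares_bound[of "cmod (f x)" "cmod (g x)"] by (simp add: power2_sum)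
      finally show "norm ((cmod (f x + g x))\<^sup>2) \<le> norm (2 * (cmod (f x))\<^sup>2 + 2 * (cmod (g x))\<^sup>2)"
        by simp
    qed
  qed
qed

lemma sq_integrable_mult_bounded:
  assumes "sq_integrable M f" "g \<in> borel_measurable M" "\<And>x. x \<in> space M \<Longrightarrow> cmod (g x) \<le> B"
  shows "sq_integrable M (\<lambda>x. g x * f x)"
proof (rule sq_integrable_bound[OF _ assms(1)])
  show "(\<lambda>x. g x * f x) \<in> borel_measurable M"
    using assms by (auto simp: sq_integrable_def)
  show "AE x in M. cmod (g x * f x) \<le> B * cmod (f x)"
    using assms(3) by (auto intro!: AE_I2 mult_right_mono simp: norm_mult)
qed

lemma sq_integrable_cmult: "sq_integrable M f \<Longrightarrow> sq_integrable M (\<lambda>x. c * f x)"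
  by (rule sq_integrable_mult_bounded[where B = "cmod c"]) auto

lemma sq_integrable_diff:
  assumes "sq_integrable M f" "sq_integrable M g"
  shows "sq_integrable M (\<lambda>x. f x - g x)"
  using sq_integrable_add[OF assms(1) sq_integrable_cmult[OF assms(2), of "-1"]] by simp

lemma sq_integrable_zero [simp]: "sq_integrable M (\<lambda>x. 0)"
  by (simp add: sq_integrable_def)

lemma sq_integrable_sum:
  "(\<And>i. i \<in> A \<Longrightarrow> sq_integrable M (f i)) \<Longrightarrow> sq_integrable M (\<lambda>x. \<Sum>i\<in>A. f i x)"
  by (induction A rule: infinite_finite_induct) (auto intro: sq_integrable_add)

lemma sq_integrable_AE_cong:
  assumes "sq_integrable M f" "g \<in> borel_measurable M" "AE x in M. f x = g x"
  shows "sq_integrable M g"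
proof (rule sq_integrable_bound[OF assms(2,1), of 1])
  show "AE x in M. cmod (g x) \<le> 1 * cmod (f x)" using assms(3) by eventually_elim simp
qed

lemma sq_integrable_mult:
  assumes "sq_integrable M f" "sq_integrable M g"
  shows "integrable M (\<lambda>x. f x * g x)"
proof (rule Bochner_Integration.integrable_bound)
  show "integrable M (\<lambda>x. (cmod (f x))\<^sup>2 + (cmod (g x))\<^sup>2)"
    using assms by (auto simp: sq_integrable_def)
  show "(\<lambda>x. f x * g x) \<in> borel_measurable M"
    using assms by (auto simp: sq_integrable_def)
  show "AE x in M. norm (f x * g x) \<le> norm ((cmod (f x))\<^sup>2 + (cmod (g x))\<^sup>2)"
  proof (rule AE_I2)
    fix x
    have "2 * (cmod (f x) * cmod (g x)) \<le> (cmod (f x))\<^sup>2 + (cmod (g x))\<^sup>2"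
      using sum_squares_bound[of "cmod (f x)" "cmod (g x)"] by simp
    moreover have "0 \<le> cmod (f x) * cmod (g x)" by simp
    ultimately show "norm (f x * g x) \<le> norm ((cmod (f x))\<^sup>2 + (cmod (g x))\<^sup>2)"
      unfolding norm_mult by (simp only: real_norm_def)
  qed
qed

lemma sq_integrable_cmod: "sq_integrable M f \<Longrightarrow> sq_integrable M (\<lambda>x. complex_of_real (cmod (f x)))"
  by (auto simp: sq_integrable_def)

lemma sq_integrable_cnj: "sq_integrable M f \<Longrightarrow> sq_integrable M (\<lambda>x. cnj (f x))"
  by (auto simp: sq_integrable_def intro: borel_measurable_continuous_on[OF _ , of cnj, unfolded o_def] continuous_intros)

lemma integrable_cmod_mult:
  assumes "sq_integrable M f" "sq_integrable M g"
  shows "integrable M (\<lambda>x. cmod (f x) * cmod (g x))"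
  using integrable_norm[OF sq_integrable_mult[OF assms]] by (simp add: norm_mult)

text \<open>The moduli stay inside the integral because the bounds on the potential estimate
  absolute values pointwise first.\<close>

lemma L2_Cauchy_Schwarz:
  assumes f: "sq_integrable M f" and g: "sq_integrable M g"
  shows "(LINT x|M. cmod (f x) * cmod (g x)) \<le> L2_norm M f * L2_norm M g"
proof -
  let ?F = "\<lambda>x. ennreal (cmod (f x))" and ?G = "\<lambda>x. ennreal (cmod (g x))"
  have m: "f \<in> borel_measurable M" "g \<in> borel_measurable M"
    using f g by (auto simp: sq_integrable_def)
  have fi: "(\<integral>\<^sup>+x. ?F x ^ 2 \<partial>M) = ennreal ((L2_norm M f)\<^sup>2)"
    unfolding L2_norm_power2
    by (subst nn_integral_eq_integral[symmetric]) (use f in \<open>auto simp: sq_integrable_def ennreal_power\<close>)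
  have gi: "(\<integral>\<^sup>+x. ?G x ^ 2 \<partial>M) = ennreal ((L2_norm M g)\<^sup>2)"
    unfolding L2_norm_power2
    by (subst nn_integral_eq_integral[symmetric]) (use g in \<open>auto simp: sq_integrable_def ennreal_power\<close>)
  have fg: "(\<integral>\<^sup>+x. ?F x * ?G x \<partial>M) = ennreal (LINT x|M. cmod (f x) * cmod (g x))"
    by (subst nn_integral_eq_integral[symmetric])
       (use integrable_cmod_mult[OF f g] in \<open>auto simp: ennreal_mult\<close>)
  have "(\<integral>\<^sup>+x. ?F x * ?G x \<partial>M)\<^sup>2 \<le> (\<integral>\<^sup>+x. ?F x ^ 2 \<partial>M) * (\<integral>\<^sup>+x. ?G x ^ 2 \<partial>M)"
    by (rule Cauchy_Schwarz_nn_integral) (use m in auto)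
  then have "ennreal ((LINT x|M. cmod (f x) * cmod (g x))\<^sup>2) \<le> ennreal ((L2_norm M f * L2_norm M g)\<^sup>2)"
    unfolding fi gi fg by (simp add: ennreal_power ennreal_mult power_mult_distrib)
  then have "(LINT x|M. cmod (f x) * cmod (g x))\<^sup>2 \<le> (L2_norm M f * L2_norm M g)\<^sup>2"
    by (simp add: ennreal_le_iff)
  then show ?thesis by (rule power2_le_imp_le) simp
qed

lemma L2_Cauchy_Schwarz_integral:
  assumes f: "sq_integrable M f" and g: "sq_integrable M g"
  shows "cmod (LINT x|M. f x * g x) \<le> L2_norm M f * L2_norm M g"
proof -
  have "cmod (LINT x|M. f x * g x) \<le> (LINT x|M. cmod (f x * g x))"
    by (rule integral_norm_bound)
  also have "\<dots> \<le> L2_norm M f * L2_norm M g"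
    using L2_Cauchy_Schwarz[OF f g] by (simp add: norm_mult)
  finally show ?thesis .
qed

lemma L2_norm_mono:
  assumes "sq_integrable M f" "sq_integrable M g" "\<And>x. x \<in> space M \<Longrightarrow> cmod (f x) \<le> cmod (g x)"
  shows "L2_norm M f \<le> L2_norm M g"
  unfolding L2_norm_def
  by (intro real_sqrt_le_mono integral_mono) (use assms in \<open>auto simp: sq_integrable_def intro: power_mono\<close>)

lemma L2_norm_add_power2:
  assumes "sq_integrable M f" "sq_integrable M g"
  shows "(L2_norm M (\<lambda>x. f x + g x))\<^sup>2 \<le> 2 * (L2_norm M f)\<^sup>2 + 2 * (L2_norm M g)\<^sup>2"
proof -
  have "(LINT x|M. (cmod (f x + g x))\<^sup>2) \<le> (LINT x|M. 2 * (cmod (f x))\<^sup>2 + 2 * (cmod (g x))\<^sup>2)"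
  proof (rule integral_mono)
    show "integrable M (\<lambda>x. (cmod (f x + g x))\<^sup>2)"
      using sq_integrable_add[OF assms] by (simp add: sq_integrable_def)
    show "integrable M (\<lambda>x. 2 * (cmod (f x))\<^sup>2 + 2 * (cmod (g x))\<^sup>2)"
      using assms by (auto simp: sq_integrable_def)
    fix x
    have "(cmod (f x + g x))\<^sup>2 \<le> (cmod (f x) + cmod (g x))\<^sup>2"
      by (intro power_mono norm_triangle_ineq) auto
    also have "\<dots> \<le> 2 * (cmod (f x))\<^sup>2 + 2 * (cmod (g x))\<^sup>2"
      using sum_squares_bound[of "cmod (f x)" "cmod (g x)"] by (simp add: power2_sum)
    finally show "(cmod (f x + g x))\<^sup>2 \<le> 2 * (cmod (f x))\<^sup>2 + 2 * (cmod (g x))\<^sup>2" .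
  qed
  also have "\<dots> = 2 * (L2_norm M f)\<^sup>2 + 2 * (L2_norm M g)\<^sup>2"
    unfolding L2_norm_power2 using assms by (subst Bochner_Integration.integral_add) (auto simp: sq_integrable_def)
  finally show ?thesis unfolding L2_norm_power2 .
qed

text \<open>The passage from trigonometric polynomials to \<open>u\<close>: one factor converges in
  norm, the other is fixed, and Cauchy-Schwarz controls the difference.\<close>

lemma L2_tendsto_integral_mult:
  assumes fn: "\<And>n. sq_integrable M (f n)" and f: "sq_integrable M F" and g: "sq_integrable M g"
    and lim: "(\<lambda>n. L2_norm M (\<lambda>x. f n x - F x)) \<longlonglongrightarrow> 0"
  shows "(\<lambda>n. LINT x|M. f n x * g x) \<longlonglongrightarrow> (LINT x|M. F x * g x)"
proof (rule Lim_null[THEN iffD2], rule Lim_null_comparison)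
  show "\<forall>\<^sub>F n in sequentially. norm ((LINT x|M. f n x * g x) - (LINT x|M. F x * g x))
      \<le> L2_norm M (\<lambda>x. f n x - F x) * L2_norm M g"
  proof (rule always_eventually, rule allI)
    fix n
    have "(LINT x|M. f n x * g x) - (LINT x|M. F x * g x) = (LINT x|M. (f n x - F x) * g x)"
      by (simp add: algebra_simps Bochner_Integration.integral_diff sq_integrable_mult fn f g)
    then show "norm ((LINT x|M. f n x * g x) - (LINT x|M. F x * g x))
      \<le> L2_norm M (\<lambda>x. f n x - F x) * L2_norm M g"
      using L2_Cauchy_Schwarz_integral[OF sq_integrable_diff[OF fn f] g] by simp
  qed
  show "(\<lambda>n. L2_norm M (\<lambda>x. f n x - F x) * L2_norm M g) \<longlonglongrightarrow> 0"
    using tendsto_mult_right[OF lim, of "L2_norm M g"] by simp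
qed

lemma (in finite_measure) sq_integrable_bounded:
  assumes "f \<in> borel_measurable M" "\<And>x. x \<in> space M \<Longrightarrow> cmod (f x) \<le> B"
  shows "sq_integrable M f"
  unfolding sq_integrable_def
proof
  show "integrable M (\<lambda>x. (cmod (f x))\<^sup>2)"
    by (rule integrable_const_bound[where B = "B\<^sup>2"]) (use assms in \<open>auto intro!: AE_I2 power_mono\<close>)
qed (use assms in simp)

lemma (in finite_measure) sq_integrable_imp_integrable:
  assumes "sq_integrable M f" shows "integrable M f"
  using sq_integrable_mult[OF assms sq_integrable_bounded[of "\<lambda>_. 1" 1]] by simp

section \<open>A convolution inequality and a two-norm contraction\<close>

text \<open>For consecutive roots s < t the induction step is 1/t <= 2(t - s), which is (t - s)^2 >=
  0 combined with t^2 = s^2 + 1.\<close>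

lemma sum_inverse_sqrt_le: "(\<Sum>k = 1..n. 1 / sqrt (real k)) \<le> 2 * sqrt (real n)"
proof (induction n)
  case (Suc n)
  define s where "s = sqrt (real n)"
  define t where "t = sqrt (real (Suc n))"
  have t: "t > 0" "s \<ge> 0" "t\<^sup>2 = s\<^sup>2 + 1" by (auto simp: s_def t_def)
  have "0 \<le> (t - s)\<^sup>2" by simp
  then have "2 * s * t + 1 \<le> 2 * t\<^sup>2" using t(3) unfolding power2_diff by (simp add: mult_ac)
  then have "2 * s + 1 / t \<le> 2 * t" using t(1) by (simp add: field_simps power2_eq_square)
  then have "2 * sqrt (real n) + 1 / sqrt (real (Suc n)) \<le> 2 * sqrt (real (Suc n))"
    by (simp add: s_def t_def)
  then show ?case using Suc by simp
qed simp

text \<open>The two signs contribute 2 \<open>sqrt n\<close> each, and \<open>k = 0\<close>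
  contributes nothing since \<open>1 / 0 = 0\<close>.\<close>

lemma sum_inverse_sqrt_int_le:
  fixes A :: "int set"
  assumes "\<And>k. k \<in> A \<Longrightarrow> \<bar>k\<bar> \<le> int n"
  shows "(\<Sum>k\<in>A. 1 / sqrt \<bar>of_int k\<bar>) \<le> 4 * sqrt (real n)"
proof -
  let ?f = "\<lambda>k::int. 1 / sqrt \<bar>real_of_int k\<bar>"
  have "A \<subseteq> {- int n..int n}" using assms by force
  then have "(\<Sum>k\<in>A. ?f k) \<le> (\<Sum>k\<in>{- int n..int n}. ?f k)"
    by (intro sum_mono2) auto
  also have "{- int n..int n} = {0} \<union> (int ` {1..n}) \<union> ((\<lambda>k. - int k) ` {1..n})"
  proof (intro equalityI subsetI)
    fix k :: int assume "k \<in> {- int n..int n}"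
    then have "k = 0 \<or> k = int (nat k) \<and> nat k \<in> {1..n} \<or> k = - int (nat (-k)) \<and> nat (-k) \<in> {1..n}"
      by (simp; arith)
    then consider "k = 0" | "k = int (nat k)" "nat k \<in> {1..n}" | "k = - int (nat (-k))" "nat (-k) \<in> {1..n}"
      by blast
    then show "k \<in> {0} \<union> int ` {1..n} \<union> (\<lambda>k. - int k) ` {1..n}" by cases blast+
  qed auto
  also have "(\<Sum>k\<in>\<dots>. ?f k) = (\<Sum>k\<in>int ` {1..n}. ?f k) + (\<Sum>k\<in>(\<lambda>k. - int k) ` {1..n}. ?f k)"
    by (subst sum.union_disjoint; auto simp: sum.insert_if)
  also have "(\<Sum>k\<in>int ` {1..n}. ?f k) = (\<Sum>k=1..n. 1 / sqrt (real k))"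
    by (subst sum.reindex) (auto simp: inj_on_def)
  also have "(\<Sum>k\<in>(\<lambda>k. - int k) ` {1..n}. ?f k) = (\<Sum>k=1..n. 1 / sqrt (real k))"
    by (subst sum.reindex) (auto simp: inj_on_def)
  also have "(\<Sum>k=1..n. 1 / sqrt (real k)) + (\<Sum>k=1..n. 1 / sqrt (real k)) \<le> 4 * sqrt (real n)"
    using sum_inverse_sqrt_le[of n] by simp
  finally show ?thesis .
qed

text \<open>All Sobolev weights are written as powers of |k|^(1/4): the first power belongs to
  H^(1/4), the third to H^(3/4), and the fourth is the symbol |k| of \<Lambda>. The weights are
  homogeneous, so they see nothing at frequency 0.\<close>

definition root4 :: "int \<Rightarrow> real" where "root4 k = sqrt (sqrt \<bar>of_int k\<bar>)"

lemma root4_nonneg [simp]: "0 \<le> root4 k" by (simp add: root4_def)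
lemma root4_0 [simp]: "root4 0 = 0" by (simp add: root4_def)
lemma root4_pos: "k \<noteq> 0 \<Longrightarrow> 0 < root4 k" by (simp add: root4_def)
lemma root4_eq_0_iff [simp]: "root4 k = 0 \<longleftrightarrow> k = 0" by (simp add: root4_def)
lemma root4_power2: "(root4 k)\<^sup>2 = sqrt \<bar>of_int k\<bar>" by (simp add: root4_def)
lemma root4_power4: "(root4 k) ^ 4 = \<bar>of_int k\<bar>"
proof -
  have "(root4 k) ^ 4 = ((root4 k)\<^sup>2)\<^sup>2" by (simp flip: power_mult)
  then show ?thesis by (simp add: root4_power2)
qed
lemma root4_ge_1: "k \<noteq> 0 \<Longrightarrow> 1 \<le> root4 k"
  by (simp add: root4_def)
text \<open>If one of \<open>k\<close>, \<open>k - m\<close> exceeds 2|m|, the two are comparable,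
  and both weights can be expressed through \<open>k\<close> alone. The constant
  \<open>sqrt 2\<close> is a generous bound for 2^(1/4).\<close>

lemma near_diagonal_weight:
  fixes k m :: int
  assumes "\<not> (\<bar>k\<bar> \<le> 2 * \<bar>m\<bar> \<and> \<bar>k - m\<bar> \<le> 2 * \<bar>m\<bar>)"
  shows "\<bar>m\<bar> \<le> \<bar>k\<bar>" "1 / (root4 k * root4 (k - m)) \<le> sqrt 2 / (root4 k)\<^sup>2"
proof -
  have h: "\<bar>m\<bar> \<le> \<bar>k\<bar>" "\<bar>k\<bar> \<le> 2 * \<bar>k - m\<bar>" "k \<noteq> 0" "k - m \<noteq> 0"
  proof -
    have t: "\<bar>k\<bar> \<le> \<bar>k - m\<bar> + \<bar>m\<bar>" "\<bar>k - m\<bar> \<le> \<bar>k\<bar> + \<bar>m\<bar>" "0 \<le> \<bar>m\<bar>" by linarith+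
    consider "2 * \<bar>m\<bar> < \<bar>k\<bar>" | "2 * \<bar>m\<bar> < \<bar>k - m\<bar>" using assms not_le by blast
    then have "\<bar>m\<bar> \<le> \<bar>k\<bar> \<and> \<bar>k\<bar> \<le> 2 * \<bar>k - m\<bar> \<and> 0 < \<bar>k\<bar> \<and> 0 < \<bar>k - m\<bar>"
    proof cases
      case 1
      show ?thesis by (intro conjI) (use 1 t in linarith)+
    next
      case 2
      show ?thesis by (intro conjI) (use 2 t in linarith)+
    qed
    then show "\<bar>m\<bar> \<le> \<bar>k\<bar>" "\<bar>k\<bar> \<le> 2 * \<bar>k - m\<bar>" "k \<noteq> 0" "k - m \<noteq> 0" by auto
  qed
  show "\<bar>m\<bar> \<le> \<bar>k\<bar>" by (rule h)
  have "real_of_int \<bar>k\<bar> \<le> 2 * real_of_int \<bar>k - m\<bar>" using h(2) by linarith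
  then have "root4 k \<le> sqrt (sqrt (2 * \<bar>of_int (k - m)\<bar>))"
    unfolding root4_def by (intro real_sqrt_le_mono) simp
  also have "\<dots> = sqrt (sqrt 2) * root4 (k - m)" by (simp add: root4_def real_sqrt_mult)
  also have "\<dots> \<le> sqrt 2 * root4 (k - m)"
    by (intro mult_right_mono real_sqrt_le_mono) (auto simp: real_le_lsqrt)
  finally have "root4 k \<le> sqrt 2 * root4 (k - m)" .
  then show "1 / (root4 k * root4 (k - m)) \<le> sqrt 2 / (root4 k)\<^sup>2"
    using root4_pos[OF h(3)] root4_pos[OF h(4)] by (simp add: field_simps power2_eq_square)
qed

text \<open>One of \<open>k\<close>, \<open>k - m\<close> has size at least |m|/2, so its inverse
  root is at most \<open>sqrt (2 / |m|)\<close>; the inverse roots of the other sum to at most 4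
  \<open>sqrt (2 |m|)\<close>. The two cases together give 2 * 8 = 16, uniformly in
  \<open>m\<close>.\<close>

lemma far_diagonal_sum:
  fixes A :: "int set" and m :: int
  assumes "\<And>k. k \<in> A \<Longrightarrow> \<bar>k\<bar> \<le> 2 * \<bar>m\<bar> \<and> \<bar>k - m\<bar> \<le> 2 * \<bar>m\<bar>" and "finite A"
  shows "(\<Sum>k\<in>A. (1 / (root4 k * root4 (k - m)))\<^sup>2) \<le> 16"
proof (cases "m = 0")
  case True
  \<comment> \<open>Only \<open>k = 0\<close> is left, where the summand is
    \<open>1 / 0 = 0\<close>.\<close>
  then have "A \<subseteq> {0}" using assms by fastforce
  then have "(\<Sum>k\<in>A. (1 / (root4 k * root4 (k - m)))\<^sup>2) = 0"
    by (intro sum.neutral) auto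
  then show ?thesis by simp
next
  case False
  let ?g = "\<lambda>k::int. 1 / sqrt \<bar>real_of_int k\<bar>"
  let ?q = "sqrt (2 / real_of_int \<bar>m\<bar>)"
  have le: "(1 / (root4 k * root4 (k - m)))\<^sup>2 \<le> ?q * (?g k + ?g (k - m))" for k
  proof -
    have eq: "(1 / (root4 k * root4 (k - m)))\<^sup>2 = ?g k * ?g (k - m)"
      by (simp add: power_divide power_mult_distrib root4_power2)
    have small: "?g l \<le> ?q" if "\<bar>m\<bar> \<le> 2 * \<bar>l\<bar>" for l
    proof -
      have l: "l \<noteq> 0" using that False by auto
      have "real_of_int \<bar>m\<bar> \<le> 2 * real_of_int \<bar>l\<bar>" using that by linarith
      then have "1 / \<bar>real_of_int l\<bar> \<le> 2 / real_of_int \<bar>m\<bar>" using l False by (simp add: field_simps)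
      then have "sqrt (1 / \<bar>real_of_int l\<bar>) \<le> ?q" by (rule real_sqrt_le_mono)
      then show ?thesis by (simp add: real_sqrt_divide)
    qed
    have nn: "0 \<le> ?g k" "0 \<le> ?g (k - m)" "0 \<le> ?q" by auto
    have double: "a \<le> 2 * b \<or> a \<le> 2 * c" if "a \<le> b + c" for a b c :: int using that by linarith
    have "\<bar>m\<bar> \<le> \<bar>k\<bar> + \<bar>k - m\<bar>" by linarith
    from double[OF this] consider "\<bar>m\<bar> \<le> 2 * \<bar>k\<bar>" | "\<bar>m\<bar> \<le> 2 * \<bar>k - m\<bar>" by blast
    then show ?thesis
    proof cases
      case 1
      have "?g k * ?g (k - m) \<le> ?q * ?g (k - m)" using small[OF 1] nn by (intro mult_right_mono) auto
      also have "\<dots> \<le> ?q * (?g k + ?g (k - m))" using nn by (intro mult_left_mono) auto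
      finally show ?thesis using eq by simp
    next
      case 2
      have "?g k * ?g (k - m) \<le> ?g k * ?q" using small[OF 2] nn by (intro mult_left_mono) auto
      also have "\<dots> = ?q * ?g k" by simp
      also have "\<dots> \<le> ?q * (?g k + ?g (k - m))" using nn by (intro mult_left_mono) auto
      finally show ?thesis using eq by simp
    qed
  qed
  define n where "n = nat (2 * \<bar>m\<bar>)"
  have n: "int n = 2 * \<bar>m\<bar>" by (simp add: n_def)
  have s1: "(\<Sum>k\<in>A. ?g k) \<le> 4 * sqrt (real n)"
    by (rule sum_inverse_sqrt_int_le) (use assms n in auto)
  have s2: "(\<Sum>k\<in>A. ?g (k - m)) \<le> 4 * sqrt (real n)"
  proof -
    have "(\<Sum>k\<in>A. ?g (k - m)) = (\<Sum>k\<in>(\<lambda>k. k - m) ` A. ?g k)"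
      by (subst sum.reindex) (auto simp: inj_on_def)
    also have "\<dots> \<le> 4 * sqrt (real n)"
      by (rule sum_inverse_sqrt_int_le) (use assms n in auto)
    finally show ?thesis .
  qed
  have "(\<Sum>k\<in>A. (1 / (root4 k * root4 (k - m)))\<^sup>2) \<le> (\<Sum>k\<in>A. ?q * (?g k + ?g (k - m)))"
    by (rule sum_mono) (rule le)
  also have "\<dots> = ?q * ((\<Sum>k\<in>A. ?g k) + (\<Sum>k\<in>A. ?g (k - m)))"
    by (simp only: sum_distrib_left[symmetric] sum.distrib)
  also have "\<dots> \<le> ?q * (8 * sqrt (real n))" using s1 s2 by (intro mult_left_mono) auto
  also have "\<dots> = 8 * sqrt (2 / real_of_int \<bar>m\<bar> * real n)" by (simp only: real_sqrt_mult)
  also have "2 / real_of_int \<bar>m\<bar> * real n = 2\<^sup>2"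
  proof -
    have "real n = 2 * real_of_int \<bar>m\<bar>" using n by linarith
    then show ?thesis using False by simp
  qed
  also have "8 * sqrt (2\<^sup>2) = (16::real)" by (subst real_sqrt_abs) simp
  finally show ?thesis .
qed

lemma sum_shift_le:
  fixes b :: "int \<Rightarrow> real"
  assumes "finite S" "finite A" "inj_on g A" "\<And>k. 0 \<le> b k" "\<And>k. k \<notin> S \<Longrightarrow> b k = 0"
  shows "(\<Sum>m\<in>A. b (g m)) \<le> (\<Sum>k\<in>S. b k)"
proof -
  have "(\<Sum>m\<in>A. b (g m)) = (\<Sum>k\<in>g ` A. b k)" using assms by (subst sum.reindex) auto
  also have "\<dots> = (\<Sum>k\<in>g ` A \<inter> S. b k)"
    by (rule sum.mono_neutral_right) (use assms in auto)
  also have "\<dots> \<le> (\<Sum>k\<in>S. b k)" by (rule sum_mono2) (use assms in auto)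
  finally show ?thesis .
qed

text \<open>The embedding of \<open>H\<^sup>1\<^sup>/\<^sup>4\<close> into \<open>L\<^sup>4\<close>, on the side of Fourier coefficients. The cases where \<open>m\<close> is comparable to the larger of \<open>k\<close> and \<open>k - m\<close>, and where it
  is much smaller, need Cauchy-Schwarz with different distributions of the weights.\<close>

lemma sum_square_convolution_le:
  fixes a :: "int \<Rightarrow> real"
  assumes S: "finite S" and a0: "\<And>k. k \<notin> S \<Longrightarrow> a k = 0" and M: "finite M" and ann: "\<And>k. 0 \<le> a k"
  shows "(\<Sum>m\<in>M. (\<Sum>k\<in>S. a k * a (k - m) / (root4 k * root4 (k - m)))\<^sup>2) \<le> 44 * (\<Sum>k\<in>S. (a k)\<^sup>2)\<^sup>2"
proof -
  define A where "A = (\<Sum>k\<in>S. (a k)\<^sup>2)"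
  have A0: "0 \<le> A" by (auto simp: A_def intro: sum_nonneg)
  define R where "R m = {k\<in>S. \<bar>k\<bar> \<le> 2 * \<bar>m\<bar> \<and> \<bar>k - m\<bar> \<le> 2 * \<bar>m\<bar>}" for m
  let ?t = "\<lambda>m k. a k * a (k - m) / (root4 k * root4 (k - m))"
  let ?c1 = "\<lambda>m. \<Sum>k\<in>R m. ?t m k" and ?c2 = "\<lambda>m. \<Sum>k\<in>S - R m. ?t m k"
  have RS: "R m \<subseteq> S" "finite (R m)" for m using S by (auto simp: R_def)
  have "(\<Sum>k\<in>S. ?t m k)\<^sup>2 \<le> 2 * (?c1 m)\<^sup>2 + 2 * (?c2 m)\<^sup>2" for m
  proof -
    have "(\<Sum>k\<in>S. ?t m k) = ?c1 m + ?c2 m"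
      using sum.subset_diff[OF RS(1) S, of "?t m" m] by simp
    then show ?thesis using sum_squares_bound[of "?c1 m" "?c2 m"] by (simp add: power2_sum)
  qed
  then have "(\<Sum>m\<in>M. (\<Sum>k\<in>S. ?t m k)\<^sup>2) \<le> (\<Sum>m\<in>M. 2 * (?c1 m)\<^sup>2 + 2 * (?c2 m)\<^sup>2)"
    by (rule sum_mono)
  also have "\<dots> = 2 * (\<Sum>m\<in>M. (?c1 m)\<^sup>2) + 2 * (\<Sum>m\<in>M. (?c2 m)\<^sup>2)"
    by (simp add: sum.distrib sum_distrib_left)
  \<comment> \<open>Cauchy-Schwarz with both weights in one factor: \<open>far_diagonal_sum\<close>
    bounds that factor by 16 for every \<open>m\<close>, and the other factor sums over
    \<open>m\<close> to at most A^2.\<close>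
  also have "(\<Sum>m\<in>M. (?c1 m)\<^sup>2) \<le> 16 * A\<^sup>2"
  proof -
    have "(?c1 m)\<^sup>2 \<le> 16 * (\<Sum>k\<in>S. (a k)\<^sup>2 * (a (k - m))\<^sup>2)" for m
    proof -
      have "(?c1 m)\<^sup>2 = (\<Sum>k\<in>R m. (1 / (root4 k * root4 (k - m))) * (a k * a (k - m)))\<^sup>2" by simp
      also have "\<dots> \<le> (\<Sum>k\<in>R m. (1 / (root4 k * root4 (k - m)))\<^sup>2) * (\<Sum>k\<in>R m. (a k * a (k - m))\<^sup>2)"
        by (rule Cauchy_Schwarz_ineq_sum)
      also have "\<dots> \<le> 16 * (\<Sum>k\<in>S. (a k * a (k - m))\<^sup>2)"
      proof (rule mult_mono)
        show "(\<Sum>k\<in>R m. (1 / (root4 k * root4 (k - m)))\<^sup>2) \<le> 16"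
          by (rule far_diagonal_sum) (use S in \<open>auto simp: R_def\<close>)
        show "(\<Sum>k\<in>R m. (a k * a (k - m))\<^sup>2) \<le> (\<Sum>k\<in>S. (a k * a (k - m))\<^sup>2)"
          by (rule sum_mono2) (use RS S in auto)
      qed (auto intro: sum_nonneg)
      finally show ?thesis by (simp add: power_mult_distrib)
    qed
    then have "(\<Sum>m\<in>M. (?c1 m)\<^sup>2) \<le> (\<Sum>m\<in>M. 16 * (\<Sum>k\<in>S. (a k)\<^sup>2 * (a (k - m))\<^sup>2))"
      by (rule sum_mono)
    also have "\<dots> = 16 * (\<Sum>k\<in>S. (a k)\<^sup>2 * (\<Sum>m\<in>M. (a (k - m))\<^sup>2))"
      unfolding sum_distrib_left by (subst sum.swap) simp
    also have "\<dots> \<le> 16 * (\<Sum>k\<in>S. (a k)\<^sup>2 * A)"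
    proof (intro mult_left_mono sum_mono)
      fix k
      show "(\<Sum>m\<in>M. (a (k - m))\<^sup>2) \<le> A"
        unfolding A_def by (rule sum_shift_le[OF S M]) (use a0 in \<open>auto simp: inj_on_def\<close>)
    qed auto
    also have "\<dots> = 16 * A\<^sup>2" by (simp add: A_def power2_eq_square sum_distrib_right)
    finally show ?thesis .
  qed
  also have "(\<Sum>m\<in>M. (?c2 m)\<^sup>2) \<le> 6 * A\<^sup>2"
  proof -
    \<comment> \<open>After the weights have been moved to \<open>k\<close>, the index
      \<open>m\<close> survives only in the cut-off |m| <= |k|. At most 2|k| + 1 <= 3|k| values of
      \<open>m\<close> pass it, each contributing 2 (a k)^2 / |k|, whence the factor 6.\<close>
    let ?b = "\<lambda>m k. if \<bar>m\<bar> \<le> \<bar>k\<bar> then sqrt 2 * a k / (root4 k)\<^sup>2 else 0"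
    have "(?c2 m)\<^sup>2 \<le> (\<Sum>k\<in>S. (?b m k)\<^sup>2) * A" for m
    proof -
      have "?c2 m \<le> (\<Sum>k\<in>S - R m. ?b m k * a (k - m))"
      proof (rule sum_mono)
        fix k assume "k \<in> S - R m"
        then have h: "\<not> (\<bar>k\<bar> \<le> 2 * \<bar>m\<bar> \<and> \<bar>k - m\<bar> \<le> 2 * \<bar>m\<bar>)" by (auto simp: R_def)
        have "?t m k = (a k * a (k - m)) * (1 / (root4 k * root4 (k - m)))" by simp
        also have "\<dots> \<le> (a k * a (k - m)) * (sqrt 2 / (root4 k)\<^sup>2)"
          by (rule mult_left_mono[OF near_diagonal_weight(2)[OF h]]) (simp add: ann)
        finally show "?t m k \<le> ?b m k * a (k - m)"
          using near_diagonal_weight(1)[OF h] by (simp add: mult_ac)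
      qed
      also have "\<dots> \<le> (\<Sum>k\<in>S. ?b m k * a (k - m))"
        by (rule sum_mono2) (use S ann in auto)
      finally have "(?c2 m)\<^sup>2 \<le> (\<Sum>k\<in>S. ?b m k * a (k - m))\<^sup>2"
        by (rule power_mono) (auto intro!: sum_nonneg simp: ann)
      also have "\<dots> \<le> (\<Sum>k\<in>S. (?b m k)\<^sup>2) * (\<Sum>k\<in>S. (a (k - m))\<^sup>2)"
        by (rule Cauchy_Schwarz_ineq_sum)
      also have "\<dots> \<le> (\<Sum>k\<in>S. (?b m k)\<^sup>2) * A"
        unfolding A_def
        by (intro mult_left_mono sum_shift_le[OF S S]) (use a0 in \<open>auto simp: inj_on_def intro: sum_nonneg\<close>)
      finally show ?thesis .
    qed
    then have "(\<Sum>m\<in>M. (?c2 m)\<^sup>2) \<le> (\<Sum>m\<in>M. (\<Sum>k\<in>S. (?b m k)\<^sup>2) * A)" by (rule sum_mono)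
    also have "\<dots> = (\<Sum>k\<in>S. \<Sum>m\<in>M. (?b m k)\<^sup>2) * A"
      by (subst sum.swap) (simp add: sum_distrib_right)
    also have "\<dots> \<le> (\<Sum>k\<in>S. 6 * (a k)\<^sup>2) * A"
    proof (intro mult_right_mono sum_mono A0)
      fix k
      show "(\<Sum>m\<in>M. (?b m k)\<^sup>2) \<le> 6 * (a k)\<^sup>2"
      proof (cases "k = 0")
        case False
        have "(\<Sum>m\<in>M. (?b m k)\<^sup>2) = (\<Sum>m\<in>M \<inter> {m. \<bar>m\<bar> \<le> \<bar>k\<bar>}. 2 * (a k)\<^sup>2 / \<bar>of_int k\<bar>)"
          unfolding sum.inter_restrict[OF M]
          by (intro sum.cong) (auto simp: power_divide power_mult_distrib root4_power4 simp flip: power_mult)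
        also have "\<dots> = real (card (M \<inter> {m. \<bar>m\<bar> \<le> \<bar>k\<bar>})) * (2 * (a k)\<^sup>2 / \<bar>of_int k\<bar>)" by simp
        also have "\<dots> \<le> (3 * \<bar>of_int k\<bar>) * (2 * (a k)\<^sup>2 / \<bar>of_int k\<bar>)"
        proof (rule mult_right_mono)
          have "card (M \<inter> {m. \<bar>m\<bar> \<le> \<bar>k\<bar>}) \<le> card {- \<bar>k\<bar>..\<bar>k\<bar>}" by (rule card_mono) auto
          also have "\<dots> = nat (2 * \<bar>k\<bar> + 1)" by simp
          finally show "real (card (M \<inter> {m. \<bar>m\<bar> \<le> \<bar>k\<bar>})) \<le> 3 * \<bar>of_int k\<bar>"
            using False by linarith
        qed simp
        also have "\<dots> = 6 * (a k)\<^sup>2" using False by simp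
        finally show ?thesis .
      qed (auto intro!: order_trans[OF sum_nonpos])
    qed
    also have "\<dots> = 6 * A\<^sup>2"
      by (simp only: sum_distrib_left[symmetric] A_def power2_eq_square mult.assoc)
    finally show ?thesis .
  qed
  \<comment> \<open>44 = 2 * 16 + 2 * 6.\<close>
  finally show ?thesis by (simp add: A_def)
qed

text \<open>The fixed point of a map that contracts two weighted \<open>l\<^sup>2\<close> norms. Neumann iteration on the
  finite index set \<open>J n\<close> stays bounded in the stronger norm, and in the weaker norm it approaches
  \<open>v\<close> up to the tail of \<open>v\<close> outside \<open>J n\<close>.\<close>

lemma two_norm_contraction:
  fixes v F :: "'i \<Rightarrow> complex" and K :: "'i \<Rightarrow> 'i \<Rightarrow> complex" and \<alpha> :: "'i \<Rightarrow> real"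
    and J :: "nat \<Rightarrow> 'i set"
  defines "N1 \<equiv> \<lambda>c A. L2_set (\<lambda>i. \<alpha> i * cmod (c i)) A"
    and "N3 \<equiv> \<lambda>c A. L2_set (\<lambda>i. \<alpha> i ^ 3 * cmod (c i)) A"
  assumes fin: "\<And>n. finite (J n)" and mono: "\<And>m n. m \<le> n \<Longrightarrow> J m \<subseteq> J n"
    and pos: "\<And>i n. i \<in> J n \<Longrightarrow> 0 < \<alpha> i"
    and B1: "\<And>n c \<phi>. cmod (\<Sum>i\<in>J n. \<Sum>j\<in>J n. \<phi> i * K i j * c j) \<le> 1/2 * N3 c (J n) * N1 \<phi> (J n)"
    and B2: "\<And>n c \<phi>. cmod (\<Sum>i\<in>J n. \<Sum>j\<in>J n. \<phi> i * K i j * c j) \<le> 1/2 * N1 c (J n) * N3 \<phi> (J n)"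
    and F: "\<And>n \<phi>. cmod (\<Sum>i\<in>J n. \<phi> i * F i) \<le> C * N1 \<phi> (J n)"
    and eq: "\<And>i n. i \<in> J n \<Longrightarrow> (\<lambda>m. \<Sum>j\<in>J m. K i j * v j) \<longlonglongrightarrow> of_real (\<alpha> i ^ 4) * v i - F i"
    and bdd: "\<And>n. N1 v (J n) \<le> B" and C0: "0 \<le> C"
  shows "N3 v (J n0) \<le> 2 * C"
proof (rule field_le_epsilon)
  fix \<epsilon> :: real assume \<epsilon>: "\<epsilon> > 0"
  have N_nonneg: "0 \<le> N1 c A" "0 \<le> N3 c A" for c A by (auto simp: N1_def N3_def)
  \<comment> \<open>The sums of squares of \<open>v\<close> over \<open>J n\<close> increase and are
    bounded by B^2, so they form a Cauchy sequence.\<close>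
  have tail: "\<exists>n\<ge>n0. \<forall>m\<ge>n. N1 v (J m - J n) \<le> \<delta>" if \<delta>: "\<delta> > 0" for \<delta>
  proof -
    define s where "s n = (\<Sum>i\<in>J n. (\<alpha> i * cmod (v i))\<^sup>2)" for n
    have sN: "s n = (N1 v (J n))\<^sup>2" for n
      by (simp add: s_def N1_def L2_set_def sum_nonneg)
    have inc: "incseq s"
      unfolding s_def by (intro monoI sum_mono2 fin mono) auto
    have "s n \<le> B\<^sup>2" for n unfolding sN by (intro power_mono bdd N_nonneg)
    then obtain L where L: "s \<longlonglongrightarrow> L" "\<And>n. s n \<le> L"
      using incseq_convergent[OF inc, of "B\<^sup>2"] by blast
    have "\<forall>\<^sub>F n in sequentially. dist (s n) L < \<delta>\<^sup>2" using L(1) \<delta> by (intro tendstoD) auto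
    then obtain n1 where n1: "\<And>n. n \<ge> n1 \<Longrightarrow> dist (s n) L < \<delta>\<^sup>2" by (auto simp: eventually_sequentially)
    define n where "n = max n0 n1"
    have "N1 v (J m - J n) \<le> \<delta>" if m: "m \<ge> n" for m
    proof -
      have "(N1 v (J m - J n))\<^sup>2 = (\<Sum>i\<in>J m - J n. (\<alpha> i * cmod (v i))\<^sup>2)"
        by (simp add: N1_def L2_set_def sum_nonneg)
      also have "\<dots> = s m - s n" unfolding s_def using mono[OF m] fin by (subst sum_diff) auto
      also have "\<dots> \<le> \<delta>\<^sup>2" using n1[of n] L(2)[of m] by (simp add: n_def dist_real_def)
      finally show ?thesis using \<delta> by (rule_tac power2_le_imp_le) auto
    qed
    then show ?thesis by (intro exI[of _ n]) (auto simp: n_def)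
  qed
  \<comment> \<open>On the finite set \<open>J n0\<close> the strong norm is at most
    \<open>D\<close> times the weak one. \<open>D\<close> may be huge, but it is fixed before
    \<delta>, which is chosen to absorb it; inserting 1 keeps \<open>Max\<close> meaningful for
    empty \<open>J n0\<close>.\<close>
  define D where "D = Max (insert 1 ((\<lambda>i. (\<alpha> i)\<^sup>2) ` J n0))"
  have D1: "1 \<le> D" unfolding D_def by (rule Max_ge) (use fin in auto)
  have D: "(\<alpha> i)\<^sup>2 \<le> D" if "i \<in> J n0" for i unfolding D_def by (rule Max_ge) (use fin that in auto)
  define \<delta> where "\<delta> = \<epsilon> / (2 * D)"
  have \<delta>: "\<delta> > 0" using \<epsilon> D1 by (simp add: \<delta>_def)
  obtain n where n: "n \<ge> n0" "\<And>m. m \<ge> n \<Longrightarrow> N1 v (J m - J n) \<le> \<delta>" using tail[OF \<delta>] by blast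
  \<comment> \<open>The error made when the infinite system is truncated to \<open>J n\<close>. By
    \<open>B2\<close> it is small in the norm dual to \<open>N3\<close>.\<close>
  define r where "r i = of_real (\<alpha> i ^ 4) * v i - F i - (\<Sum>j\<in>J n. K i j * v j)" for i
  have r: "cmod (\<Sum>i\<in>J n. \<phi> i * r i) \<le> 1/2 * \<delta> * N3 \<phi> (J n)" for \<phi>
  proof (rule Lim_bounded)
    show "(\<lambda>m. cmod (\<Sum>i\<in>J n. \<phi> i * ((\<Sum>j\<in>J m. K i j * v j) - (\<Sum>j\<in>J n. K i j * v j))))
        \<longlonglongrightarrow> cmod (\<Sum>i\<in>J n. \<phi> i * r i)"
      unfolding r_def by (intro tendsto_intros eq)
    show "\<forall>m\<ge>n. cmod (\<Sum>i\<in>J n. \<phi> i * ((\<Sum>j\<in>J m. K i j * v j) - (\<Sum>j\<in>J n. K i j * v j)))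
        \<le> 1/2 * \<delta> * N3 \<phi> (J n)"
    proof (intro allI impI)
      fix m assume m: "m \<ge> n"
      note sub = mono[OF m]
      \<comment> \<open>Both families are extended by 0 to \<open>J m\<close>, so that
        \<open>B2\<close> on the larger set sees only the columns in \<open>J m - J n\<close>, where
        \<open>v\<close> has a small tail.\<close>
      let ?\<phi> = "\<lambda>i. if i \<in> J n then \<phi> i else 0" and ?c = "\<lambda>j. if j \<in> J m - J n then v j else 0"
      have "(\<Sum>i\<in>J n. \<phi> i * ((\<Sum>j\<in>J m. K i j * v j) - (\<Sum>j\<in>J n. K i j * v j)))
         = (\<Sum>i\<in>J n. \<Sum>j\<in>J m - J n. \<phi> i * K i j * v j)"
        using sub fin by (subst sum_diff[symmetric]) (auto simp: sum_distrib_left mult.assoc)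
      also have "\<dots> = (\<Sum>i\<in>J m. \<Sum>j\<in>J m. ?\<phi> i * K i j * ?c j)"
      proof (rule sum.mono_neutral_cong_left)
        fix i assume i: "i \<in> J n"
        show "(\<Sum>j\<in>J m - J n. \<phi> i * K i j * v j) = (\<Sum>j\<in>J m. ?\<phi> i * K i j * ?c j)"
          by (rule sum.mono_neutral_cong_left) (use fin i in auto)
      qed (use sub fin in auto)
      finally have "cmod (\<Sum>i\<in>J n. \<phi> i * ((\<Sum>j\<in>J m. K i j * v j) - (\<Sum>j\<in>J n. K i j * v j)))
          \<le> 1/2 * N1 ?c (J m) * N3 ?\<phi> (J m)" using B2[where n = m and \<phi> = ?\<phi> and c = ?c] by simp
      also have "N1 ?c (J m) = N1 v (J m - J n)"
        unfolding N1_def L2_set_def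
        by (intro arg_cong[of _ _ sqrt] sum.mono_neutral_cong_right) (use fin in auto)
      also have "N3 ?\<phi> (J m) = N3 \<phi> (J n)"
        unfolding N3_def L2_set_def
        by (intro arg_cong[of _ _ sqrt] sum.mono_neutral_cong_right) (use fin sub in auto)
      also have "1/2 * N1 v (J m - J n) * N3 \<phi> (J n) \<le> 1/2 * \<delta> * N3 \<phi> (J n)"
        using n(2)[OF m] by (intro mult_right_mono mult_left_mono N_nonneg) auto
      finally show "cmod (\<Sum>i\<in>J n. \<phi> i * ((\<Sum>j\<in>J m. K i j * v j) - (\<Sum>j\<in>J n. K i j * v j)))
        \<le> 1/2 * \<delta> * N3 \<phi> (J n)" .
    qed
  qed
  \<comment> \<open>Duality of weighted sequence spaces: the test vector \<alpha>^2 times the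
    conjugate of \<open>c\<close> has weak norm \<open>N3 c\<close>, and its pairing with
    \<open>G\<close> is the square of \<open>N3 c\<close>.\<close>
  have dual3: "N3 c (J n) \<le> q"
    if c: "\<And>i. i \<in> J n \<Longrightarrow> c i = G i / of_real (\<alpha> i ^ 4)" and q: "0 \<le> q"
      and G: "\<And>\<phi>. cmod (\<Sum>i\<in>J n. \<phi> i * G i) \<le> q * N1 \<phi> (J n)" for c G q
  proof -
    define \<phi> where "\<phi> i = of_real ((\<alpha> i)\<^sup>2) * cnj (c i)" for i
    have N: "N1 \<phi> (J n) = N3 c (J n)"
      unfolding N1_def N3_def \<phi>_def
      by (intro L2_set_cong refl) (auto simp: norm_mult power2_eq_square power3_eq_cube)
    have "(\<Sum>i\<in>J n. \<phi> i * G i) = of_real ((N3 c (J n))\<^sup>2)"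
    proof -
      have "(N3 c (J n))\<^sup>2 = (\<Sum>i\<in>J n. (\<alpha> i ^ 3 * cmod (c i))\<^sup>2)"
        by (simp add: N3_def L2_set_def sum_nonneg)
      moreover have "\<phi> i * G i = of_real ((\<alpha> i ^ 3 * cmod (c i))\<^sup>2)" if i: "i \<in> J n" for i
      proof -
        have "G i = of_real (\<alpha> i ^ 4) * c i" using c[OF i] pos[OF i] by simp
        then have "\<phi> i * G i = of_real ((\<alpha> i)\<^sup>2 * \<alpha> i ^ 4) * (c i * cnj (c i))"
          by (simp add: \<phi>_def)
        also have "\<dots> = of_real ((\<alpha> i ^ 3 * cmod (c i))\<^sup>2)"
          by (simp add: complex_norm_square[symmetric] power_mult_distrib flip: power_add power_mult)
        finally show ?thesis .
      qed
      ultimately show ?thesis by (simp del: of_real_power)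
    qed
    then have "(N3 c (J n))\<^sup>2 \<le> q * N3 c (J n)" using G[of \<phi>] N by (simp del: of_real_power)
    then show ?thesis using N_nonneg[of c "J n"] q
      by (cases "N3 c (J n) = 0") (auto simp: power2_eq_square)
  qed
  \<comment> \<open>The mirror image, with \<alpha>^2 in the denominator of the test vector.\<close>
  have dual1: "N1 c (J n) \<le> q"
    if c: "\<And>i. i \<in> J n \<Longrightarrow> c i = G i / of_real (\<alpha> i ^ 4)" and q: "0 \<le> q"
      and G: "\<And>\<phi>. cmod (\<Sum>i\<in>J n. \<phi> i * G i) \<le> q * N3 \<phi> (J n)" for c G q
  proof -
    define \<phi> where "\<phi> i = cnj (c i) / of_real ((\<alpha> i)\<^sup>2)" for i
    have N: "N3 \<phi> (J n) = N1 c (J n)"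
      unfolding N1_def N3_def \<phi>_def
      by (intro L2_set_cong refl) (auto simp: norm_divide norm_mult power2_eq_square power3_eq_cube dest!: pos)
    have "(\<Sum>i\<in>J n. \<phi> i * G i) = of_real ((N1 c (J n))\<^sup>2)"
    proof -
      have "(N1 c (J n))\<^sup>2 = (\<Sum>i\<in>J n. (\<alpha> i * cmod (c i))\<^sup>2)"
        by (simp add: N1_def L2_set_def sum_nonneg)
      moreover have "\<phi> i * G i = of_real ((\<alpha> i * cmod (c i))\<^sup>2)" if i: "i \<in> J n" for i
      proof -
        have "G i = of_real (\<alpha> i ^ 4) * c i" using c[OF i] pos[OF i] by simp
        then have "\<phi> i * G i = of_real (\<alpha> i ^ 4 / (\<alpha> i)\<^sup>2) * (c i * cnj (c i))"
          by (simp add: \<phi>_def)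
        also have "\<alpha> i ^ 4 / (\<alpha> i)\<^sup>2 = (\<alpha> i)\<^sup>2" using pos[OF i] by (simp add: field_simps flip: power_add)
        also have "of_real ((\<alpha> i)\<^sup>2) * (c i * cnj (c i)) = of_real ((\<alpha> i * cmod (c i))\<^sup>2)"
          by (simp add: complex_norm_square[symmetric] power_mult_distrib)
        finally show ?thesis .
      qed
      ultimately show ?thesis by (simp del: of_real_power)
    qed
    then have "(N1 c (J n))\<^sup>2 \<le> q * N1 c (J n)" using G[of \<phi>] N by (simp del: of_real_power)
    then show ?thesis using N_nonneg[of c "J n"] q
      by (cases "N1 c (J n) = 0") (auto simp: power2_eq_square)
  qed
  have triangle: "N1 (\<lambda>i. f i + g i) A \<le> N1 f A + N1 g A" "N3 (\<lambda>i. f i + g i) A \<le> N3 f A + N3 g A"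
    if "\<And>i. i \<in> A \<Longrightarrow> 0 \<le> \<alpha> i" for f g A
  proof -
    have le: "L2_set (\<lambda>i. p i * cmod (f i + g i)) A \<le> L2_set (\<lambda>i. p i * cmod (f i)) A + L2_set (\<lambda>i. p i * cmod (g i)) A"
      if p: "\<And>i. i \<in> A \<Longrightarrow> 0 \<le> p i" for p
    proof (rule order_trans[OF L2_set_mono L2_set_triangle_ineq])
      fix i assume "i \<in> A"
      then show "p i * cmod (f i + g i) \<le> p i * cmod (f i) + p i * cmod (g i)"
        using mult_left_mono[OF norm_triangle_ineq p] by (simp add: distrib_left)
    qed (use p in simp)
    show "N1 (\<lambda>i. f i + g i) A \<le> N1 f A + N1 g A" "N3 (\<lambda>i. f i + g i) A \<le> N3 f A + N3 g A"
      unfolding N1_def N3_def by (rule le; use that in simp)+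
  qed
  \<comment> \<open>Neumann iterates of the truncated system, started at 0. They need not converge
    to \<open>v\<close>, since \<open>v\<close> solves the truncated system only up to
    \<open>r\<close>.\<close>
  define V where "V m = rec_nat (\<lambda>i. 0) (\<lambda>_ w i. (F i + (\<Sum>j\<in>J n. K i j * w j)) / of_real (\<alpha> i ^ 4)) m" for m :: nat
  have V0: "V 0 = (\<lambda>i. 0)" and VS: "V (Suc m) = (\<lambda>i. (F i + (\<Sum>j\<in>J n. K i j * V m j)) / of_real (\<alpha> i ^ 4))" for m
    by (simp_all add: V_def)
  have Vbd: "N3 (V m) (J n) \<le> 2 * C" for m
  proof (induction m)
    case 0
    then show ?case using C0 by (simp add: V0 N3_def L2_set_def)
  next
    case (Suc m)
    have "N3 (V (Suc m)) (J n) \<le> C + 1/2 * N3 (V m) (J n)"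
    proof (rule dual3)
      show "0 \<le> C + 1/2 * N3 (V m) (J n)" using C0 N_nonneg by simp
      fix \<phi>
      have "(\<Sum>i\<in>J n. \<phi> i * (F i + (\<Sum>j\<in>J n. K i j * V m j)))
        = (\<Sum>i\<in>J n. \<phi> i * F i) + (\<Sum>i\<in>J n. \<Sum>j\<in>J n. \<phi> i * K i j * V m j)"
        by (simp add: distrib_left sum.distrib sum_distrib_left mult.assoc)
      also have "cmod \<dots> \<le> C * N1 \<phi> (J n) + 1/2 * N3 (V m) (J n) * N1 \<phi> (J n)"
        by (rule order_trans[OF norm_triangle_ineq add_mono[OF F B1]])
      finally show "cmod (\<Sum>i\<in>J n. \<phi> i * (F i + (\<Sum>j\<in>J n. K i j * V m j)))
        \<le> (C + 1/2 * N3 (V m) (J n)) * N1 \<phi> (J n)" by (simp add: distrib_right)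
    qed (simp add: VS)
    then show ?case using Suc by simp
  qed
  \<comment> \<open>Each iteration halves the weak distance and adds \<delta>/2 from the residual;
    \<delta> is the fixed point of x = x/2 + \<delta>/2.\<close>
  have diff: "N1 (\<lambda>i. v i - V m i) (J n) \<le> (1/2) ^ m * N1 v (J n) + \<delta>" for m
  proof (induction m)
    case 0
    then show ?case using \<delta> by (simp add: V0)
  next
    case (Suc m)
    let ?w = "\<lambda>i. v i - V m i"
    have "N1 (\<lambda>i. v i - V (Suc m) i) (J n) \<le> 1/2 * N1 ?w (J n) + 1/2 * \<delta>"
    proof (rule dual1)
      fix i assume i: "i \<in> J n"
      have "of_real (\<alpha> i ^ 4) * v i = F i + (\<Sum>j\<in>J n. K i j * v j) + r i" by (simp add: r_def)
      moreover have "(\<Sum>j\<in>J n. K i j * v j) = (\<Sum>j\<in>J n. K i j * ?w j) + (\<Sum>j\<in>J n. K i j * V m j)"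
        by (simp add: algebra_simps flip: sum.distrib)
      ultimately show "v i - V (Suc m) i = ((\<Sum>j\<in>J n. K i j * ?w j) + r i) / of_real (\<alpha> i ^ 4)"
        using pos[OF i] unfolding VS by (simp add: field_simps)
    next
      show "0 \<le> 1/2 * N1 ?w (J n) + 1/2 * \<delta>" using N_nonneg \<delta> by simp
      fix \<phi>
      have "(\<Sum>i\<in>J n. \<phi> i * ((\<Sum>j\<in>J n. K i j * ?w j) + r i))
        = (\<Sum>i\<in>J n. \<Sum>j\<in>J n. \<phi> i * K i j * ?w j) + (\<Sum>i\<in>J n. \<phi> i * r i)"
        by (simp only: distrib_left sum.distrib sum_distrib_left mult.assoc)
      also have "cmod \<dots> \<le> 1/2 * N1 ?w (J n) * N3 \<phi> (J n) + 1/2 * \<delta> * N3 \<phi> (J n)"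
        by (rule order_trans[OF norm_triangle_ineq add_mono[OF B2 r]])
      finally show "cmod (\<Sum>i\<in>J n. \<phi> i * ((\<Sum>j\<in>J n. K i j * ?w j) + r i))
        \<le> (1/2 * N1 ?w (J n) + 1/2 * \<delta>) * N3 \<phi> (J n)" by (simp add: distrib_right)
    qed
    also have "\<dots> \<le> 1/2 * ((1/2) ^ m * N1 v (J n) + \<delta>) + 1/2 * \<delta>" using Suc by simp
    also have "\<dots> = (1/2) ^ Suc m * N1 v (J n) + \<delta>" by (simp add: distrib_left)
    finally show ?case .
  qed
  \<comment> \<open>The strong norm of \<open>v\<close> is split into that of an iterate, bounded by
    2C, and that of the difference, which on \<open>J n0\<close> costs only the factor
    \<open>D\<close> over the weak norm. Then \<open>m\<close> tends to infinity.\<close>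
  have "N3 v (J n0) \<le> 2 * C + D * ((1/2) ^ m * N1 v (J n) + \<delta>)" for m
  proof -
    let ?w = "\<lambda>i. v i - V m i"
    have sub: "J n0 \<subseteq> J n" using n(1) by (rule mono)
    have "N3 v (J n0) = N3 (\<lambda>i. V m i + ?w i) (J n0)" by simp
    also have "\<dots> \<le> N3 (V m) (J n0) + N3 ?w (J n0)"
      by (rule triangle) (use pos[THEN less_imp_le] sub in blast)
    also have "N3 (V m) (J n0) \<le> N3 (V m) (J n)"
      unfolding N3_def L2_set_def by (intro real_sqrt_le_mono sum_mono2 fin sub) auto
    also have "\<dots> \<le> 2 * C" by (rule Vbd)
    also have "N3 ?w (J n0) \<le> L2_set (\<lambda>i. D * (\<alpha> i * cmod (?w i))) (J n0)"
      unfolding N3_def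
    proof (rule L2_set_mono)
      fix i assume i: "i \<in> J n0"
      have "\<alpha> i ^ 3 * cmod (?w i) = (\<alpha> i)\<^sup>2 * (\<alpha> i * cmod (?w i))"
        by (simp add: power2_eq_square power3_eq_cube)
      also have "\<dots> \<le> D * (\<alpha> i * cmod (?w i))"
        using D[OF i] pos[OF i] by (intro mult_right_mono) auto
      finally show "\<alpha> i ^ 3 * cmod (?w i) \<le> D * (\<alpha> i * cmod (?w i))" .
    qed (use pos[THEN less_imp_le] in auto)
    also have "\<dots> = D * N1 ?w (J n0)"
      unfolding N1_def using D1 by (subst L2_set_right_distrib) auto
    also have "N1 ?w (J n0) \<le> N1 ?w (J n)"
      unfolding N1_def L2_set_def by (intro real_sqrt_le_mono sum_mono2 fin sub) auto
    also have "\<dots> \<le> (1/2) ^ m * N1 v (J n) + \<delta>" by (rule diff)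
    finally show ?thesis using D1 by simp
  qed
  moreover have "(\<lambda>m. 2 * C + D * ((1/2) ^ m * N1 v (J n) + \<delta>)) \<longlonglongrightarrow> 2 * C + D * (0 * N1 v (J n) + \<delta>)"
    by (intro tendsto_intros LIMSEQ_power_zero) simp
  ultimately have "N3 v (J n0) \<le> 2 * C + D * (0 * N1 v (J n) + \<delta>)"
    by (intro LIMSEQ_le_const) auto
  moreover have "D * \<delta> \<le> \<epsilon>" using D1 \<epsilon> by (simp add: \<delta>_def)
  ultimately show "N3 v (J n0) \<le> 2 * C + \<epsilon>" by simp
qed

section \<open>Fourier coefficients on the circle\<close>

lemma space_circle [simp]: "space circle = {0..<2 * pi}"
  by (simp add: circle_def)

lemma emeasure_circle: "emeasure circle (space circle) = ennreal (2 * pi)"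
  by (simp add: circle_def emeasure_restrict_space)

interpretation circle: finite_measure circle
  by standard (simp add: emeasure_circle[simplified])

interpretation circle2: pair_sigma_finite circle circle ..

interpretation torus: finite_measure "circle \<Otimes>\<^sub>M circle"
  by (intro finite_measure_pair_measure circle.finite_measure_axioms)

lemma measure_circle: "measure circle {0..<2 * pi} = 2 * pi"
  using emeasure_circle by (simp add: measure_def)

lemma borel_measurable_circle: "f \<in> borel_measurable borel \<Longrightarrow> f \<in> borel_measurable circle"
  unfolding circle_def by (intro measurable_restrict_space1) (simp add: measurable_completion)

lemma measurable_circle_id [measurable]: "(\<lambda>x. x) \<in> borel_measurable circle"
  by (rule borel_measurable_circle) simp

lemma integrable_circle_continuous:
  fixes f :: "real \<Rightarrow> complex"
  assumes "continuous_on UNIV f"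
  shows "integrable circle f"
proof -
  have "bounded (f ` {0..2 * pi})"
    by (intro compact_imp_bounded compact_continuous_image) (auto intro: continuous_on_subset[OF assms])
  then obtain B where "\<forall>y\<in>f ` {0..2 * pi}. norm y \<le> B" unfolding bounded_iff by blast
  then have "\<And>x. x \<in> {0..2 * pi} \<Longrightarrow> norm (f x) \<le> B" by auto
  then show ?thesis
    by (intro circle.integrable_const_bound[where B = B] AE_I2 borel_measurable_circle
        borel_measurable_continuous_onI[OF assms]) auto
qed

lemma integral_circle_cis: "(LINT x|circle. cis (of_int k * x)) = (if k = 0 then 2 * pi else 0)"
proof (cases "k = 0")
  case True
  then show ?thesis using measure_circle by (simp add: scaleR_conv_of_real)
next
  case False
  have int: "integrable circle (\<lambda>x. cis (of_int k * x))"
    by (intro integrable_circle_continuous continuous_intros)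
  let ?F = "\<lambda>x::real. cis (of_int k * x) / (\<i> * of_int k)"
  have "((\<lambda>x. cis (of_int k * x)) has_integral (?F (2 * pi) - ?F 0)) {0..2 * pi}"
    unfolding cis_conv_exp
    by (rule fundamental_theorem_of_calculus)
       (use False in \<open>auto intro!: derivative_eq_intros has_vector_derivative_real_field simp: field_simps\<close>)
  moreover have "?F (2 * pi) = ?F 0"
    using cis_multiple_2pi[of "of_int k"] by (simp add: mult.commute)
  ultimately have "((\<lambda>x. cis (of_int k * x)) has_integral 0) {0..2 * pi}" by simp
  then have "((\<lambda>x. cis (of_int k * x)) has_integral 0) {0..<2 * pi}"
    by (rule has_integral_spike_set_eq[THEN iffD1, rotated 2])
       (auto intro: negligible_subset[of "{2 * pi}"])
  then have "integral {0..<2 * pi} (\<lambda>x. cis (of_int k * x)) = 0" by (rule integral_unique)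
  moreover have "(LINT x|circle. cis (of_int k * x)) = integral {0..<2 * pi} (\<lambda>x. cis (of_int k * x))"
    unfolding circle_def by (rule lebesgue_integral_eq_integral) (use int in \<open>auto simp: circle_def\<close>)
  ultimately show ?thesis using False by simp
qed

text \<open>Scalar counterpart of \<open>fourier_coeff\<close>. Complex values are allowed, so that
  it also applies to trigonometric polynomials.\<close>

definition fcoeff :: "(real \<Rightarrow> complex) \<Rightarrow> int \<Rightarrow> complex" where
  "fcoeff w k = (LINT x|circle. w x * cis (- (of_int k * x))) / (2 * pi)"

text \<open>Over an infinite \<open>S\<close> the sum is 0 by convention, which is why several
  bounds below carry no finiteness assumption.\<close>

definition trig :: "int set \<Rightarrow> (int \<Rightarrow> complex) \<Rightarrow> real \<Rightarrow> complex" where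
  "trig S c x = (\<Sum>k\<in>S. c k * cis (of_int k * x))"

lemma continuous_on_trig [continuous_intros]: "continuous_on A (trig S c)"
  unfolding trig_def[abs_def] by (intro continuous_intros)

lemma borel_measurable_trig [measurable]: "trig S c \<in> borel_measurable borel"
  by (intro borel_measurable_continuous_onI continuous_on_trig)

lemma cmod_trig_le: "cmod (trig S c x) \<le> (\<Sum>k\<in>S. cmod (c k))"
  unfolding trig_def by (rule order_trans[OF norm_sum]) (simp add: norm_mult)

lemma sq_integrable_trig [simp]: "sq_integrable circle (trig S c)"
  by (rule circle.sq_integrable_bounded[OF _ cmod_trig_le]) (simp add: borel_measurable_circle)

lemma trig_add: "trig S c x + trig S d x = trig S (\<lambda>k. c k + d k) x"
  by (simp add: trig_def sum.distrib distrib_right)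

lemma trig_diff: "trig S c x - trig S d x = trig S (\<lambda>k. c k - d k) x"
  by (simp add: trig_def sum_subtractf left_diff_distrib)

lemma trig_mono_neutral:
  assumes "finite T" "S \<subseteq> T" shows "trig S c = trig T (\<lambda>k. if k \<in> S then c k else 0)"
  unfolding trig_def by (intro ext sum.mono_neutral_cong_left) (use assms in auto)

lemma cis_minus_mult: "cis (of_int k * x) * cis (- (of_int l * x)) = cis (of_int (k - l) * x)"
  by (simp add: cis_mult algebra_simps)

lemma integrable_circle_mult_cis:
  assumes "integrable circle w"
  shows "integrable circle (\<lambda>x. w x * cis (a * x))"
proof (rule Bochner_Integration.integrable_bound[OF assms])
  show "(\<lambda>x. w x * cis (a * x)) \<in> borel_measurable circle"
    by (intro borel_measurable_times borel_measurable_integrable[OF assms] borel_measurable_circle[of "\<lambda>x. cis (a * x)"]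
        borel_measurable_continuous_onI continuous_intros)
qed (simp add: norm_mult)

lemma integrable_circle_mult_cis':
  assumes "integrable circle w"
  shows "integrable circle (\<lambda>x. w x * cis (- (a * x)))"
  using integrable_circle_mult_cis[OF assms, of "-a"] by simp

lemma fcoeff_diff:
  assumes "integrable circle v" "integrable circle w"
  shows "fcoeff (\<lambda>x. v x - w x) k = fcoeff v k - fcoeff w k"
  unfolding fcoeff_def left_diff_distrib
  by (subst Bochner_Integration.integral_diff) (auto simp: diff_divide_distrib integrable_circle_mult_cis' assms)

lemma fcoeff_add:
  assumes "integrable circle v" "integrable circle w"
  shows "fcoeff (\<lambda>x. v x + w x) k = fcoeff v k + fcoeff w k"
  unfolding fcoeff_def distrib_right
  by (subst Bochner_Integration.integral_add) (auto simp: add_divide_distrib integrable_circle_mult_cis' assms)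

lemma integrable_trig [simp]: "integrable circle (trig S c)"
  by (intro integrable_circle_continuous continuous_intros)

text \<open>The pairing is bilinear, without conjugation, hence the frequency \<open>- k\<close>.
  The reflections of indices later on have this origin.\<close>

lemma integral_mult_trig:
  fixes c :: "int \<Rightarrow> complex"
  assumes "integrable circle w"
  shows "(LINT x|circle. w x * trig S c x) = (\<Sum>k\<in>S. 2 * pi * c k * fcoeff w (- k))"
proof -
  have "(LINT x|circle. w x * trig S c x) = (LINT x|circle. (\<Sum>k\<in>S. c k * (w x * cis (of_int k * x))))"
    by (simp add: trig_def sum_distrib_left mult_ac)
  also have "\<dots> = (\<Sum>k\<in>S. c k * (LINT x|circle. w x * cis (of_int k * x)))"
    by (subst Bochner_Integration.integral_sum) (auto simp: integrable_circle_mult_cis assms)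
  also have "\<dots> = (\<Sum>k\<in>S. 2 * pi * c k * fcoeff w (- k))"
    by (intro sum.cong) (auto simp: fcoeff_def)
  finally show ?thesis .
qed

lemma fcoeff_trig:
  assumes "finite S"
  shows "fcoeff (trig S c) k = (if k \<in> S then c k else 0)"
proof -
  have "(LINT x|circle. trig S c x * cis (- (of_int k * x)))
      = (LINT x|circle. (\<Sum>l\<in>S. c l * cis (of_int (l - k) * x)))"
    by (simp only: trig_def sum_distrib_right mult.assoc cis_minus_mult)
  also have "\<dots> = (\<Sum>l\<in>S. c l * (if l - k = 0 then 2 * pi else 0))"
    unfolding integral_circle_cis[symmetric]
    by (subst Bochner_Integration.integral_sum)
       (auto intro!: integrable_circle_continuous continuous_intros)
  also have "\<dots> = (if k \<in> S then c k * (2 * pi) else 0)"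
    using assms by (simp add: if_distrib cong: if_cong)
  finally show ?thesis by (simp add: fcoeff_def)
qed

lemma integral_mult_cnj_trig:
  assumes "integrable circle w"
  shows "(LINT x|circle. w x * cnj (trig S c x)) = (\<Sum>k\<in>S. 2 * pi * cnj (c k) * fcoeff w k)"
proof -
  have "(LINT x|circle. w x * cnj (trig S c x)) = (LINT x|circle. (\<Sum>k\<in>S. cnj (c k) * (w x * cis (- (of_int k * x)))))"
    by (simp add: trig_def sum_distrib_left mult_ac cis_cnj)
  also have "\<dots> = (\<Sum>k\<in>S. cnj (c k) * (LINT x|circle. w x * cis (- (of_int k * x))))"
    by (subst Bochner_Integration.integral_sum) (auto simp: integrable_circle_mult_cis' assms)
  also have "\<dots> = (\<Sum>k\<in>S. 2 * pi * cnj (c k) * fcoeff w k)"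
    by (intro sum.cong) (auto simp: fcoeff_def)
  finally show ?thesis .
qed

lemma L2_norm_trig:
  assumes "finite S"
  shows "(L2_norm circle (trig S c))\<^sup>2 = 2 * pi * (\<Sum>k\<in>S. (cmod (c k))\<^sup>2)"
proof -
  have "complex_of_real ((L2_norm circle (trig S c))\<^sup>2) = (LINT x|circle. trig S c x * cnj (trig S c x))"
    unfolding L2_norm_power2 complex_norm_square[symmetric] by (rule integral_complex_of_real[symmetric])
  also have "\<dots> = (\<Sum>k\<in>S. 2 * pi * cnj (c k) * c k)"
    by (subst integral_mult_cnj_trig) (auto simp: fcoeff_trig assms)
  also have "\<dots> = complex_of_real (2 * pi * (\<Sum>k\<in>S. (cmod (c k))\<^sup>2))"
    unfolding of_real_mult of_real_sum sum_distrib_left complex_norm_square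
    by (intro sum.cong) (auto simp: mult_ac)
  finally show ?thesis by (simp only: of_real_eq_iff)
qed

lemma Bessel:
  assumes w: "sq_integrable circle w" and S: "finite S"
  shows "2 * pi * (\<Sum>k\<in>S. (cmod (fcoeff w k))\<^sup>2) \<le> (L2_norm circle w)\<^sup>2"
proof -
  let ?t = "trig S (fcoeff w)"
  let ?A = "2 * pi * (\<Sum>k\<in>S. (cmod (fcoeff w k))\<^sup>2)"
  have i1: "integrable circle (\<lambda>x. w x * cnj (?t x))" and i2: "integrable circle (\<lambda>x. (cmod (w x))\<^sup>2)"
    and i3: "integrable circle (\<lambda>x. (cmod (?t x))\<^sup>2)"
    using sq_integrable_mult[OF w sq_integrable_cnj[OF sq_integrable_trig[of S "fcoeff w"]]] w
      sq_integrable_trig[of S "fcoeff w"] by (auto simp: sq_integrable_def)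
  have eq: "(cmod (w x - ?t x))\<^sup>2 = (cmod (w x))\<^sup>2 - 2 * Re (w x * cnj (?t x)) + (cmod (?t x))\<^sup>2" for x
    by (simp only: cmod_power2) (simp add: power2_eq_square algebra_simps)
  have "0 \<le> (LINT x|circle. (cmod (w x - ?t x))\<^sup>2)" by simp
  also have "\<dots> = (LINT x|circle. (cmod (w x))\<^sup>2) - 2 * (LINT x|circle. Re (w x * cnj (?t x))) + (LINT x|circle. (cmod (?t x))\<^sup>2)"
  proof -
    define R where "R x = Re (w x * cnj (?t x))" for x
    have "integrable circle R" unfolding R_def by (rule integrable_Re[OF i1])
    then show ?thesis unfolding eq R_def[symmetric] using i2 i3 by simp
  qed
  also have "(LINT x|circle. Re (w x * cnj (?t x))) = Re (LINT x|circle. w x * cnj (?t x))"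
    using i1 by (rule integral_Re)
  also have "(LINT x|circle. w x * cnj (?t x)) = of_real ?A"
    unfolding integral_mult_cnj_trig[OF circle.sq_integrable_imp_integrable[OF w]]
    unfolding of_real_mult of_real_sum sum_distrib_left complex_norm_square
    by (intro sum.cong) (auto simp: mult_ac)
  also have "(LINT x|circle. (cmod (?t x))\<^sup>2) = ?A"
    using L2_norm_trig[OF S, of "fcoeff w"] by (simp add: L2_norm_power2)
  finally show ?thesis unfolding L2_norm_power2 by simp
qed

lemma Bessel_summable:
  assumes "sq_integrable circle w"
  shows "(\<lambda>k. (cmod (fcoeff w k))\<^sup>2) summable_on UNIV"
proof (rule nonneg_bdd_above_summable_on)
  show "bdd_above (sum (\<lambda>k. (cmod (fcoeff w k))\<^sup>2) ` {F. F \<subseteq> UNIV \<and> finite F})"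
  proof (rule bdd_aboveI2)
    fix F :: "int set" assume "F \<in> {F. F \<subseteq> UNIV \<and> finite F}"
    then show "(\<Sum>k\<in>F. (cmod (fcoeff w k))\<^sup>2) \<le> (L2_norm circle w)\<^sup>2 / (2 * pi)"
      using Bessel[OF assms, of F] by (simp add: field_simps)
  qed
qed auto

text \<open>Collects terms by the difference \<open>m = k - l\<close>. The Fejer kernel, |trig|^2
  and the square function of a trigonometric polynomial all have this shape.\<close>

lemma double_trig_eq_trig:
  assumes S: "finite S"
  shows "(\<Sum>k\<in>S. \<Sum>l\<in>S. g k l * cis (of_int (k - l) * x))
    = trig ((\<lambda>(k, l). k - l) ` (S \<times> S)) (\<lambda>m. \<Sum>k\<in>S. if k - m \<in> S then g k (k - m) else 0) x"
proof -
  let ?M = "(\<lambda>(k, l). k - l) ` (S \<times> S)"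
  have M: "finite ?M" using S by auto
  have inner: "(\<Sum>l\<in>S. g k l * cis (of_int (k - l) * x))
      = (\<Sum>m\<in>?M. (if k - m \<in> S then g k (k - m) else 0) * cis (of_int m * x))" if k: "k \<in> S" for k
  proof -
    have "(\<Sum>l\<in>S. g k l * cis (of_int (k - l) * x)) = (\<Sum>m\<in>(\<lambda>l. k - l) ` S. g k (k - m) * cis (of_int m * x))"
      by (subst sum.reindex) (auto simp: inj_on_def)
    also have "\<dots> = (\<Sum>m\<in>?M. (if k - m \<in> S then g k (k - m) else 0) * cis (of_int m * x))"
    proof (rule sum.mono_neutral_cong_left[OF M])
      show "(\<lambda>l. k - l) ` S \<subseteq> ?M" using k by auto
      show "\<forall>m\<in>?M - (\<lambda>l. k - l) ` S. (if k - m \<in> S then g k (k - m) else 0) * cis (of_int m * x) = 0"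
      proof
        fix m assume m: "m \<in> ?M - (\<lambda>l. k - l) ` S"
        have "k - m \<notin> S"
        proof
          assume "k - m \<in> S"
          then have "k - (k - m) \<in> (\<lambda>l. k - l) ` S" by (rule imageI)
          then show False using m by simp
        qed
        then show "(if k - m \<in> S then g k (k - m) else 0) * cis (of_int m * x) = 0" by simp
      qed
    qed auto
    finally show ?thesis .
  qed
  have "(\<Sum>k\<in>S. \<Sum>l\<in>S. g k l * cis (of_int (k - l) * x))
    = (\<Sum>k\<in>S. \<Sum>m\<in>?M. (if k - m \<in> S then g k (k - m) else 0) * cis (of_int m * x))"
    by (intro sum.cong refl inner)
  also have "\<dots> = (\<Sum>m\<in>?M. \<Sum>k\<in>S. (if k - m \<in> S then g k (k - m) else 0) * cis (of_int m * x))"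
    by (rule sum.swap)
  finally show ?thesis unfolding trig_def by (simp only: sum_distrib_right)
qed

text \<open>Orthogonality reduces the norm to the discrete convolution inequality; 88 pi = 2 pi *
  44.\<close>

lemma L2_norm_double_trig:
  assumes S: "finite S" and a: "\<And>k. 0 \<le> a k" "\<And>k. k \<notin> S \<Longrightarrow> a k = 0"
    and g: "\<And>k l. k \<in> S \<Longrightarrow> l \<in> S \<Longrightarrow> cmod (g k l) \<le> a k * a l / (root4 k * root4 l)"
  shows "(L2_norm circle (\<lambda>x. \<Sum>k\<in>S. \<Sum>l\<in>S. g k l * cis (of_int (k - l) * x)))\<^sup>2
    \<le> 88 * pi * (\<Sum>k\<in>S. (a k)\<^sup>2)\<^sup>2"
proof -
  let ?M = "(\<lambda>(k, l). k - l) ` (S \<times> S)"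
  let ?h = "\<lambda>m. \<Sum>k\<in>S. if k - m \<in> S then g k (k - m) else 0"
  have M: "finite ?M" using S by auto
  have "(L2_norm circle (\<lambda>x. \<Sum>k\<in>S. \<Sum>l\<in>S. g k l * cis (of_int (k - l) * x)))\<^sup>2
      = 2 * pi * (\<Sum>m\<in>?M. (cmod (?h m))\<^sup>2)"
    unfolding double_trig_eq_trig[OF S] using L2_norm_trig[OF M] by blast
  also have "(\<Sum>m\<in>?M. (cmod (?h m))\<^sup>2) \<le> (\<Sum>m\<in>?M. (\<Sum>k\<in>S. a k * a (k - m) / (root4 k * root4 (k - m)))\<^sup>2)"
  proof (intro sum_mono power_mono)
    fix m
    show "cmod (?h m) \<le> (\<Sum>k\<in>S. a k * a (k - m) / (root4 k * root4 (k - m)))"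
      by (rule order_trans[OF norm_sum sum_mono]) (use g a in auto)
  qed auto
  also have "\<dots> \<le> 44 * (\<Sum>k\<in>S. (a k)\<^sup>2)\<^sup>2"
    by (rule sum_square_convolution_le) (use S M a in auto)
  finally show ?thesis by simp
qed

section \<open>Fejer means and uniqueness\<close>

lemma AE_pair_fst_snd:
  assumes "sigma_finite_measure M2" "AE x in M1. Q x" "sigma_finite_measure M1" "AE y in M2. R y"
  shows "AE p in M1 \<Otimes>\<^sub>M M2. Q (fst p) \<and> R (snd p)"
proof -
  interpret M2: sigma_finite_measure M2 by fact
  obtain N where N: "{x\<in>space M1. \<not> Q x} \<subseteq> N" "N \<in> sets M1" "emeasure M1 N = 0"
    using AE_E[OF assms(2)] by metis
  obtain N' where N': "{x\<in>space M2. \<not> R x} \<subseteq> N'" "N' \<in> sets M2" "emeasure M2 N' = 0"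
    using AE_E[OF assms(4)] by metis
  have "N \<times> space M2 \<in> null_sets (M1 \<Otimes>\<^sub>M M2)" "space M1 \<times> N' \<in> null_sets (M1 \<Otimes>\<^sub>M M2)"
    using N N' by (auto simp: null_sets_def M2.emeasure_pair_measure_Times)
  then have "(N \<times> space M2) \<union> (space M1 \<times> N') \<in> null_sets (M1 \<Otimes>\<^sub>M M2)" by (rule null_sets.Un)
  then show ?thesis
    by (rule AE_I') (use N(1) N'(1) in \<open>auto simp: space_pair_measure\<close>)
qed

lemma AE_circle2:
  assumes "AE x in circle. Q x"
  shows "AE p in circle \<Otimes>\<^sub>M circle. Q (fst p) \<and> Q (snd p)"
  using assms by (intro AE_pair_fst_snd circle.sigma_finite_measure_axioms)

text \<open>\<open>ennreal\<close> clips at 0, so the two densities are the positive and the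
  negative part of \<open>f\<close>. Their measures are finite on rays and agree there, hence they
  are equal.\<close>

lemma AE_zero_if_integral_rays_zero:
  fixes f :: "real \<Rightarrow> real"
  assumes f: "integrable lborel f" and zero: "\<And>a. (LINT x|lborel. indicator {a<..} x * f x) = 0"
  shows "AE x in lborel. f x = 0"
proof -
  have fm [measurable]: "f \<in> borel_measurable borel" using f by auto
  let ?M = "density lborel (\<lambda>x. ennreal (f x))" and ?N = "density lborel (\<lambda>x. ennreal (- f x))"
  have int: "integrable lborel (\<lambda>x. indicator {a<..} x * f x)" for a
    using integrable_mult_indicator[OF _ f, of "{a<..}"] by simp
  have M: "emeasure ?M {a<..} = (\<integral>\<^sup>+x. ennreal (indicator {a<..} x * f x) \<partial>lborel)" for a
    by (subst emeasure_density) (auto intro!: nn_integral_cong split: split_indicator)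
  have N: "emeasure ?N {a<..} = (\<integral>\<^sup>+x. ennreal (- (indicator {a<..} x * f x)) \<partial>lborel)" for a
    by (subst emeasure_density) (auto intro!: nn_integral_cong split: split_indicator)
  have fin: "emeasure ?M {a<..} < \<infinity>" "emeasure ?N {a<..} < \<infinity>" for a
    unfolding M N using int[of a] by (auto simp: real_integrable_def less_top)
  have "?M = ?N"
  proof (rule measure_eqI_lessThan)
    fix a
    have "enn2real (emeasure ?M {a<..}) - enn2real (emeasure ?N {a<..}) = 0"
      unfolding M N zero[of a, symmetric] by (rule real_lebesgue_integral_def[OF int, symmetric])
    then show "emeasure ?M {a<..} = emeasure ?N {a<..}"
      using fin[of a] by (metis ennreal_enn2real eq_iff_diff_eq_0 infinity_ennreal_def)
    show "emeasure ?M {a<..} < \<infinity>" by (rule fin)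
  qed auto
  then have "AE x in lborel. ennreal (f x) = ennreal (- f x)"
    by (intro sigma_finite_measure.density_unique[OF lborel.sigma_finite_measure_axioms]) auto
  then show ?thesis
  proof eventually_elim
    case (elim x)
    then show ?case by (cases "f x \<ge> 0") (auto simp: ennreal_neg)
  qed
qed

lemma AE_zero_if_integral_rays_zero_lebesgue:
  fixes f :: "real \<Rightarrow> real"
  assumes f: "integrable lebesgue f" and zero: "\<And>a. (LINT x|lebesgue. indicator {a<..} x * f x) = 0"
  shows "AE x in lebesgue. f x = 0"
proof -
  obtain g where g: "g \<in> borel_measurable lborel" "AE x in lborel. f x = g x"
    using completion_ex_borel_measurable_real[OF borel_measurable_integrable[OF f]] by auto
  have ae: "AE x in lebesgue. f x = g x" using g(2) by (rule AE_completion)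
  have gm: "g \<in> borel_measurable lebesgue" using g(1) by (rule measurable_completion)
  have "integrable lebesgue g" using f gm ae by (subst integrable_cong_AE[symmetric]) auto
  then have gi: "integrable lborel g" using integrable_completion[OF g(1)] by simp
  have "(LINT x|lborel. indicator {a<..} x * g x) = 0" for a
  proof -
    have "(LINT x|lborel. indicator {a<..} x * g x) = (LINT x|lebesgue. indicator {a<..} x * g x)"
      by (rule integral_completion[symmetric]) (use g(1) in measurable)
    also have "\<dots> = (LINT x|lebesgue. indicator {a<..} x * f x)"
    proof (rule integral_cong_AE)
      have ind: "(indicator {a<..} :: real \<Rightarrow> real) \<in> borel_measurable lebesgue"
        by (rule borel_measurable_indicator) simp
      show "(\<lambda>x. indicator {a<..} x * g x) \<in> borel_measurable lebesgue"
        "(\<lambda>x. indicator {a<..} x * f x) \<in> borel_measurable lebesgue"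
        using ind gm f by auto
      show "AE x in lebesgue. indicator {a<..} x * g x = indicator {a<..} x * f x"
        using ae by eventually_elim simp
    qed
    finally show ?thesis using zero by simp
  qed
  then have "AE x in lborel. g x = 0" by (rule AE_zero_if_integral_rays_zero[OF gi])
  then have "AE x in lebesgue. g x = 0" by (rule AE_completion)
  with ae show ?thesis by eventually_elim simp
qed

section \<open>The chordal distance and the Fejer kernel\<close>

lemma circle_dist_nonneg [simp]: "0 \<le> circle_dist x y" by (simp add: circle_dist_def)

text \<open>The distance is the chord between two points of the unit circle. In this form it cancels
  against geometric sums.\<close>

lemma circle_dist_eq: "circle_dist x y = cmod (1 - cis (x - y))"
proof -
  have two: "2 * ((x - y) / 2) = x - y" by simp
  have "(cmod (1 - cis (x - y)))\<^sup>2 = 2 - 2 * cos (x - y)"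
    using sin_cos_squared_add[of "x - y"] by (simp add: cmod_power2 power2_diff algebra_simps)
  also have "\<dots> = (circle_dist x y)\<^sup>2"
    using cos_double_sin[of "(x - y) / 2"] unfolding two by (simp add: circle_dist_def power_mult_distrib)
  finally show ?thesis by (rule power2_eq_imp_eq[symmetric]) auto
qed

lemma circle_dist_commute: "circle_dist x y = circle_dist y x"
proof -
  have "sin ((y - x) / 2) = - sin ((x - y) / 2)"
    by (metis minus_diff_eq minus_divide_left sin_minus)
  then show ?thesis by (simp add: circle_dist_def)
qed

text \<open>The ranges are asymmetric on purpose: \<open>y\<close> may be an endpoint, so that a
  compact set of \<open>y\<close> can be used, and then \<open>x\<close> has to be interior because
  0 and 2 pi are the same point.\<close>

lemma circle_dist_pos:
  assumes "0 < x" "x < 2 * pi" "0 \<le> y" "y \<le> 2 * pi" "x \<noteq> y"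
  shows "0 < circle_dist x y"
proof -
  have "sin ((x - y) / 2) \<noteq> 0"
    using sin_gt_zero[of "(x - y) / 2"] sin_gt_zero[of "(y - x) / 2"] assms sin_minus[of "(x - y) / 2"]
    by (cases "x < y") (auto simp: minus_divide_left)
  then show ?thesis by (simp add: circle_dist_def)
qed

text \<open>The number of representations of \<open>m\<close> as a difference of two elements of
  \<open>{0..<N}\<close>, that is max(0, N - |m|). As a count it comes directly from the expansion
  of a squared sum.\<close>

definition fejer_count :: "nat \<Rightarrow> int \<Rightarrow> nat" where
  "fejer_count N m = card {k \<in> {0..<int N}. k - m \<in> {0..<int N}}"

definition fejer_weight :: "nat \<Rightarrow> int \<Rightarrow> real" where
  "fejer_weight N m = fejer_count N m / N"

definition fejer_freqs :: "nat \<Rightarrow> int set" where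
  "fejer_freqs N = (\<lambda>(k, l). k - l) ` ({0..<int N} \<times> {0..<int N})"

text \<open>Written as a square, so that nonnegativity is immediate and decay away from 0 follows
  from the geometric sum.\<close>

definition fejer_kernel :: "nat \<Rightarrow> real \<Rightarrow> real" where
  "fejer_kernel N z = (cmod (\<Sum>a\<in>{0..<int N}. cis (of_int a * z)))\<^sup>2 / N"

definition fejer_mean :: "nat \<Rightarrow> (real \<Rightarrow> complex) \<Rightarrow> real \<Rightarrow> complex" where
  "fejer_mean N w = trig (fejer_freqs N) (\<lambda>m. fejer_weight N m * fcoeff w m)"

lemma finite_fejer_freqs [simp]: "finite (fejer_freqs N)"
  by (simp add: fejer_freqs_def)

lemma fejer_weight_nonneg [simp]: "0 \<le> fejer_weight N m"
  by (simp add: fejer_weight_def)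

lemma fejer_weight_le_1: "fejer_weight N m \<le> 1"
proof -
  have "fejer_count N m \<le> card {0..<int N}" unfolding fejer_count_def by (rule card_mono) auto
  then show ?thesis by (cases "N = 0") (simp_all add: fejer_weight_def)
qed

lemma fejer_weight_0: "0 < N \<Longrightarrow> fejer_weight N 0 = 1"
proof -
  have "fejer_count N 0 = card {0..<int N}" unfolding fejer_count_def by (rule arg_cong[of _ _ card]) auto
  then show "fejer_weight N 0 = 1" if "0 < N" using that by (simp add: fejer_weight_def)
qed

lemma fejer_weight_eq_0: "m \<notin> fejer_freqs N \<Longrightarrow> fejer_weight N m = 0"
proof -
  assume m: "m \<notin> fejer_freqs N"
  have "{k \<in> {0..<int N}. k - m \<in> {0..<int N}} = {}"
  proof (rule ccontr)
    assume "{k \<in> {0..<int N}. k - m \<in> {0..<int N}} \<noteq> {}"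
    then obtain k where "k \<in> {0..<int N}" "k - m \<in> {0..<int N}" by blast
    then have "k - (k - m) \<in> fejer_freqs N" unfolding fejer_freqs_def by (intro image_eqI[of _ _ "(k, k - m)"]) auto
    then show False using m by simp
  qed
  then have "fejer_count N m = 0" unfolding fejer_count_def by (simp only: card.empty)
  then show ?thesis by (simp add: fejer_weight_def)
qed

lemma fejer_weight_tendsto: "(\<lambda>N. fejer_weight N m) \<longlonglongrightarrow> 1"
proof (rule real_tendsto_sandwich)
  show "\<forall>\<^sub>F N in sequentially. 1 - real_of_int \<bar>m\<bar> * (1 / real N) \<le> fejer_weight N m"
  proof (rule eventually_sequentiallyI)
    fix N :: nat assume N: "1 \<le> N"
    have "{max 0 m..<min (int N) (int N + m)} \<subseteq> {k \<in> {0..<int N}. k - m \<in> {0..<int N}}" by auto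
    then have "card {max 0 m..<min (int N) (int N + m)} \<le> fejer_count N m"
      unfolding fejer_count_def
      by (intro card_mono finite_subset[OF _ finite_atLeastLessThan_int[of 0 "int N"]]) auto
    moreover have "int N - \<bar>m\<bar> \<le> int (card {max 0 m..<min (int N) (int N + m)})" by (simp; arith)
    ultimately have "real N - real_of_int \<bar>m\<bar> \<le> real (fejer_count N m)" by linarith
    then show "1 - real_of_int \<bar>m\<bar> * (1 / real N) \<le> fejer_weight N m"
      using N divide_right_mono[of "real N - real_of_int \<bar>m\<bar>" "real (fejer_count N m)" "real N"]
      by (simp add: fejer_weight_def diff_divide_distrib)
  qed
  have "(\<lambda>N. 1 - real_of_int \<bar>m\<bar> * (1 / real N)) \<longlonglongrightarrow> 1 - real_of_int \<bar>m\<bar> * 0"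
    by (intro tendsto_intros lim_1_over_n)
  then show "(\<lambda>N. 1 - real_of_int \<bar>m\<bar> * (1 / real N)) \<longlonglongrightarrow> 1" by simp
qed (auto simp: fejer_weight_le_1)

lemma fejer_kernel_nonneg [simp]: "0 \<le> fejer_kernel N z"
  by (simp add: fejer_kernel_def)

lemma fejer_kernel_eq_trig: "complex_of_real (fejer_kernel N z) = trig (fejer_freqs N) (\<lambda>m. fejer_weight N m) z"
proof -
  let ?S = "{0..<int N}"
  have "complex_of_real ((cmod (\<Sum>a\<in>?S. cis (of_int a * z)))\<^sup>2)
      = (\<Sum>k\<in>?S. \<Sum>l\<in>?S. 1 * cis (of_int (k - l) * z))"
    unfolding complex_norm_square cnj_sum sum_product cis_cnj cis_mult
    by (simp add: algebra_simps)
  also have "\<dots> = trig (fejer_freqs N) (\<lambda>m. \<Sum>k\<in>?S. if k - m \<in> ?S then 1 else 0) z"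
    unfolding fejer_freqs_def by (rule double_trig_eq_trig) simp
  also have "(\<lambda>m. \<Sum>k\<in>?S. if k - m \<in> ?S then 1 else (0::complex)) = (\<lambda>m. of_nat (fejer_count N m))"
    unfolding fejer_count_def
    by (rule ext) (subst sum.inter_filter[symmetric], simp_all only: finite_atLeastLessThan_int sum_constant mult_1_right)
  finally have "complex_of_real (fejer_kernel N z) = trig (fejer_freqs N) (\<lambda>m. of_nat (fejer_count N m)) z / N"
    by (simp add: fejer_kernel_def)
  then show ?thesis by (simp add: trig_def fejer_weight_def sum_divide_distrib mult_ac)
qed

lemma fejer_mean_eq_integral:
  assumes "integrable circle w"
  shows "fejer_mean N w x = (LINT y|circle. w y * of_real (fejer_kernel N (x - y))) / (2 * pi)"
proof -
  have "(LINT y|circle. w y * of_real (fejer_kernel N (x - y)))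
      = (LINT y|circle. w y * cnj (trig (fejer_freqs N) (\<lambda>m. fejer_weight N m * cis (- (of_int m * x))) y))"
    unfolding fejer_kernel_eq_trig
    by (intro Bochner_Integration.integral_cong)
       (auto simp: trig_def cis_cnj cis_mult algebra_simps mult.assoc[symmetric] intro!: sum.cong)
  also have "\<dots> = 2 * pi * fejer_mean N w x"
    unfolding integral_mult_cnj_trig[OF assms]
    by (simp add: fejer_mean_def trig_def sum_distrib_left cis_cnj mult_ac)
  finally show ?thesis by simp
qed

lemma integrable_fejer_kernel [simp]: "integrable circle (\<lambda>y. fejer_kernel N (x - y))"
proof -
  have "integrable circle (\<lambda>y. complex_of_real (fejer_kernel N (x - y)))"
    unfolding fejer_kernel_eq_trig trig_def
    by (intro integrable_circle_continuous continuous_intros)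
  then show ?thesis using integrable_Re by fastforce
qed

lemma integral_fejer_kernel:
  assumes "0 < N" shows "(LINT y|circle. fejer_kernel N (x - y)) = 2 * pi"
proof -
  have one: "(\<lambda>_. 1::complex) = trig {0} (\<lambda>_. 1)" by (simp add: trig_def fun_eq_iff)
  have c: "fcoeff (\<lambda>_. 1) m = (if m = 0 then 1 else 0)" for m
    unfolding one by (subst fcoeff_trig) auto
  have "0 \<in> fejer_freqs N" unfolding fejer_freqs_def using assms by (auto intro!: image_eqI[of _ _ "(0,0)"])
  then have "fejer_mean N (\<lambda>_. 1) x = 1"
    using assms by (simp add: fejer_mean_def trig_def c if_distrib[of "\<lambda>u. u * _"] if_distrib[of "\<lambda>u. _ * u"]
        fejer_weight_0 cong: if_cong)
  then have "complex_of_real (LINT y|circle. fejer_kernel N (x - y)) / (2 * pi) = 1"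
    by (subst (asm) fejer_mean_eq_integral) auto
  then have "complex_of_real (LINT y|circle. fejer_kernel N (x - y)) = complex_of_real (2 * pi)" by simp
  then show ?thesis by (simp only: of_real_eq_iff)
qed

text \<open>The kernel is nonnegative with total mass 2 pi. This uniform bound, which sharp partial
  sums do not share, is the reason for using Fejer means.\<close>

lemma fejer_mean_bounded:
  assumes "integrable circle w" "\<And>y. y \<in> {0..<2 * pi} \<Longrightarrow> cmod (w y) \<le> 1"
  shows "cmod (fejer_mean N w x) \<le> 1"
proof (cases "N = 0")
  case True
  then show ?thesis by (simp add: fejer_mean_def trig_def fejer_freqs_def)
next
  case False
  have "cmod (LINT y|circle. w y * of_real (fejer_kernel N (x - y)))
      \<le> (LINT y|circle. fejer_kernel N (x - y))"
  proof (rule order_trans[OF integral_norm_bound integral_mono], rule integrable_norm)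
    show "integrable circle (\<lambda>y. w y * of_real (fejer_kernel N (x - y)))"
    proof (rule Bochner_Integration.integrable_bound[of _ "\<lambda>y. fejer_kernel N (x - y)"])
      show "(\<lambda>y. w y * of_real (fejer_kernel N (x - y))) \<in> borel_measurable circle"
        using borel_measurable_integrable[OF assms(1)] borel_measurable_integrable[OF integrable_fejer_kernel] by simp
      show "AE y in circle. norm (w y * of_real (fejer_kernel N (x - y))) \<le> norm (fejer_kernel N (x - y))"
        using assms(2) by (intro AE_I2) (auto simp: norm_mult intro: mult_left_le_one_le)
    qed simp
    fix y assume "y \<in> space circle"
    then show "norm (w y * of_real (fejer_kernel N (x - y))) \<le> fejer_kernel N (x - y)"
      using assms(2) by (auto simp: norm_mult intro: mult_left_le_one_le)
  qed simp
  then show ?thesis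
    using False by (simp add: fejer_mean_eq_integral[OF assms(1)] norm_divide integral_fejer_kernel)
qed

text \<open>The geometric sum equals (1 - z^N) / (1 - z), with numerator at most 2 and denominator
  at least \<delta>.\<close>

lemma fejer_kernel_bound:
  assumes "\<delta> > 0" "\<delta> \<le> circle_dist x y"
  shows "fejer_kernel N (x - y) \<le> 4 / (\<delta>\<^sup>2 * N)"
proof -
  let ?z = "x - y"
  have "(\<Sum>a\<in>{0..<int N}. cis (of_int a * ?z)) = (\<Sum>a<N. cis ?z ^ a)"
    by (rule sum.reindex_bij_witness[of _ int nat]) (auto simp: Complex.DeMoivre)
  then have eq: "(1 - cis ?z) * (\<Sum>a\<in>{0..<int N}. cis (of_int a * ?z)) = 1 - cis ?z ^ N"
    by (simp add: one_diff_power_eq)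
  have "\<delta> * cmod (\<Sum>a\<in>{0..<int N}. cis (of_int a * ?z)) \<le> cmod (1 - cis ?z) * cmod (\<Sum>a\<in>{0..<int N}. cis (of_int a * ?z))"
    using assms by (intro mult_right_mono) (auto simp: circle_dist_eq)
  also have "\<dots> = cmod (1 - cis ?z ^ N)" by (simp add: eq flip: norm_mult)
  also have "\<dots> \<le> 2" using norm_triangle_ineq4[of 1 "cis ?z ^ N"] by (simp add: norm_power)
  finally have "cmod (\<Sum>a\<in>{0..<int N}. cis (of_int a * ?z)) \<le> 2 / \<delta>" using assms by (simp add: field_simps)
  then have "(cmod (\<Sum>a\<in>{0..<int N}. cis (of_int a * ?z)))\<^sup>2 \<le> (2 / \<delta>)\<^sup>2" by (rule power_mono) simp
  then have "fejer_kernel N ?z \<le> (2 / \<delta>)\<^sup>2 / N" unfolding fejer_kernel_def by (rule divide_right_mono) simp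
  also have "\<dots> = 4 / (\<delta>\<^sup>2 * N)" by (simp add: power_divide)
  finally show ?thesis .
qed

lemma fejer_mean_indicator_tendsto_0:
  assumes A: "A \<in> sets borel" and x: "0 < x" "x < 2 * pi" and r: "r > 0" "A \<inter> {x - r<..<x + r} = {}"
  shows "(\<lambda>N. fejer_mean N (indicator A) x) \<longlonglongrightarrow> 0"
proof -
  have int: "integrable circle (indicator A :: real \<Rightarrow> complex)"
    using A by (intro circle.integrable_const_bound[where B = 1] borel_measurable_circle)
      (auto split: split_indicator)
  \<comment> \<open>The closed interval makes \<open>K\<close> compact, so the continuous distance
    from \<open>x\<close> has a positive minimum on it.\<close>
  define K where "K = {0..2 * pi} - {x - r<..<x + r}"
  have K: "compact K" unfolding K_def by (intro compact_diff) auto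
  obtain \<delta> where \<delta>: "\<delta> > 0" "\<And>y. y \<in> K \<Longrightarrow> \<delta> \<le> circle_dist x y"
  proof (cases "K = {}")
    case False
    have "continuous_on K (circle_dist x)" unfolding circle_dist_def[abs_def] by (intro continuous_intros) auto
    then obtain y0 where "y0 \<in> K" "\<forall>y\<in>K. circle_dist x y0 \<le> circle_dist x y"
      using continuous_attains_inf[OF K False] by blast
    then show ?thesis using circle_dist_pos[OF x, of y0] r by (intro that[of "circle_dist x y0"]) (auto simp: K_def)
  qed (use that[of 1] in auto)
  have ev: "\<forall>\<^sub>F N in sequentially. norm (fejer_mean N (indicator A) x) \<le> 4 / \<delta>\<^sup>2 * (1 / N)"
  proof (rule eventually_sequentiallyI)
    fix N :: nat assume "1 \<le> N"
    have "cmod (LINT y|circle. indicator A y * of_real (fejer_kernel N (x - y))) \<le> (LINT y|circle. 4 / (\<delta>\<^sup>2 * N))"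
    proof (rule order_trans[OF integral_norm_bound integral_mono], rule integrable_norm)
      have m: "(\<lambda>y. indicator A y * complex_of_real (fejer_kernel N (x - y))) \<in> borel_measurable circle"
        using borel_measurable_integrable[OF int] borel_measurable_integrable[OF integrable_fejer_kernel] by simp
      have le: "norm (indicator A y * complex_of_real (fejer_kernel N (x - y))) \<le> 4 / (\<delta>\<^sup>2 * N)"
        if "y \<in> space circle" for y
      proof (cases "y \<in> A")
        case True
        then have "y \<in> K" using that r(2) by (auto simp: K_def)
        then show ?thesis using fejer_kernel_bound[OF \<delta>(1) \<delta>(2)] True by simp
      qed simp
      then show "\<And>y. y \<in> space circle \<Longrightarrow> norm (indicator A y * complex_of_real (fejer_kernel N (x - y))) \<le> 4 / (\<delta>\<^sup>2 * N)" .
      show "integrable circle (\<lambda>y. indicator A y * complex_of_real (fejer_kernel N (x - y)))"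
        using m le by (intro circle.integrable_const_bound AE_I2)
    qed simp
    then show "norm (fejer_mean N (indicator A) x) \<le> 4 / \<delta>\<^sup>2 * (1 / N)"
      unfolding fejer_mean_eq_integral[OF int] using measure_circle
      by (simp add: norm_divide) (simp add: field_simps)
  qed
  have l: "(\<lambda>N. 4 / \<delta>\<^sup>2 * (1 / real N)) \<longlonglongrightarrow> 4 / \<delta>\<^sup>2 * 0" by (intro tendsto_intros lim_1_over_n)
  show ?thesis by (rule Lim_null_comparison[OF ev]) (use l in simp)
qed

lemma AE_circle_iff: "(AE x in circle. P x) \<longleftrightarrow> (AE x in lebesgue. x \<in> {0..<2 * pi} \<longrightarrow> P x)"
  unfolding circle_def by (subst AE_restrict_space_iff) auto

lemma AE_circle_neq: "AE x in circle. x \<noteq> a"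
proof -
  have "AE x in lborel. x \<noteq> a" by (rule AE_lborel_singleton)
  then have "AE x in lebesgue. x \<noteq> a" by (rule AE_completion)
  then show ?thesis unfolding AE_circle_iff by eventually_elim simp
qed

lemma fejer_mean_ray_tendsto:
  assumes x: "0 < x" "x < 2 * pi" "x \<noteq> a"
  shows "(\<lambda>N. fejer_mean N (indicator {a<..}) x) \<longlonglongrightarrow> indicator {a<..} x"
proof (cases "x < a")
  case True
  then show ?thesis
    using fejer_mean_indicator_tendsto_0[of "{a<..}" x "a - x"] x by (simp add: disjoint_iff)
next
  case False
  have t: "(\<lambda>N. fejer_mean N (indicator {..a}) x) \<longlonglongrightarrow> 0"
    by (rule fejer_mean_indicator_tendsto_0[of _ _ "x - a"]) (use x False in auto)
  have eq: "fejer_mean N (indicator {a<..}) x = 1 - fejer_mean N (indicator {..a}) x" if "1 \<le> N" for N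
  proof -
    let ?k = "\<lambda>y. complex_of_real (fejer_kernel N (x - y))"
    have int: "integrable circle (\<lambda>y. indicator A y * ?k y)" "integrable circle (indicator A :: real \<Rightarrow> complex)"
      if "A \<in> sets borel" for A
    proof -
      show i: "integrable circle (indicator A :: real \<Rightarrow> complex)"
        using that by (intro circle.integrable_const_bound[where B = 1] borel_measurable_circle)
          (auto split: split_indicator)
      show "integrable circle (\<lambda>y. indicator A y * ?k y)"
      proof (rule Bochner_Integration.integrable_bound[of _ "\<lambda>y. fejer_kernel N (x - y)"])
        show "(\<lambda>y. indicator A y * ?k y) \<in> borel_measurable circle"
          using borel_measurable_integrable[OF i] borel_measurable_integrable[OF integrable_fejer_kernel] by simp
      qed (auto split: split_indicator)
    qed
    have "(LINT y|circle. indicator {a<..} y * ?k y) + (LINT y|circle. indicator {..a} y * ?k y)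
        = (LINT y|circle. indicator {a<..} y * ?k y + indicator {..a} y * ?k y)"
      using int by (subst Bochner_Integration.integral_add) auto
    also have "\<dots> = (LINT y|circle. ?k y)"
      by (intro Bochner_Integration.integral_cong) (auto split: split_indicator)
    also have "\<dots> = of_real (2 * pi)" using integral_fejer_kernel[of N x] that by simp
    finally show ?thesis
      using int by (simp add: fejer_mean_eq_integral field_simps)
  qed
  have "(\<lambda>N. 1 - fejer_mean N (indicator {..a}) x) \<longlonglongrightarrow> 1 - 0" by (intro tendsto_intros t)
  then have "(\<lambda>N. 1 - fejer_mean N (indicator {..a}) x) \<longlonglongrightarrow> 1" by simp
  then have "(\<lambda>N. fejer_mean N (indicator {a<..}) x) \<longlonglongrightarrow> 1"
    by (rule Lim_transform_eventually) (use eq in \<open>auto intro!: eventually_sequentiallyI[of 1]\<close>)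
  then show ?thesis using False x by simp
qed

text \<open>\<open>w\<close> integrates to 0 against every Fejer mean. By dominated convergence it
  integrates to 0 over every ray, and rays determine an integrable function. Indicators of rays
  suffice as limits, so no density theorem is involved.\<close>

lemma fcoeff_zero_imp_AE_zero:
  assumes w: "integrable circle w" and zero: "\<And>k. fcoeff w k = 0"
  shows "AE x in circle. w x = 0"
proof -
  have ind: "integrable circle (indicator {a<..} :: real \<Rightarrow> complex)" for a
    by (intro circle.integrable_const_bound[where B = 1] borel_measurable_circle) (auto split: split_indicator)
  have z: "(LINT x|circle. w x * indicator {a<..} x) = 0" for a
  proof -
    have "(\<lambda>N. LINT x|circle. w x * fejer_mean N (indicator {a<..}) x) \<longlonglongrightarrow> (LINT x|circle. w x * indicator {a<..} x)"
    proof (rule integral_dominated_convergence)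
      show "integrable circle (\<lambda>x. cmod (w x))" using w by simp
      show "AE x in circle. (\<lambda>N. w x * fejer_mean N (indicator {a<..}) x) \<longlonglongrightarrow> w x * indicator {a<..} x"
        using AE_circle_neq[of 0] AE_circle_neq[of a] AE_space
        by eventually_elim (intro tendsto_intros fejer_mean_ray_tendsto, auto)
      show "AE x in circle. norm (w x * fejer_mean N (indicator {a<..}) x) \<le> cmod (w x)" for N
        unfolding norm_mult
        by (intro AE_I2 mult_right_le_one_le fejer_mean_bounded ind) (auto split: split_indicator)
      show "(\<lambda>x. w x * indicator {a<..} x) \<in> borel_measurable circle"
        using borel_measurable_integrable[OF w] borel_measurable_integrable[OF ind] by simp
      show "(\<lambda>x. w x * fejer_mean N (indicator {a<..}) x) \<in> borel_measurable circle" for N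
        using borel_measurable_integrable[OF w] by (simp add: fejer_mean_def borel_measurable_circle)
    qed
    moreover have "(LINT x|circle. w x * fejer_mean N (indicator {a<..}) x) = 0" for N
      using integral_mult_trig[OF w, of "fejer_freqs N"] by (simp add: fejer_mean_def zero)
    ultimately show ?thesis by (simp add: LIMSEQ_const_iff)
  qed
  have wi: "integrable circle (\<lambda>x. w x * indicator {a<..} x)" for a
  proof (rule Bochner_Integration.integrable_bound[OF w])
    show "(\<lambda>x. w x * indicator {a<..} x) \<in> borel_measurable circle"
      using borel_measurable_integrable[OF w] borel_measurable_integrable[OF ind] by simp
  qed (auto split: split_indicator)
  \<comment> \<open>To be applied to real and imaginary parts, because the criterion on rays is
    about real functions.\<close>
  have main: "AE x in circle. f (w x) = 0"
    if f: "bounded_linear f" and fm: "\<And>z a. f (z * indicator {a<..} (x::real)) = f z * indicator {a<..} x" for f :: "complex \<Rightarrow> real" and x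
  proof -
    have fr: "f (z * indicator {a<..} (x::real)) = f z * indicator {a<..} x" for z a x
      using f by (auto split: split_indicator simp: linear_simps)
    let ?g = "\<lambda>x. indicator {0..<2 * pi} x * f (w x)"
    have "integrable circle (\<lambda>x. f (w x))" by (rule integrable_bounded_linear[OF f w])
    then have gi: "integrable lebesgue ?g"
      unfolding circle_def by (subst (asm) integrable_restrict_space) auto
    have "(LINT x|lebesgue. indicator {a<..} x * ?g x) = 0" for a
    proof -
      have "(LINT x|lebesgue. indicator {a<..} x * ?g x) = (LINT x|circle. f (w x * indicator {a<..} x))"
        unfolding circle_def fr
        by (subst integral_restrict_space) (auto simp: mult_ac)
      also have "\<dots> = f (LINT x|circle. w x * indicator {a<..} x)"
        by (rule integral_bounded_linear[OF f wi])
      finally show ?thesis using z f by (simp add: linear_simps)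
    qed
    then have "AE x in lebesgue. ?g x = 0" by (rule AE_zero_if_integral_rays_zero_lebesgue[OF gi])
    then show ?thesis unfolding AE_circle_iff by eventually_elim auto
  qed
  have "AE x in circle. Re (w x) = 0" "AE x in circle. Im (w x) = 0"
    by (rule main[of _ 0], auto intro: bounded_linear_Re bounded_linear_Im split: split_indicator)+
  then show ?thesis by eventually_elim (simp add: complex_eq_iff)
qed

section \<open>Riesz-Fischer and difference quotients\<close>

lemma borel_measurable_cnj:
  assumes "f \<in> borel_measurable M" shows "(\<lambda>x. cnj (f x)) \<in> borel_measurable M"
  by (rule measurable_compose[OF assms borel_measurable_continuous_onI]) (intro continuous_intros)

text \<open>Takes the place of completeness of L^2: a uniform norm bound and convergence almost
  everywhere bound the norm of the limit.\<close>

lemma L2_Fatou: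
  assumes f: "\<And>n. f n \<in> borel_measurable M" and F: "F \<in> borel_measurable M"
    and lim: "AE x in M. (\<lambda>n. f n x) \<longlonglongrightarrow> F x"
    and int: "\<And>n. (\<integral>\<^sup>+x. ennreal ((cmod (f n x))\<^sup>2) \<partial>M) \<le> ennreal B" and B: "0 \<le> B"
  shows "sq_integrable M F" and "(L2_norm M F)\<^sup>2 \<le> B"
proof -
  have "(\<integral>\<^sup>+x. ennreal ((cmod (F x))\<^sup>2) \<partial>M) = (\<integral>\<^sup>+x. liminf (\<lambda>n. ennreal ((cmod (f n x))\<^sup>2)) \<partial>M)"
  proof (rule nn_integral_cong_AE)
    show "AE x in M. ennreal ((cmod (F x))\<^sup>2) = liminf (\<lambda>n. ennreal ((cmod (f n x))\<^sup>2))"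
      using lim
    proof eventually_elim
      case (elim x)
      have "(\<lambda>n. ennreal ((cmod (f n x))\<^sup>2)) \<longlonglongrightarrow> ennreal ((cmod (F x))\<^sup>2)"
        by (intro tendsto_ennrealI tendsto_intros elim)
      from lim_imp_Liminf[OF sequentially_bot this] show ?case by simp
    qed
  qed
  also have "\<dots> \<le> liminf (\<lambda>n. \<integral>\<^sup>+x. ennreal ((cmod (f n x))\<^sup>2) \<partial>M)"
    by (rule nn_integral_liminf) (use f in measurable)
  also have "\<dots> \<le> ennreal B"
    by (rule Liminf_le) (auto intro!: always_eventually int)
  finally have le: "(\<integral>\<^sup>+x. ennreal ((cmod (F x))\<^sup>2) \<partial>M) \<le> ennreal B" .
  have i: "integrable M (\<lambda>x. (cmod (F x))\<^sup>2)"
  proof (rule integrableI_bounded)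
    show "(\<integral>\<^sup>+x. ennreal (norm ((cmod (F x))\<^sup>2)) \<partial>M) < \<infinity>"
      using le by (simp add: order_le_less_trans[OF _ ennreal_less_top])
  qed (use F in measurable)
  then show "sq_integrable M F" using F by (simp add: sq_integrable_def)
  have "ennreal (LINT x|M. (cmod (F x))\<^sup>2) \<le> ennreal B"
    using le by (subst nn_integral_eq_integral[symmetric, OF i]) auto
  then show "(L2_norm M F)\<^sup>2 \<le> B" using B by (simp add: L2_norm_power2)
qed

lemma nn_integral_L2_norm:
  assumes "sq_integrable M f"
  shows "(\<integral>\<^sup>+x. ennreal ((cmod (f x))\<^sup>2) \<partial>M) = ennreal ((L2_norm M f)\<^sup>2)"
  unfolding L2_norm_power2
  by (rule nn_integral_eq_integral) (use assms in \<open>auto simp: sq_integrable_def\<close>)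

lemma integral_cmod_le_L2_norm:
  assumes "sq_integrable circle f"
  shows "(LINT x|circle. cmod (f x)) \<le> sqrt (2 * pi) * L2_norm circle f"
proof -
  have 1: "sq_integrable circle (\<lambda>_. 1)" by (rule circle.sq_integrable_bounded[of _ 1]) auto
  have "L2_norm circle (\<lambda>_. 1) = sqrt (2 * pi)" using measure_circle by (simp add: L2_norm_def)
  then show ?thesis using L2_Cauchy_Schwarz[OF assms 1] by (simp add: mult.commute)
qed

lemma cmod_fcoeff_le:
  assumes "sq_integrable circle f"
  shows "cmod (fcoeff f k) \<le> L2_norm circle f"
proof -
  have "(cmod (fcoeff f k))\<^sup>2 \<le> 2 * pi * (\<Sum>j\<in>{k}. (cmod (fcoeff f j))\<^sup>2)"
    using pi_gt3 by (simp add: mult_le_cancel_right1)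
  also have "\<dots> \<le> (L2_norm circle f)\<^sup>2" by (rule Bessel[OF assms]) simp
  finally show ?thesis by (rule power2_le_imp_le) simp
qed

abbreviation freq_box :: "nat \<Rightarrow> int set" where "freq_box n \<equiv> {- int n..int n}"

lemma finite_subset_box: "finite X \<Longrightarrow> \<exists>n. X \<subseteq> freq_box n"
proof (induction X rule: finite_induct)
  case (insert x X)
  then obtain n where "X \<subseteq> freq_box n" by blast
  have "k \<in> freq_box (max n (nat \<bar>x\<bar>))" if "k \<in> insert x X" for k
  proof (cases "k = x")
    case False
    then have "k \<in> freq_box n" using that \<open>X \<subseteq> freq_box n\<close> by auto
    then show ?thesis unfolding atLeastAtMost_iff by linarith
  qed auto
  then have "insert x X \<subseteq> freq_box (max n (nat \<bar>x\<bar>))" by blast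
  then show ?case by blast
qed simp

lemma filterlim_box: "filterlim freq_box (finite_subsets_at_top UNIV) sequentially"
  unfolding filterlim_finite_subsets_at_top
proof (intro allI impI)
  fix X :: "int set" assume "finite X \<and> X \<subseteq> UNIV"
  then obtain n where "X \<subseteq> freq_box n" using finite_subset_box by blast
  then show "\<forall>\<^sub>F m in sequentially. finite (freq_box m) \<and> X \<subseteq> freq_box m \<and> freq_box m \<subseteq> UNIV"
    by (intro eventually_sequentiallyI[of n]) (auto dest!: subsetD)
qed

lemma box_sums:
  fixes f :: "int \<Rightarrow> real"
  assumes "f summable_on UNIV"
  shows "(\<lambda>n. sum f (freq_box n)) \<longlonglongrightarrow> infsum f UNIV"
  using filterlim_compose[OF has_sum_infsum[OF assms, unfolded has_sum_def] filterlim_box] by simp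

text \<open>Partial sums along a subsequence with tails below 4^(-j) have L^1 increments of order
  2^(-j), hence converge almost everywhere. The subsequence is part of the conclusion because the
  applications of Fatou's lemma need pointwise convergence.\<close>

lemma Riesz_Fischer:
  fixes c :: "int \<Rightarrow> complex"
  assumes c: "(\<lambda>k. (cmod (c k))\<^sup>2) summable_on UNIV"
  obtains g r where "sq_integrable circle g" "strict_mono r"
    "AE x in circle. (\<lambda>j. trig (freq_box (r j)) c x) \<longlonglongrightarrow> g x" "\<And>k. fcoeff g k = c k"
proof -
  let ?f = "\<lambda>k. (cmod (c k))\<^sup>2"
  let ?S = "\<lambda>n. trig (freq_box n) c"
  have lim: "(\<lambda>n. sum ?f (freq_box n)) \<longlonglongrightarrow> infsum ?f UNIV" by (rule box_sums[OF c])
  have le: "sum ?f X \<le> infsum ?f UNIV" if "finite X" for X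
    by (rule finite_sum_le_infsum[OF c that]) auto
  have "\<exists>p. \<forall>n\<ge>p. infsum ?f UNIV - sum ?f (freq_box n) < (1/4) ^ j" for j
  proof -
    have "\<forall>\<^sub>F n in sequentially. dist (sum ?f (freq_box n)) (infsum ?f UNIV) < (1/4) ^ j"
      using lim by (rule tendstoD) simp
    then obtain p where "\<And>n. p \<le> n \<Longrightarrow> dist (sum ?f (freq_box n)) (infsum ?f UNIV) < (1/4) ^ j"
      by (auto simp: eventually_sequentially)
    then have "infsum ?f UNIV - sum ?f (freq_box n) < (1/4) ^ j" if "p \<le> n" for n
      using that by (simp add: dist_real_def abs_less_iff)
    then show ?thesis by blast
  qed
  then obtain p where p: "\<And>j n. p j \<le> n \<Longrightarrow> infsum ?f UNIV - sum ?f (freq_box n) < (1/4) ^ j" by metis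
  \<comment> \<open>Partial sums of the successors: strictly increasing and at least
    \<open>p j\<close>.\<close>
  define r where "r j = (\<Sum>i\<le>j. Suc (p i))" for j
  have r: "strict_mono r" by (rule strict_monoI_Suc) (simp add: r_def)
  have pr: "p j \<le> r j" for j unfolding r_def by (rule order_trans[OF _ member_le_sum[of j]]) auto
  have diff: "(L2_norm circle (\<lambda>x. ?S (r i) x - ?S (r j) x))\<^sup>2 \<le> 2 * pi * (1/4) ^ j" if "j \<le> i" for i j
  proof -
    have sub: "freq_box (r j) \<subseteq> freq_box (r i)" using strict_mono_leD[OF r that] by auto
    have "(\<lambda>x. ?S (r i) x - ?S (r j) x) = trig (freq_box (r i)) (\<lambda>k. if k \<in> freq_box (r j) then 0 else c k)"
      unfolding trig_mono_neutral[OF _ sub, of c, simplified] trig_diff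
      by (intro ext) (auto simp: trig_def intro!: sum.cong)
    then have "(L2_norm circle (\<lambda>x. ?S (r i) x - ?S (r j) x))\<^sup>2
        = 2 * pi * (\<Sum>k\<in>freq_box (r i). (cmod (if k \<in> freq_box (r j) then 0 else c k))\<^sup>2)"
      by (simp only:) (rule L2_norm_trig, simp)
    also have "(\<Sum>k\<in>freq_box (r i). (cmod (if k \<in> freq_box (r j) then 0 else c k))\<^sup>2) = sum ?f (freq_box (r i) - freq_box (r j))"
      by (rule sum.mono_neutral_cong_right) auto
    also have "\<dots> = sum ?f (freq_box (r i)) - sum ?f (freq_box (r j))"
      using sub by (intro sum_diff) auto
    also have "\<dots> \<le> (1/4) ^ j"
      using p[OF pr[of j]] le[of "freq_box (r i)"] by simp
    finally show ?thesis by simp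
  qed
  let ?D = "\<lambda>j x. ?S (r (Suc j)) x - ?S (r j) x"
  have D: "sq_integrable circle (?D j)" for j by (intro sq_integrable_diff sq_integrable_trig)
  have Dm: "(\<lambda>x. ennreal (cmod (?D j x))) \<in> borel_measurable circle" for j
    using sq_integrable_measurable[OF D[of j]] by measurable
  have D1: "(\<integral>\<^sup>+x. ennreal (cmod (?D j x)) \<partial>circle) \<le> ennreal (2 * pi * (1/2) ^ j)" for j
  proof -
    have "(\<integral>\<^sup>+x. ennreal (cmod (?D j x)) \<partial>circle) = ennreal (LINT x|circle. cmod (?D j x))"
      using circle.sq_integrable_imp_integrable[OF D] by (intro nn_integral_eq_integral) auto
    also have "(LINT x|circle. cmod (?D j x)) \<le> sqrt (2 * pi) * L2_norm circle (?D j)"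
      by (rule integral_cmod_le_L2_norm[OF D])
    also have "\<dots> \<le> sqrt (2 * pi) * sqrt (2 * pi * (1/4) ^ j)"
      using diff[of j "Suc j"] by (intro mult_left_mono real_le_rsqrt) auto
    also have "\<dots> = sqrt ((2 * pi * (1/2) ^ j)\<^sup>2)"
      unfolding real_sqrt_mult[symmetric]
      by (simp add: power2_eq_square power_mult_distrib[symmetric] mult_ac)
    also have "\<dots> = 2 * pi * (1/2) ^ j" by simp
    finally show ?thesis by (simp add: ennreal_leI)
  qed
  have "(\<integral>\<^sup>+x. (\<Sum>j. ennreal (cmod (?D j x))) \<partial>circle) = (\<Sum>j. \<integral>\<^sup>+x. ennreal (cmod (?D j x)) \<partial>circle)"
    by (rule nn_integral_suminf) (rule Dm)
  also have "\<dots> \<le> (\<Sum>j. ennreal (2 * pi * (1/2) ^ j))"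
    by (intro suminf_le D1 summableI)
  also have "\<dots> = ennreal (\<Sum>j. 2 * pi * (1/2) ^ j)"
    by (intro suminf_ennreal2 summable_mult summable_geometric) auto
  finally have fin: "(\<integral>\<^sup>+x. (\<Sum>j. ennreal (cmod (?D j x))) \<partial>circle) \<noteq> \<infinity>"
    by (auto simp: top_unique)
  have "AE x in circle. (\<Sum>j. ennreal (cmod (?D j x))) \<noteq> \<infinity>"
    by (rule nn_integral_PInf_AE[OF borel_measurable_suminf_order[OF Dm] fin])
  then have conv: "AE x in circle. convergent (\<lambda>j. ?S (r j) x)"
  proof eventually_elim
    case (elim x)
    then have "summable (\<lambda>j. cmod (?D j x))" by (intro summable_suminf_not_top) auto
    then have "summable (\<lambda>j. ?D j x)" by (rule summable_norm_cancel)
    then have "convergent (\<lambda>n. \<Sum>j<n. ?D j x)" by (simp add: summable_iff_convergent)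
    then have "convergent (\<lambda>n. (\<Sum>j<n. ?D j x) + ?S (r 0) x)"
      by (intro convergent_add convergent_const)
    moreover have "(\<Sum>j<n. ?D j x) + ?S (r 0) x = ?S (r n) x" for n
      by (subst sum_lessThan_telescope) simp
    ultimately show ?case by simp
  qed
  define g where "g x = lim (\<lambda>j. ?S (r j) x)" for x
  have Sm: "?S n \<in> borel_measurable circle" for n by (intro borel_measurable_circle borel_measurable_trig)
  have gm: "g \<in> borel_measurable circle" unfolding g_def[abs_def] by (intro borel_measurable_lim_metric Sm)
  have glim: "AE x in circle. (\<lambda>j. ?S (r j) x) \<longlonglongrightarrow> g x"
    using conv unfolding g_def by eventually_elim (simp add: convergent_LIMSEQ_iff)
  \<comment> \<open>Fatou in the later index of a Cauchy estimate turns pointwise convergence into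
    convergence in norm with a rate.\<close>
  have gS: "sq_integrable circle (\<lambda>x. g x - ?S (r j) x)" "(L2_norm circle (\<lambda>x. g x - ?S (r j) x))\<^sup>2 \<le> 2 * pi * (1/4) ^ j" for j
  proof -
    have l: "AE x in circle. (\<lambda>i. ?S (r (i + j)) x - ?S (r j) x) \<longlonglongrightarrow> g x - ?S (r j) x"
      using glim
    proof eventually_elim
      case (elim x)
      then show ?case by (intro tendsto_intros LIMSEQ_ignore_initial_segment)
    qed
    have i: "(\<integral>\<^sup>+x. ennreal ((cmod (?S (r (i + j)) x - ?S (r j) x))\<^sup>2) \<partial>circle) \<le> ennreal (2 * pi * (1/4) ^ j)" for i
      by (subst nn_integral_L2_norm[OF sq_integrable_diff[OF sq_integrable_trig sq_integrable_trig]])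
         (intro ennreal_leI diff, simp)
    have m1: "(\<lambda>x. ?S (r (i + j)) x - ?S (r j) x) \<in> borel_measurable circle" for i
      using Sm by simp
    have m2: "(\<lambda>x. g x - ?S (r j) x) \<in> borel_measurable circle" using gm Sm by simp
    show "sq_integrable circle (\<lambda>x. g x - ?S (r j) x)" by (rule L2_Fatou(1)[OF m1 m2 l i]) simp
    show "(L2_norm circle (\<lambda>x. g x - ?S (r j) x))\<^sup>2 \<le> 2 * pi * (1/4) ^ j" by (rule L2_Fatou(2)[OF m1 m2 l i]) simp
  qed
  have g: "sq_integrable circle g"
    using sq_integrable_add[OF gS(1)[of 0] sq_integrable_trig[of "freq_box (r 0)" c]] by simp
  have "fcoeff g k = c k" for k
  proof -
    \<comment> \<open>Once \<open>k\<close> lies in the box, the partial sum has the exact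
      coefficient \<open>c k\<close>, so the discrepancy is a coefficient of the small
      remainder.\<close>
    have "cmod (fcoeff g k - c k) \<le> sqrt (2 * pi) * (1/2) ^ j" if j: "nat \<bar>k\<bar> \<le> j" for j
    proof -
      have "j \<le> r j" by (rule strict_mono_imp_increasing[OF r])
      then have "k \<in> freq_box (r j)" using j by auto
      then have "fcoeff g k - c k = fcoeff (\<lambda>x. g x - ?S (r j) x) k"
        by (subst fcoeff_diff) (auto simp: fcoeff_trig circle.sq_integrable_imp_integrable[OF g])
      also have "cmod \<dots> \<le> L2_norm circle (\<lambda>x. g x - ?S (r j) x)" by (rule cmod_fcoeff_le[OF gS(1)])
      also have "\<dots> \<le> sqrt (2 * pi * (1/4) ^ j)" by (intro real_le_rsqrt gS(2))
      also have "\<dots> = sqrt (2 * pi) * (1/2) ^ j"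
      proof -
        have "(1/4 :: real) ^ j = ((1/2) ^ j)\<^sup>2" by (simp add: power2_eq_square power_mult_distrib[symmetric])
        then show ?thesis by (simp add: real_sqrt_mult)
      qed
      finally show ?thesis .
    qed
    moreover have "(\<lambda>j. sqrt (2 * pi) * (1/2) ^ j) \<longlonglongrightarrow> sqrt (2 * pi) * 0"
      by (intro tendsto_intros LIMSEQ_power_zero) simp
    ultimately have "cmod (fcoeff g k - c k) \<le> sqrt (2 * pi) * 0"
      by (intro LIMSEQ_le_const[of "\<lambda>j. sqrt (2 * pi) * (1/2) ^ j"]) blast+
    then show ?thesis by simp
  qed
  with g r glim show ?thesis using that by blast
qed

text \<open>The Riesz-Fischer limit has the coefficients of \<open>w\<close>, so uniqueness
  identifies it with \<open>w\<close>.\<close>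

lemma trig_subsequence_AE:
  assumes w: "sq_integrable circle w"
  obtains r where "strict_mono r" "AE x in circle. (\<lambda>j. trig (freq_box (r j)) (fcoeff w) x) \<longlonglongrightarrow> w x"
proof -
  obtain g r where g: "sq_integrable circle g" "strict_mono r"
    "AE x in circle. (\<lambda>j. trig (freq_box (r j)) (fcoeff w) x) \<longlonglongrightarrow> g x" "\<And>k. fcoeff g k = fcoeff w k"
    using Riesz_Fischer[OF Bessel_summable[OF w]] by blast
  note i = circle.sq_integrable_imp_integrable
  have "AE x in circle. g x - w x = 0"
    by (rule fcoeff_zero_imp_AE_zero) (use g w i in \<open>auto simp: fcoeff_diff\<close>)
  with g(3) have "AE x in circle. (\<lambda>j. trig (freq_box (r j)) (fcoeff w) x) \<longlonglongrightarrow> w x"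
    by eventually_elim simp
  then show ?thesis using that g(2) by blast
qed

text \<open>The converse of Bessel's inequality, by Fatou along the subsequence.\<close>

lemma Parseval_le:
  assumes w: "sq_integrable circle w"
  shows "(L2_norm circle w)\<^sup>2 \<le> 2 * pi * (\<Sum>\<^sub>\<infinity>k. (cmod (fcoeff w k))\<^sup>2)"
proof -
  obtain r where r: "strict_mono r" "AE x in circle. (\<lambda>j. trig (freq_box (r j)) (fcoeff w) x) \<longlonglongrightarrow> w x"
    using trig_subsequence_AE[OF w] by blast
  show ?thesis
  proof (rule L2_Fatou(2)[OF _ sq_integrable_measurable[OF w] r(2)])
    show "trig (freq_box (r n)) (fcoeff w) \<in> borel_measurable circle" for n
      by (intro borel_measurable_circle borel_measurable_trig)
    show "(\<integral>\<^sup>+x. ennreal ((cmod (trig (freq_box (r n)) (fcoeff w) x))\<^sup>2) \<partial>circle)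
        \<le> ennreal (2 * pi * (\<Sum>\<^sub>\<infinity>k. (cmod (fcoeff w k))\<^sup>2))" for n
      unfolding nn_integral_L2_norm[OF sq_integrable_trig] L2_norm_trig[OF finite_atLeastAtMost_int]
      by (intro ennreal_leI mult_left_mono finite_sum_le_infsum Bessel_summable[OF w]) auto
  qed (intro mult_nonneg_nonneg infsum_nonneg, auto)
qed

section \<open>Difference quotients of exponentials\<close>

definition freqs :: "int \<Rightarrow> int set" where
  "freqs k = (if 0 \<le> k then {0..<k} else {k..<0})"

lemma finite_freqs [simp]: "finite (freqs k)" by (simp add: freqs_def)
lemma card_freqs: "card (freqs k) = nat \<bar>k\<bar>" by (simp add: freqs_def)

text \<open>The minimum of |k| and |l| is at most their geometric mean; a bound that factorises in
  \<open>k\<close> and \<open>l\<close> is what the convolution inequality accepts.\<close>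

lemma card_freqs_Int_le: "real (card (freqs k \<inter> freqs l)) \<le> (root4 k)\<^sup>2 * (root4 l)\<^sup>2"
proof -
  have "card (freqs k \<inter> freqs l) \<le> card (freqs k)" "card (freqs k \<inter> freqs l) \<le> card (freqs l)"
    by (auto intro!: card_mono)
  then have le: "real (card (freqs k \<inter> freqs l)) \<le> \<bar>of_int k\<bar>" "real (card (freqs k \<inter> freqs l)) \<le> \<bar>of_int l\<bar>"
    unfolding card_freqs by linarith+
  have "(real (card (freqs k \<inter> freqs l)))\<^sup>2 \<le> \<bar>of_int k\<bar> * \<bar>of_int l\<bar>"
    unfolding power2_eq_square by (intro mult_mono le) auto
  then have "real (card (freqs k \<inter> freqs l)) \<le> sqrt (\<bar>of_int k\<bar> * \<bar>of_int l\<bar>)" by (rule real_le_rsqrt)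
  then show ?thesis by (simp add: root4_power2 real_sqrt_mult)
qed

text \<open>The quotient by \<open>1 - cis z\<close> is plus or minus a geometric sum, over
  exponents from 0 to k - 1 for positive \<open>k\<close> and from k to -1 for negative
  \<open>k\<close>; \<open>freqs\<close> and \<open>sgn\<close> encode both cases at once.\<close>

lemma one_minus_cis_eq:
  "1 - cis (of_int k * z) = (1 - cis z) * (of_int (sgn k) * trig (freqs k) (\<lambda>_. 1) z)"
proof (cases "0 \<le> k")
  case True
  then have "trig (freqs k) (\<lambda>_. 1) z = (\<Sum>a<nat k. cis z ^ a)"
    unfolding trig_def freqs_def
    by (intro sum.reindex_bij_witness[of _ int nat]) (auto simp: Complex.DeMoivre)
  then have "(1 - cis z) * trig (freqs k) (\<lambda>_. 1) z = 1 - cis z ^ nat k" by (simp add: one_diff_power_eq)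
  also have "cis z ^ nat k = cis (of_int k * z)" using True by (simp add: Complex.DeMoivre)
  finally show ?thesis using True by (cases "k = 0") auto
next
  case False
  define n where "n = nat (- k)"
  have k: "k = - int n" using False by (simp add: n_def)
  have "trig (freqs k) (\<lambda>_. 1) z = (\<Sum>a<n. cis (of_int k * z) * cis z ^ a)"
    unfolding trig_def freqs_def using False
    by (intro sum.reindex_bij_witness[of _ "\<lambda>a. k + int a" "\<lambda>a. nat (a - k)"])
       (auto simp: Complex.DeMoivre cis_mult k algebra_simps)
  then have "(1 - cis z) * trig (freqs k) (\<lambda>_. 1) z = cis (of_int k * z) * (1 - cis z ^ n)"
    by (simp add: one_diff_power_eq sum_distrib_left mult_ac)
  also have "\<dots> = cis (of_int k * z) - 1" by (simp add: Complex.DeMoivre k cis_mult algebra_simps)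
  finally show ?thesis using False by (simp add: algebra_simps)
qed

text \<open>Its L^2 norm on the torus is the Gagliardo seminorm of H^(1/2). On the diagonal the
  value is 0, by division by 0.\<close>

definition DD :: "(real \<Rightarrow> complex) \<Rightarrow> real \<times> real \<Rightarrow> complex" where
  "DD w p = (w (fst p) - w (snd p)) / of_real (circle_dist (fst p) (snd p))"

text \<open>The uncompleted product sigma-algebra suffices, because every integrand is built from
  functions measurable on a single factor.\<close>

abbreviation torus :: "(real \<times> real) measure" where "torus \<equiv> circle \<Otimes>\<^sub>M circle"

lemma measurable_torus_fst:
  assumes "f \<in> borel_measurable circle" shows "(\<lambda>p. f (fst p)) \<in> borel_measurable torus"
  using measurable_compose[OF measurable_fst assms] .

lemma measurable_torus_snd:
  assumes "f \<in> borel_measurable circle" shows "(\<lambda>p. f (snd p)) \<in> borel_measurable torus"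
  using measurable_compose[OF measurable_snd assms] .

lemma borel_measurable_circle_dist [measurable]: "(\<lambda>p. circle_dist (fst p) (snd p)) \<in> borel_measurable torus"
proof -
  have [measurable]: "fst \<in> borel_measurable torus" "snd \<in> borel_measurable torus"
    using measurable_torus_fst[OF measurable_circle_id] measurable_torus_snd[OF measurable_circle_id] by simp_all
  show ?thesis unfolding circle_dist_def by measurable
qed

lemma borel_measurable_DD [measurable]:
  assumes "w \<in> borel_measurable circle" shows "DD w \<in> borel_measurable torus"
proof -
  have [measurable]: "(\<lambda>p. w (fst p)) \<in> borel_measurable torus" "(\<lambda>p. w (snd p)) \<in> borel_measurable torus"
    using assms by (auto intro: measurable_torus_fst measurable_torus_snd)
  show ?thesis unfolding DD_def[abs_def] by measurable
qed

lemma DD_diff: "DD (\<lambda>x. v x - w x) p = DD v p - DD w p"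
  by (simp add: DD_def diff_divide_distrib[symmetric])
lemma DD_cmult: "DD (\<lambda>x. a * w x) p = a * DD w p"
  by (simp add: DD_def right_diff_distrib[symmetric])
lemma DD_sum: "DD (\<lambda>x. \<Sum>i\<in>A. f i x) p = (\<Sum>i\<in>A. DD (f i) p)"
  by (simp add: DD_def sum_subtractf[symmetric] sum_divide_distrib)
lemma DD_trig: "DD (trig S c) p = (\<Sum>k\<in>S. c k * DD (\<lambda>x. cis (of_int k * x)) p)"
  unfolding trig_def[abs_def] DD_sum DD_cmult ..

lemma cmod_cis_diff_le: "cmod (cis (of_int k * x) - cis (of_int k * y)) \<le> \<bar>of_int k\<bar> * circle_dist x y"
proof -
  have "cis (of_int k * x) - cis (of_int k * y) = - cis (of_int k * y) * (1 - cis (of_int k * (x - y)))"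
    by (simp add: right_diff_distrib cis_mult algebra_simps)
  then have "cmod (cis (of_int k * x) - cis (of_int k * y)) = cmod (1 - cis (of_int k * (x - y)))"
    by (simp add: norm_mult)
  also have "\<dots> = circle_dist x y * (cmod (of_int (sgn k)) * cmod (trig (freqs k) (\<lambda>_. 1) (x - y)))"
    unfolding one_minus_cis_eq[of k] by (simp add: norm_mult circle_dist_eq)
  also have "\<dots> \<le> circle_dist x y * (1 * \<bar>of_int k\<bar>)"
  proof (intro mult_left_mono mult_mono)
    show "cmod (trig (freqs k) (\<lambda>_. 1) (x - y)) \<le> \<bar>of_int k\<bar>"
      using cmod_trig_le[of "freqs k" "\<lambda>_. 1" "x - y"] by (simp add: card_freqs)
    show "cmod (of_int (sgn k)) \<le> 1" by (simp add: sgn_if)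
  qed auto
  finally show ?thesis by (simp add: mult.commute)
qed

lemma cmod_DD_cis_le: "cmod (DD (\<lambda>x. cis (of_int k * x)) p) \<le> \<bar>of_int k\<bar>"
  using cmod_cis_diff_le[of k "fst p" "snd p"]
  by (cases "circle_dist (fst p) (snd p) = 0") (auto simp: DD_def norm_divide divide_le_eq less_le)

lemma cmod_DD_trig_le: "cmod (DD (trig S c) p) \<le> (\<Sum>k\<in>S. cmod (c k) * \<bar>of_int k\<bar>)"
  unfolding DD_trig
  by (rule order_trans[OF norm_sum sum_mono]) (auto simp: norm_mult intro: mult_left_mono cmod_DD_cis_le)

lemma borel_measurable_cis_circle [measurable]: "(\<lambda>x. cis (a * x)) \<in> borel_measurable circle"
  by (intro borel_measurable_circle borel_measurable_continuous_onI continuous_intros)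

lemma sq_integrable_DD_trig [simp]: "sq_integrable torus (DD (trig S c))"
  by (rule torus.sq_integrable_bounded[OF _ cmod_DD_trig_le])
     (intro borel_measurable_DD borel_measurable_circle borel_measurable_trig)

lemma sq_integrable_DD_cis [simp]: "sq_integrable torus (DD (\<lambda>x. cis (of_int k * x)))"
  by (rule torus.sq_integrable_bounded[OF _ cmod_DD_cis_le])
     (intro borel_measurable_DD borel_measurable_cis_circle)

text \<open>The quotient \<open>(1 - cis (k z)) / (1 - cis z)\<close> is a geometric sum, so that the products of these
  quotients are integrated by orthogonality.\<close>

lemma integral_DD_cis:
  assumes "x \<in> {0..<2 * pi}"
  shows "(LINT y|circle. DD (\<lambda>x. cis (of_int k * x)) (x, y) * cnj (DD (\<lambda>x. cis (of_int l * x)) (x, y)))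
    = 2 * pi * card (freqs k \<inter> freqs l) * cis (of_int (k - l) * x)"
proof -
  let ?q = "\<lambda>k y. trig (freqs k) (\<lambda>a. cis (- (of_int a * x))) y"
  let ?e = "cis (of_int (k - l) * x)"
  have sh: "trig (freqs k) (\<lambda>_. 1) (y - x) = ?q k y" for k y
    by (simp add: trig_def cis_mult algebra_simps)
  have split: "cis (of_int k * x) - cis (of_int k * y) = cis (of_int k * x) * ((1 - cis (y - x)) * (of_int (sgn k) * ?q k y))" for k y
    unfolding sh[symmetric] one_minus_cis_eq[of k "y - x", symmetric] by (simp add: right_diff_distrib cis_mult algebra_simps)
  have "AE y in circle. DD (\<lambda>x. cis (of_int k * x)) (x, y) * cnj (DD (\<lambda>x. cis (of_int l * x)) (x, y))
      = ?e * of_int (sgn k * sgn l) * (?q k y * cnj (?q l y))"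
    \<comment> \<open>Excludes the diagonal, where \<open>DD\<close> is a division by 0, and the
      endpoint excluded by \<open>circle_dist_pos\<close>.\<close>
    using AE_circle_neq[of x] AE_circle_neq[of 0] AE_space
  proof eventually_elim
    case (elim y)
    have d: "circle_dist y x > 0" using elim assms by (intro circle_dist_pos) auto
    have d2: "(1 - cis (y - x)) * cnj (1 - cis (y - x)) = of_real (circle_dist x y) * of_real (circle_dist x y)"
      using complex_norm_square[of "1 - cis (y - x)"]
      by (simp add: circle_dist_eq[of y x, symmetric] circle_dist_commute[of x y] power2_eq_square)
    have ee: "cis (of_int k * x) * cnj (cis (of_int l * x)) = ?e" by (simp add: cis_cnj cis_mult algebra_simps)
    have "DD (\<lambda>x. cis (of_int k * x)) (x, y) * cnj (DD (\<lambda>x. cis (of_int l * x)) (x, y))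
      = (cis (of_int k * x) * cnj (cis (of_int l * x))) * ((1 - cis (y - x)) * cnj (1 - cis (y - x)))
         * of_int (sgn k * sgn l) * (?q k y * cnj (?q l y)) / (of_real (circle_dist x y) * of_real (circle_dist x y))"
      unfolding DD_def fst_conv snd_conv split by simp
    also have "\<dots> = ?e * of_int (sgn k * sgn l) * (?q k y * cnj (?q l y))"
      unfolding d2 ee using d by (simp add: circle_dist_commute[of x y])
    finally show ?case .
  qed
  then have "(LINT y|circle. DD (\<lambda>x. cis (of_int k * x)) (x, y) * cnj (DD (\<lambda>x. cis (of_int l * x)) (x, y)))
      = (LINT y|circle. ?e * of_int (sgn k * sgn l) * (?q k y * cnj (?q l y)))"
  proof (rule integral_cong_AE[rotated 2])
    have "(\<lambda>y. DD (\<lambda>x. cis (of_int j * x)) (x, y)) \<in> borel_measurable circle" for j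
      using measurable_compose[OF measurable_Pair1'[of x circle circle] borel_measurable_DD[OF borel_measurable_cis_circle]] assms
      by simp
    then show "(\<lambda>y. DD (\<lambda>x. cis (of_int k * x)) (x, y) * cnj (DD (\<lambda>x. cis (of_int l * x)) (x, y))) \<in> borel_measurable circle"
      by (intro borel_measurable_times borel_measurable_cnj)
    show "(\<lambda>y. ?e * of_int (sgn k * sgn l) * (?q k y * cnj (?q l y))) \<in> borel_measurable circle"
      by (intro borel_measurable_times borel_measurable_cnj borel_measurable_circle borel_measurable_trig) auto
  qed
  also have "\<dots> = ?e * of_int (sgn k * sgn l) * (LINT y|circle. ?q k y * cnj (?q l y))" by simp
  also have "(LINT y|circle. ?q k y * cnj (?q l y)) = (\<Sum>a\<in>freqs l. 2 * pi * (cis (of_int a * x) * (if a \<in> freqs k then cis (- (of_int a * x)) else 0)))"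
    by (subst integral_mult_cnj_trig) (auto simp: fcoeff_trig cis_cnj mult.assoc)
  also have "\<dots> = (\<Sum>a\<in>freqs l. if a \<in> freqs k then 2 * pi else 0)"
    unfolding of_real_sum by (intro sum.cong) (auto simp: cis_mult)
  also have "\<dots> = 2 * pi * card (freqs k \<inter> freqs l)"
    by (subst sum.inter_restrict[symmetric]) (auto simp: Int_commute)
  also have "?e * of_int (sgn k * sgn l) * of_real (2 * pi * card (freqs k \<inter> freqs l)) = 2 * pi * card (freqs k \<inter> freqs l) * ?e"
  \<comment> \<open>\<open>freqs\<close> of a positive and of a negative number are disjoint, so a
    nonempty intersection forces equal signs and the product of the signs is 1.\<close>
  proof (cases "freqs k \<inter> freqs l = {}")
    case False
    then have "sgn k * sgn l = 1" by (auto simp: freqs_def sgn_if split: if_splits)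
    then show ?thesis by simp
  qed simp
  finally show ?thesis .
qed

section \<open>The Gagliardo energy\<close>

text \<open>Integration in \<open>x\<close> kills k \<noteq> l, and on the diagonal
  \<open>card (freqs k)\<close> = |k| appears: this is how the seminorm acquires the symbol of
  \<Lambda>.\<close>

lemma integral_torus_DD_cis:
  "(LINT p|torus. DD (\<lambda>x. cis (of_int k * x)) p * cnj (DD (\<lambda>x. cis (of_int l * x)) p))
    = (if k = l then (2 * pi)\<^sup>2 * \<bar>of_int k\<bar> else 0)"
proof -
  let ?f = "\<lambda>p. DD (\<lambda>x. cis (of_int k * x)) p * cnj (DD (\<lambda>x. cis (of_int l * x)) p)"
  have "integrable torus ?f" by (intro sq_integrable_mult sq_integrable_cnj sq_integrable_DD_cis)
  then have "(LINT p|torus. ?f p) = (LINT x|circle. LINT y|circle. ?f (x, y))"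
    by (rule circle2.integral_fst'[symmetric])
  also have "\<dots> = (LINT x|circle. 2 * pi * card (freqs k \<inter> freqs l) * cis (of_int (k - l) * x))"
    by (intro Bochner_Integration.integral_cong integral_DD_cis) auto
  also have "\<dots> = 2 * pi * card (freqs k \<inter> freqs l) * (LINT x|circle. cis (of_int (k - l) * x))"
    by (rule integral_mult_right_zero)
  also have "\<dots> = (if k = l then (2 * pi)\<^sup>2 * \<bar>of_int k\<bar> else 0)"
    unfolding integral_circle_cis by (simp add: card_freqs power2_eq_square flip: of_int_abs)
  finally show ?thesis .
qed

lemma L2_norm_DD_trig:
  assumes S: "finite S"
  shows "(L2_norm torus (DD (trig S c)))\<^sup>2 = (2 * pi)\<^sup>2 * (\<Sum>k\<in>S. \<bar>of_int k\<bar> * (cmod (c k))\<^sup>2)"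
proof -
  let ?D = "\<lambda>k. DD (\<lambda>x. cis (of_int k * x))"
  have i: "integrable torus (\<lambda>p. ?D k p * cnj (?D l p))" for k l
    by (intro sq_integrable_mult sq_integrable_cnj sq_integrable_DD_cis)
  have "complex_of_real ((L2_norm torus (DD (trig S c)))\<^sup>2) = (LINT p|torus. DD (trig S c) p * cnj (DD (trig S c) p))"
    unfolding L2_norm_power2 complex_norm_square[symmetric] by (rule integral_complex_of_real[symmetric])
  also have "\<dots> = (LINT p|torus. (\<Sum>k\<in>S. \<Sum>l\<in>S. c k * cnj (c l) * (?D k p * cnj (?D l p))))"
    unfolding DD_trig cnj_sum sum_product by (simp add: mult_ac)
  also have "\<dots> = (\<Sum>k\<in>S. \<Sum>l\<in>S. c k * cnj (c l) * (LINT p|torus. ?D k p * cnj (?D l p)))"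
    by (simp add: Bochner_Integration.integral_sum i)
  also have "\<dots> = (\<Sum>k\<in>S. \<Sum>l\<in>S. if k = l then c k * cnj (c k) * ((2 * pi)\<^sup>2 * \<bar>of_int k\<bar>) else 0)"
    unfolding integral_torus_DD_cis by (intro sum.cong) auto
  also have "\<dots> = (\<Sum>k\<in>S. c k * cnj (c k) * ((2 * pi)\<^sup>2 * \<bar>of_int k\<bar>))"
    using S by simp
  also have "\<dots> = complex_of_real ((2 * pi)\<^sup>2 * (\<Sum>k\<in>S. \<bar>of_int k\<bar> * (cmod (c k))\<^sup>2))"
    unfolding of_real_mult of_real_sum sum_distrib_left complex_norm_square
    by (intro sum.cong) (auto simp: mult_ac)
  finally show ?thesis by (simp only: of_real_eq_iff)
qed

text \<open>Convergence of the partial sums for almost every \<open>x\<close> gives convergence of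
  \<open>DD\<close> for almost every pair, and Fatou passes the exact formula for polynomials to the
  limit as an inequality.\<close>

lemma Gagliardo_le:
  assumes w: "sq_integrable circle w" and s: "(\<lambda>k. \<bar>of_int k\<bar> * (cmod (fcoeff w k))\<^sup>2) summable_on UNIV"
  shows "sq_integrable torus (DD w)"
    and "(L2_norm torus (DD w))\<^sup>2 \<le> (2 * pi)\<^sup>2 * (\<Sum>\<^sub>\<infinity>k. \<bar>of_int k\<bar> * (cmod (fcoeff w k))\<^sup>2)"
proof -
  obtain r where r: "strict_mono r" "AE x in circle. (\<lambda>j. trig (freq_box (r j)) (fcoeff w) x) \<longlonglongrightarrow> w x"
    using trig_subsequence_AE[OF w] by blast
  have m1: "DD (trig (freq_box (r n)) (fcoeff w)) \<in> borel_measurable torus" for n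
    by (intro borel_measurable_DD borel_measurable_circle borel_measurable_trig)
  have m2: "DD w \<in> borel_measurable torus" by (intro borel_measurable_DD sq_integrable_measurable[OF w])
  have l: "AE p in torus. (\<lambda>n. DD (trig (freq_box (r n)) (fcoeff w)) p) \<longlonglongrightarrow> DD w p"
    using AE_circle2[OF r(2)]
  proof eventually_elim
    case (elim p)
    then show ?case
      unfolding DD_def divide_inverse by (intro tendsto_mult tendsto_diff tendsto_const) auto
  qed
  have i: "(\<integral>\<^sup>+p. ennreal ((cmod (DD (trig (freq_box (r n)) (fcoeff w)) p))\<^sup>2) \<partial>torus)
        \<le> ennreal ((2 * pi)\<^sup>2 * (\<Sum>\<^sub>\<infinity>k. \<bar>of_int k\<bar> * (cmod (fcoeff w k))\<^sup>2))" for n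
    unfolding nn_integral_L2_norm[OF sq_integrable_DD_trig] L2_norm_DD_trig[OF finite_atLeastAtMost_int]
    by (intro ennreal_leI mult_left_mono finite_sum_le_infsum s) auto
  have B: "0 \<le> (2 * pi)\<^sup>2 * (\<Sum>\<^sub>\<infinity>k. \<bar>of_int k\<bar> * (cmod (fcoeff w k))\<^sup>2)"
    by (intro mult_nonneg_nonneg infsum_nonneg) auto
  show "sq_integrable torus (DD w)" by (rule L2_Fatou(1)[OF m1 m2 l i B])
  show "(L2_norm torus (DD w))\<^sup>2 \<le> (2 * pi)\<^sup>2 * (\<Sum>\<^sub>\<infinity>k. \<bar>of_int k\<bar> * (cmod (fcoeff w k))\<^sup>2)"
    by (rule L2_Fatou(2)[OF m1 m2 l i B])
qed

text \<open>Dominated convergence for unordered sums: outside a finite set the sum of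
  \<open>f\<close> is small for all \<open>n\<close> at once.\<close>

lemma infsum_dominated_tendsto_0:
  fixes f :: "'a \<Rightarrow> real"
  assumes f: "f summable_on UNIV" "\<And>k. 0 \<le> f k" and \<mu>: "\<And>n k. 0 \<le> \<mu> n k" "\<And>n k. \<mu> n k \<le> 1" "\<And>k. (\<lambda>n. \<mu> n k) \<longlonglongrightarrow> 0"
  shows "\<And>n. (\<lambda>k. \<mu> n k * f k) summable_on UNIV" and "(\<lambda>n. \<Sum>\<^sub>\<infinity>k. \<mu> n k * f k) \<longlonglongrightarrow> 0"
proof -
  show s: "(\<lambda>k. \<mu> n k * f k) summable_on UNIV" for n
    by (rule summable_on_comparison_test[OF f(1)]) (use f \<mu> in \<open>auto intro: mult_left_le_one_le\<close>)
  show "(\<lambda>n. \<Sum>\<^sub>\<infinity>k. \<mu> n k * f k) \<longlonglongrightarrow> 0"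
  proof (rule tendstoI)
    fix e :: real assume e: "e > 0"
    obtain X where X: "finite X" "infsum f UNIV - sum f X < e / 2"
    proof -
      have "\<forall>\<^sub>F X in finite_subsets_at_top UNIV. dist (sum f X) (infsum f UNIV) < e / 2"
        using has_sum_infsum[OF f(1)] e unfolding has_sum_def by (intro tendstoD) auto
      then obtain X where X: "finite X" "dist (sum f X) (infsum f UNIV) < e / 2"
        unfolding eventually_finite_subsets_at_top by blast
      have "infsum f UNIV - sum f X < e / 2" using X(2) unfolding dist_real_def by linarith
      then show ?thesis using that X(1) by blast
    qed
    have le: "(\<Sum>\<^sub>\<infinity>k. \<mu> n k * f k) \<le> (\<Sum>k\<in>X. \<mu> n k * f k) + (infsum f UNIV - sum f X)" for n
    proof (rule infsum_le_finite_sums[OF s])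
      fix Y :: "'a set" assume Y: "finite Y"
      have "(\<Sum>k\<in>Y. \<mu> n k * f k) \<le> (\<Sum>k\<in>X \<union> Y. \<mu> n k * f k)"
        by (rule sum_mono2) (use X Y f \<mu> in auto)
      also have "\<dots> = (\<Sum>k\<in>X. \<mu> n k * f k) + (\<Sum>k\<in>Y - X. \<mu> n k * f k)"
        using X Y by (subst sum.union_disjoint[symmetric]) (auto intro!: sum.cong)
      also have "(\<Sum>k\<in>Y - X. \<mu> n k * f k) \<le> (\<Sum>k\<in>Y - X. f k)"
        by (rule sum_mono) (use f \<mu> in \<open>auto intro: mult_left_le_one_le\<close>)
      also have "(\<Sum>k\<in>Y - X. f k) = sum f (X \<union> Y) - sum f X"
        using X Y by (subst sum_diff[symmetric]) (auto intro!: sum.cong)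
      also have "sum f (X \<union> Y) \<le> infsum f UNIV"
        by (rule finite_sum_le_infsum) (use f X Y in auto)
      finally show "(\<Sum>k\<in>Y. \<mu> n k * f k) \<le> (\<Sum>k\<in>X. \<mu> n k * f k) + (infsum f UNIV - sum f X)" by simp
    qed
    have "(\<lambda>n. \<Sum>k\<in>X. \<mu> n k * f k) \<longlonglongrightarrow> (\<Sum>k\<in>X. 0 * f k)" by (intro tendsto_intros \<mu>)
    then have "\<forall>\<^sub>F n in sequentially. (\<Sum>k\<in>X. \<mu> n k * f k) < e / 2"
      using e by (intro order_tendstoD(2)) auto
    then show "\<forall>\<^sub>F n in sequentially. dist (\<Sum>\<^sub>\<infinity>k. \<mu> n k * f k) 0 < e"
    proof eventually_elim
      case (elim n)
      have "0 \<le> (\<Sum>\<^sub>\<infinity>k. \<mu> n k * f k)" by (intro infsum_nonneg) (use f \<mu> in auto)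
      then show ?case using le[of n] X(2) elim by simp
    qed
  qed
qed

text \<open>Two instances are used. Sharp cut-offs keep the coefficients exact; Fejer weights keep
  sup bounds. Both converge in L^2 and in the energy norm, for the same reason.\<close>

locale multiplier =
  fixes m :: "nat \<Rightarrow> int \<Rightarrow> real" and A :: "nat \<Rightarrow> int set"
  assumes finite_A: "\<And>n. finite (A n)"
    and m_outside: "\<And>n k. k \<notin> A n \<Longrightarrow> m n k = 0"
    and m_nonneg: "\<And>n k. 0 \<le> m n k" and m_le_1: "\<And>n k. m n k \<le> 1"
    and m_tendsto: "\<And>k. (\<lambda>n. m n k) \<longlonglongrightarrow> 1"
begin

definition approx :: "(real \<Rightarrow> complex) \<Rightarrow> nat \<Rightarrow> real \<Rightarrow> complex" where
  "approx w n = trig (A n) (\<lambda>k. m n k * fcoeff w k)"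

lemma sq_integrable_approx [simp]: "sq_integrable circle (approx w n)"
  by (simp add: approx_def)

lemma fcoeff_minus_approx:
  assumes "sq_integrable circle w"
  shows "fcoeff (\<lambda>x. w x - approx w n x) k = of_real (1 - m n k) * fcoeff w k"
  using assms unfolding approx_def
  by (subst fcoeff_diff) (auto simp: circle.sq_integrable_imp_integrable fcoeff_trig finite_A m_outside left_diff_distrib)

lemma square_tendsto: "(\<lambda>n. (1 - m n k)\<^sup>2) \<longlonglongrightarrow> 0"
  using tendsto_power[OF tendsto_diff[OF tendsto_const m_tendsto[of k]], of 1 2] by simp

lemma square_le_1: "(1 - m n k)\<^sup>2 \<le> 1"
  using m_nonneg[of n k] m_le_1[of n k] by (simp add: power_le_one)

lemma approx_tendsto:
  assumes w: "sq_integrable circle w"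
  shows "(\<lambda>n. L2_norm circle (\<lambda>x. w x - approx w n x)) \<longlonglongrightarrow> 0"
proof -
  let ?s = "\<lambda>n. \<Sum>\<^sub>\<infinity>k. (1 - m n k)\<^sup>2 * (cmod (fcoeff w k))\<^sup>2"
  have lim: "?s \<longlonglongrightarrow> 0"
    by (intro infsum_dominated_tendsto_0(2) Bessel_summable[OF w] square_tendsto square_le_1) auto
  show ?thesis
  proof (rule Lim_null_comparison[where g = "\<lambda>n. sqrt (2 * pi * ?s n)"])
    show "\<forall>\<^sub>F n in sequentially. norm (L2_norm circle (\<lambda>x. w x - approx w n x)) \<le> sqrt (2 * pi * ?s n)"
    proof (intro always_eventually allI)
      fix n
      have "(L2_norm circle (\<lambda>x. w x - approx w n x))\<^sup>2 \<le> 2 * pi * ?s n"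
        using Parseval_le[OF sq_integrable_diff[OF w sq_integrable_approx[of w n]]]
        unfolding fcoeff_minus_approx[OF w] by (simp add: norm_mult power_mult_distrib del: of_real_diff)
      then show "norm (L2_norm circle (\<lambda>x. w x - approx w n x)) \<le> sqrt (2 * pi * ?s n)"
        by (simp add: real_le_rsqrt)
    qed
    show "(\<lambda>n. sqrt (2 * pi * ?s n)) \<longlonglongrightarrow> 0"
      using tendsto_real_sqrt[OF tendsto_mult[OF tendsto_const[of "2 * pi"] lim]] by simp
  qed
qed

lemma DD_approx_tendsto:
  assumes w: "sq_integrable circle w" and s: "(\<lambda>k. \<bar>of_int k\<bar> * (cmod (fcoeff w k))\<^sup>2) summable_on UNIV"
  shows "(\<lambda>n. L2_norm torus (\<lambda>p. DD w p - DD (approx w n) p)) \<longlonglongrightarrow> 0"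
proof -
  let ?g = "\<lambda>n k. (1 - m n k)\<^sup>2 * (\<bar>of_int k\<bar> * (cmod (fcoeff w k))\<^sup>2)"
  let ?s = "\<lambda>n. \<Sum>\<^sub>\<infinity>k. ?g n k"
  have lim: "?s \<longlonglongrightarrow> 0"
    by (intro infsum_dominated_tendsto_0(2) s square_tendsto square_le_1) auto
  have summ: "?g n summable_on UNIV" for n
    by (intro infsum_dominated_tendsto_0(1) s square_tendsto square_le_1) auto
  show ?thesis
  proof (rule Lim_null_comparison[where g = "\<lambda>n. sqrt ((2 * pi)\<^sup>2 * ?s n)"])
    show "\<forall>\<^sub>F n in sequentially. norm (L2_norm torus (\<lambda>p. DD w p - DD (approx w n) p)) \<le> sqrt ((2 * pi)\<^sup>2 * ?s n)"
    proof (intro always_eventually allI)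
      fix n
      have g: "\<bar>of_int k\<bar> * (cmod (fcoeff (\<lambda>x. w x - approx w n x) k))\<^sup>2 = ?g n k" for k
        unfolding fcoeff_minus_approx[OF w] by (simp add: norm_mult power_mult_distrib del: of_real_diff)
      have "(L2_norm torus (DD (\<lambda>x. w x - approx w n x)))\<^sup>2 \<le> (2 * pi)\<^sup>2 * ?s n"
        using Gagliardo_le(2)[OF sq_integrable_diff[OF w sq_integrable_approx[of w n]], unfolded g, OF summ] .
      then show "norm (L2_norm torus (\<lambda>p. DD w p - DD (approx w n) p)) \<le> sqrt ((2 * pi)\<^sup>2 * ?s n)"
        unfolding DD_diff by (simp add: real_le_rsqrt)
    qed
    show "(\<lambda>n. sqrt ((2 * pi)\<^sup>2 * ?s n)) \<longlonglongrightarrow> 0"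
      using tendsto_real_sqrt[OF tendsto_mult[OF tendsto_const[of "(2 * pi)\<^sup>2"] lim]] by simp
  qed
qed

end

interpretation partial_sum: multiplier "\<lambda>n k. if k \<in> freq_box n then 1 else 0" freq_box
proof
  fix k :: int
  show "(\<lambda>n. if k \<in> freq_box n then 1 else (0::real)) \<longlonglongrightarrow> 1"
    by (rule tendsto_eventually, rule eventually_sequentiallyI[of "nat \<bar>k\<bar>"]) auto
qed auto

interpretation fejer: multiplier fejer_weight fejer_freqs
  by standard (auto simp: fejer_weight_eq_0 fejer_weight_le_1 fejer_weight_tendsto)

lemma partial_sum_approx: "partial_sum.approx w n = trig (freq_box n) (fcoeff w)"
  unfolding partial_sum.approx_def by (auto simp: trig_def intro!: sum.cong)

lemma fejer_approx: "fejer.approx w n = fejer_mean n w"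
  by (simp add: fejer.approx_def fejer_mean_def)

text \<open>Up to the factor (2 pi)^2 this is the pairing of \<Lambda>w with the mode, so products
  of difference quotients are the weak form of \<Lambda>. The sequence obtained from partial sums is
  eventually constant.\<close>

lemma integral_DD_mult_DD_cis:
  assumes w: "sq_integrable circle w" and s: "(\<lambda>k. \<bar>of_int k\<bar> * (cmod (fcoeff w k))\<^sup>2) summable_on UNIV"
  shows "(LINT p|torus. DD w p * DD (\<lambda>x. cis (of_int k * x)) p) = (2 * pi)\<^sup>2 * \<bar>of_int k\<bar> * fcoeff w (- k)"
proof -
  let ?D = "\<lambda>k. DD (\<lambda>x. cis (of_int k * x))"
  have cnj: "?D k p = cnj (?D (- k) p)" for p by (simp add: DD_def cis_cnj)
  have "(\<lambda>n. LINT p|torus. DD (trig (freq_box n) (fcoeff w)) p * ?D k p) \<longlonglongrightarrow> (LINT p|torus. DD w p * ?D k p)"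
  proof (rule L2_tendsto_integral_mult)
    show "(\<lambda>n. L2_norm torus (\<lambda>p. DD (trig (freq_box n) (fcoeff w)) p - DD w p)) \<longlonglongrightarrow> 0"
      using partial_sum.DD_approx_tendsto[OF w s] unfolding L2_norm_def partial_sum_approx
      by (subst norm_minus_commute)
  qed (auto intro: Gagliardo_le[OF w s])
  moreover have "(LINT p|torus. DD (trig (freq_box n) (fcoeff w)) p * ?D k p) = (2 * pi)\<^sup>2 * \<bar>of_int k\<bar> * fcoeff w (- k)"
    if n: "nat \<bar>k\<bar> \<le> n" for n
  proof -
    have "(LINT p|torus. DD (trig (freq_box n) (fcoeff w)) p * ?D k p)
      = (LINT p|torus. (\<Sum>l\<in>freq_box n. fcoeff w l * (?D l p * cnj (?D (- k) p))))"
      unfolding DD_trig sum_distrib_right cnj by (simp add: mult_ac)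
    also have "\<dots> = (\<Sum>l\<in>freq_box n. fcoeff w l * (LINT p|torus. ?D l p * cnj (?D (- k) p)))"
      by (subst Bochner_Integration.integral_sum)
         (use sq_integrable_DD_cis[of "- k"] in \<open>auto intro!: integrable_mult_right sq_integrable_mult sq_integrable_cnj\<close>)
    also have "\<dots> = (\<Sum>l\<in>freq_box n. if l = - k then (2 * pi)\<^sup>2 * \<bar>of_int k\<bar> * fcoeff w (- k) else 0)"
      unfolding integral_torus_DD_cis by (intro sum.cong) auto
    also have "\<dots> = (2 * pi)\<^sup>2 * \<bar>of_int k\<bar> * fcoeff w (- k)"
      using n by (subst sum.delta) auto
    finally show ?thesis .
  qed
  then have "(\<lambda>n. LINT p|torus. DD (trig (freq_box n) (fcoeff w)) p * ?D k p) \<longlonglongrightarrow> (2 * pi)\<^sup>2 * \<bar>of_int k\<bar> * fcoeff w (- k)"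
    by (intro tendsto_eventually eventually_sequentiallyI[of "nat \<bar>k\<bar>"])
  ultimately show ?thesis by (rule LIMSEQ_unique)
qed

text \<open>The carre du champ of \<Lambda>: 2 pi times |d_{1/2} w|^2 for scalar
  \<open>w\<close>.\<close>

definition carre :: "(real \<Rightarrow> complex) \<Rightarrow> real \<Rightarrow> real" where
  "carre w x = (LINT y|circle. (cmod (DD w (x, y)))\<^sup>2)"

lemma carre_nonneg [simp]: "0 \<le> carre w x"
  by (simp add: carre_def)

lemma borel_measurable_carre:
  assumes "w \<in> borel_measurable circle" shows "carre w \<in> borel_measurable circle"
  unfolding carre_def[abs_def]
  by (rule circle.borel_measurable_lebesgue_integral) (use borel_measurable_DD[OF assms] in simp)

lemma carre_trig:
  assumes S: "finite S" and x: "x \<in> {0..<2 * pi}"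
  shows "complex_of_real (carre (trig S c) x)
    = 2 * pi * (\<Sum>k\<in>S. \<Sum>l\<in>S. c k * cnj (c l) * card (freqs k \<inter> freqs l) * cis (of_int (k - l) * x))"
proof -
  let ?D = "\<lambda>k y. DD (\<lambda>x. cis (of_int k * x)) (x, y)"
  have m: "(\<lambda>y. ?D k y) \<in> borel_measurable circle" for k
    using measurable_compose[OF measurable_Pair1'[of x circle circle] borel_measurable_DD[OF borel_measurable_cis_circle]] x
    by simp
  have sq: "sq_integrable circle (\<lambda>y. ?D k y)" for k
    by (rule circle.sq_integrable_bounded[OF m cmod_DD_cis_le])
  have i: "integrable circle (\<lambda>y. ?D k y * cnj (?D l y))" for k l
    by (intro sq_integrable_mult sq_integrable_cnj sq)
  have "complex_of_real (carre (trig S c) x) = (LINT y|circle. DD (trig S c) (x, y) * cnj (DD (trig S c) (x, y)))"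
    unfolding carre_def complex_norm_square[symmetric] by (rule integral_complex_of_real[symmetric])
  also have "\<dots> = (LINT y|circle. (\<Sum>k\<in>S. \<Sum>l\<in>S. c k * cnj (c l) * (?D k y * cnj (?D l y))))"
    unfolding DD_trig cnj_sum sum_product by (simp add: mult_ac)
  also have "\<dots> = (\<Sum>k\<in>S. \<Sum>l\<in>S. c k * cnj (c l) * (LINT y|circle. ?D k y * cnj (?D l y)))"
    by (simp add: Bochner_Integration.integral_sum i)
  also have "\<dots> = 2 * pi * (\<Sum>k\<in>S. \<Sum>l\<in>S. c k * cnj (c l) * card (freqs k \<inter> freqs l) * cis (of_int (k - l) * x))"
    unfolding integral_DD_cis[OF x] by (simp add: sum_distrib_left mult_ac)
  finally show ?thesis .
qed

text \<open>The coefficient bound |k|^(1/2) |l|^(1/2) equals |k|^(3/4) |l|^(3/4) divided by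
  |k|^(1/4) |l|^(1/4). So the square function of an H^(3/4) function obeys the same bound as the
  square of an H^(1/4) function.\<close>

lemma L2_norm_carre_trig:
  assumes S: "finite S"
  shows "(L2_norm circle (\<lambda>x. of_real (carre (trig S c) x)))\<^sup>2
    \<le> (2 * pi)\<^sup>2 * (88 * pi) * (\<Sum>k\<in>S. (root4 k ^ 3 * cmod (c k))\<^sup>2)\<^sup>2"
proof -
  let ?a = "\<lambda>k. if k \<in> S then root4 k ^ 3 * cmod (c k) else 0"
  let ?g = "\<lambda>k l. 2 * pi * (c k * cnj (c l) * card (freqs k \<inter> freqs l))"
  have "(L2_norm circle (\<lambda>x. of_real (carre (trig S c) x)))\<^sup>2
     = (L2_norm circle (\<lambda>x. 2 * pi * (\<Sum>k\<in>S. \<Sum>l\<in>S. (c k * cnj (c l) * card (freqs k \<inter> freqs l)) * cis (of_int (k - l) * x))))\<^sup>2"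
    unfolding L2_norm_power2
    by (intro Bochner_Integration.integral_cong refl) (simp only: space_circle carre_trig[OF S])
  also have "\<dots> = (2 * pi)\<^sup>2 * (L2_norm circle (\<lambda>x. \<Sum>k\<in>S. \<Sum>l\<in>S. (c k * cnj (c l) * card (freqs k \<inter> freqs l)) * cis (of_int (k - l) * x)))\<^sup>2"
    unfolding L2_norm_power2 norm_mult power_mult_distrib by simp
  also have "(L2_norm circle (\<lambda>x. \<Sum>k\<in>S. \<Sum>l\<in>S. (c k * cnj (c l) * card (freqs k \<inter> freqs l)) * cis (of_int (k - l) * x)))\<^sup>2
    \<le> 88 * pi * (\<Sum>k\<in>S. (?a k)\<^sup>2)\<^sup>2"
  proof (rule L2_norm_double_trig[OF S])
    fix k l assume kl: "k \<in> S" "l \<in> S"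
    have "cmod (c k * cnj (c l) * card (freqs k \<inter> freqs l)) = (cmod (c k) * cmod (c l)) * real (card (freqs k \<inter> freqs l))"
      by (simp add: norm_mult)
    also have "\<dots> \<le> (cmod (c k) * cmod (c l)) * ((root4 k)\<^sup>2 * (root4 l)\<^sup>2)"
      by (intro mult_left_mono card_freqs_Int_le) auto
    also have "\<dots> = ?a k * ?a l / (root4 k * root4 l)"
      using kl by (cases "k = 0"; cases "l = 0") (auto simp: power2_eq_square power3_eq_cube)
    finally show "cmod (c k * cnj (c l) * card (freqs k \<inter> freqs l)) \<le> ?a k * ?a l / (root4 k * root4 l)" .
  qed auto
  finally show ?thesis by (simp add: mult_ac cong: sum.cong)
qed

text \<open>The L^4 bound for H^(1/4), squared. Frequency 0 is excluded because the homogeneous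
  weight cannot control it.\<close>

lemma L2_norm_cmod_square_trig:
  assumes S: "finite S" "0 \<notin> S"
  shows "(L2_norm circle (\<lambda>x. of_real ((cmod (trig S c x))\<^sup>2)))\<^sup>2 \<le> 88 * pi * (\<Sum>k\<in>S. (root4 k * cmod (c k))\<^sup>2)\<^sup>2"
proof -
  let ?a = "\<lambda>k. if k \<in> S then root4 k * cmod (c k) else 0"
  have eq: "complex_of_real ((cmod (trig S c x))\<^sup>2) = (\<Sum>k\<in>S. \<Sum>l\<in>S. (c k * cnj (c l)) * cis (of_int (k - l) * x))" for x
    unfolding complex_norm_square trig_def cnj_sum sum_product cis_minus_mult[symmetric]
    by (simp add: cis_cnj mult_ac)
  have "(L2_norm circle (\<lambda>x. \<Sum>k\<in>S. \<Sum>l\<in>S. (c k * cnj (c l)) * cis (of_int (k - l) * x)))\<^sup>2 \<le> 88 * pi * (\<Sum>k\<in>S. (?a k)\<^sup>2)\<^sup>2"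
  proof (rule L2_norm_double_trig[OF S(1)])
    fix k l assume kl: "k \<in> S" "l \<in> S"
    then have "root4 k \<noteq> 0" "root4 l \<noteq> 0" using S(2) by auto
    then show "cmod (c k * cnj (c l)) \<le> ?a k * ?a l / (root4 k * root4 l)"
      using kl by (simp add: norm_mult)
  qed auto
  then show ?thesis unfolding eq by (simp cong: sum.cong)
qed

text \<open>Integration in \<open>y\<close> turns the square into \<open>carre\<close> times
  |trig|^2, and Cauchy-Schwarz in \<open>x\<close> combines the two preceding bounds: 176 pi^2 = 2
  pi * 88 pi.\<close>

lemma L2_norm_DD_mult:
  assumes S: "finite S" and T: "finite T" "0 \<notin> T"
  shows "sq_integrable torus (\<lambda>p. trig T b (fst p) * DD (trig S c) p)"
    and "(L2_norm torus (\<lambda>p. trig T b (fst p) * DD (trig S c) p))\<^sup>2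
      \<le> 176 * pi\<^sup>2 * (\<Sum>k\<in>S. (root4 k ^ 3 * cmod (c k))\<^sup>2) * (\<Sum>k\<in>T. (root4 k * cmod (b k))\<^sup>2)"
proof -
  let ?v = "trig S c" and ?\<phi> = "trig T b"
  show sq: "sq_integrable torus (\<lambda>p. ?\<phi> (fst p) * DD ?v p)"
    by (rule sq_integrable_mult_bounded[OF sq_integrable_DD_trig measurable_torus_fst cmod_trig_le])
       (intro borel_measurable_circle borel_measurable_trig)
  have i: "integrable torus (\<lambda>p. (cmod (?\<phi> (fst p) * DD ?v p))\<^sup>2)"
    using sq by (simp add: sq_integrable_def)
  have C: "sq_integrable circle (\<lambda>x. complex_of_real (carre ?v x))"
  proof (rule circle.sq_integrable_bounded)
    show "(\<lambda>x. complex_of_real (carre ?v x)) \<in> borel_measurable circle"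
      using borel_measurable_carre[OF borel_measurable_circle[OF borel_measurable_trig]] by simp
    fix x assume x: "x \<in> space circle"
    then show "cmod (complex_of_real (carre ?v x)) \<le> cmod (of_real (2 * pi)) * (\<Sum>k\<in>S. \<Sum>l\<in>S. cmod (c k * cnj (c l) * card (freqs k \<inter> freqs l)))"
      unfolding carre_trig[OF S x[unfolded space_circle]] norm_mult[of "of_real (2*pi)"]
      by (intro mult_left_mono order_trans[OF norm_sum sum_mono]) (auto simp: norm_mult intro!: order_trans[OF norm_sum sum_mono])
  qed
  have P: "sq_integrable circle (\<lambda>x. complex_of_real ((cmod (?\<phi> x))\<^sup>2))"
  proof (rule circle.sq_integrable_bounded)
    have [measurable]: "?\<phi> \<in> borel_measurable circle" by (intro borel_measurable_circle borel_measurable_trig)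
    show "(\<lambda>x. complex_of_real ((cmod (?\<phi> x))\<^sup>2)) \<in> borel_measurable circle" by measurable
    show "cmod (complex_of_real ((cmod (?\<phi> x))\<^sup>2)) \<le> (\<Sum>k\<in>T. cmod (b k))\<^sup>2" for x
      using cmod_trig_le by (simp add: norm_power power_mono)
  qed
  have "(L2_norm torus (\<lambda>p. ?\<phi> (fst p) * DD ?v p))\<^sup>2 = (LINT x|circle. LINT y|circle. (cmod (?\<phi> x * DD ?v (x, y)))\<^sup>2)"
    unfolding L2_norm_power2 using circle2.integral_fst'[OF i] by simp
  also have "\<dots> = (LINT x|circle. cmod (complex_of_real (carre ?v x)) * cmod (complex_of_real ((cmod (?\<phi> x))\<^sup>2)))"
    by (intro Bochner_Integration.integral_cong) (auto simp: norm_mult norm_power power_mult_distrib carre_def)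
  also have "\<dots> \<le> L2_norm circle (\<lambda>x. of_real (carre ?v x)) * L2_norm circle (\<lambda>x. of_real ((cmod (?\<phi> x))\<^sup>2))"
    by (rule L2_Cauchy_Schwarz[OF C P])
  also have "\<dots> \<le> sqrt ((2 * pi)\<^sup>2 * (88 * pi) * (\<Sum>k\<in>S. (root4 k ^ 3 * cmod (c k))\<^sup>2)\<^sup>2)
      * sqrt (88 * pi * (\<Sum>k\<in>T. (root4 k * cmod (b k))\<^sup>2)\<^sup>2)"
    by (intro mult_mono real_le_rsqrt L2_norm_carre_trig[OF S] L2_norm_cmod_square_trig[OF T]) auto
  also have "\<dots> = sqrt ((176 * pi\<^sup>2 * (\<Sum>k\<in>S. (root4 k ^ 3 * cmod (c k))\<^sup>2) * (\<Sum>k\<in>T. (root4 k * cmod (b k))\<^sup>2))\<^sup>2)"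
    unfolding real_sqrt_mult[symmetric] by (simp add: power2_eq_square mult_ac)
  also have "\<dots> = 176 * pi\<^sup>2 * (\<Sum>k\<in>S. (root4 k ^ 3 * cmod (c k))\<^sup>2) * (\<Sum>k\<in>T. (root4 k * cmod (b k))\<^sup>2)"
    by (simp add: sum_nonneg)
  finally show "(L2_norm torus (\<lambda>p. ?\<phi> (fst p) * DD ?v p))\<^sup>2
      \<le> 176 * pi\<^sup>2 * (\<Sum>k\<in>S. (root4 k ^ 3 * cmod (c k))\<^sup>2) * (\<Sum>k\<in>T. (root4 k * cmod (b k))\<^sup>2)" .
qed

section \<open>The equation at a fixed time\<close>

definition is_trig :: "(real \<Rightarrow> complex) \<Rightarrow> bool" where
  "is_trig \<phi> \<longleftrightarrow> (\<exists>S c. finite S \<and> \<phi> = trig S c)"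

lemma is_trig_trig [simp]: "finite S \<Longrightarrow> is_trig (trig S c)"
  by (auto simp: is_trig_def)

lemma is_trig_cis: "is_trig (\<lambda>x. a * cis (of_int k * x))"
  unfolding is_trig_def by (intro exI[of _ "{k}"] exI[of _ "\<lambda>_. a"]) (auto simp: trig_def)

lemma is_trig_add:
  assumes "is_trig \<phi>" "is_trig \<psi>" shows "is_trig (\<lambda>x. \<phi> x + \<psi> x)"
proof -
  obtain S c T d where *: "finite S" "\<phi> = trig S c" "finite T" "\<psi> = trig T d"
    using assms by (auto simp: is_trig_def)
  have "\<phi> = trig (S \<union> T) (\<lambda>k. if k \<in> S then c k else 0)" "\<psi> = trig (S \<union> T) (\<lambda>k. if k \<in> T then d k else 0)"
    using * trig_mono_neutral[of "S \<union> T" S c] trig_mono_neutral[of "S \<union> T" T d] by auto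
  then have "(\<lambda>x. \<phi> x + \<psi> x) = trig (S \<union> T) (\<lambda>k. (if k \<in> S then c k else 0) + (if k \<in> T then d k else 0))"
    by (auto simp: trig_add)
  then show ?thesis using * by simp
qed

lemma is_trig_sum: "(\<And>k. k \<in> A \<Longrightarrow> is_trig (f k)) \<Longrightarrow> is_trig (\<lambda>x. \<Sum>k\<in>A. f k x)"
proof (induction A rule: infinite_finite_induct)
  case (insert k A)
  then show ?case using is_trig_add[of "f k" "\<lambda>x. \<Sum>k\<in>A. f k x"] by simp
qed (use is_trig_trig[of "{}"] in \<open>auto simp: trig_def[abs_def]\<close>)

lemma is_trig_mult:
  assumes "is_trig \<phi>" "is_trig \<psi>" shows "is_trig (\<lambda>x. \<phi> x * \<psi> x)"
proof -
  obtain S c T d where *: "finite S" "\<phi> = trig S c" "finite T" "\<psi> = trig T d"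
    using assms by (auto simp: is_trig_def)
  have cis: "cis (of_int (k + l) * x) = cis (of_int k * x) * cis (of_int l * x)" for k l x
    by (simp add: cis_mult distrib_right)
  have "(\<lambda>x. \<phi> x * \<psi> x) = (\<lambda>x. \<Sum>k\<in>S. \<Sum>l\<in>T. (c k * d l) * cis (of_int (k + l) * x))"
    unfolding *(2,4) trig_def[abs_def] sum_product cis
    by (simp only: mult_ac)
  then show ?thesis by (simp only:) (intro is_trig_sum is_trig_cis)
qed

lemma is_trig_bounded:
  assumes "is_trig \<phi>" obtains B where "0 \<le> B" "\<And>x. cmod (\<phi> x) \<le> B" "\<And>p. cmod (DD \<phi> p) \<le> B"
proof -
  obtain S c where *: "finite S" "\<phi> = trig S c" using assms by (auto simp: is_trig_def)
  let ?a = "\<Sum>k\<in>S. cmod (c k)" and ?b = "\<Sum>k\<in>S. cmod (c k) * \<bar>of_int k\<bar>"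
  have "0 \<le> ?a" "0 \<le> ?b" by (auto intro!: sum_nonneg)
  moreover have "cmod (\<phi> x) \<le> ?a" "cmod (DD \<phi> p) \<le> ?b" for x p
    unfolding *(2) by (rule cmod_trig_le, rule cmod_DD_trig_le)
  ultimately show ?thesis
    by (intro that[of "?a + ?b"]) (auto intro: order_trans[of _ ?a] order_trans[of _ ?b])
qed

lemma is_trig_measurable: "is_trig \<phi> \<Longrightarrow> \<phi> \<in> borel_measurable circle"
  by (auto simp: is_trig_def intro!: borel_measurable_circle)

lemma torus_integral_swap:
  fixes f :: "real \<times> real \<Rightarrow> 'a::{banach, second_countable_topology}"
  assumes "f \<in> borel_measurable torus"
  shows "(LINT p|torus. f (snd p, fst p)) = (LINT p|torus. f p)"
  using circle2.integral_product_swap[OF assms] by (simp add: case_prod_unfold)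

lemma integrable_torus_swap:
  fixes f :: "real \<times> real \<Rightarrow> 'a::{banach, second_countable_topology}"
  assumes "integrable torus f"
  shows "integrable torus (\<lambda>p. f (snd p, fst p))"
  using circle2.integrable_product_swap[OF assms] by (simp add: case_prod_unfold)

lemma DD_mult: "DD (\<lambda>x. v x * w x) p = v (fst p) * DD w p + w (snd p) * DD v p"
  by (simp add: DD_def add_divide_distrib[symmetric] algebra_simps)

lemma DD_swap: "DD w (snd p, fst p) = - DD w p"
  by (simp add: DD_def circle_dist_commute minus_divide_left)

lemma circle_dist_DD_le: "circle_dist (fst p) (snd p) * cmod (DD w p) \<le> cmod (w (fst p)) + cmod (w (snd p))"
  by (cases "circle_dist (fst p) (snd p) = 0") (auto simp: DD_def norm_divide norm_triangle_ineq4)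

lemma sq_integrable_torus_snd:
  assumes "sq_integrable circle w"
  shows "sq_integrable torus (\<lambda>p. w (snd p))" "(L2_norm torus (\<lambda>p. w (snd p)))\<^sup>2 = 2 * pi * (L2_norm circle w)\<^sup>2"
    "sq_integrable torus (\<lambda>p. w (fst p))" "(L2_norm torus (\<lambda>p. w (fst p)))\<^sup>2 = 2 * pi * (L2_norm circle w)\<^sup>2"
proof -
  have m: "w \<in> borel_measurable circle" and i: "integrable circle (\<lambda>x. (cmod (w x))\<^sup>2)"
    using assms by (auto simp: sq_integrable_def)
  have mf: "(\<lambda>p. w (fst p)) \<in> borel_measurable torus" by (rule measurable_torus_fst[OF m])
  have nn: "(\<integral>\<^sup>+p. ennreal ((cmod (w (fst p)))\<^sup>2) \<partial>torus) = ennreal (2 * pi * (L2_norm circle w)\<^sup>2)"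
  proof -
    have "(\<integral>\<^sup>+p. ennreal ((cmod (w (fst p)))\<^sup>2) \<partial>torus) = (\<integral>\<^sup>+x. \<integral>\<^sup>+y. ennreal ((cmod (w x))\<^sup>2) \<partial>circle \<partial>circle)"
      by (subst circle.nn_integral_fst[symmetric]) (use mf in auto)
    also have "\<dots> = (\<integral>\<^sup>+x. ennreal ((cmod (w x))\<^sup>2) * ennreal (2 * pi) \<partial>circle)"
      by (simp only: nn_integral_const emeasure_circle)
    also have "\<dots> = ennreal ((L2_norm circle w)\<^sup>2) * ennreal (2 * pi)"
      by (subst nn_integral_multc) (use m nn_integral_L2_norm[OF assms] in auto)
    finally show ?thesis by (simp add: ennreal_mult[symmetric] mult.commute)
  qed
  have if': "integrable torus (\<lambda>p. (cmod (w (fst p)))\<^sup>2)"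
    by (rule integrableI_bounded) (use mf nn in auto)
  show f: "sq_integrable torus (\<lambda>p. w (fst p))" using if' mf by (simp add: sq_integrable_def)
  show fn: "(L2_norm torus (\<lambda>p. w (fst p)))\<^sup>2 = 2 * pi * (L2_norm circle w)\<^sup>2"
    using nn unfolding nn_integral_L2_norm[OF f] by (subst (asm) ennreal_inj) auto
  show "sq_integrable torus (\<lambda>p. w (snd p))"
    using integrable_torus_swap[OF if'] measurable_torus_snd[OF m] by (simp add: sq_integrable_def)
  have "(LINT p|torus. (cmod (w (snd p)))\<^sup>2) = (LINT p|torus. (cmod (w (fst p)))\<^sup>2)"
    using torus_integral_swap[OF borel_measurable_integrable[OF if']] by simp
  then show "(L2_norm torus (\<lambda>p. w (snd p)))\<^sup>2 = 2 * pi * (L2_norm circle w)\<^sup>2"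
    using fn by (simp add: L2_norm_power2)
qed

text \<open>Multiplication by a bounded Lipschitz function is bounded in the energy norm; one
  \<open>B\<close> serves for both constants. The explicit bound is applied to the error of an
  approximation of \<open>u\<close>.\<close>

lemma sq_integrable_DD_mult_trig:
  assumes w: "sq_integrable circle w" "sq_integrable torus (DD w)"
    and B: "0 \<le> B" "\<And>x. cmod (\<psi> x) \<le> B" "\<And>p. cmod (DD \<psi> p) \<le> B" and \<psi>: "\<psi> \<in> borel_measurable circle"
  shows "sq_integrable torus (DD (\<lambda>x. w x * \<psi> x))"
    and "(L2_norm torus (DD (\<lambda>x. w x * \<psi> x)))\<^sup>2 \<le> 2 * B\<^sup>2 * (2 * pi * (L2_norm circle w)\<^sup>2 + (L2_norm torus (DD w))\<^sup>2)"
proof -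
  have eq: "DD (\<lambda>x. w x * \<psi> x) = (\<lambda>p. DD \<psi> p * w (fst p) + \<psi> (snd p) * DD w p)"
    by (rule ext, unfold DD_mult) (simp add: mult.commute)
  note w1 = sq_integrable_torus_snd(3)[OF w(1)]
  have s1: "sq_integrable torus (\<lambda>p. DD \<psi> p * w (fst p))"
    by (rule sq_integrable_mult_bounded[OF w1 borel_measurable_DD[OF \<psi>] B(3)])
  have s2: "sq_integrable torus (\<lambda>p. \<psi> (snd p) * DD w p)"
    by (rule sq_integrable_mult_bounded[OF w(2) measurable_torus_snd[OF \<psi>] B(2)])
  show "sq_integrable torus (DD (\<lambda>x. w x * \<psi> x))" unfolding eq by (rule sq_integrable_add[OF s1 s2])
  have "L2_norm torus (\<lambda>p. DD \<psi> p * w (fst p)) \<le> L2_norm torus (\<lambda>p. of_real B * w (fst p))"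
    by (rule L2_norm_mono[OF s1 sq_integrable_cmult[OF w1]]) (use B in \<open>auto simp: norm_mult intro: mult_right_mono\<close>)
  then have n1: "(L2_norm torus (\<lambda>p. DD \<psi> p * w (fst p)))\<^sup>2 \<le> (L2_norm torus (\<lambda>p. of_real B * w (fst p)))\<^sup>2"
    by (intro power_mono) auto
  have "L2_norm torus (\<lambda>p. \<psi> (snd p) * DD w p) \<le> L2_norm torus (\<lambda>p. of_real B * DD w p)"
    by (rule L2_norm_mono[OF s2 sq_integrable_cmult[OF w(2)]]) (use B in \<open>auto simp: norm_mult intro: mult_right_mono\<close>)
  then have n2: "(L2_norm torus (\<lambda>p. \<psi> (snd p) * DD w p))\<^sup>2 \<le> (L2_norm torus (\<lambda>p. of_real B * DD w p))\<^sup>2"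
    by (intro power_mono) auto
  have sc: "(L2_norm torus (\<lambda>p. of_real B * g p))\<^sup>2 = B\<^sup>2 * (L2_norm torus g)\<^sup>2" for g
    by (simp add: L2_norm_power2 norm_mult power_mult_distrib)
  show "(L2_norm torus (DD (\<lambda>x. w x * \<psi> x)))\<^sup>2 \<le> 2 * B\<^sup>2 * (2 * pi * (L2_norm circle w)\<^sup>2 + (L2_norm torus (DD w))\<^sup>2)"
    unfolding eq using L2_norm_add_power2[OF s1 s2] n1 n2
    unfolding sc sq_integrable_torus_snd(4)[OF w(1)] by (simp add: algebra_simps)
qed

text \<open>A single time slice, with \<open>f\<close> in the role of minus the time derivative. The
  constraint holds at every point, which allows pointwise algebra; a slice is changed on a null set
  to achieve this. The equation is stated through coefficients because everything before is about
  coefficients.\<close>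

locale perturbed_half_harmonic =
  fixes u f :: "real \<Rightarrow> real ^ 'n"
  assumes u_measurable: "u \<in> borel_measurable circle"
    and u_unit: "\<And>x. norm (u x) = 1"
    and f_sq_integrable: "\<And>j. sq_integrable circle (\<lambda>x. of_real (f x $ j))"
    and energy: "\<And>j. (\<lambda>k. \<bar>of_int k\<bar> * (cmod (fcoeff (\<lambda>x. of_real (u x $ j)) k))\<^sup>2) summable_on UNIV"
    and equation: "\<And>j k. of_real \<bar>of_int k\<bar> * fcoeff (\<lambda>x. of_real (u x $ j)) k
      = fcoeff (\<lambda>x. of_real (half_gradient_sq u x) * of_real (u x $ j)) k + fcoeff (\<lambda>x. of_real (f x $ j)) k"
begin

definition U :: "'n \<Rightarrow> real \<Rightarrow> complex" where "U j x = of_real (u x $ j)"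
definition F :: "'n \<Rightarrow> real \<Rightarrow> complex" where "F j x = of_real (f x $ j)"
definition G :: "real \<Rightarrow> complex" where "G x = of_real (half_gradient_sq u x)"
definition e :: "real \<times> real \<Rightarrow> real" where
  "e p = (norm (u (fst p) - u (snd p)))\<^sup>2 / (circle_dist (fst p) (snd p))\<^sup>2"
text \<open>The sum over components, rather than the Euclidean length, dominates every
  \<open>W i j\<close> with constant 1.\<close>

definition H :: "real \<times> real \<Rightarrow> real" where "H p = (\<Sum>j\<in>UNIV. cmod (DD (U j) p))"

text \<open>The antisymmetric potential of the equation, divided by the distance.\<close>

definition W :: "'n \<Rightarrow> 'n \<Rightarrow> real \<times> real \<Rightarrow> complex" where
  "W i j p = U i (fst p) * DD (U j) p - U j (fst p) * DD (U i) p"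

text \<open>Integrand of the bilinear form of the operator. For \<open>v = U j\<close>, summing the
  first term over \<open>j\<close> yields the product of the averages of \<open>U i\<close> and
  \<open>\<phi>\<close>, where the equation has the average of their product. The second term is the
  difference, by (ac + bd)/2 = (a + b)(c + d)/4 + (a - b)(c - d)/4.\<close>

definition A :: "'n \<Rightarrow> 'n \<Rightarrow> (real \<Rightarrow> complex) \<Rightarrow> (real \<Rightarrow> complex) \<Rightarrow> real \<times> real \<Rightarrow> complex" where
  "A i j v \<phi> p = W i j p * DD v p * ((\<phi> (fst p) + \<phi> (snd p)) / 2)
     + (if i = j then of_real ((norm (u (fst p) - u (snd p)))\<^sup>2) * DD v p * DD \<phi> p / 4 else 0)"

lemma F_sq: "sq_integrable circle (F j)"
  using f_sq_integrable[of j] by (simp add: F_def[abs_def])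

lemma U_measurable: "U j \<in> borel_measurable circle"
  unfolding U_def[abs_def]
  by (rule measurable_compose[OF u_measurable]) (intro borel_measurable_continuous_onI continuous_intros)

lemma cmod_U_le: "cmod (U j x) \<le> 1"
  using component_le_norm_cart[of "u x" j] u_unit[of x] by (simp add: U_def)

lemma U_sq: "sq_integrable circle (U j)"
  by (rule circle.sq_integrable_bounded[OF U_measurable cmod_U_le])

lemma U_energy: "(\<lambda>k. \<bar>of_int k\<bar> * (cmod (fcoeff (U j) k))\<^sup>2) summable_on UNIV"
  using energy[of j] by (simp add: U_def[abs_def])

lemma U_equation: "of_real \<bar>of_int k\<bar> * fcoeff (U j) k = fcoeff (\<lambda>x. G x * U j x) k + fcoeff (F j) k"
  using equation[of k j] by (simp add: U_def[abs_def] F_def[abs_def] G_def)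

lemma DD_U_sq: "sq_integrable torus (DD (U j))"
  by (rule Gagliardo_le(1)[OF U_sq U_energy])

lemma e_eq: "e p = (\<Sum>j\<in>UNIV. (cmod (DD (U j) p))\<^sup>2)"
proof -
  have "(norm (u (fst p) - u (snd p)))\<^sup>2 = (\<Sum>j\<in>UNIV. (u (fst p) $ j - u (snd p) $ j)\<^sup>2)"
    unfolding norm_vec_def L2_set_def by (simp add: sum_nonneg)
  moreover have "(cmod (DD (U j) p))\<^sup>2 = (u (fst p) $ j - u (snd p) $ j)\<^sup>2 / (circle_dist (fst p) (snd p))\<^sup>2" for j
    by (simp add: DD_def U_def norm_divide power_divide flip: of_real_diff)
  ultimately show ?thesis by (simp add: e_def sum_divide_distrib)
qed

lemma e_nonneg [simp]: "0 \<le> e p" by (simp add: e_def)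

lemma e_integrable: "integrable torus e"
proof -
  have "integrable torus (\<lambda>p. \<Sum>j\<in>UNIV. (cmod (DD (U j) p))\<^sup>2)"
    using DD_U_sq by (intro Bochner_Integration.integrable_sum) (simp add: sq_integrable_def)
  then show ?thesis by (simp add: e_eq[abs_def])
qed

lemma half_gradient_sq_eq: "half_gradient_sq u x = (LINT y|circle. e (x, y)) / (2 * pi)"
  by (simp add: half_gradient_sq_def e_def)

lemma G_integrable: "integrable circle G"
proof -
  have "integrable circle (\<lambda>x. LINT y|circle. e (x, y))" by (rule circle2.integrable_fst'[OF e_integrable])
  then show ?thesis unfolding G_def[abs_def] half_gradient_sq_eq by simp
qed

lemma G_mult_integrable:
  assumes "\<eta> \<in> borel_measurable circle" "\<And>x. cmod (\<eta> x) \<le> B"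
  shows "integrable circle (\<lambda>x. G x * \<eta> x)"
proof (rule Bochner_Integration.integrable_bound)
  show "integrable circle (\<lambda>x. of_real B * G x)" using G_integrable by simp
  show "(\<lambda>x. G x * \<eta> x) \<in> borel_measurable circle" using borel_measurable_integrable[OF G_integrable] assms by simp
  show "AE x in circle. norm (G x * \<eta> x) \<le> norm (of_real B * G x)"
    using assms(2) norm_ge_zero order_trans[OF norm_ge_zero assms(2)]
    by (intro AE_I2) (auto simp: norm_mult mult.commute[of "cmod (G _)"] intro!: mult_right_mono)
qed

lemma integral_G_mult:
  assumes "\<eta> \<in> borel_measurable circle" "\<And>x. cmod (\<eta> x) \<le> B"
  shows "integrable torus (\<lambda>p. of_real (e p) * \<eta> (fst p))"
    and "2 * pi * (LINT x|circle. G x * \<eta> x) = (LINT p|torus. of_real (e p) * \<eta> (fst p))"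
proof -
  show i: "integrable torus (\<lambda>p. of_real (e p) * \<eta> (fst p))"
  proof (rule Bochner_Integration.integrable_bound)
    show "integrable torus (\<lambda>p. B * e p)" using e_integrable by simp
    show "(\<lambda>p. complex_of_real (e p) * \<eta> (fst p)) \<in> borel_measurable torus"
      using borel_measurable_integrable[OF e_integrable] measurable_torus_fst[OF assms(1)] by simp
    show "AE p in torus. norm (complex_of_real (e p) * \<eta> (fst p)) \<le> norm (B * e p)"
      using assms(2) order_trans[OF norm_ge_zero assms(2)]
      by (intro AE_I2) (auto simp: norm_mult abs_mult mult.commute[of "e _" "cmod _"] intro!: mult_right_mono)
  qed
  have "(LINT p|torus. of_real (e p) * \<eta> (fst p)) = (LINT x|circle. LINT y|circle. of_real (e (x, y)) * \<eta> x)"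
    using circle2.integral_fst'[OF i] by simp
  also have "\<dots> = (LINT x|circle. of_real (2 * pi) * (G x * \<eta> x))"
    by (intro Bochner_Integration.integral_cong) (auto simp: G_def half_gradient_sq_eq)
  finally show "2 * pi * (LINT x|circle. G x * \<eta> x) = (LINT p|torus. of_real (e p) * \<eta> (fst p))"
    by simp
qed

lemma equation_trig:
  assumes "is_trig \<phi>"
  shows "(LINT p|torus. DD (U i) p * DD \<phi> p)
    = 2 * pi * (LINT x|circle. G x * (U i x * \<phi> x)) + 2 * pi * (LINT x|circle. F i x * \<phi> x)"
proof -
  obtain S c where *: "finite S" "\<phi> = trig S c" using assms by (auto simp: is_trig_def)
  have GU: "integrable circle (\<lambda>x. G x * U i x)" by (rule G_mult_integrable[OF U_measurable cmod_U_le])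
  have "(LINT p|torus. DD (U i) p * DD \<phi> p) = (LINT p|torus. (\<Sum>k\<in>S. c k * (DD (U i) p * DD (\<lambda>x. cis (of_int k * x)) p)))"
    unfolding * DD_trig by (simp add: sum_distrib_left mult_ac)
  also have "\<dots> = (\<Sum>k\<in>S. c k * (LINT p|torus. DD (U i) p * DD (\<lambda>x. cis (of_int k * x)) p))"
    by (subst Bochner_Integration.integral_sum)
       (auto intro!: integrable_mult_right sq_integrable_mult DD_U_sq)
  also have "\<dots> = (\<Sum>k\<in>S. c k * ((2 * pi)\<^sup>2 * (of_real \<bar>of_int (- k)\<bar> * fcoeff (U i) (- k))))"
    unfolding integral_DD_mult_DD_cis[OF U_sq U_energy] by (simp add: mult_ac)
  also have "\<dots> = 2 * pi * (\<Sum>k\<in>S. 2 * pi * c k * fcoeff (\<lambda>x. G x * U i x) (- k)) + 2 * pi * (\<Sum>k\<in>S. 2 * pi * c k * fcoeff (F i) (- k))"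
    unfolding U_equation by (simp add: sum_distrib_left sum.distrib[symmetric] power2_eq_square algebra_simps)
  also have "\<dots> = 2 * pi * (LINT x|circle. (G x * U i x) * \<phi> x) + 2 * pi * (LINT x|circle. F i x * \<phi> x)"
    unfolding *(2) integral_mult_trig[OF GU] integral_mult_trig[OF circle.sq_integrable_imp_integrable[OF F_sq]] ..
  finally show ?thesis by (simp add: mult.assoc)
qed

text \<open>Moving the undifferenced factors from \<open>x\<close> to \<open>y\<close> changes the
  expression by \<delta>u_i \<delta>u_j - \<delta>u_j \<delta>u_i = 0.\<close>

lemma W_eq_snd: "W i j p = U i (snd p) * DD (U j) p - U j (snd p) * DD (U i) p"
proof -
  have "U i (fst p) * (U j (fst p) - U j (snd p)) - U j (fst p) * (U i (fst p) - U i (snd p))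
    = U i (snd p) * (U j (fst p) - U j (snd p)) - U j (snd p) * (U i (fst p) - U i (snd p))"
    by (simp add: algebra_simps)
  then show ?thesis by (simp add: W_def DD_def diff_divide_distrib[symmetric] del: mult.commute)
qed

text \<open>Here the constraint enters the algebra: for unit vectors the inner product of u(x) with
  \<delta>u is |\<delta>u|^2 / 2, so the sum over \<open>j\<close> is |\<delta>u|^2 times u_i(x) -
  \<delta>u_i / 2, which is the average of u_i.\<close>

lemma sum_W_DD_U: "(\<Sum>j\<in>UNIV. W i j p * DD (U j) p) = of_real (e p) * (U i (fst p) + U i (snd p)) / 2"
proof -
  let ?x = "fst p" and ?y = "snd p" and ?d = "circle_dist (fst p) (snd p)"
  have n: "(norm (u x))\<^sup>2 = (\<Sum>j\<in>UNIV. (u x $ j)\<^sup>2)" for x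
    unfolding norm_vec_def L2_set_def by (simp add: sum_nonneg)
  have real: "(\<Sum>j\<in>UNIV. (u ?x $ i * (u ?x $ j - u ?y $ j) - u ?x $ j * (u ?x $ i - u ?y $ i)) * (u ?x $ j - u ?y $ j))
    = (\<Sum>j\<in>UNIV. (u ?x $ j - u ?y $ j)\<^sup>2) * (u ?x $ i + u ?y $ i) / 2"
  proof -
    let ?s = "\<Sum>j\<in>UNIV. u ?x $ j * u ?y $ j"
    have 1: "(\<Sum>j\<in>UNIV. u ?x $ j * u ?x $ j) = 1" "(\<Sum>j\<in>UNIV. u ?y $ j * u ?y $ j) = 1"
      using n[of ?x] n[of ?y] u_unit by (simp_all add: power2_eq_square)
    have sq: "(\<Sum>j\<in>UNIV. (u ?x $ j - u ?y $ j)\<^sup>2) = 2 - 2 * ?s"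
    proof -
      have "(\<Sum>j\<in>UNIV. (u ?x $ j - u ?y $ j)\<^sup>2)
        = (\<Sum>j\<in>UNIV. u ?x $ j * u ?x $ j) + (\<Sum>j\<in>UNIV. u ?y $ j * u ?y $ j) - 2 * ?s"
        by (simp add: power2_eq_square algebra_simps sum.distrib sum_subtractf sum_distrib_left)
      then show ?thesis using 1 by simp
    qed
    have "(\<Sum>j\<in>UNIV. (u ?x $ i * (u ?x $ j - u ?y $ j) - u ?x $ j * (u ?x $ i - u ?y $ i)) * (u ?x $ j - u ?y $ j))
       = (\<Sum>j\<in>UNIV. u ?x $ i * (u ?x $ j - u ?y $ j)\<^sup>2 - (u ?x $ i - u ?y $ i) * (u ?x $ j * u ?x $ j - u ?x $ j * u ?y $ j))"
      by (intro sum.cong) (auto simp: power2_eq_square algebra_simps)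
    also have "\<dots> = u ?x $ i * (2 - 2 * ?s) - (u ?x $ i - u ?y $ i) * (1 - ?s)"
      by (simp only: sum_subtractf sum_distrib_left[symmetric] sq 1)
    finally show ?thesis unfolding sq by (simp add: algebra_simps)
  qed
  have "(\<Sum>j\<in>UNIV. W i j p * DD (U j) p)
    = complex_of_real (\<Sum>j\<in>UNIV. (u ?x $ i * (u ?x $ j - u ?y $ j) - u ?x $ j * (u ?x $ i - u ?y $ i)) * (u ?x $ j - u ?y $ j)) / of_real (?d\<^sup>2)"
    unfolding of_real_sum sum_divide_distrib
    by (intro sum.cong) (auto simp: W_def DD_def U_def power2_eq_square diff_divide_distrib[symmetric])
  also have "\<dots> = of_real (e p) * (U i ?x + U i ?y) / 2"
  proof -
    have "(norm (u ?x - u ?y))\<^sup>2 = (\<Sum>j\<in>UNIV. (u ?x $ j - u ?y $ j)\<^sup>2)"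
      unfolding norm_vec_def L2_set_def by (simp add: sum_nonneg)
    then show ?thesis unfolding real e_def by (simp add: U_def)
  qed
  finally show ?thesis .
qed

lemma W_measurable: "W i j \<in> borel_measurable torus"
  unfolding W_def[abs_def]
  by (intro borel_measurable_diff borel_measurable_times measurable_torus_fst[OF U_measurable] borel_measurable_DD[OF U_measurable])

text \<open>\<open>W\<close> vanishes for \<open>i = j\<close>; otherwise its two terms are bounded
  by two different summands of \<open>H\<close>.\<close>

lemma cmod_W_le: "cmod (W i j p) \<le> H p"
proof (cases "i = j")
  case True
  then show ?thesis by (auto simp: W_def H_def intro: sum_nonneg)
next
  case False
  have "cmod (W i j p) \<le> cmod (U i (fst p) * DD (U j) p) + cmod (U j (fst p) * DD (U i) p)"
    unfolding W_def by (rule norm_triangle_ineq4)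
  also have "\<dots> \<le> cmod (DD (U j) p) + cmod (DD (U i) p)"
    unfolding norm_mult by (intro add_mono mult_left_le_one_le cmod_U_le) auto
  also have "\<dots> = (\<Sum>l\<in>{i, j}. cmod (DD (U l) p))" using False by simp
  also have "\<dots> \<le> H p" unfolding H_def by (rule sum_mono2) auto
  finally show ?thesis .
qed

lemma H_nonneg [simp]: "0 \<le> H p" by (auto simp: H_def intro: sum_nonneg)

lemma H_sq: "sq_integrable torus (\<lambda>p. of_real (H p))"
  unfolding H_def of_real_sum by (intro sq_integrable_sum sq_integrable_cmod DD_U_sq)

lemma W_sq: "sq_integrable torus (W i j)"
  by (rule sq_integrable_bound[OF W_measurable H_sq, where B = 1]) (use cmod_W_le in auto)

text \<open>One factor |\<delta>u| is at most 2, which leaves a single difference quotient and a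
  factor of the distance. That factor later cancels the denominator of
  \<open>DD \<phi>\<close>.\<close>

lemma norm_diff_power2_le:
  assumes "circle_dist (fst p) (snd p) \<noteq> 0"
  shows "(norm (u (fst p) - u (snd p)))\<^sup>2 \<le> 2 * (H p * circle_dist (fst p) (snd p))"
proof -
  let ?d = "circle_dist (fst p) (snd p)"
  have "norm (u (fst p) - u (snd p)) \<le> (\<Sum>j\<in>UNIV. \<bar>(u (fst p) - u (snd p)) $ j\<bar>)" by (rule norm_le_l1_cart)
  also have "\<dots> = H p * ?d"
    unfolding H_def sum_distrib_right using assms
    by (intro sum.cong) (auto simp: DD_def U_def norm_divide simp flip: of_real_diff)
  finally have le: "norm (u (fst p) - u (snd p)) \<le> H p * ?d" .
  have "norm (u (fst p) - u (snd p)) \<le> 2"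
    using norm_triangle_ineq4[of "u (fst p)" "u (snd p)"] u_unit by simp
  then have "(norm (u (fst p) - u (snd p)))\<^sup>2 \<le> 2 * norm (u (fst p) - u (snd p))"
    unfolding power2_eq_square by (intro mult_right_mono) auto
  with le show ?thesis by linarith
qed

end

text \<open>The series of |k|^(-3/2), bounded by telescoping against 3 - 2 / \<open>sqrt n\<close>
  on each side of 0.\<close>

lemma sum_inverse_root4_power6_le:
  assumes "finite T" "0 \<notin> T"
  shows "(\<Sum>k\<in>T. (1 / root4 k ^ 3)\<^sup>2) \<le> 6"
proof -
  have r: "(1 / root4 k ^ 3)\<^sup>2 = 1 / (\<bar>of_int k\<bar> * sqrt \<bar>of_int k\<bar>)" for k
  proof -
    have "(root4 k ^ 3)\<^sup>2 = root4 k ^ 4 * (root4 k)\<^sup>2" by (simp flip: power_mult power_add)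
    then show ?thesis by (simp add: power_divide root4_power4 root4_power2)
  qed
  have tele: "(\<Sum>k=1..n. 1 / (real k * sqrt (real k))) \<le> 3 - 2 / sqrt (real n)" if "1 \<le> n" for n
    using that
  proof (induction n rule: dec_induct)
    case (step n)
    define s where "s = sqrt (real n)"
    define t where "t = sqrt (real (Suc n))"
    have st: "0 < s" "0 < t" "t\<^sup>2 = s\<^sup>2 + 1" "s \<le> t" using step by (auto simp: s_def t_def)
    have "(t - s) * (t + s) = 1" using st(3) by (simp add: algebra_simps power2_eq_square)
    then have "1 \<le> (t - s) * (2 * t)" using st mult_left_mono[of "t + s" "2 * t" "t - s"] by simp
    then have "t * 1 \<le> t * ((t - s) * (2 * t))" using st by (intro mult_left_mono) auto
    then have "s \<le> t * ((t - s) * (2 * t))" using st(4) by linarith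
    then have "s * t \<le> t * ((t - s) * (2 * t)) * t" using st(2) by (intro mult_right_mono) auto
    then have "1 / (t\<^sup>2 * t) \<le> 2 / s - 2 / t"
      using st(1,2) by (simp add: divide_simps) (simp add: power2_eq_square algebra_simps)
    then have "1 / (real (Suc n) * sqrt (real (Suc n))) \<le> 2 / sqrt (real n) - 2 / sqrt (real (Suc n))"
      by (simp add: s_def t_def)
    then show ?case using step by simp
  qed simp
  let ?f = "\<lambda>k::int. 1 / (\<bar>real_of_int k\<bar> * sqrt \<bar>real_of_int k\<bar>)"
  obtain n where n: "T \<subseteq> freq_box n" using finite_subset_box[OF assms(1)] by blast
  \<comment> \<open>The successor guarantees \<open>1 <= m\<close>, as \<open>tele\<close>
    demands.\<close>
  define m where "m = Suc n"
  have "T \<subseteq> int ` {1..m} \<union> (\<lambda>k. - int k) ` {1..m}"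
  proof
    fix k assume k: "k \<in> T"
    then have "k \<noteq> 0" "k \<in> freq_box n" using n assms(2) by auto
    then have b: "k \<noteq> 0" "\<bar>k\<bar> \<le> int n" by auto
    then have "k = int (nat k) \<and> nat k \<in> {1..m} \<or> k = - int (nat (- k)) \<and> nat (- k) \<in> {1..m}"
      unfolding m_def by (simp; arith)
    then show "k \<in> int ` {1..m} \<union> (\<lambda>k. - int k) ` {1..m}" by blast
  qed
  then have "(\<Sum>k\<in>T. ?f k) \<le> (\<Sum>k\<in>int ` {1..m} \<union> (\<lambda>k. - int k) ` {1..m}. ?f k)"
    by (intro sum_mono2) auto
  also have "\<dots> = (\<Sum>k\<in>int ` {1..m}. ?f k) + (\<Sum>k\<in>(\<lambda>k. - int k) ` {1..m}. ?f k)"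
    by (subst sum.union_disjoint) auto
  also have "(\<Sum>k\<in>int ` {1..m}. ?f k) = (\<Sum>k=1..m. 1 / (real k * sqrt (real k)))"
    by (subst sum.reindex) (auto simp: inj_on_def)
  also have "(\<Sum>k\<in>(\<lambda>k. - int k) ` {1..m}. ?f k) = (\<Sum>k=1..m. 1 / (real k * sqrt (real k)))"
    by (subst sum.reindex) (auto simp: inj_on_def)
  also have "(\<Sum>k=1..m. 1 / (real k * sqrt (real k))) \<le> 3"
    by (rule order_trans[OF tele]) (auto simp: m_def)
  finally show ?thesis unfolding r by simp
qed

text \<open>Homogeneous H^(1/4) and, below, H^(3/4) norms on the level of coefficients, restricted
  to a set of frequencies.\<close>

definition norm14 :: "int set \<Rightarrow> (int \<Rightarrow> complex) \<Rightarrow> real" where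
  "norm14 S c = L2_set (\<lambda>k. root4 k * cmod (c k)) S"
definition norm34 :: "int set \<Rightarrow> (int \<Rightarrow> complex) \<Rightarrow> real" where
  "norm34 S c = L2_set (\<lambda>k. root4 k ^ 3 * cmod (c k)) S"

lemma norm14_nonneg [simp]: "0 \<le> norm14 S c" and norm34_nonneg [simp]: "0 \<le> norm34 S c"
  by (auto simp: norm14_def norm34_def)

lemma norm14_power2: "(norm14 S c)\<^sup>2 = (\<Sum>k\<in>S. (root4 k * cmod (c k))\<^sup>2)"
  and norm34_power2: "(norm34 S c)\<^sup>2 = (\<Sum>k\<in>S. (root4 k ^ 3 * cmod (c k))\<^sup>2)"
  by (auto simp: norm14_def norm34_def L2_set_def sum_nonneg)

text \<open>Since 3/4 > 1/2, an H^(3/4) function without constant term has an absolutely convergent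
  Fourier series; this is the embedding into L^infinity.\<close>

lemma sum_cmod_le_norm34:
  assumes "finite T" "0 \<notin> T"
  shows "(\<Sum>k\<in>T. cmod (b k)) \<le> sqrt 6 * norm34 T b"
proof -
  have "(\<Sum>k\<in>T. cmod (b k)) = (\<Sum>k\<in>T. \<bar>1 / root4 k ^ 3\<bar> * \<bar>root4 k ^ 3 * cmod (b k)\<bar>)"
    using assms by (intro sum.cong) auto
  also have "\<dots> \<le> L2_set (\<lambda>k. 1 / root4 k ^ 3) T * L2_set (\<lambda>k. root4 k ^ 3 * cmod (b k)) T"
    by (rule L2_set_mult_ineq)
  also have "L2_set (\<lambda>k. 1 / root4 k ^ 3) T \<le> sqrt 6"
    unfolding L2_set_def by (intro real_sqrt_le_mono sum_inverse_root4_power6_le assms)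
  finally show ?thesis by (simp add: norm34_def mult_right_mono)
qed

text \<open>On frequencies of size at least \<open>N\<close> the weight |k|^(1/2) is at least
  \<open>sqrt N\<close>. This gain, and its analogue for the energy, is one source of
  smallness.\<close>

lemma sum_cmod_square_le_norm14:
  assumes "\<And>k. k \<in> T \<Longrightarrow> int N \<le> \<bar>k\<bar>" "0 < N"
  shows "(\<Sum>k\<in>T. (cmod (b k))\<^sup>2) \<le> (norm14 T b)\<^sup>2 / sqrt N"
proof -
  have "(\<Sum>k\<in>T. (cmod (b k))\<^sup>2) * sqrt N \<le> (norm14 T b)\<^sup>2"
    unfolding norm14_power2 sum_distrib_right
  proof (rule sum_mono)
    fix k assume "k \<in> T"
    then have "real N \<le> \<bar>of_int k\<bar>" using assms by force
    then have "sqrt N \<le> (root4 k)\<^sup>2" by (simp add: root4_power2)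
    then show "(cmod (b k))\<^sup>2 * sqrt N \<le> (root4 k * cmod (b k))\<^sup>2"
      by (simp add: power_mult_distrib mult.commute mult_right_mono)
  qed
  then show ?thesis using assms(2) by (simp add: field_simps)
qed

lemma sum_energy_le_norm34:
  assumes "\<And>k. k \<in> T \<Longrightarrow> int N \<le> \<bar>k\<bar>" "0 < N"
  shows "(\<Sum>k\<in>T. \<bar>of_int k\<bar> * (cmod (b k))\<^sup>2) \<le> (norm34 T b)\<^sup>2 / sqrt N"
proof -
  have "(\<Sum>k\<in>T. \<bar>of_int k\<bar> * (cmod (b k))\<^sup>2) * sqrt N \<le> (norm34 T b)\<^sup>2"
    unfolding norm34_power2 sum_distrib_right
  proof (rule sum_mono)
    fix k assume "k \<in> T"
    then have "real N \<le> \<bar>of_int k\<bar>" using assms by force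
    then have "sqrt N \<le> (root4 k)\<^sup>2" by (simp add: root4_power2)
    then have "(root4 k ^ 4 * (cmod (b k))\<^sup>2) * sqrt N \<le> (root4 k ^ 4 * (cmod (b k))\<^sup>2) * (root4 k)\<^sup>2"
      by (rule mult_left_mono) simp
    also have "\<dots> = (root4 k ^ 3 * cmod (b k))\<^sup>2"
      by (simp add: power_mult_distrib mult_ac flip: power_mult power_add)
    finally show "\<bar>of_int k\<bar> * (cmod (b k))\<^sup>2 * sqrt N \<le> (root4 k ^ 3 * cmod (b k))\<^sup>2"
      by (simp add: root4_power4)
  qed
  then show ?thesis using assms(2) by (simp add: field_simps)
qed

section \<open>The bilinear form and the equation written with it\<close>

context perturbed_half_harmonic
begin

text \<open>What remains of \<open>A\<close> without \<open>DD v\<close>. It is square integrable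
  for trigonometric \<open>\<phi>\<close>, so limits in \<open>v\<close> are limits in L^2 against a
  fixed function.\<close>

definition M :: "'n \<Rightarrow> 'n \<Rightarrow> (real \<Rightarrow> complex) \<Rightarrow> real \<times> real \<Rightarrow> complex" where
  "M i j \<phi> p = W i j p * ((\<phi> (fst p) + \<phi> (snd p)) / 2)
     + (if i = j then of_real ((norm (u (fst p) - u (snd p)))\<^sup>2) * DD \<phi> p / 4 else 0)"

lemma A_eq_M: "A i j v \<phi> p = DD v p * M i j \<phi> p"
  by (simp add: A_def M_def algebra_simps)

lemma norm_diff_measurable: "(\<lambda>p. complex_of_real ((norm (u (fst p) - u (snd p)))\<^sup>2)) \<in> borel_measurable torus"
proof -
  have [measurable]: "(\<lambda>p. u (fst p)) \<in> borel_measurable torus" "(\<lambda>p. u (snd p)) \<in> borel_measurable torus"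
    using measurable_compose[OF measurable_fst u_measurable] measurable_compose[OF measurable_snd u_measurable] by auto
  show ?thesis by measurable
qed

lemma norm_diff_power2_le_4: "(norm (u (fst p) - u (snd p)))\<^sup>2 \<le> 4"
proof -
  have "norm (u (fst p) - u (snd p)) \<le> 2"
    using norm_triangle_ineq4[of "u (fst p)" "u (snd p)"] u_unit by simp
  then have "(norm (u (fst p) - u (snd p)))\<^sup>2 \<le> 2\<^sup>2" by (rule power_mono) simp
  then show ?thesis by simp
qed

lemma M_sq:
  assumes "is_trig \<phi>" shows "sq_integrable torus (M i j \<phi>)"
proof -
  obtain B where B: "0 \<le> B" "\<And>x. cmod (\<phi> x) \<le> B" "\<And>p. cmod (DD \<phi> p) \<le> B" using is_trig_bounded[OF assms] by blast
  note m = is_trig_measurable[OF assms]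
  have 1: "sq_integrable torus (\<lambda>p. ((\<phi> (fst p) + \<phi> (snd p)) / 2) * W i j p)"
  proof (rule sq_integrable_mult_bounded[OF W_sq])
    show "(\<lambda>p. (\<phi> (fst p) + \<phi> (snd p)) / 2) \<in> borel_measurable torus"
      using measurable_torus_fst[OF m] measurable_torus_snd[OF m] by simp
    show "cmod ((\<phi> (fst p) + \<phi> (snd p)) / 2) \<le> B" for p
      using norm_triangle_ineq[of "\<phi> (fst p)" "\<phi> (snd p)"] B(2)[of "fst p"] B(2)[of "snd p"]
      by (simp add: norm_divide)
  qed
  have 2: "sq_integrable torus (\<lambda>p. of_real ((norm (u (fst p) - u (snd p)))\<^sup>2) * DD \<phi> p / 4)"
  proof (rule torus.sq_integrable_bounded)
    show "(\<lambda>p. of_real ((norm (u (fst p) - u (snd p)))\<^sup>2) * DD \<phi> p / 4) \<in> borel_measurable torus"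
      using norm_diff_measurable borel_measurable_DD[OF m] by simp
    fix p
    have "(norm (u (fst p) - u (snd p)))\<^sup>2 * cmod (DD \<phi> p) \<le> 4 * B"
      using B norm_diff_power2_le_4 by (intro mult_mono) auto
    then show "cmod (of_real ((norm (u (fst p) - u (snd p)))\<^sup>2) * DD \<phi> p / 4) \<le> B"
      by (simp add: norm_mult norm_divide norm_power)
  qed
  show ?thesis
    unfolding M_def[abs_def] by (cases "i = j") (use sq_integrable_add[OF 1 2] 1 in \<open>auto simp: mult.commute\<close>)
qed

lemma A_integrable:
  assumes "is_trig \<phi>" "sq_integrable torus (DD v)" shows "integrable torus (A i j v \<phi>)"
  unfolding A_eq_M[abs_def] by (intro sq_integrable_mult assms M_sq)

lemma e_swap: "e (snd p, fst p) = e p"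
  by (simp add: e_def circle_dist_commute norm_minus_commute)

text \<open>The form is symmetric in the two points; as \<open>e\<close> is too, both halves have
  the same integral, and that is the term with \<open>G\<close>.\<close>

lemma sum_A_U: "(\<Sum>j\<in>UNIV. A i j (U j) \<phi> p)
    = (of_real (e p) * (U i (fst p) * \<phi> (fst p)) + of_real (e p) * (U i (snd p) * \<phi> (snd p))) / 2"
proof -
  let ?d = "circle_dist (fst p) (snd p)"
  have "(\<Sum>j\<in>UNIV. A i j (U j) \<phi> p) = (\<Sum>j\<in>UNIV. W i j p * DD (U j) p) * ((\<phi> (fst p) + \<phi> (snd p)) / 2)
     + of_real ((norm (u (fst p) - u (snd p)))\<^sup>2) * DD (U i) p * DD \<phi> p / 4"
    unfolding A_def sum.distrib sum_distrib_right by simp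
  also have "of_real ((norm (u (fst p) - u (snd p)))\<^sup>2) * DD (U i) p * DD \<phi> p
      = of_real (e p) * ((U i (fst p) - U i (snd p)) * (\<phi> (fst p) - \<phi> (snd p)))"
    by (simp add: DD_def e_def power2_eq_square)
  finally show ?thesis unfolding sum_W_DD_U by (simp add: algebra_simps add_divide_distrib diff_divide_distrib)
qed

lemma equation_A:
  assumes "is_trig \<phi>"
  shows "(LINT p|torus. DD (U i) p * DD \<phi> p)
    = (\<Sum>j\<in>UNIV. LINT p|torus. A i j (U j) \<phi> p) + 2 * pi * (LINT x|circle. F i x * \<phi> x)"
proof -
  obtain B where B: "0 \<le> B" "\<And>x. cmod (\<phi> x) \<le> B" "\<And>p. cmod (DD \<phi> p) \<le> B"
    using is_trig_bounded[OF assms] by blast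
  let ?\<eta> = "\<lambda>x. U i x * \<phi> x"
  have m: "?\<eta> \<in> borel_measurable circle" using U_measurable is_trig_measurable[OF assms] by simp
  have b: "cmod (?\<eta> x) \<le> B" for x
  proof -
    have "cmod (U i x) * cmod (\<phi> x) \<le> 1 * B" using cmod_U_le B by (intro mult_mono) auto
    then show ?thesis by (simp add: norm_mult)
  qed
  note i = integral_G_mult[OF m b]
  have i2: "integrable torus (\<lambda>p. of_real (e p) * ?\<eta> (snd p))"
    using integrable_torus_swap[OF i(1)] by (simp only: e_swap fst_conv snd_conv)
  have sw: "(LINT p|torus. of_real (e p) * ?\<eta> (snd p)) = (LINT p|torus. of_real (e p) * ?\<eta> (fst p))"
    using torus_integral_swap[OF borel_measurable_integrable[OF i(1)]] by (simp only: e_swap fst_conv snd_conv)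
  have "(\<Sum>j\<in>UNIV. LINT p|torus. A i j (U j) \<phi> p) = (LINT p|torus. (\<Sum>j\<in>UNIV. A i j (U j) \<phi> p))"
    by (rule Bochner_Integration.integral_sum[symmetric]) (intro A_integrable assms DD_U_sq)
  also have "\<dots> = ((LINT p|torus. of_real (e p) * ?\<eta> (fst p)) + (LINT p|torus. of_real (e p) * ?\<eta> (snd p))) / 2"
    unfolding sum_A_U integral_divide_zero Bochner_Integration.integral_add[OF i(1) i2] ..
  also have "\<dots> = 2 * pi * (LINT x|circle. G x * ?\<eta> x)" unfolding sw i(2)[symmetric] by simp
  finally show ?thesis using equation_trig[OF assms, of i] by simp
qed

text \<open>The equation may be tested with \<open>u \<psi>\<close>: by Fejer means, which are bounded and converge in the
  energy norm.\<close>

lemma equation_U_mult_trig: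
  assumes \<psi>: "is_trig \<psi>"
  shows "(LINT p|torus. DD (U j) p * DD (\<lambda>x. U i x * \<psi> x) p)
    = 2 * pi * (LINT x|circle. G x * (U j x * (U i x * \<psi> x))) + 2 * pi * (LINT x|circle. F j x * (U i x * \<psi> x))"
proof -
  obtain B where B: "0 \<le> B" "\<And>x. cmod (\<psi> x) \<le> B" "\<And>p. cmod (DD \<psi> p) \<le> B" using is_trig_bounded[OF \<psi>] by blast
  note m = is_trig_measurable[OF \<psi>]
  define w where "w n = fejer_mean n (U i)" for n
  have w_trig: "is_trig (w n)" for n by (simp add: w_def fejer_mean_def)
  have w_sq: "sq_integrable circle (w n)" and Dw_sq: "sq_integrable torus (DD (w n))" for n
    by (simp_all add: w_def fejer_mean_def)
  have w_le: "cmod (w n x) \<le> 1" for n x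
    unfolding w_def by (rule fejer_mean_bounded[OF circle.sq_integrable_imp_integrable[OF U_sq] cmod_U_le])
  have lim0: "(\<lambda>n. L2_norm circle (\<lambda>x. U i x - w n x)) \<longlonglongrightarrow> 0"
    using fejer.approx_tendsto[OF U_sq[of i]] by (simp add: fejer_approx w_def)
  have limD: "(\<lambda>n. L2_norm torus (DD (\<lambda>x. U i x - w n x))) \<longlonglongrightarrow> 0"
    using fejer.DD_approx_tendsto[OF U_sq[of i] U_energy] by (simp add: fejer_approx w_def DD_diff[abs_def])
  have d_sq: "sq_integrable circle (\<lambda>x. U i x - w n x)" for n by (intro sq_integrable_diff U_sq w_sq)
  have dD_sq: "sq_integrable torus (DD (\<lambda>x. U i x - w n x))" for n
    unfolding DD_diff[abs_def] by (intro sq_integrable_diff DD_U_sq Dw_sq)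
  have UD: "sq_integrable torus (DD (\<lambda>x. U i x * \<psi> x))"
    by (rule sq_integrable_DD_mult_trig(1)[OF U_sq DD_U_sq B m])
  have wD: "sq_integrable torus (DD (\<lambda>x. w n x * \<psi> x))" for n
    by (rule sq_integrable_DD_mult_trig(1)[OF w_sq Dw_sq B m])
  have lim1: "(\<lambda>n. LINT p|torus. DD (\<lambda>x. w n x * \<psi> x) p * DD (U j) p) \<longlonglongrightarrow> (LINT p|torus. DD (\<lambda>x. U i x * \<psi> x) p * DD (U j) p)"
  proof (rule L2_tendsto_integral_mult[OF wD UD DD_U_sq])
    have eq: "L2_norm torus (\<lambda>p. DD (\<lambda>x. w n x * \<psi> x) p - DD (\<lambda>x. U i x * \<psi> x) p)
        = L2_norm torus (DD (\<lambda>x. (U i x - w n x) * \<psi> x))" for n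
      unfolding L2_norm_def left_diff_distrib DD_diff by (subst norm_minus_commute) (rule refl)
    let ?b = "\<lambda>n. 2 * B\<^sup>2 * (2 * pi * (L2_norm circle (\<lambda>x. U i x - w n x))\<^sup>2 + (L2_norm torus (DD (\<lambda>x. U i x - w n x)))\<^sup>2)"
    have b0: "?b \<longlonglongrightarrow> 2 * B\<^sup>2 * (2 * pi * 0\<^sup>2 + 0\<^sup>2)" by (intro tendsto_intros lim0 limD)
    show "(\<lambda>n. L2_norm torus (\<lambda>p. DD (\<lambda>x. w n x * \<psi> x) p - DD (\<lambda>x. U i x * \<psi> x) p)) \<longlonglongrightarrow> 0"
      unfolding eq
    proof (rule Lim_null_comparison)
      show "(\<lambda>n. sqrt (?b n)) \<longlonglongrightarrow> 0" using tendsto_real_sqrt[OF b0] by simp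
      show "\<forall>\<^sub>F n in sequentially. norm (L2_norm torus (DD (\<lambda>x. (U i x - w n x) * \<psi> x))) \<le> sqrt (?b n)"
        using sq_integrable_DD_mult_trig(2)[OF d_sq dD_sq B m]
        by (intro always_eventually allI) (simp add: real_le_rsqrt)
    qed
  qed
  have F\<psi>: "sq_integrable circle (\<lambda>x. \<psi> x * F j x)" by (rule sq_integrable_mult_bounded[OF F_sq m B(2)])
  have lim2: "(\<lambda>n. LINT x|circle. w n x * (\<psi> x * F j x)) \<longlonglongrightarrow> (LINT x|circle. U i x * (\<psi> x * F j x))"
  proof (rule L2_tendsto_integral_mult[OF w_sq U_sq F\<psi>])
    show "(\<lambda>n. L2_norm circle (\<lambda>x. w n x - U i x)) \<longlonglongrightarrow> 0"
      using lim0 unfolding L2_norm_def by (subst norm_minus_commute)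
  qed
  have "(\<lambda>n. LINT x|circle. norm (U i x - w n x)) \<longlonglongrightarrow> 0"
  proof (rule Lim_null_comparison)
    show "\<forall>\<^sub>F n in sequentially. norm (LINT x|circle. norm (U i x - w n x)) \<le> sqrt (2 * pi) * L2_norm circle (\<lambda>x. U i x - w n x)"
      using integral_cmod_le_L2_norm[OF d_sq] by simp
    show "(\<lambda>n. sqrt (2 * pi) * L2_norm circle (\<lambda>x. U i x - w n x)) \<longlonglongrightarrow> 0"
      using tendsto_mult[OF tendsto_const[of "sqrt (2 * pi)"] lim0] by simp
  qed
  \<comment> \<open>\<open>G\<close> is only integrable, so its term needs dominated convergence: a
    subsequence converging almost everywhere, together with the bound 1 on Fejer means.\<close>
  then obtain r where r: "strict_mono r" "AE x in circle. (\<lambda>n. U i x - w (r n) x) \<longlonglongrightarrow> 0"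
    using tendsto_L1_AE_subseq[of circle "\<lambda>n x. U i x - w n x"] circle.sq_integrable_imp_integrable[OF d_sq] by auto
  have UU: "(\<lambda>x. U j x * (v x * \<psi> x)) \<in> borel_measurable circle"
      and UUb: "\<And>x. cmod (v x) \<le> 1 \<Longrightarrow> cmod (U j x * (v x * \<psi> x)) \<le> B" if "v \<in> borel_measurable circle" for v
  proof -
    show "(\<lambda>x. U j x * (v x * \<psi> x)) \<in> borel_measurable circle" using that m U_measurable by simp
    fix x assume v: "cmod (v x) \<le> 1"
    have "cmod (U j x) * (cmod (v x) * cmod (\<psi> x)) \<le> 1 * (1 * B)"
      using cmod_U_le B v by (intro mult_mono) auto
    then show "cmod (U j x * (v x * \<psi> x)) \<le> B" by (simp add: norm_mult)
  qed
  have lim3: "(\<lambda>n. LINT x|circle. G x * (U j x * (w (r n) x * \<psi> x))) \<longlonglongrightarrow> (LINT x|circle. G x * (U j x * (U i x * \<psi> x)))"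
  proof (rule integral_dominated_convergence)
    show "integrable circle (\<lambda>x. B * cmod (G x))" using G_integrable by simp
    show "(\<lambda>x. G x * (U j x * (U i x * \<psi> x))) \<in> borel_measurable circle"
      using UU[OF U_measurable] borel_measurable_integrable[OF G_integrable] by simp
    show "(\<lambda>x. G x * (U j x * (w (r n) x * \<psi> x))) \<in> borel_measurable circle" for n
      using UU[OF sq_integrable_measurable[OF w_sq]] borel_measurable_integrable[OF G_integrable] by simp
    show "AE x in circle. (\<lambda>n. G x * (U j x * (w (r n) x * \<psi> x))) \<longlonglongrightarrow> G x * (U j x * (U i x * \<psi> x))"
      using r(2)
    proof eventually_elim
      case (elim x)
      have "(\<lambda>n. U i x - (U i x - w (r n) x)) \<longlonglongrightarrow> U i x - 0" by (intro tendsto_intros elim)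
      then have "(\<lambda>n. w (r n) x) \<longlonglongrightarrow> U i x" by simp
      then show ?case by (intro tendsto_intros)
    qed
    show "AE x in circle. norm (G x * (U j x * (w (r n) x * \<psi> x))) \<le> B * cmod (G x)" for n
      using UUb[OF sq_integrable_measurable[OF w_sq] w_le]
      by (intro AE_I2) (simp add: norm_mult mult.commute[of "cmod (G _)"] mult_right_mono)
  qed
  have eq: "(LINT p|torus. DD (\<lambda>x. w n x * \<psi> x) p * DD (U j) p)
    = 2 * pi * (LINT x|circle. G x * (U j x * (w n x * \<psi> x))) + 2 * pi * (LINT x|circle. w n x * (\<psi> x * F j x))" for n
    using equation_trig[OF is_trig_mult[OF w_trig \<psi>], of j n] by (simp add: mult_ac)
  have "(\<lambda>n. 2 * pi * (LINT x|circle. G x * (U j x * (w (r n) x * \<psi> x))) + 2 * pi * (LINT x|circle. w (r n) x * (\<psi> x * F j x)))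
    \<longlonglongrightarrow> 2 * pi * (LINT x|circle. G x * (U j x * (U i x * \<psi> x))) + 2 * pi * (LINT x|circle. U i x * (\<psi> x * F j x))"
    by (intro tendsto_intros lim3 LIMSEQ_subseq_LIMSEQ[OF lim2 r(1), unfolded o_def])
  moreover have "(\<lambda>n. LINT p|torus. DD (\<lambda>x. w (r n) x * \<psi> x) p * DD (U j) p) \<longlonglongrightarrow> (LINT p|torus. DD (\<lambda>x. U i x * \<psi> x) p * DD (U j) p)"
    by (rule LIMSEQ_subseq_LIMSEQ[OF lim1 r(1), unfolded o_def])
  ultimately have "(LINT p|torus. DD (\<lambda>x. U i x * \<psi> x) p * DD (U j) p)
     = 2 * pi * (LINT x|circle. G x * (U j x * (U i x * \<psi> x))) + 2 * pi * (LINT x|circle. U i x * (\<psi> x * F j x))"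
    unfolding eq using LIMSEQ_unique by blast
  then show ?thesis by (simp add: mult_ac)
qed

text \<open>The divergence of the potential. Testing equation \<open>j\<close> with
  \<open>U i * \<psi>\<close> and equation \<open>i\<close> with \<open>U j * \<psi>\<close> and
  subtracting, the terms with \<open>G\<close> cancel by symmetry, as do the products of two
  difference quotients of \<open>u\<close>; only \<open>F\<close> survives.\<close>

lemma integral_W_DD:
  assumes \<psi>: "is_trig \<psi>"
  shows "(LINT p|torus. W i j p * DD \<psi> p) = 2 * pi * (LINT x|circle. (F j x * U i x - F i x * U j x) * \<psi> x)"
proof -
  obtain B where B: "0 \<le> B" "\<And>x. cmod (\<psi> x) \<le> B" "\<And>p. cmod (DD \<psi> p) \<le> B" using is_trig_bounded[OF \<psi>] by blast
  note m = is_trig_measurable[OF \<psi>]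
  have UD: "sq_integrable torus (DD (\<lambda>x. U i x * \<psi> x))" for i
    by (rule sq_integrable_DD_mult_trig(1)[OF U_sq DD_U_sq B m])
  have pw: "W i j p * DD \<psi> p = DD (U j) p * DD (\<lambda>x. U i x * \<psi> x) p - DD (U i) p * DD (\<lambda>x. U j x * \<psi> x) p" for p
    unfolding DD_mult by (subst W_eq_snd) (simp add: DD_def algebra_simps add_divide_distrib diff_divide_distrib)
  have FU: "integrable circle (\<lambda>x. F j x * (U i x * \<psi> x))" for i j
  proof -
    have "sq_integrable circle (\<lambda>x. U i x * \<psi> x)"
      by (rule circle.sq_integrable_bounded[of _ B])
         (use U_measurable m mult_mono[OF cmod_U_le B(2) zero_le_one norm_ge_zero] in \<open>simp_all add: norm_mult\<close>)
    then show ?thesis by (rule sq_integrable_mult[OF F_sq])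
  qed
  have "(LINT p|torus. W i j p * DD \<psi> p) = (LINT p|torus. DD (U j) p * DD (\<lambda>x. U i x * \<psi> x) p) - (LINT p|torus. DD (U i) p * DD (\<lambda>x. U j x * \<psi> x) p)"
    unfolding pw by (intro Bochner_Integration.integral_diff sq_integrable_mult DD_U_sq UD)
  also have "\<dots> = 2 * pi * ((LINT x|circle. F j x * (U i x * \<psi> x)) - (LINT x|circle. F i x * (U j x * \<psi> x)))"
    unfolding equation_U_mult_trig[OF \<psi>] by (simp add: algebra_simps)
  also have "(LINT x|circle. F j x * (U i x * \<psi> x)) - (LINT x|circle. F i x * (U j x * \<psi> x))
      = (LINT x|circle. (F j x * U i x - F i x * U j x) * \<psi> x)"
    by (subst Bochner_Integration.integral_diff[OF FU FU, symmetric]) (simp add: algebra_simps)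
  finally show ?thesis .
qed

end

section \<open>Smallness at high frequencies\<close>

context perturbed_half_harmonic
begin

lemma H_measurable: "H \<in> borel_measurable torus"
  unfolding H_def[abs_def]
proof (intro borel_measurable_sum)
  show "(\<lambda>p. cmod (DD (U j) p)) \<in> borel_measurable torus" for j
    using borel_measurable_DD[OF U_measurable, of j] by measurable
qed

text \<open>Common majorant of both bounds. The first argument is differenced and will be measured
  in H^(3/4), the second only multiplies and will be measured in H^(1/4).\<close>

definition NN :: "(real \<Rightarrow> complex) \<Rightarrow> (real \<Rightarrow> complex) \<Rightarrow> real" where
  "NN v \<phi> = (LINT p|torus. H p * cmod (\<phi> (fst p) * DD v p))"

lemma H_mult_integrable:
  assumes "is_trig v" "is_trig \<phi>"
  shows "integrable torus (\<lambda>p. H p * cmod (\<phi> (fst p) * DD v p))"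
    and "integrable torus (\<lambda>p. H p * cmod (\<phi> (snd p) * DD v p))"
    and "(LINT p|torus. H p * cmod (\<phi> (snd p) * DD v p)) = NN v \<phi>"
proof -
  obtain B where B: "0 \<le> B" "\<And>x. cmod (v x) \<le> B" "\<And>p. cmod (DD v p) \<le> B" using is_trig_bounded[OF assms(1)] by blast
  obtain C where C: "0 \<le> C" "\<And>x. cmod (\<phi> x) \<le> C" "\<And>p. cmod (DD \<phi> p) \<le> C" using is_trig_bounded[OF assms(2)] by blast
  have sq: "sq_integrable torus (\<lambda>p. \<phi> (fst p) * DD v p)"
  proof (rule torus.sq_integrable_bounded)
    show "(\<lambda>p. \<phi> (fst p) * DD v p) \<in> borel_measurable torus"
      by (intro borel_measurable_times measurable_torus_fst borel_measurable_DD is_trig_measurable assms)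
    show "cmod (\<phi> (fst p) * DD v p) \<le> C * B" for p
      unfolding norm_mult by (intro mult_mono B C) auto
  qed
  show i: "integrable torus (\<lambda>p. H p * cmod (\<phi> (fst p) * DD v p))"
    using integrable_cmod_mult[OF H_sq sq] by simp
  have Hs: "H (snd p, fst p) = H p" for p by (simp add: H_def DD_swap)
  show "integrable torus (\<lambda>p. H p * cmod (\<phi> (snd p) * DD v p))"
    using integrable_torus_swap[OF i] by (simp only: Hs DD_swap fst_conv snd_conv norm_mult norm_minus_cancel)
  show "(LINT p|torus. H p * cmod (\<phi> (snd p) * DD v p)) = NN v \<phi>"
    using torus_integral_swap[OF borel_measurable_integrable[OF i]]
    unfolding NN_def by (simp only: Hs DD_swap fst_conv snd_conv norm_mult norm_minus_cancel)
qed

lemma integral_le_NN: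
  fixes g :: "real \<times> real \<Rightarrow> complex"
  assumes "is_trig v" "is_trig \<phi>" "integrable torus g"
    and "\<And>p. cmod (g p) \<le> H p * cmod (\<phi> (fst p) * DD v p) + H p * cmod (\<phi> (snd p) * DD v p)"
  shows "cmod (LINT p|torus. g p) \<le> 2 * NN v \<phi>"
proof -
  note i = H_mult_integrable[OF assms(1,2)]
  have "cmod (LINT p|torus. g p) \<le> (LINT p|torus. cmod (g p))" by (rule integral_norm_bound)
  also have "\<dots> \<le> (LINT p|torus. H p * cmod (\<phi> (fst p) * DD v p) + H p * cmod (\<phi> (snd p) * DD v p))"
    by (intro integral_mono integrable_norm assms Bochner_Integration.integrable_add i)
  also have "\<dots> = 2 * NN v \<phi>"
    by (subst Bochner_Integration.integral_add[OF i(1,2)]) (simp add: i(3), simp add: NN_def)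
  finally show ?thesis .
qed

text \<open>One |\<delta>u| is traded for a factor of the distance, which undoes the difference
  quotient of \<open>\<phi>\<close>. Thus the term with weight |\<delta>u|^2 obeys the bound of the
  potential term.\<close>

lemma cubic_le:
  "cmod (of_real ((norm (u (fst p) - u (snd p)))\<^sup>2) * DD v p * DD \<phi> p / 4)
    \<le> H p * cmod (DD v p) * (cmod (\<phi> (fst p)) + cmod (\<phi> (snd p))) / 2"
proof (cases "circle_dist (fst p) (snd p) = 0")
  case True
  then show ?thesis by (simp add: DD_def)
next
  case False
  let ?d = "circle_dist (fst p) (snd p)"
  have "(norm (u (fst p) - u (snd p)))\<^sup>2 * (cmod (DD v p) * cmod (DD \<phi> p)) \<le> 2 * (H p * ?d) * (cmod (DD v p) * cmod (DD \<phi> p))"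
    by (intro mult_right_mono norm_diff_power2_le[OF False]) auto
  also have "\<dots> = 2 * (H p * cmod (DD v p)) * (?d * cmod (DD \<phi> p))" by simp
  also have "\<dots> \<le> 2 * (H p * cmod (DD v p)) * (cmod (\<phi> (fst p)) + cmod (\<phi> (snd p)))"
    by (intro mult_left_mono circle_dist_DD_le) auto
  finally show ?thesis unfolding norm_mult norm_divide by (simp add: norm_power mult_ac)
qed

lemma A_term_le:
  "cmod (W i j p * DD v p * ((\<phi> (fst p) + \<phi> (snd p)) / 2))
    \<le> H p * cmod (DD v p) * (cmod (\<phi> (fst p)) + cmod (\<phi> (snd p))) / 2"
proof -
  have "cmod (W i j p) * cmod (DD v p) * cmod (\<phi> (fst p) + \<phi> (snd p)) \<le> H p * cmod (DD v p) * (cmod (\<phi> (fst p)) + cmod (\<phi> (snd p)))"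
    by (intro mult_mono cmod_W_le norm_triangle_ineq) auto
  then show ?thesis by (simp add: norm_mult norm_divide)
qed

lemma A_bound_strong:
  assumes "is_trig v" "is_trig \<phi>"
  shows "cmod (LINT p|torus. A i j v \<phi> p) \<le> 2 * NN v \<phi>"
proof (rule integral_le_NN[OF assms])
  obtain S c where "finite S" "v = trig S c" using assms(1) by (auto simp: is_trig_def)
  then show "integrable torus (A i j v \<phi>)" by (intro A_integrable assms) simp
  fix p
  let ?r = "H p * cmod (DD v p) * (cmod (\<phi> (fst p)) + cmod (\<phi> (snd p))) / 2"
  have "0 \<le> ?r" by simp
  then have "cmod (A i j v \<phi> p) \<le> ?r + ?r"
    unfolding A_def by (intro order_trans[OF norm_triangle_ineq add_mono] A_term_le) (use cubic_le[of p v \<phi>] in auto)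
  then show "cmod (A i j v \<phi> p) \<le> H p * cmod (\<phi> (fst p) * DD v p) + H p * cmod (\<phi> (snd p) * DD v p)"
    by (simp add: norm_mult algebra_simps)
qed

text \<open>The symmetric product rule writes the potential term as \<open>W\<close> against
  \<open>DD\<close> of the product \<open>v * \<phi>\<close>, minus the same term with
  \<open>v\<close> and \<open>\<phi>\<close> exchanged. The former is the divergence and leaves only
  \<open>F\<close>; the latter, with the cubic term of opposite sign, is \<open>g\<close> and obeys
  the strong bound with exchanged roles.\<close>

lemma A_bound_weak:
  assumes v: "is_trig v" and \<phi>: "is_trig \<phi>"
  shows "cmod (LINT p|torus. A i j v \<phi> p) \<le> 2 * NN \<phi> v
    + 2 * pi * cmod (LINT x|circle. (F j x * U i x - F i x * U j x) * (v x * \<phi> x))"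
proof -
  define g where "g p = W i j p * DD \<phi> p * ((v (fst p) + v (snd p)) / 2)
    - (if i = j then of_real ((norm (u (fst p) - u (snd p)))\<^sup>2) * DD \<phi> p * DD v p / 4 else 0)" for p
  have DDv: "sq_integrable torus (DD v)" and DD\<phi>: "sq_integrable torus (DD \<phi>)"
    using v \<phi> by (auto simp: is_trig_def)
  have v\<phi>: "is_trig (\<lambda>x. v x * \<phi> x)" by (rule is_trig_mult[OF v \<phi>])
  have pw: "A i j v \<phi> p = W i j p * DD (\<lambda>x. v x * \<phi> x) p - g p" for p
  proof -
    have "DD (\<lambda>x. v x * \<phi> x) p = DD v p * ((\<phi> (fst p) + \<phi> (snd p)) / 2) + DD \<phi> p * ((v (fst p) + v (snd p)) / 2)"
    proof -
      have num: "v x * \<phi> x - v y * \<phi> y = (v x - v y) * ((\<phi> x + \<phi> y) / 2) + (\<phi> x - \<phi> y) * ((v x + v y) / 2)" for x y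
        by (simp add: field_simps)
      show ?thesis unfolding DD_def num by (simp add: add_divide_distrib)
    qed
    then show ?thesis by (simp add: A_def g_def algebra_simps)
  qed
  have i1: "integrable torus (\<lambda>p. W i j p * DD (\<lambda>x. v x * \<phi> x) p)"
    using v\<phi> by (intro sq_integrable_mult W_sq) (auto simp: is_trig_def)
  have gi: "integrable torus g"
  proof -
    have "integrable torus (\<lambda>p. W i j p * DD (\<lambda>x. v x * \<phi> x) p - A i j v \<phi> p)"
      by (intro Bochner_Integration.integrable_diff i1 A_integrable \<phi> DDv)
    then show ?thesis by (simp add: pw)
  qed
  have gb: "cmod (LINT p|torus. g p) \<le> 2 * NN \<phi> v"
  proof (rule integral_le_NN[OF \<phi> v gi])
    fix p
    let ?r = "H p * cmod (DD \<phi> p) * (cmod (v (fst p)) + cmod (v (snd p))) / 2"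
    have "0 \<le> ?r" by simp
    then have "cmod (g p) \<le> ?r + ?r"
      unfolding g_def by (intro order_trans[OF norm_triangle_ineq4 add_mono] A_term_le) (use cubic_le[of p \<phi> v] in auto)
    then show "cmod (g p) \<le> H p * cmod (v (fst p) * DD \<phi> p) + H p * cmod (v (snd p) * DD \<phi> p)"
      by (simp add: norm_mult algebra_simps)
  qed
  have "(LINT p|torus. A i j v \<phi> p) = (LINT p|torus. W i j p * DD (\<lambda>x. v x * \<phi> x) p) - (LINT p|torus. g p)"
    unfolding pw by (rule Bochner_Integration.integral_diff[OF i1 gi])
  also have "cmod \<dots> \<le> cmod (LINT p|torus. W i j p * DD (\<lambda>x. v x * \<phi> x) p) + cmod (LINT p|torus. g p)"
    by (rule norm_triangle_ineq4)
  finally show ?thesis using gb unfolding integral_W_DD[OF v\<phi>] by (simp add: norm_mult)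
qed

lemma L2_norm_mult_DD_le:
  assumes S: "finite S" and T: "finite T" "0 \<notin> T"
  shows "L2_norm torus (\<lambda>p. trig T b (fst p) * DD (trig S c) p) \<le> sqrt 176 * pi * norm34 S c * norm14 T b"
proof (rule power2_le_imp_le)
  show "(L2_norm torus (\<lambda>p. trig T b (fst p) * DD (trig S c) p))\<^sup>2 \<le> (sqrt 176 * pi * norm34 S c * norm14 T b)\<^sup>2"
    using L2_norm_DD_mult(2)[OF assms] by (simp add: power_mult_distrib norm14_power2 norm34_power2)
qed simp

text \<open>A bound without smallness and without restriction on \<open>S\<close>. It serves for the
  low frequencies of \<open>u\<close>, which act as a forcing term.\<close>

lemma NN_le:
  assumes S: "finite S" and T: "finite T" "0 \<notin> T"
  shows "NN (trig S c) (trig T b) \<le> L2_norm torus (\<lambda>p. of_real (H p)) * (sqrt 176 * pi) * norm34 S c * norm14 T b"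
proof -
  have "NN (trig S c) (trig T b) \<le> L2_norm torus (\<lambda>p. of_real (H p)) * L2_norm torus (\<lambda>p. trig T b (fst p) * DD (trig S c) p)"
    using L2_Cauchy_Schwarz[OF H_sq L2_norm_DD_mult(1)[OF assms, of b c]] by (simp add: NN_def)
  also have "\<dots> \<le> L2_norm torus (\<lambda>p. of_real (H p)) * (sqrt 176 * pi * norm34 S c * norm14 T b)"
    by (intro mult_left_mono L2_norm_mult_DD_le assms) simp
  finally show ?thesis by (simp add: mult_ac)
qed

lemma H_truncated_tendsto:
  "(\<lambda>m. L2_norm torus (\<lambda>p. of_real (if real m < H p then H p else 0))) \<longlonglongrightarrow> 0"
proof -
  have Hm: "H \<in> borel_measurable torus" and Hi: "integrable torus (\<lambda>p. (H p)\<^sup>2)"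
    using H_sq H_measurable by (auto simp: sq_integrable_def)
  have "(\<lambda>m. LINT p|torus. (if real m < H p then H p else 0)\<^sup>2) \<longlonglongrightarrow> (LINT p|torus. 0)"
  proof (rule integral_dominated_convergence[OF _ _ Hi])
    show "AE p in torus. (\<lambda>m. (if real m < H p then H p else 0)\<^sup>2) \<longlonglongrightarrow> 0"
    proof (intro AE_I2 tendsto_eventually)
      fix p
      obtain m0 :: nat where "H p \<le> real m0" using real_arch_simple by blast
      then show "\<forall>\<^sub>F m in sequentially. (if real m < H p then H p else 0)\<^sup>2 = 0"
        by (intro eventually_sequentiallyI[of m0]) auto
    qed
    show "AE p in torus. norm ((if real m < H p then H p else 0)\<^sup>2) \<le> (H p)\<^sup>2" for m by auto
    show "(\<lambda>p. (if real m < H p then H p else 0)\<^sup>2) \<in> borel_measurable torus" for m using Hm by measurable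
  qed simp
  then have "(\<lambda>m. sqrt (LINT p|torus. (if real m < H p then H p else 0)\<^sup>2)) \<longlonglongrightarrow> sqrt 0"
    by (intro tendsto_real_sqrt) simp
  then show ?thesis unfolding L2_norm_def by simp
qed

text \<open>\<open>H\<close> is cut at a height \<open>m\<close>. The part above is small in L^2,
  whatever the frequencies. The part below is at most \<open>m\<close>, and both arguments, having
  high frequencies, gain n^(-1/4) in plain L^2 norms.\<close>

lemma NN_small:
  assumes "\<epsilon> > 0"
  obtains N where "0 < N" "\<And>n S c T b. N \<le> n \<Longrightarrow> finite S \<Longrightarrow> finite T \<Longrightarrow> (\<And>k. k \<in> S \<Longrightarrow> int n \<le> \<bar>k\<bar>)
    \<Longrightarrow> (\<And>k. k \<in> T \<Longrightarrow> int n \<le> \<bar>k\<bar>) \<Longrightarrow> NN (trig S c) (trig T b) \<le> \<epsilon> * norm34 S c * norm14 T b"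
proof -
  have "\<forall>\<^sub>F m in sequentially. L2_norm torus (\<lambda>p. of_real (if real m < H p then H p else 0)) < \<epsilon> / 2 / (sqrt 176 * pi)"
    using assms by (intro order_tendstoD[OF H_truncated_tendsto]) simp
  \<comment> \<open>The threshold cancels the constant of \<open>L2_norm_mult_DD_le\<close>, leaving
    \<epsilon>/2.\<close>
  then obtain m where m: "L2_norm torus (\<lambda>p. of_real (if real m < H p then H p else 0)) < \<epsilon> / 2 / (sqrt 176 * pi)"
    by (auto simp: eventually_sequentially)
  let ?H1 = "\<lambda>p. if real m < H p then H p else 0"
  have H1: "sq_integrable torus (\<lambda>p. of_real (?H1 p))"
  proof (rule sq_integrable_bound[OF _ H_sq, where B = 1])
    have "H \<in> borel_measurable torus" by (rule H_measurable)
    then show "(\<lambda>p. complex_of_real (?H1 p)) \<in> borel_measurable torus" by measurable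
  qed auto
  \<comment> \<open>Makes m (2 pi)^2 / \<open>sqrt n\<close> at most \<epsilon>/2 for n >=
    N0.\<close>
  obtain N0 :: nat where N0: "(m * (2 * pi)\<^sup>2 * 2 / \<epsilon>)\<^sup>2 \<le> real N0" using real_arch_simple by blast
  define N where "N = Suc N0"
  have *: "NN (trig S c) (trig T b) \<le> \<epsilon> * norm34 S c * norm14 T b"
    if n: "N \<le> n" and S: "finite S" "\<And>k. k \<in> S \<Longrightarrow> int n \<le> \<bar>k\<bar>" and T: "finite T" "\<And>k. k \<in> T \<Longrightarrow> int n \<le> \<bar>k\<bar>" for n S c T b
  proof -
    have n0: "0 < n" using n by (simp add: N_def)
    have T0: "0 \<notin> T" using T(2)[of 0] n0 by auto
    let ?v = "trig S c" and ?\<phi> = "trig T b"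
    have v: "is_trig ?v" "is_trig ?\<phi>" using S T by auto
    note Q = L2_norm_DD_mult(1)[OF S(1) T(1) T0, of b c]
    note P = sq_integrable_torus_snd(3,4)[OF sq_integrable_trig[of T b]]
    have i1: "integrable torus (\<lambda>p. ?H1 p * cmod (?\<phi> (fst p) * DD ?v p))"
      using integrable_cmod_mult[OF H1 Q] by (simp add: if_distrib[of "\<lambda>x. x * _"] cong: if_cong)
    have i2: "integrable torus (\<lambda>p. cmod (?\<phi> (fst p)) * cmod (DD ?v p))"
      by (rule integrable_cmod_mult[OF P(1) sq_integrable_DD_trig])
    have "NN ?v ?\<phi> \<le> (LINT p|torus. ?H1 p * cmod (?\<phi> (fst p) * DD ?v p) + m * (cmod (?\<phi> (fst p)) * cmod (DD ?v p)))"
      unfolding NN_def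
    proof (intro integral_mono H_mult_integrable(1) v Bochner_Integration.integrable_add i1 integrable_mult_right i2)
      fix p
      show "H p * cmod (?\<phi> (fst p) * DD ?v p) \<le> ?H1 p * cmod (?\<phi> (fst p) * DD ?v p) + m * (cmod (?\<phi> (fst p)) * cmod (DD ?v p))"
        by (cases "real m < H p") (auto simp: norm_mult intro!: mult_right_mono)
    qed
    also have "\<dots> = (LINT p|torus. ?H1 p * cmod (?\<phi> (fst p) * DD ?v p)) + m * (LINT p|torus. cmod (?\<phi> (fst p)) * cmod (DD ?v p))"
      by (subst Bochner_Integration.integral_add[OF i1 integrable_mult_right[OF i2]]) simp
    also have "(LINT p|torus. ?H1 p * cmod (?\<phi> (fst p) * DD ?v p)) \<le> \<epsilon> / 2 * norm34 S c * norm14 T b"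
    proof -
      have "(LINT p|torus. ?H1 p * cmod (?\<phi> (fst p) * DD ?v p)) = (LINT p|torus. cmod (of_real (?H1 p)) * cmod (?\<phi> (fst p) * DD ?v p))"
        by (intro Bochner_Integration.integral_cong) auto
      also have "\<dots> \<le> L2_norm torus (\<lambda>p. of_real (?H1 p)) * L2_norm torus (\<lambda>p. ?\<phi> (fst p) * DD ?v p)"
        by (rule L2_Cauchy_Schwarz[OF H1 Q])
      also have "\<dots> \<le> (\<epsilon> / 2 / (sqrt 176 * pi)) * (sqrt 176 * pi * norm34 S c * norm14 T b)"
        by (intro mult_mono less_imp_le[OF m] L2_norm_mult_DD_le S T T0) (use assms in auto)
      finally show ?thesis by simp
    qed
    also have "real m * (LINT p|torus. cmod (?\<phi> (fst p)) * cmod (DD ?v p)) \<le> \<epsilon> / 2 * norm34 S c * norm14 T b"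
    proof -
      have "L2_norm torus (\<lambda>p. ?\<phi> (fst p)) \<le> sqrt ((2 * pi)\<^sup>2 * ((norm14 T b)\<^sup>2 / sqrt n))"
      proof (rule real_le_rsqrt)
        have "(2 * pi)\<^sup>2 * (\<Sum>k\<in>T. (cmod (b k))\<^sup>2) \<le> (2 * pi)\<^sup>2 * ((norm14 T b)\<^sup>2 / sqrt n)"
          by (intro mult_left_mono sum_cmod_square_le_norm14 T(2) n0) auto
        then show "(L2_norm torus (\<lambda>p. ?\<phi> (fst p)))\<^sup>2 \<le> (2 * pi)\<^sup>2 * ((norm14 T b)\<^sup>2 / sqrt n)"
          unfolding P(2) L2_norm_trig[OF T(1)] power2_eq_square[of "2 * pi"] by (simp only: mult.assoc)
      qed
      moreover have "L2_norm torus (DD ?v) \<le> sqrt ((2 * pi)\<^sup>2 * ((norm34 S c)\<^sup>2 / sqrt n))"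
        by (rule real_le_rsqrt, unfold L2_norm_DD_trig[OF S(1)]) (intro mult_left_mono sum_energy_le_norm34 S(2) n0, auto)
      ultimately have "L2_norm torus (\<lambda>p. ?\<phi> (fst p)) * L2_norm torus (DD ?v)
          \<le> sqrt ((2 * pi)\<^sup>2 * ((norm14 T b)\<^sup>2 / sqrt n)) * sqrt ((2 * pi)\<^sup>2 * ((norm34 S c)\<^sup>2 / sqrt n))"
        by (intro mult_mono) auto
      also have "\<dots> = sqrt (((2 * pi)\<^sup>2 * norm14 T b * norm34 S c / sqrt n)\<^sup>2)"
        unfolding real_sqrt_mult[symmetric] by (simp add: power2_eq_square mult_ac)
      also have "\<dots> = (2 * pi)\<^sup>2 * norm14 T b * norm34 S c / sqrt n" by simp
      finally have CS: "(LINT p|torus. cmod (?\<phi> (fst p)) * cmod (DD ?v p)) \<le> (2 * pi)\<^sup>2 * norm14 T b * norm34 S c / sqrt n"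
        using L2_Cauchy_Schwarz[OF P(1) sq_integrable_DD_trig[of S c]] by linarith
      have sn: "m * (2 * pi)\<^sup>2 * 2 / \<epsilon> \<le> sqrt n"
      proof (rule real_le_rsqrt)
        show "(m * (2 * pi)\<^sup>2 * 2 / \<epsilon>)\<^sup>2 \<le> real n" using N0 n by (simp add: N_def)
      qed
      have "real m * ((2 * pi)\<^sup>2 * norm14 T b * norm34 S c / sqrt n) = (m * (2 * pi)\<^sup>2 / sqrt n) * (norm34 S c * norm14 T b)" by simp
      also have "\<dots> \<le> \<epsilon> / 2 * (norm34 S c * norm14 T b)"
      proof (rule mult_right_mono)
        have "m * (2 * pi)\<^sup>2 * 2 \<le> \<epsilon> * sqrt n" using sn assms by (simp add: pos_divide_le_eq mult.commute)
        then show "m * (2 * pi)\<^sup>2 / sqrt n \<le> \<epsilon> / 2" using n0 by (simp add: pos_divide_le_eq)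
      qed simp
      finally show ?thesis using mult_left_mono[OF CS, of "real m"] by simp
    qed
    finally show ?thesis by (simp add: mult_ac)
  qed
  show ?thesis by (rule that[of N]) (use * in \<open>auto simp: N_def\<close>)
qed

text \<open>\<open>\<phi>\<close> goes to L^infinity by its H^(3/4) norm, \<open>F\<close> and
  \<open>v\<close> to L^2, and the high frequencies of \<open>v\<close> gain n^(-1/4).\<close>

lemma perturbation_bound:
  assumes S: "finite S" "\<And>k. k \<in> S \<Longrightarrow> int n \<le> \<bar>k\<bar>" and T: "finite T" "\<And>k. k \<in> T \<Longrightarrow> int n \<le> \<bar>k\<bar>" and n: "0 < n"
  shows "cmod (LINT x|circle. (F j x * U i x - F i x * U j x) * (trig S c x * trig T b x))
    \<le> (L2_norm circle (F i) + L2_norm circle (F j)) * sqrt (2 * pi) * sqrt 6 / root4 n * norm14 S c * norm34 T b"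
proof -
  let ?v = "trig S c" and ?\<phi> = "trig T b"
  have T0: "0 \<notin> T" using T(2)[of 0] n by auto
  let ?B = "sqrt 6 * norm34 T b"
  have \<phi>: "cmod (?\<phi> x) \<le> ?B" for x
    using cmod_trig_le[of T b x] sum_cmod_le_norm34[OF T(1) T0, of b] by linarith
  have i: "integrable circle (\<lambda>x. cmod (F l x) * cmod (?v x))" for l
    by (rule integrable_cmod_mult[OF F_sq sq_integrable_trig])
  have b: "cmod ((F j x * U i x - F i x * U j x) * (?v x * ?\<phi> x)) \<le> ?B * (cmod (F i x) * cmod (?v x) + cmod (F j x) * cmod (?v x))" for x
  proof -
    have "cmod (F j x * U i x - F i x * U j x) \<le> cmod (F j x * U i x) + cmod (F i x * U j x)" by (rule norm_triangle_ineq4)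
    also have "\<dots> \<le> cmod (F j x) + cmod (F i x)"
      unfolding norm_mult by (intro add_mono mult_right_le_one_le cmod_U_le) auto
    finally have "cmod (F j x * U i x - F i x * U j x) * (cmod (?v x) * cmod (?\<phi> x)) \<le> (cmod (F j x) + cmod (F i x)) * (cmod (?v x) * ?B)"
      by (intro mult_mono \<phi>) auto
    then show ?thesis unfolding norm_mult by (simp add: algebra_simps)
  qed
  have "cmod (LINT x|circle. (F j x * U i x - F i x * U j x) * (?v x * ?\<phi> x))
     \<le> (LINT x|circle. cmod ((F j x * U i x - F i x * U j x) * (?v x * ?\<phi> x)))" by (rule integral_norm_bound)
  also have "\<dots> \<le> (LINT x|circle. ?B * (cmod (F i x) * cmod (?v x) + cmod (F j x) * cmod (?v x)))"
  proof (rule integral_mono_AE')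
    show "integrable circle (\<lambda>x. ?B * (cmod (F i x) * cmod (?v x) + cmod (F j x) * cmod (?v x)))"
      using i by simp
  qed (use b in auto)
  also have "\<dots> = ?B * ((LINT x|circle. cmod (F i x) * cmod (?v x)) + (LINT x|circle. cmod (F j x) * cmod (?v x)))"
    using i by simp
  also have "\<dots> \<le> ?B * (L2_norm circle (F i) * L2_norm circle ?v + L2_norm circle (F j) * L2_norm circle ?v)"
    by (intro mult_left_mono add_mono L2_Cauchy_Schwarz F_sq sq_integrable_trig) auto
  also have "\<dots> = ?B * (L2_norm circle (F i) + L2_norm circle (F j)) * L2_norm circle ?v"
    by (simp add: algebra_simps)
  finally have le: "cmod (LINT x|circle. (F j x * U i x - F i x * U j x) * (?v x * ?\<phi> x))
    \<le> ?B * (L2_norm circle (F i) + L2_norm circle (F j)) * L2_norm circle ?v" .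
  have "L2_norm circle ?v \<le> sqrt (2 * pi) / root4 n * norm14 S c"
  proof (rule power2_le_imp_le)
    have "(L2_norm circle ?v)\<^sup>2 \<le> 2 * pi * ((norm14 S c)\<^sup>2 / sqrt n)"
      unfolding L2_norm_trig[OF S(1)] by (intro mult_left_mono sum_cmod_square_le_norm14 S n) auto
    also have "\<dots> = (sqrt (2 * pi) / root4 n * norm14 S c)\<^sup>2"
      by (simp add: power_mult_distrib power_divide root4_power2)
    finally show "(L2_norm circle ?v)\<^sup>2 \<le> (sqrt (2 * pi) / root4 n * norm14 S c)\<^sup>2" .
  qed simp
  then have "?B * (L2_norm circle (F i) + L2_norm circle (F j)) * L2_norm circle ?v
    \<le> ?B * (L2_norm circle (F i) + L2_norm circle (F j)) * (sqrt (2 * pi) / root4 n * norm14 S c)"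
    by (rule mult_left_mono) simp
  with le show ?thesis by (simp add: mult_ac)
qed

lemma A_small:
  assumes "\<epsilon> > 0"
  obtains N where "0 < N" "\<And>i j S c T b. finite S \<Longrightarrow> finite T \<Longrightarrow> (\<And>k. k \<in> S \<Longrightarrow> int N \<le> \<bar>k\<bar>)
      \<Longrightarrow> (\<And>k. k \<in> T \<Longrightarrow> int N \<le> \<bar>k\<bar>) \<Longrightarrow> cmod (LINT p|torus. A i j (trig S c) (trig T b) p) \<le> \<epsilon> * norm34 S c * norm14 T b"
    "\<And>i j S c T b. finite S \<Longrightarrow> finite T \<Longrightarrow> (\<And>k. k \<in> S \<Longrightarrow> int N \<le> \<bar>k\<bar>)
      \<Longrightarrow> (\<And>k. k \<in> T \<Longrightarrow> int N \<le> \<bar>k\<bar>) \<Longrightarrow> cmod (LINT p|torus. A i j (trig S c) (trig T b) p) \<le> \<epsilon> * norm14 S c * norm34 T b"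
proof -
  \<comment> \<open>The bounds contain 2 \<open>NN\<close>, which thus costs \<epsilon>/2; the other
    \<epsilon>/2 is reserved for the term with \<open>F\<close>.\<close>
  have e4: "\<epsilon> / 4 > 0" using assms by simp
  obtain N1 where N1: "0 < N1" "\<And>n S c T b. N1 \<le> n \<Longrightarrow> finite S \<Longrightarrow> finite T \<Longrightarrow> (\<And>k. k \<in> S \<Longrightarrow> int n \<le> \<bar>k\<bar>)
    \<Longrightarrow> (\<And>k. k \<in> T \<Longrightarrow> int n \<le> \<bar>k\<bar>) \<Longrightarrow> NN (trig S c) (trig T b) \<le> \<epsilon> / 4 * norm34 S c * norm14 T b"
    using NN_small[OF e4] by blast
  define L where "L = (\<Sum>j\<in>UNIV. L2_norm circle (F j))"
  have L: "L2_norm circle (F j) \<le> L" for j unfolding L_def by (rule member_le_sum) auto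
  have L0: "0 \<le> L" using L[of undefined] order_trans[OF L2_norm_nonneg] by blast
  let ?K = "2 * pi * ((L + L) * sqrt (2 * pi) * sqrt 6)"
  \<comment> \<open>The fourth power, because the gain in \<open>perturbation_bound\<close> is only
    N^(-1/4).\<close>
  obtain N2 :: nat where N2: "(2 * ?K / \<epsilon>) ^ 4 \<le> real N2" using real_arch_simple by blast
  define N where "N = max N1 N2"
  have N: "0 < N" "N1 \<le> N" using N1(1) by (auto simp: N_def)
  have K0: "0 \<le> ?K" using L0 by simp
  have r: "?K / root4 N \<le> \<epsilon> / 2"
  proof -
    have "(2 * ?K / \<epsilon>) ^ 4 \<le> root4 N ^ 4" using N2 by (simp add: root4_power4 N_def)
    then have "2 * ?K / \<epsilon> \<le> root4 N" by (rule power_le_imp_le_base[of _ 3, simplified]) auto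
    then show ?thesis using assms N(1) root4_pos[of "int N"] by (simp add: field_simps)
  qed
  have 1: "cmod (LINT p|torus. A i j (trig S c) (trig T b) p) \<le> \<epsilon> * norm34 S c * norm14 T b"
    if "finite S" "finite T" "\<And>k. k \<in> S \<Longrightarrow> int N \<le> \<bar>k\<bar>" "\<And>k. k \<in> T \<Longrightarrow> int N \<le> \<bar>k\<bar>" for i j S c T b
  proof -
    have "cmod (LINT p|torus. A i j (trig S c) (trig T b) p) \<le> 2 * NN (trig S c) (trig T b)"
      by (rule A_bound_strong) (use that in auto)
    also have "\<dots> \<le> 2 * (\<epsilon> / 4 * norm34 S c * norm14 T b)" by (intro mult_left_mono N1(2)[OF N(2)] that) auto
    also have "\<dots> \<le> \<epsilon> * norm34 S c * norm14 T b" using assms by simp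
    finally show ?thesis .
  qed
  have 2: "cmod (LINT p|torus. A i j (trig S c) (trig T b) p) \<le> \<epsilon> * norm14 S c * norm34 T b"
    if that: "finite S" "finite T" "\<And>k. k \<in> S \<Longrightarrow> int N \<le> \<bar>k\<bar>" "\<And>k. k \<in> T \<Longrightarrow> int N \<le> \<bar>k\<bar>" for i j S c T b
  proof -
    let ?I = "LINT x|circle. (F j x * U i x - F i x * U j x) * (trig S c x * trig T b x)"
    have "cmod (LINT p|torus. A i j (trig S c) (trig T b) p) \<le> 2 * NN (trig T b) (trig S c) + 2 * pi * cmod ?I"
      by (rule A_bound_weak) (use that in auto)
    also have "NN (trig T b) (trig S c) \<le> \<epsilon> / 4 * norm34 T b * norm14 S c" by (intro N1(2)[OF N(2)] that)
    also have "cmod ?I \<le> (L2_norm circle (F i) + L2_norm circle (F j)) * sqrt (2 * pi) * sqrt 6 / root4 N * norm14 S c * norm34 T b"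
      by (rule perturbation_bound) (use that N in auto)
    also have "\<dots> \<le> (L + L) * sqrt (2 * pi) * sqrt 6 / root4 N * norm14 S c * norm34 T b"
      by (intro mult_right_mono divide_right_mono add_mono L) auto
    finally have "cmod (LINT p|torus. A i j (trig S c) (trig T b) p) \<le> 2 * (\<epsilon> / 4 * norm34 T b * norm14 S c)
        + (?K / root4 N) * (norm14 S c * norm34 T b)" by (simp add: mult_ac)
    also have "(?K / root4 N) * (norm14 S c * norm34 T b) \<le> \<epsilon> / 2 * (norm14 S c * norm34 T b)"
      by (rule mult_right_mono[OF r]) simp
    finally show ?thesis by (simp add: mult_ac)
  qed
  show ?thesis by (rule that[OF N(1) 1 2])
qed

end

section \<open>Regularity at a fixed time\<close>

text \<open>Allows a pointwise Fatou bound to be squared before Fatou's lemma is applied again in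
  the other variable.\<close>

lemma liminf_power2_le:
  fixes a :: "nat \<Rightarrow> ennreal"
  shows "(liminf a)\<^sup>2 \<le> liminf (\<lambda>n. (a n)\<^sup>2)"
proof -
  define I where "I n = (INF k\<in>{n..}. a k)" for n
  have mono: "I m \<le> I n" if "m \<le> n" for m n unfolding I_def by (rule INF_superset_mono) (use that in auto)
  have sq: "(I n)\<^sup>2 \<le> (INF k\<in>{n..}. (a k)\<^sup>2)" for n
    unfolding power2_eq_square I_def by (intro INF_greatest mult_mono INF_lower) auto
  have "I m * I n \<le> (SUP n. INF k\<in>{n..}. (a k)\<^sup>2)" for m n
  proof -
    have "I m * I n \<le> (I (max m n))\<^sup>2"
      unfolding power2_eq_square by (intro mult_mono mono) auto
    also have "\<dots> \<le> (INF k\<in>{max m n..}. (a k)\<^sup>2)" by (rule sq)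
    also have "\<dots> \<le> (SUP n. INF k\<in>{n..}. (a k)\<^sup>2)" by (rule SUP_upper) simp
    finally show ?thesis .
  qed
  then have "(SUP m. SUP n. I m * I n) \<le> (SUP n. INF k\<in>{n..}. (a k)\<^sup>2)"
    by (intro SUP_least)
  also have "(SUP m. SUP n. I m * I n) = (SUP n. I n) * (SUP n. I n)"
    by (simp add: SUP_mult_left_ennreal[symmetric] SUP_mult_right_ennreal[symmetric])
  finally show ?thesis
    unfolding liminf_SUP_INF I_def power2_eq_square .
qed

lemma sum_UNIV_Times: "(\<Sum>i\<in>UNIV \<times> R. f i) = (\<Sum>a\<in>(UNIV :: 'a::finite set). \<Sum>k\<in>R. f (a, k))"
  by (simp add: sum.cartesian_product)

section \<open>The linear system for the high-frequency coefficients\<close>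

context perturbed_half_harmonic
begin

abbreviation ek :: "int \<Rightarrow> real \<Rightarrow> complex" where "ek k \<equiv> \<lambda>x. cis (of_int k * x)"

lemma is_trig_ek: "is_trig (ek k)"
  using is_trig_cis[of 1 k] by simp

lemma A_trig: "A i j (trig S c) (trig T b) p = (\<Sum>l\<in>S. \<Sum>k\<in>T. c l * b k * A i j (ek l) (ek k) p)"
proof -
  have M: "M i j (trig T b) p = (\<Sum>k\<in>T. b k * M i j (ek k) p)"
  proof -
    have "W i j p * ((trig T b (fst p) + trig T b (snd p)) / 2)
      = (\<Sum>k\<in>T. b k * (W i j p * ((ek k (fst p) + ek k (snd p)) / 2)))"
      unfolding trig_def sum.distrib[symmetric] sum_divide_distrib sum_distrib_left
      by (intro sum.cong) (auto simp: algebra_simps)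
    moreover have "of_real ((norm (u (fst p) - u (snd p)))\<^sup>2) * DD (trig T b) p / 4
      = (\<Sum>k\<in>T. b k * (of_real ((norm (u (fst p) - u (snd p)))\<^sup>2) * DD (ek k) p / 4))"
      unfolding DD_trig sum_divide_distrib sum_distrib_left by (intro sum.cong) (auto simp: algebra_simps)
    ultimately show ?thesis unfolding M_def distrib_left sum.distrib by auto
  qed
  show ?thesis unfolding A_eq_M M DD_trig sum_product by (simp add: mult_ac)
qed

lemma integral_A_trig:
  "(LINT p|torus. A i j (trig S c) (trig T b) p) = (\<Sum>l\<in>S. \<Sum>k\<in>T. c l * b k * (LINT p|torus. A i j (ek l) (ek k) p))"
proof -
  have i: "integrable torus (A i j (ek l) (ek k))" for l k
    by (intro A_integrable is_trig_ek sq_integrable_DD_cis)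
  show ?thesis unfolding A_trig by (simp add: Bochner_Integration.integral_sum i)
qed

lemma limit_A:
  "(\<lambda>n. LINT p|torus. A i j (trig (freq_box n) (fcoeff (U j))) (ek k) p) \<longlonglongrightarrow> (LINT p|torus. A i j (U j) (ek k) p)"
  unfolding A_eq_M
proof (rule L2_tendsto_integral_mult[OF sq_integrable_DD_trig DD_U_sq M_sq[OF is_trig_ek]])
  show "(\<lambda>n. L2_norm torus (\<lambda>p. DD (trig (freq_box n) (fcoeff (U j))) p - DD (U j) p)) \<longlonglongrightarrow> 0"
    using partial_sum.DD_approx_tendsto[OF U_sq[of j] U_energy] unfolding L2_norm_def partial_sum_approx
    by (subst norm_minus_commute)
qed

text \<open>The mode \<open>- k\<close> extracts the coefficient at \<open>k\<close> under the
  bilinear pairing. This is the system to which \<open>two_norm_contraction\<close> is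
  applied.\<close>

lemma coefficient_equation:
  "of_real \<bar>of_int k\<bar> * fcoeff (U a) k
    = (\<Sum>b\<in>UNIV. LINT p|torus. A a b (U b) (ek (- k)) p) / of_real ((2 * pi)\<^sup>2) + fcoeff (F a) k"
proof -
  have "(2 * pi)\<^sup>2 * \<bar>of_int k\<bar> * fcoeff (U a) k = (LINT p|torus. DD (U a) p * DD (ek (- k)) p)"
    using integral_DD_mult_DD_cis[OF U_sq U_energy, of a "- k"] by simp
  also have "\<dots> = (\<Sum>b\<in>UNIV. LINT p|torus. A a b (U b) (ek (- k)) p) + 2 * pi * (LINT x|circle. F a x * ek (- k) x)"
    by (rule equation_A[OF is_trig_ek])
  also have "(LINT x|circle. F a x * ek (- k) x) = 2 * pi * fcoeff (F a) k" by (simp add: fcoeff_def)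
  finally show ?thesis by (simp add: field_simps power2_eq_square)
qed

text \<open>Finite truncations of the high frequencies, invariant under reflection because the test
  modes are reflected.\<close>

definition ring :: "nat \<Rightarrow> nat \<Rightarrow> int set" where
  "ring N n = {k \<in> freq_box n. int N \<le> \<bar>k\<bar>}"

lemma finite_ring [simp]: "finite (ring N n)"
  by (rule finite_subset[of _ "freq_box n"]) (auto simp: ring_def)

lemma uminus_ring: "uminus ` ring N n = ring N n"
proof
  show "uminus ` ring N n \<subseteq> ring N n" by (auto simp: ring_def)
  show "ring N n \<subseteq> uminus ` ring N n"
  proof
    fix k assume "k \<in> ring N n"
    then have "- k \<in> ring N n" by (auto simp: ring_def)
    then show "k \<in> uminus ` ring N n" by (intro image_eqI[of _ _ "- k"]) auto
  qed
qed

lemma sum_ring_uminus: "(\<Sum>k\<in>ring N n. g (- k)) = (\<Sum>k\<in>ring N n. g k)"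
  using sum.reindex[of uminus "ring N n" g] by (simp add: uminus_ring)

text \<open>\<open>two_norm_contraction\<close> with \<alpha> = |k|^(1/4) on pairs of component and
  frequency: \<alpha>^4 is the symbol of \<Lambda>, the weak norm is that of H^(1/4), the strong one
  that of H^(3/4). The bound is uniform in \<open>n\<close>, so it survives the limit.\<close>

lemma H34_bound:
  "\<exists>N D. \<forall>n b. (\<Sum>k\<in>ring N n. (root4 k ^ 3 * cmod (fcoeff (U b) k))\<^sup>2) \<le> D"
proof -
  let ?n = "real CARD('n)"
  \<comment> \<open>The form is a sum over all pairs of components; this choice makes the total
    contraction factor 1/2.\<close>
  define \<epsilon> where "\<epsilon> = 1 / (2 * ?n\<^sup>2)"
  have \<epsilon>: "\<epsilon> > 0" by (simp add: \<epsilon>_def)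
  obtain N where N: "0 < N"
    and strong: "\<And>i j S c T b. finite S \<Longrightarrow> finite T \<Longrightarrow> (\<And>k. k \<in> S \<Longrightarrow> int N \<le> \<bar>k\<bar>)
      \<Longrightarrow> (\<And>k. k \<in> T \<Longrightarrow> int N \<le> \<bar>k\<bar>) \<Longrightarrow> cmod (LINT p|torus. A i j (trig S c) (trig T b) p) \<le> \<epsilon> * norm34 S c * norm14 T b"
    and weak: "\<And>i j S c T b. finite S \<Longrightarrow> finite T \<Longrightarrow> (\<And>k. k \<in> S \<Longrightarrow> int N \<le> \<bar>k\<bar>)
      \<Longrightarrow> (\<And>k. k \<in> T \<Longrightarrow> int N \<le> \<bar>k\<bar>) \<Longrightarrow> cmod (LINT p|torus. A i j (trig S c) (trig T b) p) \<le> \<epsilon> * norm14 S c * norm34 T b"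
    using A_small[OF \<epsilon>] by blast
  define R where "R = ring N"
  have Rfin: "finite (R n)" for n by (simp add: R_def)
  have RN: "k \<in> R n \<Longrightarrow> int N \<le> \<bar>k\<bar>" for n k by (auto simp: R_def ring_def)
  have R0: "0 \<notin> R n" for n using N by (auto simp: R_def ring_def)
  define J where "J n = (UNIV :: 'n set) \<times> R n" for n
  define \<alpha> where "\<alpha> i = root4 (snd i)" for i :: "'n \<times> int"
  define v where "v i = fcoeff (U (fst i)) (snd i)" for i
  \<comment> \<open>The frequencies too low for the smallness bounds. Their contribution to the form
    is moved to the forcing term \<open>Fv\<close>.\<close>
  define L where "L = {k::int. \<bar>k\<bar> < int N}"
  have Lfin: "finite L" by (rule finite_subset[of _ "freq_box N"]) (auto simp: L_def)
  define q where "q = complex_of_real (1 / (2 * pi)\<^sup>2)"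
  have q1: "cmod q \<le> 1"
  proof -
    have "1 \<le> (2 * pi)\<^sup>2" using pi_gt3 by (intro one_le_power) simp
    moreover have "cmod q = \<bar>1 / (2 * pi)\<^sup>2\<bar>" unfolding q_def by (rule norm_of_real)
    ultimately show ?thesis by simp
  qed
  \<comment> \<open>Row \<open>i\<close> is the tested component and mode, column \<open>j\<close>
    the unknown coefficient; \<open>q\<close> is the normalisation in
    \<open>coefficient_equation\<close>.\<close>
  define K where "K i j = q * (LINT p|torus. A (fst i) (fst j) (ek (snd j)) (ek (- snd i)) p)" for i j
  define Fv where "Fv i = fcoeff (F (fst i)) (snd i)
    + q * (\<Sum>b\<in>UNIV. LINT p|torus. A (fst i) b (trig L (fcoeff (U b))) (ek (- snd i)) p)" for i
  let ?N1 = "\<lambda>c n. L2_set (\<lambda>i. \<alpha> i * cmod (c i)) (J n)"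
  let ?N3 = "\<lambda>c n. L2_set (\<lambda>i. \<alpha> i ^ 3 * cmod (c i)) (J n)"
  have Jfin: "finite (J n)" for n by (simp add: J_def Rfin)
  have comp: "L2_set (\<lambda>k. g k * cmod (c (a, k))) (R n) \<le> L2_set (\<lambda>i. g (snd i) * cmod (c i)) (J n)" for g c a n
  proof -
    have "(\<Sum>k\<in>R n. (g k * cmod (c (a, k)))\<^sup>2) \<le> (\<Sum>b\<in>UNIV. \<Sum>k\<in>R n. (g k * cmod (c (b, k)))\<^sup>2)"
      by (rule member_le_sum) (auto intro: sum_nonneg)
    also have "\<dots> = (\<Sum>i\<in>J n. (g (snd i) * cmod (c i))\<^sup>2)" by (simp add: J_def sum_UNIV_Times)
    finally show ?thesis unfolding L2_set_def by (rule real_sqrt_le_mono)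
  qed
  \<comment> \<open>Testing with the modes \<open>- k\<close> reflects the coefficients of the test
    function; even weights and the symmetric ring preserve its norms.\<close>
  have reflect: "L2_set (\<lambda>k. g k * cmod (c (a, - k))) (R n) = L2_set (\<lambda>k. g k * cmod (c (a, k))) (R n)"
    if "\<And>k. g (- k) = g k" for g c a n
    using sum_ring_uminus[of "\<lambda>k. (g k * cmod (c (a, k)))\<^sup>2" N n] that by (simp add: L2_set_def R_def)
  have r4: "root4 (- k) = root4 k" for k by (simp add: root4_def)
  have n1c: "norm14 (R n) (\<lambda>k. c (a, k)) \<le> ?N1 c n" and n3c: "norm34 (R n) (\<lambda>k. c (a, k)) \<le> ?N3 c n"
    and n1c': "norm14 (R n) (\<lambda>k. c (a, - k)) \<le> ?N1 c n" and n3c': "norm34 (R n) (\<lambda>k. c (a, - k)) \<le> ?N3 c n" for a c n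
    unfolding norm14_def norm34_def \<alpha>_def
    using comp[of root4 c a n] comp[of "\<lambda>k. root4 k ^ 3" c a n]
      reflect[of root4 c a n] reflect[of "\<lambda>k. root4 k ^ 3" c a n] by (simp_all add: r4)
  have pairing: "(\<Sum>k\<in>R n. \<phi> (a, k) * (LINT p|torus. A a b w (ek (- k)) p)) = (LINT p|torus. A a b w (trig (R n) (\<lambda>k. \<phi> (a, - k))) p)"
    if "w = trig S c" for \<phi> a b n w S c
  proof -
    have 1: "(LINT p|torus. A a b (trig S c) (ek k) p) = (\<Sum>l\<in>S. c l * (LINT p|torus. A a b (ek l) (ek k) p))" for k
    proof -
      have "ek k = trig {k} (\<lambda>_. 1)" by (simp add: trig_def fun_eq_iff)
      then show ?thesis using integral_A_trig[of a b S c "{k}" "\<lambda>_. 1"] by simp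
    qed
    have "(\<Sum>k\<in>R n. \<phi> (a, k) * (LINT p|torus. A a b w (ek (- k)) p)) = (\<Sum>k\<in>R n. \<phi> (a, - k) * (LINT p|torus. A a b w (ek k) p))"
      using sum_ring_uminus[of "\<lambda>k. \<phi> (a, - k) * (LINT p|torus. A a b w (ek k) p)" N n] by (simp add: R_def)
    also have "\<dots> = (\<Sum>k\<in>R n. \<Sum>l\<in>S. c l * \<phi> (a, - k) * (LINT p|torus. A a b (ek l) (ek k) p))"
      unfolding that 1 by (simp add: sum_distrib_left mult_ac)
    also have "\<dots> = (\<Sum>l\<in>S. \<Sum>k\<in>R n. c l * \<phi> (a, - k) * (LINT p|torus. A a b (ek l) (ek k) p))" by (rule sum.swap)
    finally show ?thesis unfolding that integral_A_trig .
  qed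
  have single: "(\<Sum>l\<in>S. c l * (LINT p|torus. A a b (ek l) (ek k) p)) = (LINT p|torus. A a b (trig S c) (ek k) p)" for S c a b k
  proof -
    have "ek k = trig {k} (\<lambda>_. 1)" by (simp add: trig_def fun_eq_iff)
    then show ?thesis using integral_A_trig[of a b S c "{k}" "\<lambda>_. 1"] by simp
  qed
  have Kv: "(\<Sum>j\<in>J n. K i j * c j) = q * (\<Sum>b\<in>UNIV. LINT p|torus. A (fst i) b (trig (R n) (\<lambda>l. c (b, l))) (ek (- snd i)) p)" for i c n
  proof -
    have "(\<Sum>j\<in>J n. K i j * c j) = q * (\<Sum>b\<in>UNIV. \<Sum>l\<in>R n. c (b, l) * (LINT p|torus. A (fst i) b (ek l) (ek (- snd i)) p))"
      by (simp add: J_def sum_UNIV_Times K_def sum_distrib_left mult_ac)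
    then show ?thesis unfolding single .
  qed
  have form: "(\<Sum>i\<in>J n. \<Sum>j\<in>J n. \<phi> i * K i j * c j)
      = q * (\<Sum>a\<in>UNIV. \<Sum>b\<in>UNIV. LINT p|torus. A a b (trig (R n) (\<lambda>l. c (b, l))) (trig (R n) (\<lambda>k. \<phi> (a, - k))) p)" for \<phi> c n
  proof -
    have "(\<Sum>i\<in>J n. \<Sum>j\<in>J n. \<phi> i * K i j * c j) = (\<Sum>i\<in>J n. \<phi> i * (\<Sum>j\<in>J n. K i j * c j))"
      by (simp add: sum_distrib_left mult.assoc)
    also have "\<dots> = (\<Sum>a\<in>UNIV. \<Sum>k\<in>R n. \<phi> (a, k) * (q * (\<Sum>b\<in>UNIV. LINT p|torus. A a b (trig (R n) (\<lambda>l. c (b, l))) (ek (- k)) p)))"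
      unfolding Kv unfolding J_def sum_UNIV_Times by simp
    also have "\<dots> = q * (\<Sum>a\<in>UNIV. \<Sum>k\<in>R n. \<Sum>b\<in>UNIV. \<phi> (a, k) * (LINT p|torus. A a b (trig (R n) (\<lambda>l. c (b, l))) (ek (- k)) p))"
      by (simp add: sum_distrib_left mult_ac)
    also have "\<dots> = q * (\<Sum>a\<in>UNIV. \<Sum>b\<in>UNIV. \<Sum>k\<in>R n. \<phi> (a, k) * (LINT p|torus. A a b (trig (R n) (\<lambda>l. c (b, l))) (ek (- k)) p))"
      by (intro arg_cong[of _ _ "\<lambda>x. q * x"] sum.cong refl) (rule sum.swap)
    finally show ?thesis unfolding pairing[OF refl] .
  qed
  have total: "cmod (q * (\<Sum>a\<in>UNIV. \<Sum>b\<in>(UNIV :: 'n set). z a b)) \<le> 1 / 2 * X * Y"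
    if "\<And>a b. cmod (z a b) \<le> \<epsilon> * x b * y a" "\<And>b. 0 \<le> x b" "\<And>b. x b \<le> X" "\<And>a. 0 \<le> y a" "\<And>a. y a \<le> Y"
    for z :: "'n \<Rightarrow> 'n \<Rightarrow> complex" and x y X Y
  proof -
    have X: "0 \<le> X" using that order_trans by blast
    have le: "cmod (z a b) \<le> \<epsilon> * X * Y" for a b
    proof -
      have "\<epsilon> * x b \<le> \<epsilon> * X" by (rule mult_left_mono[OF that(3) less_imp_le[OF \<epsilon>]])
      moreover have "0 \<le> \<epsilon> * X" by (rule mult_nonneg_nonneg[OF less_imp_le[OF \<epsilon>] X])
      ultimately have "(\<epsilon> * x b) * y a \<le> (\<epsilon> * X) * Y" by (rule mult_mono[OF _ that(5) _ that(4)])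
      then show ?thesis using that(1)[of a b] by linarith
    qed
    have "cmod (q * (\<Sum>a\<in>UNIV. \<Sum>b\<in>(UNIV :: 'n set). z a b)) \<le> 1 * (\<Sum>a\<in>(UNIV :: 'n set). \<Sum>b\<in>(UNIV :: 'n set). \<epsilon> * X * Y)"
      unfolding norm_mult
      by (intro mult_mono q1 order_trans[OF norm_sum] sum_mono le) auto
    also have "\<dots> = 1 / 2 * X * Y" by (simp add: \<epsilon>_def power2_eq_square)
    finally show ?thesis .
  qed
  \<comment> \<open>Bounds the forcing on H^(1/4). \<open>F\<close> is paired in plain L^2, which
    the H^(1/4) norm dominates as |k| >= 1; the finitely many low modes of \<open>u\<close> have a
    finite H^(3/4) norm, and the strong bound applies to them.\<close>
  define C where "C = (\<Sum>a\<in>UNIV. L2_norm circle (F a)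
    + (\<Sum>b\<in>UNIV. 2 * (L2_norm torus (\<lambda>p. of_real (H p)) * (sqrt 176 * pi) * norm34 L (fcoeff (U b)))))"
  have main: "L2_set (\<lambda>i. \<alpha> i ^ 3 * cmod (v i)) (J n0) \<le> 2 * C" for n0
  proof (rule two_norm_contraction[where K = K and F = Fv and J = J])
    show "finite (J n)" for n by (rule Jfin)
    show "J m \<subseteq> J n" if "m \<le> n" for m n using that by (auto simp: J_def R_def ring_def)
    show "0 < \<alpha> i" if "i \<in> J n" for i n using that R0[of n] by (auto simp: J_def \<alpha>_def intro!: root4_pos)
    show "cmod (\<Sum>i\<in>J n. \<Sum>j\<in>J n. \<phi> i * K i j * c j) \<le> 1/2 * ?N3 c n * ?N1 \<phi> n" for n c \<phi>
      unfolding form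
      by (rule total[of _ "\<lambda>b. norm34 (R n) (\<lambda>l. c (b, l))" "\<lambda>a. norm14 (R n) (\<lambda>k. \<phi> (a, - k))"])
         (auto intro!: strong Rfin RN n3c n1c')
    show "cmod (\<Sum>i\<in>J n. \<Sum>j\<in>J n. \<phi> i * K i j * c j) \<le> 1/2 * ?N1 c n * ?N3 \<phi> n" for n c \<phi>
      unfolding form
      by (rule total[of _ "\<lambda>b. norm14 (R n) (\<lambda>l. c (b, l))" "\<lambda>a. norm34 (R n) (\<lambda>k. \<phi> (a, - k))"])
         (auto intro!: weak Rfin RN n1c n3c')
    show "(\<lambda>m. \<Sum>j\<in>J m. K i j * v j) \<longlonglongrightarrow> of_real (\<alpha> i ^ 4) * v i - Fv i" if "i \<in> J n" for i n
    proof -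
      obtain a k where i: "i = (a, k)" by (cases i)
      have "(\<lambda>m. q * (\<Sum>b\<in>UNIV. (LINT p|torus. A a b (trig (freq_box m) (fcoeff (U b))) (ek (- k)) p)
          - (LINT p|torus. A a b (trig L (fcoeff (U b))) (ek (- k)) p)))
        \<longlonglongrightarrow> q * (\<Sum>b\<in>UNIV. (LINT p|torus. A a b (U b) (ek (- k)) p) - (LINT p|torus. A a b (trig L (fcoeff (U b))) (ek (- k)) p))"
        by (intro tendsto_intros limit_A)
      moreover have "(\<Sum>j\<in>J m. K i j * v j) = q * (\<Sum>b\<in>UNIV. (LINT p|torus. A a b (trig (freq_box m) (fcoeff (U b))) (ek (- k)) p)
          - (LINT p|torus. A a b (trig L (fcoeff (U b))) (ek (- k)) p))" if m: "N \<le> m" for m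
      proof -
        have freq_box: "freq_box m = L \<union> R m" "L \<inter> R m = {}" using m by (auto simp: L_def R_def ring_def)
        have "(LINT p|torus. A a b (trig (freq_box m) (fcoeff (U b))) (ek (- k)) p)
            = (LINT p|torus. A a b (trig L (fcoeff (U b))) (ek (- k)) p) + (LINT p|torus. A a b (trig (R m) (fcoeff (U b))) (ek (- k)) p)" for b
          unfolding single[symmetric] freq_box(1) by (rule sum.union_disjoint[OF Lfin Rfin freq_box(2)])
        then show ?thesis unfolding Kv i by (simp add: v_def)
      qed
      ultimately have "(\<lambda>m. \<Sum>j\<in>J m. K i j * v j)
        \<longlonglongrightarrow> q * (\<Sum>b\<in>UNIV. (LINT p|torus. A a b (U b) (ek (- k)) p) - (LINT p|torus. A a b (trig L (fcoeff (U b))) (ek (- k)) p))"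
        by (rule_tac Lim_transform_eventually) (auto intro!: eventually_sequentiallyI[of N])
      also have "q * (\<Sum>b\<in>UNIV. (LINT p|torus. A a b (U b) (ek (- k)) p) - (LINT p|torus. A a b (trig L (fcoeff (U b))) (ek (- k)) p))
        = of_real (\<alpha> i ^ 4) * v i - Fv i"
      proof -
        have "of_real (\<alpha> i ^ 4) * v i = of_real \<bar>of_int k\<bar> * fcoeff (U a) k" by (simp add: \<alpha>_def v_def i root4_power4 flip: of_real_power)
        then show ?thesis unfolding coefficient_equation
          by (simp add: i Fv_def q_def sum_subtractf right_diff_distrib)
      qed
      finally show ?thesis .
    qed
    show "?N1 v n \<le> sqrt (\<Sum>b\<in>UNIV. \<Sum>\<^sub>\<infinity>k. \<bar>of_int k\<bar> * (cmod (fcoeff (U b) k))\<^sup>2)" for n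
    proof -
      have "(\<Sum>i\<in>J n. (\<alpha> i * cmod (v i))\<^sup>2) = (\<Sum>b\<in>UNIV. \<Sum>k\<in>R n. (root4 k * cmod (fcoeff (U b) k))\<^sup>2)"
        by (simp add: J_def sum_UNIV_Times \<alpha>_def v_def)
      also have "\<dots> \<le> (\<Sum>b\<in>UNIV. \<Sum>k\<in>R n. \<bar>of_int k\<bar> * (cmod (fcoeff (U b) k))\<^sup>2)"
      \<comment> \<open>Away from frequency 0 the energy weight |k| dominates |k|^(1/2), so finite
        energy bounds the weak norm uniformly in \<open>n\<close>.\<close>
      proof (intro sum_mono)
        fix b k assume k: "k \<in> R n"
        then have "1 \<le> root4 k" using R0[of n] by (intro root4_ge_1) auto
        then have "(root4 k)\<^sup>2 \<le> root4 k ^ 4" by (intro power_increasing) auto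
        then show "(root4 k * cmod (fcoeff (U b) k))\<^sup>2 \<le> \<bar>of_int k\<bar> * (cmod (fcoeff (U b) k))\<^sup>2"
          by (simp add: power_mult_distrib root4_power4 mult_right_mono)
      qed
      also have "\<dots> \<le> (\<Sum>b\<in>UNIV. \<Sum>\<^sub>\<infinity>k. \<bar>of_int k\<bar> * (cmod (fcoeff (U b) k))\<^sup>2)"
        by (intro sum_mono finite_sum_le_infsum U_energy Rfin) auto
      finally show ?thesis unfolding L2_set_def by (rule real_sqrt_le_mono)
    qed
    show "0 \<le> C" unfolding C_def by (intro sum_nonneg add_nonneg_nonneg mult_nonneg_nonneg) auto
    show "cmod (\<Sum>i\<in>J n. \<phi> i * Fv i) \<le> C * ?N1 \<phi> n" for n \<phi>
    proof -
      have N1: "0 \<le> ?N1 \<phi> n" by simp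
      have split: "(\<Sum>i\<in>J n. \<phi> i * Fv i) = (\<Sum>a\<in>UNIV. (\<Sum>k\<in>R n. \<phi> (a, k) * fcoeff (F a) k)
        + q * (\<Sum>b\<in>UNIV. LINT p|torus. A a b (trig L (fcoeff (U b))) (trig (R n) (\<lambda>k. \<phi> (a, - k))) p))"
      proof -
        have "(\<Sum>k\<in>R n. \<phi> (a, k) * (q * (\<Sum>b\<in>UNIV. LINT p|torus. A a b (trig L (fcoeff (U b))) (ek (- k)) p)))
          = q * (\<Sum>b\<in>UNIV. LINT p|torus. A a b (trig L (fcoeff (U b))) (trig (R n) (\<lambda>k. \<phi> (a, - k))) p)" for a
        proof -
          have "(\<Sum>k\<in>R n. \<phi> (a, k) * (q * (\<Sum>b\<in>UNIV. LINT p|torus. A a b (trig L (fcoeff (U b))) (ek (- k)) p)))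
            = q * (\<Sum>k\<in>R n. \<Sum>b\<in>UNIV. \<phi> (a, k) * (LINT p|torus. A a b (trig L (fcoeff (U b))) (ek (- k)) p))"
            by (simp add: sum_distrib_left mult_ac)
          also have "\<dots> = q * (\<Sum>b\<in>UNIV. \<Sum>k\<in>R n. \<phi> (a, k) * (LINT p|torus. A a b (trig L (fcoeff (U b))) (ek (- k)) p))"
            by (intro arg_cong[of _ _ "\<lambda>x. q * x"]) (rule sum.swap)
          finally show ?thesis unfolding pairing[OF refl] .
        qed
        then show ?thesis unfolding J_def sum_UNIV_Times Fv_def fst_conv snd_conv distrib_left sum.distrib by simp
      qed
      have t1: "cmod (\<Sum>k\<in>R n. \<phi> (a, k) * fcoeff (F a) k) \<le> L2_norm circle (F a) * ?N1 \<phi> n" for a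
      proof -
        have "cmod (\<Sum>k\<in>R n. \<phi> (a, k) * fcoeff (F a) k) \<le> (\<Sum>k\<in>R n. \<bar>cmod (\<phi> (a, k))\<bar> * \<bar>cmod (fcoeff (F a) k)\<bar>)"
          by (rule order_trans[OF norm_sum]) (simp add: norm_mult)
        also have "\<dots> \<le> L2_set (\<lambda>k. cmod (\<phi> (a, k))) (R n) * L2_set (\<lambda>k. cmod (fcoeff (F a) k)) (R n)"
          by (rule L2_set_mult_ineq)
        also have "\<dots> \<le> ?N1 \<phi> n * L2_norm circle (F a)"
        proof (rule mult_mono)
          have "L2_set (\<lambda>k. cmod (\<phi> (a, k))) (R n) \<le> norm14 (R n) (\<lambda>k. \<phi> (a, k))"
            unfolding norm14_def
          proof (rule L2_set_mono)
            fix k assume "k \<in> R n"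
            then have "1 \<le> root4 k" using R0[of n] by (intro root4_ge_1) auto
            then show "cmod (\<phi> (a, k)) \<le> root4 k * cmod (\<phi> (a, k))" by (simp add: mult_le_cancel_right1)
          qed simp
          then show "L2_set (\<lambda>k. cmod (\<phi> (a, k))) (R n) \<le> ?N1 \<phi> n" using n1c[of n \<phi> a] by linarith
          have "(\<Sum>k\<in>R n. (cmod (fcoeff (F a) k))\<^sup>2) \<le> 2 * pi * (\<Sum>k\<in>R n. (cmod (fcoeff (F a) k))\<^sup>2)"
            using pi_gt3 mult_right_mono[of 1 "2 * pi" "\<Sum>k\<in>R n. (cmod (fcoeff (F a) k))\<^sup>2"]
            by (simp add: sum_nonneg)
          also have "\<dots> \<le> (L2_norm circle (F a))\<^sup>2" by (rule Bessel[OF F_sq Rfin])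
          finally show "L2_set (\<lambda>k. cmod (fcoeff (F a) k)) (R n) \<le> L2_norm circle (F a)"
            unfolding L2_set_def by (rule real_le_lsqrt[rotated -1]) (auto simp: sum_nonneg)
        qed auto
        finally show ?thesis by (simp add: mult.commute)
      qed
      have t2: "cmod (LINT p|torus. A a b (trig L (fcoeff (U b))) (trig (R n) (\<lambda>k. \<phi> (a, - k))) p)
        \<le> 2 * (L2_norm torus (\<lambda>p. of_real (H p)) * (sqrt 176 * pi) * norm34 L (fcoeff (U b))) * ?N1 \<phi> n" for a b
      proof -
        have "cmod (LINT p|torus. A a b (trig L (fcoeff (U b))) (trig (R n) (\<lambda>k. \<phi> (a, - k))) p)
          \<le> 2 * NN (trig L (fcoeff (U b))) (trig (R n) (\<lambda>k. \<phi> (a, - k)))"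
          by (rule A_bound_strong) (use Lfin Rfin in auto)
        also have "\<dots> \<le> 2 * (L2_norm torus (\<lambda>p. of_real (H p)) * (sqrt 176 * pi) * norm34 L (fcoeff (U b)) * norm14 (R n) (\<lambda>k. \<phi> (a, - k)))"
          by (intro mult_left_mono NN_le Lfin Rfin R0) auto
        also have "\<dots> \<le> 2 * (L2_norm torus (\<lambda>p. of_real (H p)) * (sqrt 176 * pi) * norm34 L (fcoeff (U b)) * ?N1 \<phi> n)"
          by (intro mult_left_mono n1c') auto
        finally show ?thesis by (simp only: mult.assoc)
      qed
      have "cmod (\<Sum>i\<in>J n. \<phi> i * Fv i) \<le> (\<Sum>a\<in>UNIV. L2_norm circle (F a) * ?N1 \<phi> n
        + 1 * (\<Sum>b\<in>UNIV. 2 * (L2_norm torus (\<lambda>p. of_real (H p)) * (sqrt 176 * pi) * norm34 L (fcoeff (U b))) * ?N1 \<phi> n))"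
        unfolding split
        by (intro order_trans[OF norm_sum] sum_mono order_trans[OF norm_triangle_ineq] add_mono t1)
           (unfold norm_mult, intro mult_mono q1 order_trans[OF norm_sum] sum_mono t2, auto)
      also have "\<dots> = C * ?N1 \<phi> n"
        unfolding C_def by (simp add: sum_distrib_right distrib_right)
      finally show ?thesis .
    qed
  qed
  have C0: "0 \<le> 2 * C" using main[of 0] order_trans[OF L2_set_nonneg] by blast
  have "(\<Sum>k\<in>ring N n. (root4 k ^ 3 * cmod (fcoeff (U b) k))\<^sup>2) \<le> (2 * C)\<^sup>2" for n b
  proof -
    have "norm34 (R n) (fcoeff (U b)) \<le> ?N3 v n" using n3c[of n v b] by (simp add: v_def)
    also have "\<dots> \<le> 2 * C" by (rule main)
    finally have "(norm34 (R n) (fcoeff (U b)))\<^sup>2 \<le> (2 * C)\<^sup>2" by (rule power_mono) simp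
    then show ?thesis by (simp add: norm34_power2 R_def)
  qed
  then show ?thesis by blast
qed

lemma H34_bound_box: "\<exists>D\<ge>0. \<forall>n. (\<Sum>k\<in>freq_box n. (root4 k ^ 3 * cmod (fcoeff (U b) k))\<^sup>2) \<le> D"
proof -
  obtain N D where ND: "\<And>n b. (\<Sum>k\<in>ring N n. (root4 k ^ 3 * cmod (fcoeff (U b) k))\<^sup>2) \<le> D"
    using H34_bound by blast
  let ?f = "\<lambda>k. (root4 k ^ 3 * cmod (fcoeff (U b) k))\<^sup>2"
  have "sum ?f (freq_box n) \<le> sum ?f (freq_box N) + D" for n
  proof -
    have "sum ?f (freq_box n) \<le> sum ?f (freq_box N \<union> ring N n)"
    proof (rule sum_mono2)
      show "freq_box n \<subseteq> freq_box N \<union> ring N n" by (auto simp: ring_def)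
    qed auto
    also have "\<dots> \<le> sum ?f (freq_box N) + sum ?f (ring N n)"
      by (subst sum.union_inter[symmetric]) (auto intro: sum_nonneg)
    finally show ?thesis using ND[of b n] by linarith
  qed
  moreover have "0 \<le> sum ?f (freq_box N) + D" using ND[of b 0] sum_nonneg[of "ring N 0" ?f] sum_nonneg[of "freq_box N" ?f]
    by (smt (verit) zero_le_power2)
  ultimately show ?thesis by blast
qed

text \<open>Fatou twice: in \<open>y\<close> for fixed \<open>x\<close>, to compare the square
  function of \<open>u\<close> with those of its partial sums, then in \<open>x\<close> for the
  squares, whose integrals are bounded by the H^(3/4) bound.\<close>

lemma carre_U_sq: "sq_integrable circle (\<lambda>x. of_real (carre (U b) x))"
proof -
  obtain D where D: "0 \<le> D" "\<And>n. (\<Sum>k\<in>freq_box n. (root4 k ^ 3 * cmod (fcoeff (U b) k))\<^sup>2) \<le> D"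
    using H34_bound_box by blast
  obtain r where r: "strict_mono r" "AE x in circle. (\<lambda>j. trig (freq_box (r j)) (fcoeff (U b)) x) \<longlonglongrightarrow> U b x"
    using trig_subsequence_AE[OF U_sq] by blast
  define T where "T j = trig (freq_box (r j)) (fcoeff (U b))" for j
  let ?B = "(2 * pi)\<^sup>2 * (88 * pi) * D\<^sup>2"
  have Tm: "T j \<in> borel_measurable circle" for j unfolding T_def by (intro borel_measurable_circle borel_measurable_trig)
  have DTm: "(\<lambda>y. DD (T j) (x, y)) \<in> borel_measurable circle" if "x \<in> space circle" for j x
    using measurable_compose[OF measurable_Pair1'[of x circle circle] borel_measurable_DD[OF Tm]] that by simp
  have cm: "(\<lambda>x. ennreal (carre (T j) x)) \<in> borel_measurable circle" for j
    using borel_measurable_carre[OF Tm] by measurable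
  have nnT: "(\<integral>\<^sup>+y. ennreal ((cmod (DD (T j) (x, y)))\<^sup>2) \<partial>circle) = ennreal (carre (T j) x)" if x: "x \<in> space circle" for j x
  proof -
    have "sq_integrable circle (\<lambda>y. DD (T j) (x, y))"
      unfolding T_def by (rule circle.sq_integrable_bounded[OF DTm[OF x, unfolded T_def] cmod_DD_trig_le])
    then show ?thesis unfolding carre_def by (intro nn_integral_eq_integral) (auto simp: sq_integrable_def)
  qed
  have int2: "(\<integral>\<^sup>+x. (ennreal (carre (T j) x))\<^sup>2 \<partial>circle) \<le> ennreal ?B" for j
  proof -
    have sq: "sq_integrable circle (\<lambda>x. complex_of_real (carre (T j) x))"
    proof (rule circle.sq_integrable_bounded)
      show "(\<lambda>x. complex_of_real (carre (T j) x)) \<in> borel_measurable circle"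
        using borel_measurable_carre[OF Tm] by simp
      let ?M = "(\<Sum>k\<in>freq_box (r j). cmod (fcoeff (U b) k) * \<bar>of_int k\<bar>)\<^sup>2"
      fix x assume x: "x \<in> space circle"
      have "carre (T j) x \<le> (LINT y|circle. ?M)"
        unfolding carre_def
      proof (rule integral_mono_AE')
        show "AE y in circle. (cmod (DD (T j) (x, y)))\<^sup>2 \<le> ?M"
          unfolding T_def by (intro AE_I2 power_mono cmod_DD_trig_le) simp
      qed auto
      also have "\<dots> = 2 * pi * ?M" using measure_circle by simp
      finally show "cmod (complex_of_real (carre (T j) x)) \<le> 2 * pi * ?M" by simp
    qed
    have "(\<integral>\<^sup>+x. (ennreal (carre (T j) x))\<^sup>2 \<partial>circle) = ennreal ((L2_norm circle (\<lambda>x. complex_of_real (carre (T j) x)))\<^sup>2)"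
      using nn_integral_L2_norm[OF sq] by (simp add: ennreal_power norm_power)
    also have "(L2_norm circle (\<lambda>x. complex_of_real (carre (T j) x)))\<^sup>2 \<le> (2 * pi)\<^sup>2 * (88 * pi) * (\<Sum>k\<in>freq_box (r j). (root4 k ^ 3 * cmod (fcoeff (U b) k))\<^sup>2)\<^sup>2"
      unfolding T_def by (rule L2_norm_carre_trig) simp
    also have "\<dots> \<le> ?B" by (intro mult_left_mono power_mono D(2) sum_nonneg) auto
    finally show ?thesis by (simp add: ennreal_leI)
  qed
  \<comment> \<open>For these \<open>x\<close> the Bochner integral in \<open>carre\<close> agrees
    with the nonnegative integral; without integrability it would be 0.\<close>
  have "AE x in circle. integrable circle (\<lambda>y. (cmod (DD (U b) (x, y)))\<^sup>2)"
    using DD_U_sq[of b] by (intro circle2.AE_integrable_fst') (simp add: sq_integrable_def)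
  then have "AE x in circle. ennreal (carre (U b) x) \<le> liminf (\<lambda>j. ennreal (carre (T j) x))"
    using r(2) AE_space
  proof eventually_elim
    case (elim x)
    have "ennreal (carre (U b) x) = (\<integral>\<^sup>+y. ennreal ((cmod (DD (U b) (x, y)))\<^sup>2) \<partial>circle)"
      unfolding carre_def by (rule nn_integral_eq_integral[symmetric]) (use elim(1) in auto)
    also have "\<dots> = (\<integral>\<^sup>+y. liminf (\<lambda>j. ennreal ((cmod (DD (T j) (x, y)))\<^sup>2)) \<partial>circle)"
    proof (rule nn_integral_cong_AE)
      show "AE y in circle. ennreal ((cmod (DD (U b) (x, y)))\<^sup>2) = liminf (\<lambda>j. ennreal ((cmod (DD (T j) (x, y)))\<^sup>2))"
        using r(2)
      proof eventually_elim
        case (elim y)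
        have "(\<lambda>j. DD (T j) (x, y)) \<longlonglongrightarrow> DD (U b) (x, y)"
          unfolding DD_def T_def divide_inverse fst_conv snd_conv
          by (intro tendsto_mult tendsto_diff tendsto_const elim \<open>(\<lambda>j. trig (freq_box (r j)) (fcoeff (U b)) x) \<longlonglongrightarrow> U b x\<close>)
        then have "(\<lambda>j. ennreal ((cmod (DD (T j) (x, y)))\<^sup>2)) \<longlonglongrightarrow> ennreal ((cmod (DD (U b) (x, y)))\<^sup>2)"
          by (intro tendsto_ennrealI tendsto_intros)
        from lim_imp_Liminf[OF sequentially_bot this] show ?case by simp
      qed
    qed
    also have "\<dots> \<le> liminf (\<lambda>j. \<integral>\<^sup>+y. ennreal ((cmod (DD (T j) (x, y)))\<^sup>2) \<partial>circle)"
      by (rule nn_integral_liminf) (use DTm[OF elim(3)] in measurable)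
    also have "\<dots> = liminf (\<lambda>j. ennreal (carre (T j) x))" unfolding nnT[OF elim(3)] ..
    finally show ?case .
  qed
  then have "AE x in circle. (ennreal (carre (U b) x))\<^sup>2 \<le> liminf (\<lambda>j. (ennreal (carre (T j) x))\<^sup>2)"
    by eventually_elim (rule order_trans[OF power_mono liminf_power2_le], auto)
  then have "(\<integral>\<^sup>+x. (ennreal (carre (U b) x))\<^sup>2 \<partial>circle) \<le> (\<integral>\<^sup>+x. liminf (\<lambda>j. (ennreal (carre (T j) x))\<^sup>2) \<partial>circle)"
    by (rule nn_integral_mono_AE)
  also have "\<dots> \<le> liminf (\<lambda>j. \<integral>\<^sup>+x. (ennreal (carre (T j) x))\<^sup>2 \<partial>circle)"
    by (rule nn_integral_liminf) (use cm in measurable)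
  also have "\<dots> \<le> ennreal ?B" using int2 by (intro Liminf_le always_eventually allI) auto
  finally have fin: "(\<integral>\<^sup>+x. (ennreal (carre (U b) x))\<^sup>2 \<partial>circle) < \<infinity>"
    by (rule order_le_less_trans) simp
  have m: "carre (U b) \<in> borel_measurable circle" by (rule borel_measurable_carre[OF U_measurable])
  have "integrable circle (\<lambda>x. (carre (U b) x)\<^sup>2)"
    by (rule integrableI_bounded) (use m fin in \<open>auto simp: ennreal_power\<close>)
  then show ?thesis using m by (simp add: sq_integrable_def norm_power)
qed

text \<open>\<open>G\<close> is the sum of the square functions of the components over 2 pi,
  wherever their integrals exist.\<close>

lemma G_sq: "sq_integrable circle G"
proof -
  have "AE x in circle. \<forall>b\<in>UNIV. integrable circle (\<lambda>y. (cmod (DD (U b) (x, y)))\<^sup>2)"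
    using DD_U_sq by (intro AE_finite_allI circle2.AE_integrable_fst') (auto simp: sq_integrable_def)
  then have ae: "AE x in circle. (\<Sum>b\<in>UNIV. (1 / (2 * pi)) * complex_of_real (carre (U b) x)) = G x"
  proof eventually_elim
    case (elim x)
    then have "half_gradient_sq u x = (\<Sum>b\<in>UNIV. carre (U b) x) / (2 * pi)"
      unfolding half_gradient_sq_eq e_eq carre_def by (subst Bochner_Integration.integral_sum) auto
    then show ?case by (simp add: G_def sum_divide_distrib)
  qed
  have "sq_integrable circle (\<lambda>x. \<Sum>b\<in>UNIV. (1 / (2 * pi)) * complex_of_real (carre (U b) x))"
    by (intro sq_integrable_sum sq_integrable_cmult carre_U_sq)
  then show ?thesis using ae borel_measurable_integrable[OF G_integrable] by (rule_tac sq_integrable_AE_cong)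
qed

text \<open>Now both terms on the right of the equation are coefficients of square integrable
  functions, so Bessel's inequality bounds |k| times the coefficient of \<open>u\<close>.\<close>

lemma H1_summable: "(\<lambda>k. (of_int k)\<^sup>2 * (cmod (fcoeff (U a) k))\<^sup>2) summable_on UNIV"
proof -
  have GU: "sq_integrable circle (\<lambda>x. G x * U a x)"
    using sq_integrable_mult_bounded[OF G_sq U_measurable cmod_U_le] by (simp add: mult.commute)
  have s: "(\<lambda>k. 2 * (cmod (fcoeff (\<lambda>x. G x * U a x) k))\<^sup>2 + 2 * (cmod (fcoeff (F a) k))\<^sup>2) summable_on UNIV"
    by (intro summable_on_add summable_on_cmult_right Bessel_summable GU F_sq)
  show ?thesis
  proof (rule summable_on_comparison_test[OF s])
    fix k :: int
    let ?x = "fcoeff (\<lambda>x. G x * U a x) k" and ?y = "fcoeff (F a) k"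
    have "(of_int k)\<^sup>2 * (cmod (fcoeff (U a) k))\<^sup>2 = (cmod (of_real \<bar>of_int k\<bar> * fcoeff (U a) k))\<^sup>2"
      by (simp add: norm_mult power_mult_distrib)
    also have "\<dots> \<le> (cmod ?x + cmod ?y)\<^sup>2"
      unfolding U_equation by (intro power_mono norm_triangle_ineq) simp
    also have "\<dots> \<le> 2 * (cmod ?x)\<^sup>2 + 2 * (cmod ?y)\<^sup>2"
      using sum_squares_bound[of "cmod ?x" "cmod ?y"] by (simp add: power2_sum)
    finally show "(of_int k)\<^sup>2 * (cmod (fcoeff (U a) k))\<^sup>2 \<le> 2 * (cmod ?x)\<^sup>2 + 2 * (cmod ?y)\<^sup>2" .
  qed simp
qed

end

section \<open>Test functions\<close>

text \<open>The recursion of \<open>Ck\<close> in one variable, so that products of a function of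
  time and a function of space are handled by parallel induction. Differentiability already yields
  continuity in the successor case.\<close>

fun smooth_upto :: "nat \<Rightarrow> (real \<Rightarrow> real) \<Rightarrow> bool" where
  "smooth_upto 0 g \<longleftrightarrow> continuous_on UNIV g"
| "smooth_upto (Suc k) g \<longleftrightarrow> (\<exists>g'. smooth_upto k g' \<and> (\<forall>t. (g has_real_derivative g' t) (at t)))"

lemma smooth_upto_imp_continuous: "smooth_upto k g \<Longrightarrow> continuous_on UNIV g"
proof (cases k)
  case (Suc l)
  assume "smooth_upto k g"
  then obtain g' where "\<And>t. (g has_real_derivative g' t) (at t)" using Suc by auto
  then show ?thesis by (intro continuous_at_imp_continuous_on ballI) (rule DERIV_isCont)
qed auto

lemma smooth_upto_Suc: "smooth_upto (Suc k) g \<Longrightarrow> smooth_upto k g"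
proof (induction k arbitrary: g)
  case 0
  from smooth_upto_imp_continuous[OF 0] show ?case by simp
next
  case (Suc k)
  then obtain g' where "smooth_upto (Suc k) g'" "\<forall>t. (g has_real_derivative g' t) (at t)" by auto
  then show ?case using Suc.IH by auto
qed

text \<open>General coefficients cover at once all derivative formulas below, which are therefore
  written in this shape even where a coefficient is 0 or 1.\<close>

lemma smooth_upto_lincomb: "smooth_upto k g \<Longrightarrow> smooth_upto k h \<Longrightarrow> smooth_upto k (\<lambda>t. a * g t + b * h t)"
proof (induction k arbitrary: g h)
  case 0
  then show ?case by (auto intro!: continuous_intros)
next
  case (Suc k)
  then obtain g' h' where *: "smooth_upto k g'" "smooth_upto k h'"
    "\<And>t. (g has_real_derivative g' t) (at t)" "\<And>t. (h has_real_derivative h' t) (at t)" by auto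
  have "((\<lambda>t. a * g t + b * h t) has_real_derivative a * g' t + b * h' t) (at t)" for t
    by (intro DERIV_add DERIV_cmult *)
  then show ?case using Suc.IH[OF *(1,2)] by auto
qed

lemma smooth_upto_mult: "smooth_upto k g \<Longrightarrow> smooth_upto k h \<Longrightarrow> smooth_upto k (\<lambda>t. g t * h t)"
proof (induction k arbitrary: g h)
  case 0
  then show ?case by (auto intro!: continuous_intros)
next
  case (Suc k)
  then obtain g' h' where *: "smooth_upto k g'" "smooth_upto k h'"
    "\<And>t. (g has_real_derivative g' t) (at t)" "\<And>t. (h has_real_derivative h' t) (at t)" by auto
  have d: "((\<lambda>t. g t * h t) has_real_derivative 1 * (g' t * h t) + 1 * (h' t * g t)) (at t)" for t
    using DERIV_mult[OF *(3,4)] by simp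
  have "smooth_upto k (\<lambda>t. 1 * (g' t * h t) + 1 * (h' t * g t))"
    by (intro smooth_upto_lincomb Suc.IH *(1,2) Suc.prems[THEN smooth_upto_Suc])
  then show ?case using d by auto
qed

lemma smooth_upto_affine: "smooth_upto k g \<Longrightarrow> smooth_upto k (\<lambda>t. g (a * t + b))"
proof (induction k arbitrary: g)
  case 0
  then show ?case by (auto intro!: continuous_intros continuous_on_compose2[of UNIV g])
next
  case (Suc k)
  then obtain g' where *: "smooth_upto k g'" "\<And>t. (g has_real_derivative g' t) (at t)" by auto
  have d: "((\<lambda>t. g (a * t + b)) has_real_derivative a * g' (a * t + b) + 0 * g' (a * t + b)) (at t)" for t
  proof -
    have "((\<lambda>t. a * t + b) has_real_derivative a) (at t)" by (auto intro!: derivative_eq_intros)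
    from DERIV_chain2[OF *(2) this] show ?thesis by (simp add: mult.commute)
  qed
  have "smooth_upto k (\<lambda>t. a * g' (a * t + b) + 0 * g' (a * t + b))"
    by (intro smooth_upto_lincomb Suc.IH *)
  then show ?case using d by auto
qed

lemma smooth_upto_trigonometric: "smooth_upto k (\<lambda>x. a * cos (c * x) + b * sin (c * x))"
proof (induction k arbitrary: a b)
  case (Suc k)
  have "((\<lambda>x. a * cos (c * x) + b * sin (c * x)) has_real_derivative (b * c) * cos (c * x) + (- a * c) * sin (c * x)) (at x)" for x
    by (auto intro!: derivative_eq_intros)
  then show ?case using Suc[of "b * c" "- a * c"] by auto
qed (auto intro!: continuous_intros)

text \<open>The classical flat function exp(-1/t) is \<open>m = 0\<close>. The powers of 1/t are
  included because the whole family is closed under differentiation up to linear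
  combinations.\<close>

definition flat :: "nat \<Rightarrow> real \<Rightarrow> real" where
  "flat m t = (if t \<le> 0 then 0 else exp (- 1 / t) / t ^ m)"

text \<open>A single term of the exponential series of 1/t beats the power t^m and leaves a factor
  t.\<close>

lemma abs_flat_le: "\<bar>flat m t\<bar> \<le> fact (Suc m) * \<bar>t\<bar>"
proof (cases "t \<le> 0")
  case False
  have "(1 / t) ^ Suc m / fact (Suc m) \<le> exp (1 / t)"
  proof -
    have "(\<Sum>n\<in>{Suc m}. (1 / t) ^ n /\<^sub>R fact n) \<le> exp (1 / t)"
      unfolding exp_def by (rule sum_le_suminf[OF summable_exp_generic]) (use False in auto)
    then show ?thesis by (simp add: divide_inverse mult.commute)
  qed
  then have "1 / t ^ Suc m / fact (Suc m) \<le> exp (1 / t)" by (simp only: power_one_over)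
  moreover have arith: "1 \<le> c * X * E" if "1 / X / c \<le> E" "0 < X" "0 < c" for c X E :: real
    using that by (simp add: field_simps)
  ultimately have "1 \<le> fact (Suc m) * t ^ Suc m * exp (1 / t)"
    using False by (intro arith) (auto simp del: fact_Suc power_Suc)
  then have "exp (- 1 / t) \<le> fact (Suc m) * t ^ Suc m"
    using False by (simp add: exp_minus field_simps)
  then have "exp (- 1 / t) / t ^ m \<le> fact (Suc m) * t" using False by (simp add: pos_divide_le_eq mult_ac)
  then show ?thesis using False by (simp add: flat_def)
next
  case True
  have "0 \<le> fact (Suc m) * \<bar>t\<bar>" by (intro mult_nonneg_nonneg) auto
  moreover have "flat m t = 0" using True by (simp add: flat_def)
  ultimately show ?thesis by (simp only: abs_zero)
qed

lemma flat_has_derivative: "(flat m has_real_derivative (- real m) * flat (Suc m) t + 1 * flat (Suc (Suc m)) t) (at t)"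
proof (cases t "0::real" rule: linorder_cases)
  case less
  have "((\<lambda>_. 0) has_real_derivative 0) (at t)" by simp
  then have "(flat m has_real_derivative 0) (at t)"
  proof (rule has_field_derivative_transform_within_open)
    show "open {..<0::real}" "t \<in> {..<0}" using less by auto
  qed (auto simp: flat_def)
  then show ?thesis using less by (simp add: flat_def)
next
  case greater
  have d: "((\<lambda>t. exp (- 1 / t) / t ^ m) has_real_derivative
      ((exp (- 1 / t) * (1 / t\<^sup>2)) * t ^ m - exp (- 1 / t) * (real m * t ^ (m - 1))) / (t ^ m * t ^ m)) (at t)"
    using greater by (auto intro!: derivative_eq_intros simp: power2_eq_square)
  have "((exp (- 1 / t) * (1 / t\<^sup>2)) * t ^ m - exp (- 1 / t) * (real m * t ^ (m - 1))) / (t ^ m * t ^ m)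
     = (- real m) * flat (Suc m) t + 1 * flat (Suc (Suc m)) t"
    using greater by (cases m) (auto simp: flat_def field_simps power2_eq_square)
  with d have "((\<lambda>t. exp (- 1 / t) / t ^ m) has_real_derivative (- real m) * flat (Suc m) t + 1 * flat (Suc (Suc m)) t) (at t)"
    by simp
  then show ?thesis
  proof (rule has_field_derivative_transform_within_open)
    show "open {0::real<..}" "t \<in> {0<..}" using greater by auto
  qed (auto simp: flat_def)
next
  case equal
  have "(flat m has_real_derivative 0) (at 0)"
    unfolding has_field_derivative_iff
  proof (rule Lim_null_comparison)
    show "\<forall>\<^sub>F y in at 0. norm ((flat m y - flat m 0) / (y - 0)) \<le> fact (Suc (Suc m)) * \<bar>y\<bar>"
    proof (rule always_eventually, rule allI)
      fix y :: real
      \<comment> \<open>The difference quotient at 0 is the next member of the family, so the linear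
        bound for that member gives derivative 0.\<close>
      have "(flat m y - flat m 0) / (y - 0) = flat (Suc m) y" by (simp add: flat_def)
      then show "norm ((flat m y - flat m 0) / (y - 0)) \<le> fact (Suc (Suc m)) * \<bar>y\<bar>"
        using abs_flat_le[of "Suc m" y] by simp
    qed
    have "((\<lambda>y::real. fact (Suc (Suc m)) * \<bar>y\<bar>) \<longlongrightarrow> fact (Suc (Suc m)) * \<bar>0\<bar>) (at 0)"
      by (intro tendsto_intros)
    then show "((\<lambda>y::real. fact (Suc (Suc m)) * \<bar>y\<bar>) \<longlongrightarrow> 0) (at 0)" by simp
  qed
  then show ?thesis using equal by (simp add: flat_def)
qed

lemma smooth_upto_flat: "smooth_upto k (flat m)"
proof (induction k arbitrary: m)
  case 0
  have "isCont (flat m) t" for t by (rule DERIV_isCont[OF flat_has_derivative])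
  then show ?case by (auto intro: continuous_at_imp_continuous_on)
next
  case (Suc k)
  have "smooth_upto k (\<lambda>t. (- real m) * flat (Suc m) t + 1 * flat (Suc (Suc m)) t)"
    by (intro smooth_upto_lincomb Suc)
  then show ?case using flat_has_derivative by auto
qed

text \<open>As \<open>flat 0\<close> tends to 1 at infinity, stretching the two factors makes the
  product tend to the indicator of the open interval, from within the unit interval. The arguments
  are spelled out as affine functions to fit \<open>smooth_upto_affine\<close>.\<close>

definition bump :: "real \<Rightarrow> real \<Rightarrow> nat \<Rightarrow> real \<Rightarrow> real" where
  "bump a b n t = flat 0 (real (Suc n) * t + (- real (Suc n) * a)) * flat 0 (- real (Suc n) * t + real (Suc n) * b)"

lemma smooth_upto_bump: "smooth_upto k (bump a b n)"
  unfolding bump_def[abs_def] by (intro smooth_upto_mult smooth_upto_affine smooth_upto_flat)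

lemma flat_0_bounds: "0 \<le> flat 0 t" "flat 0 t \<le> 1"
  by (auto simp: flat_def)

lemma bump_bounds: "0 \<le> bump a b n t" "bump a b n t \<le> 1"
  unfolding bump_def using flat_0_bounds by (auto intro!: mult_nonneg_nonneg mult_le_one)

lemma bump_outside: "t \<notin> {a<..<b} \<Longrightarrow> bump a b n t = 0"
proof -
  assume t: "t \<notin> {a<..<b}"
  have eq: "real (Suc n) * t + (- real (Suc n) * a) = real (Suc n) * (t - a)"
    "- real (Suc n) * t + real (Suc n) * b = real (Suc n) * (b - t)" by (simp_all add: algebra_simps)
  show ?thesis
  proof (cases "t \<le> a")
    case True
    then have "real (Suc n) * (t - a) \<le> 0" by (intro mult_nonneg_nonpos) auto
    then show ?thesis unfolding bump_def eq by (simp add: flat_def)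
  next
    case False
    then have "real (Suc n) * (b - t) \<le> 0" using t by (intro mult_nonneg_nonpos) auto
    then show ?thesis unfolding bump_def eq by (simp add: flat_def)
  qed
qed

lemma flat_0_scaled_tendsto:
  assumes "s > 0" shows "(\<lambda>n. flat 0 (real (Suc n) * s)) \<longlonglongrightarrow> 1"
proof -
  have "(\<lambda>n. exp (- (1 / s) * (1 / real (Suc n)))) \<longlonglongrightarrow> exp (- (1 / s) * 0)"
    by (intro tendsto_intros LIMSEQ_Suc[OF lim_1_over_n])
  moreover have "flat 0 (real (Suc n) * s) = exp (- (1 / s) * (1 / real (Suc n)))" for n
    using assms by (simp add: flat_def not_le mult_pos_pos mult.commute)
  ultimately show ?thesis by simp
qed

lemma bump_tendsto: "(\<lambda>n. bump a b n t) \<longlonglongrightarrow> indicator {a<..<b} t"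
proof (cases "t \<in> {a<..<b}")
  case True
  have "bump a b n t = flat 0 (real (Suc n) * (t - a)) * flat 0 (real (Suc n) * (b - t))" for n
    unfolding bump_def by (simp add: algebra_simps)
  moreover have "(\<lambda>n. flat 0 (real (Suc n) * (t - a)) * flat 0 (real (Suc n) * (b - t))) \<longlonglongrightarrow> 1 * 1"
    by (intro tendsto_mult flat_0_scaled_tendsto) (use True in auto)
  ultimately show ?thesis using True by simp
qed (simp add: bump_outside)

lemma continuous_bump: "continuous_on UNIV (bump a b n)"
  by (rule smooth_upto_imp_continuous[OF smooth_upto_bump[of 0]])

text \<open>Separated variables suffice as test functions, since time and Fourier modes are
  localised independently.\<close>

lemma Ck_product:
  assumes "smooth_upto k g" "smooth_upto k c"
  shows "Ck k (\<lambda>t x. (g t * c x) *\<^sub>R (w :: real ^ 'n))"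
  using assms
proof (induction k arbitrary: g c)
  case 0
  have "continuous_on UNIV (\<lambda>p. (g (fst p) * c (snd p)) *\<^sub>R w)"
    using 0 by (auto intro!: continuous_intros continuous_on_compose2[of UNIV g] continuous_on_compose2[of UNIV c])
  then show ?case by (simp add: case_prod_unfold)
next
  case (Suc k)
  obtain g' c' where *: "smooth_upto k g'" "smooth_upto k c'"
    "\<And>t. (g has_real_derivative g' t) (at t)" "\<And>t. (c has_real_derivative c' t) (at t)" using Suc.prems by auto
  have "continuous_on UNIV (\<lambda>p. (g (fst p) * c (snd p)) *\<^sub>R w)"
    using Suc.prems[THEN smooth_upto_imp_continuous]
    by (auto intro!: continuous_intros continuous_on_compose2[of UNIV g] continuous_on_compose2[of UNIV c])
  moreover have "((\<lambda>s. (g s * c x) *\<^sub>R w) has_vector_derivative (g' t * c x) *\<^sub>R w) (at t)" for t x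
    using has_vector_derivative_scaleR[OF DERIV_cmult_right[OF *(3), of "c x" t] has_vector_derivative_const[of w]]
    by simp
  moreover have "((\<lambda>y. (g t * c y) *\<^sub>R w) has_vector_derivative (g t * c' x) *\<^sub>R w) (at x)" for t x
    using has_vector_derivative_scaleR[OF DERIV_cmult[OF *(4), of "g t" x] has_vector_derivative_const[of w]]
    by simp
  moreover have "Ck k (\<lambda>t x. (g' t * c x) *\<^sub>R w)" "Ck k (\<lambda>t x. (g t * c' x) *\<^sub>R w)"
    by (intro Suc.IH *(1,2) Suc.prems[THEN smooth_upto_Suc])+
  ultimately show ?case by (auto simp: case_prod_unfold)
qed

lemma test_function_bump:
  assumes c: "\<And>k. smooth_upto k c" "\<And>x. c (x + 2 * pi) = c x" and ab: "0 < a" "a \<le> b"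
  shows "test_function (\<lambda>t x. (bump a b n t * c x) *\<^sub>R (w :: real ^ 'n))"
  unfolding test_function_def
proof (intro conjI allI, goal_cases)
  case 3
  have "(bump a b n t * c x) *\<^sub>R w = 0" if "t \<notin> {a..b}" for t x
    using that by (subst bump_outside) auto
  then show ?case using ab by blast
qed (use c in \<open>auto intro!: Ck_product smooth_upto_bump\<close>)

text \<open>The fundamental lemma of the calculus of variations on the half-line. Integrability is
  asked only on bounded intervals away from 0.\<close>

lemma AE_zero_if_bump_integrals_zero:
  fixes q :: "real \<Rightarrow> real"
  assumes q: "\<And>a b. 0 < a \<Longrightarrow> a \<le> b \<Longrightarrow> integrable half_line (\<lambda>t. indicator {a<..<b} t * q t)"
    and zero: "\<And>a b n. 0 < a \<Longrightarrow> a \<le> b \<Longrightarrow> (LINT t|half_line. bump a b n t * q t) = 0"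
  shows "AE t in half_line. q t = 0"
proof -
  have int0: "(LINT t|half_line. indicator {a<..<b} t * q t) = 0" if ab: "0 < a" "a \<le> b" for a b
  proof -
    have eq: "bump a b n t * q t = bump a b n t * (indicator {a<..<b} t * q t)" for n t
      by (cases "t \<in> {a<..<b}") (auto simp: bump_outside)
    have bm: "bump a b n \<in> borel_measurable half_line" for n
      unfolding half_line_def
      by (intro measurable_restrict_space1) (simp add: measurable_completion borel_measurable_continuous_onI[OF continuous_bump])
    have "(\<lambda>n. LINT t|half_line. bump a b n t * q t) \<longlonglongrightarrow> (LINT t|half_line. indicator {a<..<b} t * q t)"
    proof (rule integral_dominated_convergence)
      show "integrable half_line (\<lambda>t. \<bar>indicator {a<..<b} t * q t\<bar>)" using q[OF ab] by simp
      show "(\<lambda>t. indicator {a<..<b} t * q t) \<in> borel_measurable half_line" using q[OF ab] by auto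
      show "(\<lambda>t. bump a b n t * q t) \<in> borel_measurable half_line" for n
        unfolding eq using bm borel_measurable_integrable[OF q[OF ab]] by simp
      show "AE t in half_line. (\<lambda>n. bump a b n t * q t) \<longlonglongrightarrow> indicator {a<..<b} t * q t"
        by (intro AE_I2 tendsto_intros bump_tendsto)
      show "AE t in half_line. norm (bump a b n t * q t) \<le> \<bar>indicator {a<..<b} t * q t\<bar>" for n
        unfolding eq norm_mult using bump_bounds[of a b n]
        by (intro AE_I2) (auto simp: abs_mult mult_left_le_one_le)
    qed
    then show ?thesis using zero[OF ab] by (simp add: LIMSEQ_const_iff)
  qed
  have loc: "AE t in lebesgue. t \<in> {a<..<b} \<longrightarrow> q t = 0" if ab: "0 < a" "a \<le> b" for a b
  proof -
    let ?f = "\<lambda>t. indicator {a<..<b} t * q t"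
    have ind: "indicator {0<..} t * (indicator {a'<..<b'} t * q t) = indicator {a'<..<b'} t * q t" if "0 < a'" for a' b' t
      using that by (auto split: split_indicator)
    have int: "integrable lebesgue ?f"
      using q[OF ab] unfolding half_line_def by (subst (asm) integrable_restrict_space) (auto simp: ind ab)
    have L: "(LINT t|lebesgue. indicator {a'<..<b'} t * q t) = 0" if "0 < a'" "a' \<le> b'" for a' b'
      using int0[OF that] unfolding half_line_def by (subst (asm) integral_restrict_space) (auto simp: ind that)
    have "(LINT t|lebesgue. indicator {d<..} t * ?f t) = 0" for d
    proof -
      \<comment> \<open>A ray meets the interval in another interval; clamping \<open>d\<close>
        keeps its left end positive and at most \<open>b\<close>, as \<open>L\<close>
        requires.\<close>
      have "indicator {d<..} t * ?f t = indicator {max a (min d b)<..<b} t * q t" for t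
        by (auto split: split_indicator)
      then have "(LINT t|lebesgue. indicator {d<..} t * ?f t) = (LINT t|lebesgue. indicator {max a (min d b)<..<b} t * q t)"
        by presburger
      then show ?thesis using L[of "max a (min d b)" b] ab by simp
    qed
    then have "AE t in lebesgue. ?f t = 0" by (rule AE_zero_if_integral_rays_zero_lebesgue[OF int])
    then show ?thesis by eventually_elim (auto split: split_indicator_asm)
  qed
  \<comment> \<open>Countably many intervals exhaust the half-line.\<close>
  have "AE t in lebesgue. \<forall>m::nat. t \<in> {1 / real (Suc m)<..<real (Suc m)} \<longrightarrow> q t = 0"
    unfolding AE_all_countable
  proof
    fix m :: nat
    have "1 / real (Suc m) \<le> real (Suc m)" by (rule order_trans[of _ 1]) auto
    then show "AE t in lebesgue. t \<in> {1 / real (Suc m)<..<real (Suc m)} \<longrightarrow> q t = 0"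
      by (intro loc) auto
  qed
  then have "AE t in lebesgue. t \<in> {0<..} \<longrightarrow> q t = 0"
  proof eventually_elim
    case (elim t)
    show ?case
    proof
      assume t: "t \<in> {0<..}"
      obtain m1 :: nat where m1: "t < real m1" using reals_Archimedean2 by blast
      obtain m2 :: nat where m2: "1 / t < real m2" using reals_Archimedean2 by blast
      define m where "m = max m1 m2"
      have "t < real (Suc m)" "1 / t < real (Suc m)" using m1 m2 by (auto simp: m_def)
      then have "t \<in> {1 / real (Suc m)<..<real (Suc m)}" using t by (auto simp: field_simps)
      then show "q t = 0" using elim by blast
    qed
  qed
  then show ?thesis unfolding half_line_def by (subst AE_restrict_space_iff) auto
qed

section \<open>Vector-valued coefficients, Sobolev classes and the quarter Laplacian\<close>

lemma fourier_coeff_nth: "fourier_coeff f k $ j = fcoeff (\<lambda>x. of_real (f x $ j)) k"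
  by (simp add: fourier_coeff_def fcoeff_def)

lemma norm_fourier_coeff: "(norm (fourier_coeff f k))\<^sup>2 = (\<Sum>j\<in>UNIV. (cmod (fcoeff (\<lambda>x. of_real (f x $ j)) k))\<^sup>2)"
  unfolding norm_vec_def L2_set_def fourier_coeff_nth by (simp add: sum_nonneg)

lemma borel_measurable_component:
  fixes f :: "'a \<Rightarrow> real ^ 'n"
  assumes "f \<in> borel_measurable M" shows "(\<lambda>x. f x $ j) \<in> borel_measurable M"
  by (rule measurable_compose[OF assms]) (intro borel_measurable_continuous_onI continuous_intros)

lemma borel_measurable_of_components:
  fixes f :: "'a \<Rightarrow> real ^ 'n"
  assumes "\<And>j. (\<lambda>x. f x $ j) \<in> borel_measurable M" shows "f \<in> borel_measurable M"
  unfolding borel_measurable_euclidean_space[of f]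
  by (auto simp: Basis_vec_def inner_axis assms)

lemma L2_circle_iff:
  "f \<in> L2_circle \<longleftrightarrow> (\<forall>j. sq_integrable circle (\<lambda>x. of_real (f x $ j)))"
proof
  assume f: "f \<in> L2_circle"
  show "\<forall>j. sq_integrable circle (\<lambda>x. of_real (f x $ j))"
  proof
    fix j
    have i: "integrable circle (\<lambda>x. (norm (f x))\<^sup>2)" and m: "(\<lambda>x. f x $ j) \<in> borel_measurable circle"
      using f borel_measurable_component by (auto simp: L2_circle_def)
    have "integrable circle (\<lambda>x. (f x $ j)\<^sup>2)"
    proof (rule Bochner_Integration.integrable_bound[OF i])
      show "(\<lambda>x. (f x $ j)\<^sup>2) \<in> borel_measurable circle" using m by measurable
      show "AE x in circle. norm ((f x $ j)\<^sup>2) \<le> norm ((norm (f x))\<^sup>2)"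
      proof (rule AE_I2)
        fix x
        have "\<bar>f x $ j\<bar>\<^sup>2 \<le> (norm (f x))\<^sup>2" by (intro power_mono component_le_norm_cart) simp
        then show "norm ((f x $ j)\<^sup>2) \<le> norm ((norm (f x))\<^sup>2)" by simp
      qed
    qed
    then show "sq_integrable circle (\<lambda>x. of_real (f x $ j))" using m by (simp add: sq_integrable_def norm_power)
  qed
next
  assume s: "\<forall>j. sq_integrable circle (\<lambda>x. of_real (f x $ j))"
  have m: "(\<lambda>x. f x $ j) \<in> borel_measurable circle" for j
    using borel_measurable_Re[OF ] s unfolding sq_integrable_def
    by (auto dest!: spec[of _ j] intro: measurable_compose[of "\<lambda>x. complex_of_real (f x $ j)" circle borel Re borel, simplified])
  have "integrable circle (\<lambda>x. \<Sum>j\<in>UNIV. (f x $ j)\<^sup>2)"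
    using s by (intro Bochner_Integration.integrable_sum) (simp add: sq_integrable_def norm_power)
  moreover have "(\<Sum>j\<in>UNIV. (f x $ j)\<^sup>2) = (norm (f x))\<^sup>2" for x
    unfolding norm_vec_def L2_set_def by (simp add: sum_nonneg)
  ultimately show "f \<in> L2_circle" using borel_measurable_of_components[OF m] by (simp add: L2_circle_def)
qed

lemma sobolev_half_energy:
  assumes "f \<in> sobolev (1/2)"
  shows "(\<lambda>k. \<bar>of_int k\<bar> * (cmod (fcoeff (\<lambda>x. of_real (f x $ j)) k))\<^sup>2) summable_on UNIV"
    and "(\<Sum>\<^sub>\<infinity>k. \<bar>of_int k\<bar> * (cmod (fcoeff (\<lambda>x. of_real (f x $ j)) k))\<^sup>2) \<le> (sobolev_norm (1/2) f)\<^sup>2"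
proof -
  let ?g = "\<lambda>k::int. (1 + (of_int k)\<^sup>2) powr (1/2) * (norm (fourier_coeff f k))\<^sup>2"
  let ?h = "\<lambda>k::int. \<bar>of_int k\<bar> * (cmod (fcoeff (\<lambda>x. of_real (f x $ j)) k))\<^sup>2"
  have s: "?g summable_on UNIV" using assms by (simp add: sobolev_def)
  have le: "?h k \<le> ?g k" for k
  proof (rule mult_mono)
    have "\<bar>real_of_int k\<bar> = sqrt ((of_int k)\<^sup>2)" by simp
    also have "\<dots> \<le> sqrt (1 + (of_int k)\<^sup>2)" by (intro real_sqrt_le_mono) simp
    finally show "\<bar>real_of_int k\<bar> \<le> (1 + (of_int k)\<^sup>2) powr (1/2)"
      by (subst powr_half_sqrt) (auto intro: add_nonneg_nonneg)
    show "(cmod (fcoeff (\<lambda>x. of_real (f x $ j)) k))\<^sup>2 \<le> (norm (fourier_coeff f k))\<^sup>2"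
      unfolding norm_fourier_coeff by (rule member_le_sum) auto
  qed auto
  show hs: "?h summable_on UNIV" by (rule summable_on_comparison_test[OF s le]) simp
  have "(\<Sum>\<^sub>\<infinity>k. ?h k) \<le> (\<Sum>\<^sub>\<infinity>k. ?g k)" by (rule infsum_mono[OF hs s le])
  also have "\<dots> = (sobolev_norm (1/2) f)\<^sup>2"
    unfolding sobolev_norm_def by (subst real_sqrt_pow2) (auto intro!: infsum_nonneg)
  finally show "(\<Sum>\<^sub>\<infinity>k. ?h k) \<le> (sobolev_norm (1/2) f)\<^sup>2" .
qed

text \<open>The second bound involves only the Sobolev norm and is therefore uniform in
  time.\<close>

lemma half_gradient_sq_integrable:
  fixes f :: "real \<Rightarrow> real ^ 'n"
  assumes f: "f \<in> sobolev (1/2)"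
  shows "integrable circle (half_gradient_sq f)"
    and "(LINT x|circle. half_gradient_sq f x) \<le> 2 * pi * CARD('n) * (sobolev_norm (1/2) f)\<^sup>2"
proof -
  let ?U = "\<lambda>j x. complex_of_real (f x $ j)"
  let ?e = "\<lambda>p. (norm (f (fst p) - f (snd p)))\<^sup>2 / (circle_dist (fst p) (snd p))\<^sup>2"
  have e: "?e p = (\<Sum>j\<in>UNIV. (cmod (DD (?U j) p))\<^sup>2)" for p
  proof -
    have "(norm (f (fst p) - f (snd p)))\<^sup>2 = (\<Sum>j\<in>UNIV. (f (fst p) $ j - f (snd p) $ j)\<^sup>2)"
      unfolding norm_vec_def L2_set_def by (simp add: sum_nonneg)
    moreover have "(cmod (DD (?U j) p))\<^sup>2 = (f (fst p) $ j - f (snd p) $ j)\<^sup>2 / (circle_dist (fst p) (snd p))\<^sup>2" for j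
      by (simp add: DD_def norm_divide power_divide flip: of_real_diff)
    ultimately show ?thesis by (simp add: sum_divide_distrib)
  qed
  have sq: "sq_integrable circle (?U j)" for j using f by (simp add: sobolev_def L2_circle_iff)
  note G = Gagliardo_le[OF sq sobolev_half_energy(1)[OF f]]
  have ji: "integrable torus (\<lambda>p. (cmod (DD (?U j) p))\<^sup>2)" for j using G(1) by (simp add: sq_integrable_def)
  have i: "integrable torus ?e" unfolding e by (intro Bochner_Integration.integrable_sum ji)
  have hg: "half_gradient_sq f = (\<lambda>x. (LINT y|circle. ?e (x, y)) / (2 * pi))"
    by (simp add: half_gradient_sq_def fun_eq_iff)
  show "integrable circle (half_gradient_sq f)" unfolding hg using circle2.integrable_fst'[OF i] by simp
  have "(LINT x|circle. half_gradient_sq f x) = (LINT p|torus. ?e p) / (2 * pi)"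
    unfolding hg using circle2.integral_fst'[OF i] by simp
  also have "(LINT p|torus. ?e p) = (\<Sum>j\<in>UNIV. (L2_norm torus (DD (?U j)))\<^sup>2)"
    unfolding e L2_norm_power2 by (rule Bochner_Integration.integral_sum[OF ji])
  also have "\<dots> \<le> (\<Sum>j\<in>(UNIV::'n set). (2 * pi)\<^sup>2 * (sobolev_norm (1/2) f)\<^sup>2)"
    by (intro sum_mono order_trans[OF G(2)] mult_left_mono sobolev_half_energy(2)[OF f]) simp
  also have "\<dots> / (2 * pi) = 2 * pi * CARD('n) * (sobolev_norm (1/2) f)\<^sup>2"
    by (simp add: power2_eq_square)
  finally show "(LINT x|circle. half_gradient_sq f x) \<le> 2 * pi * CARD('n) * (sobolev_norm (1/2) f)\<^sup>2"
    by (simp add: divide_right_mono)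
qed

lemma frac_symbol_quarter: "frac_symbol (1/4) k = sqrt \<bar>of_int k\<bar>"
  by (simp add: frac_symbol_def powr_half_sqrt)

text \<open>The choice operator needs a witness. Riesz-Fischer supplies a complex one for each
  component; its real part has the same coefficients because they are Hermitian.\<close>

lemma frac_laplacian_L2:
  assumes "f \<in> sobolev (1/2)"
  shows "frac_laplacian (1/4) f \<in> L2_circle"
    and "fourier_coeff (frac_laplacian (1/4) f) k = frac_symbol (1/4) k *\<^sub>R fourier_coeff f k"
proof -
  let ?c = "\<lambda>j k. sqrt \<bar>of_int k\<bar> * fcoeff (\<lambda>x. of_real (f x $ j)) k"
  have "\<exists>g. sq_integrable circle (\<lambda>x. complex_of_real (g x)) \<and> (\<forall>k. fcoeff (\<lambda>x. of_real (g x)) k = ?c j k)" for j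
  proof -
    have "(\<lambda>k. (cmod (?c j k))\<^sup>2) summable_on UNIV"
      using sobolev_half_energy(1)[OF assms, of j] by (simp add: norm_mult power_mult_distrib)
    then obtain g r where g: "sq_integrable circle g" "\<And>k. fcoeff g k = ?c j k"
      by (rule Riesz_Fischer) blast
    have cnj_int: "fcoeff (\<lambda>x. cnj (w x)) k = cnj (fcoeff w (- k))" if "sq_integrable circle w" for w k
    proof -
      have "(LINT x|circle. cnj (w x) * cis (- (of_int k * x))) = (LINT x|circle. cnj (w x * cis (of_int k * x)))"
        by (simp add: cis_cnj)
      also have "\<dots> = cnj (LINT x|circle. w x * cis (of_int k * x))" by (rule Bochner_Integration.integral_bounded_linear[OF bounded_linear_cnj])
          (use integrable_circle_mult_cis[OF circle.sq_integrable_imp_integrable[OF that]] in simp)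
      finally show ?thesis by (simp add: fcoeff_def)
    qed
    have f: "sq_integrable circle (\<lambda>x. complex_of_real (f x $ j))" using assms by (simp add: sobolev_def L2_circle_iff)
    \<comment> \<open>Hermitian symmetry: \<open>f\<close> is real and the symbol is even.\<close>
    have sym: "cnj (?c j (- k)) = ?c j k" for k
      using cnj_int[OF f, of k] by simp
    have Re: "complex_of_real (Re (g x)) = (1 / 2) * (g x + cnj (g x))" for x
      by (simp add: complex_eq_iff)
    have "sq_integrable circle (\<lambda>x. complex_of_real (Re (g x)))"
      unfolding Re by (intro sq_integrable_cmult sq_integrable_add sq_integrable_cnj g)
    moreover have "fcoeff (\<lambda>x. of_real (Re (g x))) k = ?c j k" for k
    proof -
      have "fcoeff (\<lambda>x. of_real (Re (g x))) k = (1 / 2) * fcoeff (\<lambda>x. g x + cnj (g x)) k"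
        unfolding Re fcoeff_def mult.assoc integral_mult_right_zero by simp
      also have "\<dots> = (1 / 2) * (?c j k + cnj (?c j (- k)))"
        using g by (subst fcoeff_add) (auto intro!: circle.sq_integrable_imp_integrable sq_integrable_cnj simp: cnj_int)
      finally show ?thesis unfolding sym by simp
    qed
    ultimately show ?thesis by (intro exI[of _ "\<lambda>x. Re (g x)"]) blast
  qed
  then obtain g where g: "\<And>j. sq_integrable circle (\<lambda>x. complex_of_real (g j x))" "\<And>j k. fcoeff (\<lambda>x. of_real (g j x)) k = ?c j k"
    by metis
  have "\<exists>h::real \<Rightarrow> real ^ 'a. h \<in> L2_circle \<and> (\<forall>k. fourier_coeff h k = frac_symbol (1/4) k *\<^sub>R fourier_coeff f k)"
  proof (intro exI[of _ "\<lambda>x. \<chi> j. g j x"] conjI allI)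
    show "(\<lambda>x. \<chi> j. g j x) \<in> L2_circle" using g(1) by (simp add: L2_circle_iff)
    show "fourier_coeff (\<lambda>x. \<chi> j. g j x) k = frac_symbol (1/4) k *\<^sub>R fourier_coeff f k" for k
      by (simp add: vec_eq_iff fourier_coeff_nth g(2) frac_symbol_quarter scaleR_conv_of_real[where 'a = complex])
  qed
  from someI_ex[OF this] show "frac_laplacian (1/4) f \<in> L2_circle"
    "fourier_coeff (frac_laplacian (1/4) f) k = frac_symbol (1/4) k *\<^sub>R fourier_coeff f k"
    unfolding frac_laplacian_def by blast+
qed

text \<open>Test functions take real values, so the exponentials are replaced by cosine and
  sine.\<close>

definition mode :: "int \<Rightarrow> (real \<Rightarrow> real) \<Rightarrow> bool" where
  "mode k c \<longleftrightarrow> c = (\<lambda>x. cos (of_int k * x)) \<or> c = (\<lambda>x. sin (of_int k * x))"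

lemma mode_trig: assumes "mode k c" obtains d where "\<And>x. complex_of_real (c x) = trig {k, - k} d x"
\<comment> \<open>For \<open>k = 0\<close> the set \<open>{k, - k}\<close> is a singleton, and two
  coefficients 1/2 would be counted only once.\<close>
proof (cases "k = 0")
  case True
  have "complex_of_real (c x) = trig {k, - k} (\<lambda>_. c 0) x" for x
    using assms True by (auto simp: mode_def trig_def)
  then show ?thesis using that by blast
next
  case False
  from assms consider "c = (\<lambda>x. cos (of_int k * x))" | "c = (\<lambda>x. sin (of_int k * x))" by (auto simp: mode_def)
  then show ?thesis
  proof cases
    case 1
    have "complex_of_real (c x) = trig {k, - k} (\<lambda>_. 1/2) x" for x
      using False 1 by (simp add: trig_def complex_eq_iff)
    then show ?thesis using that by blast
  next
    case 2
    have "complex_of_real (c x) = trig {k, - k} (\<lambda>l. if l = k then - \<i> / 2 else \<i> / 2) x" for x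
      using False 2 by (simp add: trig_def complex_eq_iff)
    then show ?thesis using that by blast
  qed
qed

lemma mode_le: "mode k c \<Longrightarrow> \<bar>c x\<bar> \<le> 1" by (auto simp: mode_def)

lemma mode_continuous: "mode k c \<Longrightarrow> continuous_on UNIV c"
  by (auto simp: mode_def intro!: continuous_intros)

lemma mode_measurable: "mode k c \<Longrightarrow> c \<in> borel_measurable circle"
  by (intro borel_measurable_circle borel_measurable_continuous_onI mode_continuous)

lemma mode_smooth: "mode k c \<Longrightarrow> smooth_upto n c"
  using smooth_upto_trigonometric[of n 1 "of_int k" 0] smooth_upto_trigonometric[of n 0 "of_int k" 1]
  by (auto simp: mode_def)

lemma mode_periodic: "mode k c \<Longrightarrow> c (x + 2 * pi) = c x"
proof -
  have "cis (of_int k * (x + 2 * pi)) = cis (of_int k * x)"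
    using cis_multiple_2pi[of "of_int k"] by (simp add: distrib_left cis_mult[symmetric] mult.commute mult.left_commute)
  then show "mode k c \<Longrightarrow> c (x + 2 * pi) = c x" by (auto simp: mode_def complex_eq_iff)
qed

text \<open>A mode is an eigenfunction. The equality holds only almost everywhere because the chosen
  representative is arbitrary on null sets; uniqueness of coefficients identifies it.\<close>

lemma frac_laplacian_mode:
  assumes c: "mode k c"
  shows "AE x in circle. frac_laplacian (1/4) (\<lambda>x. (s * c x) *\<^sub>R axis i 1 :: real ^ 'n) x = (sqrt \<bar>of_int k\<bar> * (s * c x)) *\<^sub>R axis i 1"
proof -
  let ?f = "\<lambda>x. (s * c x) *\<^sub>R axis i 1 :: real ^ 'n" and ?h = "\<lambda>x. (sqrt \<bar>of_int k\<bar> * (s * c x)) *\<^sub>R axis i 1 :: real ^ 'n"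
  obtain d where d: "\<And>x. complex_of_real (c x) = trig {k, - k} d x" using mode_trig[OF c] by blast
  have comp: "(\<lambda>x. complex_of_real (((a * c x) *\<^sub>R axis i 1 :: real ^ 'n) $ j)) = trig {k, - k} (\<lambda>l. if j = i then of_real a * d l else 0)" for j a
    by (auto simp: axis_def d trig_def sum_distrib_left mult_ac)
  have h: "?h \<in> L2_circle"
    unfolding L2_circle_iff using comp[of "sqrt \<bar>of_int k\<bar> * s"] by (simp add: mult.assoc)
  have "fourier_coeff ?h m = frac_symbol (1/4) m *\<^sub>R fourier_coeff ?f m" for m
  proof -
    have "fourier_coeff ?h m $ j = (frac_symbol (1/4) m *\<^sub>R fourier_coeff ?f m) $ j" for j
    proof -
      have "fcoeff (\<lambda>x. complex_of_real (?h x $ j)) m = (if m \<in> {k, - k} then if j = i then of_real (sqrt \<bar>of_int k\<bar> * s) * d m else 0 else 0)"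
        using comp[of "sqrt \<bar>of_int k\<bar> * s" j] by (simp add: mult.assoc fcoeff_trig)
      moreover have "fcoeff (\<lambda>x. complex_of_real (?f x $ j)) m = (if m \<in> {k, - k} then if j = i then of_real s * d m else 0 else 0)"
        using comp[of s j] by (simp add: fcoeff_trig)
      ultimately show ?thesis
        by (auto simp: fourier_coeff_nth frac_symbol_quarter scaleR_conv_of_real[where 'a = complex])
    qed
    then show ?thesis by (simp add: vec_eq_iff)
  qed
  note ex = exI[of "\<lambda>g. g \<in> L2_circle \<and> (\<forall>m. fourier_coeff g m = frac_symbol (1/4) m *\<^sub>R fourier_coeff ?f m)", OF conjI[OF h allI[OF this]]]
  define g where "g = frac_laplacian (1/4) ?f"
  have g: "g \<in> L2_circle" "\<And>m. fourier_coeff g m = fourier_coeff ?h m"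
    using someI_ex[OF ex] \<open>\<And>m. fourier_coeff ?h m = frac_symbol (1/4) m *\<^sub>R fourier_coeff ?f m\<close>
    unfolding g_def frac_laplacian_def by auto
  have "AE x in circle. \<forall>j\<in>UNIV. complex_of_real (g x $ j) - of_real (?h x $ j) = 0"
  proof (rule AE_finite_allI)
    fix j
    have "fcoeff (\<lambda>x. of_real (g x $ j)) m = fcoeff (\<lambda>x. of_real (?h x $ j)) m" for m
      using g(2)[of m] by (simp add: vec_eq_iff fourier_coeff_nth)
    then show "AE x in circle. complex_of_real (g x $ j) - of_real (?h x $ j) = 0"
      using g(1) h unfolding L2_circle_iff
      by (intro fcoeff_zero_imp_AE_zero) (auto simp: fcoeff_diff circle.sq_integrable_imp_integrable)
  qed simp
  then show ?thesis unfolding g_def[symmetric] 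
  proof eventually_elim
    case (elim x)
    have "g x $ j = ?h x $ j" for j
    proof -
      from elim have "complex_of_real (g x $ j) - of_real (?h x $ j) = 0" by blast
      then show ?thesis by (simp only: right_minus_eq of_real_eq_iff)
    qed
    then show ?case unfolding vec_eq_iff by (rule allI)
  qed
qed

text \<open>The symbol is even, so the frequencies \<open>k\<close> and \<open>- k\<close> of a mode
  receive the same factor.\<close>

lemma integral_mult_mode:
  assumes c: "mode k c" and w: "sq_integrable circle (\<lambda>x. complex_of_real (w x))"
  shows "integrable circle (\<lambda>x. w x * c x)"
    and "(\<And>m. fcoeff (\<lambda>x. of_real (w x)) m = sqrt \<bar>of_int m\<bar> * fcoeff (\<lambda>x. of_real (v x)) m) \<Longrightarrow> sq_integrable circle (\<lambda>x. complex_of_real (v x))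
      \<Longrightarrow> (LINT x|circle. w x * c x) = sqrt \<bar>of_int k\<bar> * (LINT x|circle. v x * c x)"
proof -
  obtain d where d: "\<And>x. complex_of_real (c x) = trig {k, - k} d x" using mode_trig[OF c] by blast
  have i: "integrable circle (\<lambda>x. complex_of_real (w x * c x))" if "sq_integrable circle (\<lambda>x. complex_of_real (w x))" for w
    unfolding of_real_mult d by (intro sq_integrable_mult that sq_integrable_trig)
  show "integrable circle (\<lambda>x. w x * c x)" using integrable_Re[OF i[OF w]] by simp
  assume eq: "\<And>m. fcoeff (\<lambda>x. of_real (w x)) m = sqrt \<bar>of_int m\<bar> * fcoeff (\<lambda>x. of_real (v x)) m"
    and v: "sq_integrable circle (\<lambda>x. complex_of_real (v x))"
  have I: "complex_of_real (LINT x|circle. w x * c x) = (\<Sum>l\<in>{k, - k}. 2 * pi * d l * fcoeff (\<lambda>x. of_real (w x)) (- l))"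
    if "sq_integrable circle (\<lambda>x. complex_of_real (w x))" for w
  proof -
    have "complex_of_real (LINT x|circle. w x * c x) = (LINT x|circle. of_real (w x) * trig {k, - k} d x)"
      by (subst integral_complex_of_real[symmetric]) (simp add: d)
    then show ?thesis using integral_mult_trig[OF circle.sq_integrable_imp_integrable[OF that], of "{k, - k}" d] by simp
  qed
  have "complex_of_real (LINT x|circle. w x * c x) = complex_of_real (sqrt \<bar>of_int k\<bar> * (LINT x|circle. v x * c x))"
    unfolding of_real_mult I[OF w] I[OF v] eq sum_distrib_left by (intro sum.cong) auto
  then show "(LINT x|circle. w x * c x) = sqrt \<bar>of_int k\<bar> * (LINT x|circle. v x * c x)"
    by (simp only: of_real_eq_iff)
qed

text \<open>The two quarter Laplacians together give the factor |k|, and no chosen representative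
  remains on the right. The scalar \<open>s\<close> will be the value of a bump at a fixed
  time.\<close>

lemma weak_form_mode:
  fixes v z :: "real \<Rightarrow> real ^ 'n"
  assumes c: "mode k c" and v: "v \<in> sobolev (1/2)" and z: "z \<in> L2_circle"
  shows "(LINT x|circle. z x \<bullet> ((s * c x) *\<^sub>R axis i 1)
      + frac_laplacian (1/4) v x \<bullet> frac_laplacian (1/4) (\<lambda>x. (s * c x) *\<^sub>R axis i 1) x)
    = s * ((LINT x|circle. z x $ i * c x) + \<bar>of_int k\<bar> * (LINT x|circle. v x $ i * c x))"
proof -
  define g where "g = frac_laplacian (1/4) v"
  define h :: "real \<Rightarrow> real ^ 'n" where "h = frac_laplacian (1/4) (\<lambda>x. (s * c x) *\<^sub>R axis i 1)"
  have h: "AE x in circle. h x = (sqrt \<bar>of_int k\<bar> * (s * c x)) *\<^sub>R axis i 1"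
    unfolding h_def by (rule frac_laplacian_mode[OF c])
  have g: "g \<in> L2_circle" "\<And>m. fourier_coeff g m = frac_symbol (1/4) m *\<^sub>R fourier_coeff v m"
    unfolding g_def using frac_laplacian_L2[OF v] by auto
  have gi: "sq_integrable circle (\<lambda>x. complex_of_real (g x $ i))" and zi: "sq_integrable circle (\<lambda>x. complex_of_real (z x $ i))"
    and vi: "sq_integrable circle (\<lambda>x. complex_of_real (v x $ i))"
    using g(1) z v by (auto simp: L2_circle_iff sobolev_def)
  have "fcoeff (\<lambda>x. of_real (g x $ i)) m = sqrt \<bar>of_int m\<bar> * fcoeff (\<lambda>x. of_real (v x $ i)) m" for m
    using g(2)[of m] by (simp add: vec_eq_iff fourier_coeff_nth frac_symbol_quarter scaleR_conv_of_real[where 'a = complex])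
  from integral_mult_mode(2)[OF c gi this vi]
  have gc: "(LINT x|circle. g x $ i * c x) = sqrt \<bar>of_int k\<bar> * (LINT x|circle. v x $ i * c x)" .
  have cm: "c \<in> borel_measurable circle" by (rule mode_measurable[OF c])
  \<comment> \<open>Measurability of the chosen representative does not follow from its value almost
    everywhere; it comes from the specification of the choice, whose witness needs a Sobolev
    function.\<close>
  have hL: "h \<in> borel_measurable circle"
  proof -
    have "(\<lambda>x. (s * c x) *\<^sub>R axis i 1 :: real ^ 'n) \<in> sobolev (1/2)"
    proof -
      obtain d where d: "\<And>x. complex_of_real (c x) = trig {k, - k} d x" using mode_trig[OF c] by blast
      have comp: "(\<lambda>x. complex_of_real (((s * c x) *\<^sub>R axis i 1 :: real ^ 'n) $ j)) = trig {k, - k} (\<lambda>l. if j = i then of_real s * d l else 0)" for j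
        by (auto simp: axis_def d trig_def sum_distrib_left mult_ac)
      have "fourier_coeff (\<lambda>x. (s * c x) *\<^sub>R axis i 1 :: real ^ 'n) m = 0" if "m \<notin> {k, - k}" for m
      proof -
        have "fourier_coeff (\<lambda>x. (s * c x) *\<^sub>R axis i 1 :: real ^ 'n) m $ j = 0" for j
          unfolding fourier_coeff_nth comp using that by (simp add: fcoeff_trig)
        then show ?thesis unfolding vec_eq_iff zero_index by (rule allI)
      qed
      then have "(\<lambda>m::int. (1 + (of_int m)\<^sup>2) powr (1/2) * (norm (fourier_coeff (\<lambda>x. (s * c x) *\<^sub>R axis i 1 :: real ^ 'n) m))\<^sup>2) summable_on UNIV"
        by (subst summable_on_cong_neutral[where T = "{k, - k}" and g = "\<lambda>m. (1 + (of_int m)\<^sup>2) powr (1/2) * (norm (fourier_coeff (\<lambda>x. (s * c x) *\<^sub>R axis i 1 :: real ^ 'n) m))\<^sup>2"]) auto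
      then show ?thesis by (simp add: sobolev_def L2_circle_iff comp del: of_real_mult vector_scaleR_component)
    qed
    then show ?thesis unfolding h_def using frac_laplacian_L2(1) by (auto simp: L2_circle_def)
  qed
  have "(LINT x|circle. z x \<bullet> ((s * c x) *\<^sub>R axis i 1) + g x \<bullet> h x)
      = (LINT x|circle. s * (z x $ i * c x) + s * sqrt \<bar>of_int k\<bar> * (g x $ i * c x))"
  proof (rule integral_cong_AE)
    have zm: "z \<in> borel_measurable circle" "g \<in> borel_measurable circle" using z g(1) by (auto simp: L2_circle_def)
    note zc = borel_measurable_component[OF zm(1)] borel_measurable_component[OF zm(2)]
    show "(\<lambda>x. z x \<bullet> ((s * c x) *\<^sub>R axis i 1) + g x \<bullet> h x) \<in> borel_measurable circle"
      using zm hL cm by measurable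
    show "(\<lambda>x. s * (z x $ i * c x) + s * sqrt \<bar>of_int k\<bar> * (g x $ i * c x)) \<in> borel_measurable circle"
      using zc cm by measurable
    show "AE x in circle. z x \<bullet> ((s * c x) *\<^sub>R axis i 1) + g x \<bullet> h x = s * (z x $ i * c x) + s * sqrt \<bar>of_int k\<bar> * (g x $ i * c x)"
      using h by eventually_elim (simp add: inner_axis)
  qed
  also have "\<dots> = s * (LINT x|circle. z x $ i * c x) + s * sqrt \<bar>of_int k\<bar> * (LINT x|circle. g x $ i * c x)"
    by (subst Bochner_Integration.integral_add) (auto intro!: integral_mult_mode(1)[OF c] zi gi)
  also have "\<dots> = s * ((LINT x|circle. z x $ i * c x) + \<bar>of_int k\<bar> * (LINT x|circle. v x $ i * c x))"
    unfolding gc by (simp add: algebra_simps)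
  finally show ?thesis unfolding g_def h_def .
qed

section \<open>From the flow to almost every time\<close>

lemma AE_half_line_iff: "(AE t in half_line. P t) \<longleftrightarrow> (AE t in lebesgue. t \<in> {0<..} \<longrightarrow> P t)"
  unfolding half_line_def by (subst AE_restrict_space_iff) auto

lemma AE_half_line_circle:
  assumes "AE t in lborel. AE x in lborel. t \<in> {0<..} \<longrightarrow> x \<in> {0..<2 * pi} \<longrightarrow> P t x"
  shows "AE t in half_line. AE x in circle. P t x"
proof -
  have "AE t in lebesgue. AE x in lborel. t \<in> {0<..} \<longrightarrow> x \<in> {0..<2 * pi} \<longrightarrow> P t x"
    using assms by (rule AE_completion)
  then show ?thesis
    unfolding AE_half_line_iff
  proof eventually_elim
    case (elim t)
    show ?case
    proof
      assume t: "t \<in> {0<..}"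
      have "AE x in lebesgue. t \<in> {0<..} \<longrightarrow> x \<in> {0..<2 * pi} \<longrightarrow> P t x" using elim by (rule AE_completion)
      then show "AE x in circle. P t x" unfolding AE_circle_iff by eventually_elim (use t in auto)
    qed
  qed
qed

lemma AE_lborel_pair:
  fixes P :: "real \<times> real \<Rightarrow> bool"
  assumes "AE p in lborel. P p" shows "AE t in lborel. AE x in lborel. P (t, x)"
  using assms unfolding lborel_prod[symmetric] by (rule lborel_pair.AE_pair)

lemma AE_space_time:
  assumes "AE p in space_time. P p"
  shows "AE t in half_line. AE x in circle. P (t, x)"
proof -
  have "AE p in lebesgue. p \<in> {0<..} \<times> {0..<2 * pi} \<longrightarrow> P p"
    using assms unfolding space_time_def by (subst (asm) AE_restrict_space_iff) (auto simp: borel_Times intro!: sets_completionI_sets)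
  then have "AE p in lborel. p \<in> {0<..} \<times> {0..<2 * pi} \<longrightarrow> P p" by (simp add: AE_completion_iff)
  from AE_lborel_pair[OF this] show ?thesis
    by (intro AE_half_line_circle) (auto elim!: eventually_mono)
qed

text \<open>Measurability for the completed product measure says little about individual slices. A
  Borel function equal almost everywhere has Borel slices and parametrised integrals measurable in
  time.\<close>

lemma borel_representative:
  fixes w :: "real \<Rightarrow> real \<Rightarrow> real ^ 'n"
  assumes "case_prod w \<in> borel_measurable space_time"
  obtains v where "v \<in> borel_measurable borel" "AE t in half_line. AE x in circle. w t x = v (t, x)"
proof -
  let ?S = "{0<..} \<times> {0..<2 * pi} :: (real \<times> real) set"
  have S: "?S \<inter> space lebesgue \<in> sets lebesgue"
    by (auto simp: borel_Times intro!: sets_completionI_sets)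
  define g where "g p = indicator ?S p *\<^sub>R case_prod w p" for p
  have g: "g \<in> borel_measurable lebesgue"
    using assms unfolding space_time_def g_def[abs_def] borel_measurable_restrict_space_iff[OF S] .
  have "\<exists>h. h \<in> borel_measurable lborel \<and> (AE p in lborel. g p $ j = h p)" for j
    using completion_ex_borel_measurable_real[OF borel_measurable_component[OF g, of j]] by blast
  then obtain h where h: "\<And>j. h j \<in> borel_measurable lborel" "\<And>j. AE p in lborel. g p $ j = h j p" by metis
  define v :: "real \<times> real \<Rightarrow> real ^ 'n" where "v p = (\<chi> j. h j p)" for p
  have vm: "v \<in> borel_measurable borel"
    using h(1) by (intro borel_measurable_of_components) (simp add: v_def)
  have "AE p in lborel. \<forall>j\<in>UNIV. g p $ j = h j p" by (rule AE_finite_allI) (auto intro: h(2))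
  then have "AE p in lborel. g p = v p" by eventually_elim (simp add: v_def vec_eq_iff)
  from AE_lborel_pair[OF this] have "AE t in half_line. AE x in circle. w t x = v (t, x)"
    by (intro AE_half_line_circle) (auto simp: g_def elim!: eventually_mono)
  with vm show ?thesis by (rule that)
qed

text \<open>For Borel integrands the completed measure can be traded for \<open>lborel\<close>,
  where measurability of parametrised integrals is available.\<close>

lemma borel_measurable_circle_integral:
  fixes h :: "'a \<times> real \<Rightarrow> real"
  assumes h: "h \<in> borel_measurable (N \<Otimes>\<^sub>M borel)"
  shows "(\<lambda>a. LINT x|circle. h (a, x)) \<in> borel_measurable N"
proof -
  have eq: "(LINT x|circle. h (a, x)) = (LINT x|lborel. indicator {0..<2 * pi} x * h (a, x))" if a: "a \<in> space N" for a
  proof -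
    have m: "(\<lambda>x. h (a, x)) \<in> borel_measurable borel" using measurable_compose[OF measurable_Pair1'[OF a] h] .
    have "(LINT x|circle. h (a, x)) = (LINT x|lebesgue. indicator {0..<2 * pi} x * h (a, x))"
      unfolding circle_def by (subst integral_restrict_space) auto
    also have "\<dots> = (LINT x|lborel. indicator {0..<2 * pi} x * h (a, x))"
      by (rule integral_completion) (use m in simp)
    finally show ?thesis .
  qed
  have "(\<lambda>a. LINT x|lborel. indicator {0..<2 * pi} x * h (a, x)) \<in> borel_measurable N"
  proof (rule lborel.borel_measurable_lebesgue_integral)
    have "(\<lambda>p. indicator {0..<2 * pi} (snd p) * h p) \<in> borel_measurable (N \<Otimes>\<^sub>M borel)"
      using h by measurable
    then show "(\<lambda>(a, x). indicator {0..<2 * pi} x * h (a, x)) \<in> borel_measurable (N \<Otimes>\<^sub>M lborel)"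
      by (simp add: case_prod_unfold cong: measurable_cong_sets)
  qed
  then show ?thesis by (subst measurable_cong[OF eq])
qed

lemma borel_measurable_half_line: "g \<in> borel_measurable borel \<Longrightarrow> g \<in> borel_measurable half_line"
  unfolding half_line_def by (intro measurable_restrict_space1) (simp add: measurable_completion)

text \<open>Completeness of Lebesgue measure transfers measurability to \<open>h\<close>, about
  which nothing else is known.\<close>

lemma measurable_half_line_AE_cong:
  fixes g h :: "real \<Rightarrow> real"
  assumes g: "g \<in> borel_measurable half_line" and ae: "AE t in half_line. g t = h t"
  shows "h \<in> borel_measurable half_line"
proof -
  have S: "{0::real<..} \<inter> space lebesgue \<in> sets lebesgue" by auto
  let ?g = "\<lambda>t. indicator {0<..} t *\<^sub>R g t" and ?h = "\<lambda>t. indicator {0<..} t *\<^sub>R h t"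
  have gm: "?g \<in> borel_measurable lebesgue"
    using g unfolding half_line_def borel_measurable_restrict_space_iff[OF S] .
  have eq: "AE t in lebesgue. ?g t = ?h t"
    using ae unfolding AE_half_line_iff by eventually_elim (auto split: split_indicator)
  have "?h \<in> borel_measurable lebesgue"
  proof (rule measurableI)
    fix A :: "real set" assume A: "A \<in> sets borel"
    show "?h -` A \<inter> space lebesgue \<in> sets lebesgue"
    proof (rule completion.in_sets_AE)
      show "AE t in lebesgue. t \<in> ?g -` A \<inter> space lebesgue \<longleftrightarrow> t \<in> ?h -` A \<inter> space lebesgue"
        using eq by eventually_elim auto
      show "?g -` A \<inter> space lebesgue \<in> sets lebesgue" by (rule measurable_sets[OF gm A])
    qed auto
  qed simp
  then show ?thesis unfolding half_line_def borel_measurable_restrict_space_iff[OF S] .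
qed

lemma fcoeff_real:
  assumes "integrable circle w"
  shows "2 * pi * fcoeff (\<lambda>x. complex_of_real (w x)) k
    = of_real (LINT x|circle. w x * cos (of_int k * x)) - \<i> * of_real (LINT x|circle. w x * sin (of_int k * x))"
proof -
  have i: "integrable circle (\<lambda>x. complex_of_real (w x) * cis (- (of_int k * x)))"
    by (rule integrable_circle_mult_cis') (use assms in simp)
  let ?I = "LINT x|circle. complex_of_real (w x) * cis (- (of_int k * x))"
  have "Re ?I = (LINT x|circle. w x * cos (of_int k * x))"
    by (subst integral_Re[OF i, symmetric]) simp
  moreover have "Im ?I = - (LINT x|circle. w x * sin (of_int k * x))"
    by (subst integral_Im[OF i, symmetric]) simp
  ultimately have "?I = of_real (LINT x|circle. w x * cos (of_int k * x)) - \<i> * of_real (LINT x|circle. w x * sin (of_int k * x))"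
    by (simp add: complex_eq_iff)
  then show ?thesis by (simp add: fcoeff_def)
qed

text \<open>\<open>v\<close> is \<open>w\<close> altered on a null set so as to have length 1
  everywhere. Coefficients and half gradients do not see the change, hence \<open>v\<close> with
  \<open>f = - z\<close> satisfies the assumptions of the locale; the modes cosine and sine
  recombine to its equation.\<close>

lemma H1_at_fixed_time:
  fixes w v z :: "real \<Rightarrow> real ^ 'n"
  assumes w: "w \<in> sobolev (1/2)" and z: "z \<in> L2_circle"
    and v: "\<And>x. norm (v x) = 1" and wv: "AE x in circle. w x = v x" and vm: "v \<in> borel_measurable circle"
    and eq: "\<And>k c i. mode k c \<Longrightarrow> (LINT x|circle. z x $ i * c x) + \<bar>of_int k\<bar> * (LINT x|circle. w x $ i * c x)
      = (LINT x|circle. half_gradient_sq w x * (w x $ i * c x))"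
  shows "w \<in> sobolev 1"
proof -
  have wL: "w \<in> L2_circle" using w by (simp add: sobolev_def)
  have wm: "w \<in> borel_measurable circle" using wL by (simp add: L2_circle_def)
  \<comment> \<open>The value at \<open>x\<close> itself enters the integrand, so agreement almost
    everywhere helps only at points where \<open>w\<close> and \<open>v\<close> agree.\<close>
  have hg: "half_gradient_sq w x = half_gradient_sq v x" if "w x = v x" "x \<in> {0..<2 * pi}" for x
  proof -
    have xb: "(\<lambda>y. circle_dist x y) \<in> borel_measurable circle"
      unfolding circle_dist_def by measurable
    have "(LINT y|circle. (norm (w x - w y))\<^sup>2 / (circle_dist x y)\<^sup>2) = (LINT y|circle. (norm (v x - v y))\<^sup>2 / (circle_dist x y)\<^sup>2)"
    proof (rule integral_cong_AE)
      show "AE y in circle. (norm (w x - w y))\<^sup>2 / (circle_dist x y)\<^sup>2 = (norm (v x - v y))\<^sup>2 / (circle_dist x y)\<^sup>2"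
        using wv by eventually_elim (simp add: that)
    qed (use wm vm xb in measurable)
    then show ?thesis by (simp add: half_gradient_sq_def)
  qed
  have comp: "sq_integrable circle (\<lambda>x. complex_of_real (w x $ j))" "sq_integrable circle (\<lambda>x. complex_of_real (z x $ j))" for j
    using wL z by (auto simp: L2_circle_iff)
  have ri: "integrable circle (\<lambda>x. g x)" if "sq_integrable circle (\<lambda>x. complex_of_real (g x))" for g
    using integrable_Re[OF circle.sq_integrable_imp_integrable[OF that]] by simp
  have vcomp: "(\<lambda>x. v x $ j) \<in> borel_measurable circle" for j by (rule borel_measurable_component[OF vm])
  have wcomp: "(\<lambda>x. w x $ j) \<in> borel_measurable circle" for j by (rule borel_measurable_component[OF wm])
  have G: "integrable circle (half_gradient_sq w)" by (rule half_gradient_sq_integrable(1)[OF w])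
  have Gw: "integrable circle (\<lambda>x. half_gradient_sq w x * w x $ j)" for j
  proof (rule Bochner_Integration.integrable_bound[OF G])
    show "(\<lambda>x. half_gradient_sq w x * w x $ j) \<in> borel_measurable circle" using G wcomp by auto
    show "AE x in circle. norm (half_gradient_sq w x * w x $ j) \<le> norm (half_gradient_sq w x)"
      using wv
    proof eventually_elim
      case (elim x)
      then have "\<bar>w x $ j\<bar> \<le> 1" using component_le_norm_cart[of "v x" j] v by simp
      then show ?case by (simp add: abs_mult mult_right_le_one_le)
    qed
  qed
  have fc: "fcoeff (\<lambda>x. complex_of_real (v x $ j)) k = fcoeff (\<lambda>x. complex_of_real (w x $ j)) k" for j k
  proof -
    have "(LINT x|circle. complex_of_real (v x $ j) * cis (- (of_int k * x))) = (LINT x|circle. complex_of_real (w x $ j) * cis (- (of_int k * x)))"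
    proof (rule integral_cong_AE)
      have cm: "(\<lambda>x. cis (- (of_int k * x))) \<in> borel_measurable circle" using borel_measurable_cis_circle[of "- of_int k"] by simp
      show "(\<lambda>x. complex_of_real (v x $ j) * cis (- (of_int k * x))) \<in> borel_measurable circle" using vcomp cm by simp
      show "(\<lambda>x. complex_of_real (w x $ j) * cis (- (of_int k * x))) \<in> borel_measurable circle" using wcomp cm by simp
      show "AE x in circle. complex_of_real (v x $ j) * cis (- (of_int k * x)) = complex_of_real (w x $ j) * cis (- (of_int k * x))"
        using wv by eventually_elim simp
    qed
    then show ?thesis by (simp add: fcoeff_def)
  qed
  have GG: "fcoeff (\<lambda>x. complex_of_real (half_gradient_sq v x) * complex_of_real (v x $ j)) k
      = fcoeff (\<lambda>x. complex_of_real (half_gradient_sq w x * w x $ j)) k" for j k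
  proof -
    have ae: "AE x in circle. half_gradient_sq w x * w x $ j = half_gradient_sq v x * v x $ j"
      using wv AE_space by eventually_elim (simp add: hg)
    have vGm: "half_gradient_sq v \<in> borel_measurable circle"
    proof -
      have m: "(\<lambda>p. (norm (v (fst p) - v (snd p)))\<^sup>2 / (circle_dist (fst p) (snd p))\<^sup>2) \<in> borel_measurable torus"
      proof -
        have [measurable]: "(\<lambda>p. v (fst p)) \<in> borel_measurable torus" "(\<lambda>p. v (snd p)) \<in> borel_measurable torus"
          using measurable_compose[OF measurable_fst vm] measurable_compose[OF measurable_snd vm] by auto
        show ?thesis by measurable
      qed
      have "(\<lambda>x. LINT y|circle. (norm (v x - v y))\<^sup>2 / (circle_dist x y)\<^sup>2) \<in> borel_measurable circle"
        by (rule circle.borel_measurable_lebesgue_integral) (use m in \<open>simp add: case_prod_unfold\<close>)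
      then show ?thesis by (simp add: half_gradient_sq_def[abs_def])
    qed
    have "(LINT x|circle. complex_of_real (half_gradient_sq v x) * complex_of_real (v x $ j) * cis (- (of_int k * x)))
       = (LINT x|circle. complex_of_real (half_gradient_sq w x * w x $ j) * cis (- (of_int k * x)))"
    proof (rule integral_cong_AE)
      have cm: "(\<lambda>x. cis (- (of_int k * x))) \<in> borel_measurable circle" using borel_measurable_cis_circle[of "- of_int k"] by simp
      show "(\<lambda>x. complex_of_real (half_gradient_sq v x) * complex_of_real (v x $ j) * cis (- (of_int k * x))) \<in> borel_measurable circle"
        using vGm vcomp cm by simp
      show "(\<lambda>x. complex_of_real (half_gradient_sq w x * w x $ j) * cis (- (of_int k * x))) \<in> borel_measurable circle"
        using G wcomp cm by simp
      show "AE x in circle. complex_of_real (half_gradient_sq v x) * complex_of_real (v x $ j) * cis (- (of_int k * x))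
          = complex_of_real (half_gradient_sq w x * w x $ j) * cis (- (of_int k * x))"
        using ae by eventually_elim (simp flip: of_real_mult)
    qed
    then show ?thesis by (simp add: fcoeff_def)
  qed
  have main: "of_real \<bar>of_int k\<bar> * fcoeff (\<lambda>x. complex_of_real (w x $ j)) k
      = fcoeff (\<lambda>x. complex_of_real (half_gradient_sq w x * w x $ j)) k - fcoeff (\<lambda>x. complex_of_real (z x $ j)) k" for j k
  proof -
    have m: "mode k (\<lambda>x. cos (of_int k * x))" "mode k (\<lambda>x. sin (of_int k * x))" by (auto simp: mode_def)
    note e = eq[OF m(1), of j] eq[OF m(2), of j]
    have "2 * pi * (of_real \<bar>of_int k\<bar> * fcoeff (\<lambda>x. complex_of_real (w x $ j)) k)
      = of_real \<bar>of_int k\<bar> * (2 * pi * fcoeff (\<lambda>x. complex_of_real (w x $ j)) k)" by simp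
    also have "\<dots> = 2 * pi * fcoeff (\<lambda>x. complex_of_real (half_gradient_sq w x * w x $ j)) k - 2 * pi * fcoeff (\<lambda>x. complex_of_real (z x $ j)) k"
      unfolding fcoeff_real[OF ri[OF comp(1)]] fcoeff_real[OF ri[OF comp(2)]] fcoeff_real[OF Gw]
      using e by (simp add: complex_eq_iff mult.assoc algebra_simps)
    finally have "2 * pi * (of_real \<bar>of_int k\<bar> * fcoeff (\<lambda>x. complex_of_real (w x $ j)) k)
      = 2 * pi * (fcoeff (\<lambda>x. complex_of_real (half_gradient_sq w x * w x $ j)) k - fcoeff (\<lambda>x. complex_of_real (z x $ j)) k)"
      by (simp add: right_diff_distrib)
    then show ?thesis by simp
  qed
  have neg: "fcoeff (\<lambda>x. complex_of_real ((- z x) $ j)) k = - fcoeff (\<lambda>x. complex_of_real (z x $ j)) k" for j k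
    by (simp add: fcoeff_def)
  interpret perturbed_half_harmonic v "\<lambda>x. - z x"
  proof
    show "v \<in> borel_measurable circle" by (rule vm)
    show "norm (v x) = 1" for x by (rule v)
    show "sq_integrable circle (\<lambda>x. complex_of_real ((- z x) $ j))" for j
      using sq_integrable_cmult[OF comp(2), of "-1" j] by simp
    show "(\<lambda>k. \<bar>of_int k\<bar> * (cmod (fcoeff (\<lambda>x. complex_of_real (v x $ j)) k))\<^sup>2) summable_on UNIV" for j
      unfolding fc by (rule sobolev_half_energy(1)[OF w])
    show "complex_of_real \<bar>of_int k\<bar> * fcoeff (\<lambda>x. complex_of_real (v x $ j)) k
      = fcoeff (\<lambda>x. complex_of_real (half_gradient_sq v x) * complex_of_real (v x $ j)) k + fcoeff (\<lambda>x. complex_of_real ((- z x) $ j)) k" for j k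
      unfolding fc GG neg main by simp
  qed
  have s1: "(\<lambda>k. (of_int k)\<^sup>2 * (cmod (fcoeff (\<lambda>x. complex_of_real (w x $ j)) k))\<^sup>2) summable_on UNIV" for j
    using H1_summable[of j] by (simp add: U_def[abs_def] fc)
  have sums: "(\<lambda>k. \<Sum>j\<in>A. g j k) summable_on UNIV"
    if "finite A" "\<And>j. g j summable_on UNIV" for A :: "'n set" and g :: "'n \<Rightarrow> int \<Rightarrow> real"
    using that(1) by induction (auto intro!: summable_on_add that(2))
  have "(\<lambda>k. \<Sum>j\<in>UNIV. (cmod (fcoeff (\<lambda>x. complex_of_real (w x $ j)) k))\<^sup>2
      + (of_int k)\<^sup>2 * (cmod (fcoeff (\<lambda>x. complex_of_real (w x $ j)) k))\<^sup>2) summable_on UNIV"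
    by (intro sums summable_on_add Bessel_summable comp s1) simp
  moreover have "(\<Sum>j\<in>UNIV. (cmod (fcoeff (\<lambda>x. complex_of_real (w x $ j)) k))\<^sup>2
      + (of_int k)\<^sup>2 * (cmod (fcoeff (\<lambda>x. complex_of_real (w x $ j)) k))\<^sup>2) = (1 + (of_int k)\<^sup>2) powr 1 * (norm (fourier_coeff w k))\<^sup>2" for k
    unfolding norm_fourier_coeff by (simp add: sum.distrib sum_distrib_left distrib_right add_nonneg_nonneg)
  ultimately show ?thesis using wL by (simp add: sobolev_def)
qed

lemma space_half_line [simp]: "space half_line = {0<..}"
  by (simp add: half_line_def)

text \<open>The half-line has infinite measure, so a constant bound becomes integrable only after
  restriction to a bounded interval.\<close>

lemma integrable_half_line_indicator:
  fixes g X :: "real \<Rightarrow> real"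
  assumes g: "g \<in> borel_measurable half_line" and X: "integrable half_line X"
    and le: "AE t in half_line. \<bar>g t\<bar> \<le> K + X t"
  shows "integrable half_line (\<lambda>t. indicator {a<..<b} t * g t)"
proof (rule Bochner_Integration.integrable_bound)
  have ind: "integrable half_line (indicator {a<..<b} :: real \<Rightarrow> real)"
  proof -
    have "integrable lborel (\<lambda>t. indicator ({a<..<b} \<inter> {0<..}) t :: real)"
      by (rule integrable_real_indicator) (auto intro!: emeasure_bounded_finite[simplified] bounded_Int)
    then have "integrable lebesgue (\<lambda>t. indicator ({a<..<b} \<inter> {0<..}) t :: real)"
      by (subst integrable_completion) auto
    then show ?thesis
      unfolding half_line_def by (subst integrable_restrict_space) (auto simp: indicator_inter_arith mult.commute)
  qed
  show "integrable half_line (\<lambda>t. \<bar>K\<bar> * indicator {a<..<b} t + \<bar>X t\<bar>)"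
    using ind X by simp
  show "(\<lambda>t. indicator {a<..<b} t * g t) \<in> borel_measurable half_line"
    using g borel_measurable_integrable[OF ind] by simp
  show "AE t in half_line. norm (indicator {a<..<b} t * g t) \<le> norm (\<bar>K\<bar> * indicator {a<..<b} t + \<bar>X t\<bar>)"
    using le by eventually_elim (auto split: split_indicator)
qed

theorem proposition1p1:
  fixes u ut :: "real \<Rightarrow> real \<Rightarrow> real ^ 'n"
  assumes "CARD('n) \<ge> 2"
    and "AE (t, x) in space_time. u t x \<in> sphere 0 1"
    and "u \<in> Linf_sobolev (1/2)"
    and "weak_time_derivative u ut"
    and "ut \<in> L2_L2"
    and "half_harmonic_flow u ut"
  shows "AE t in half_line. u t \<in> sobolev 1"
proof -
  obtain C where uC: "AE t in half_line. u t \<in> sobolev (1/2) \<and> sobolev_norm (1/2) (u t) \<le> C"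
    and um: "case_prod u \<in> borel_measurable space_time"
    using assms(3) by (auto simp: Linf_sobolev_def)
  have utL: "AE t in half_line. ut t \<in> L2_circle" and utm: "case_prod ut \<in> borel_measurable space_time"
    and uti: "integrable half_line (\<lambda>t. LINT x|circle. (norm (ut t x))\<^sup>2)"
    using assms(5) by (auto simp: L2_L2_def)
  obtain u0 where u0: "u0 \<in> borel_measurable borel" "AE t in half_line. AE x in circle. u t x = u0 (t, x)"
    using borel_representative[OF um] by blast
  obtain z where z: "z \<in> borel_measurable borel" "AE t in half_line. AE x in circle. ut t x = z (t, x)"
    using borel_representative[OF utm] by blast
  \<comment> \<open>A fixed unit vector replaces the values off the sphere: \<open>w\<close> stays
    Borel, has length 1 everywhere, and still represents \<open>u\<close>.\<close>
  define w where "w p = (if norm (u0 p) = 1 then u0 p else axis undefined 1)" for p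
  have w_unit: "norm (w p) = 1" for p by (simp add: w_def)
  have wm: "w \<in> borel_measurable borel" unfolding w_def[abs_def] using u0(1) by measurable
  have uw: "AE t in half_line. AE x in circle. u t x = w (t, x)"
  proof -
    have "AE p in space_time. norm (u (fst p) (snd p)) = 1"
      using assms(2) by eventually_elim (auto simp: case_prod_unfold)
    from u0(2) AE_space_time[OF this] show ?thesis
    proof eventually_elim
      case (elim t)
      then show ?case by eventually_elim (simp add: w_def)
    qed
  qed
  have wtm: "(\<lambda>x. w (t, x)) \<in> borel_measurable circle" for t
    by (rule borel_measurable_circle) (use wm in measurable)
  have utm': "AE t in half_line. u t \<in> borel_measurable circle"
    using uC by eventually_elim (auto simp: sobolev_def L2_circle_def)
  let ?e = "\<lambda>t x y. (norm (w (t, x) - w (t, y)))\<^sup>2 / (circle_dist x y)\<^sup>2"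
  \<comment> \<open>For the Borel representative the half gradient is an integral with parameters
    (t, x), hence jointly Borel.\<close>
  have Gm: "(\<lambda>p. half_gradient_sq (\<lambda>x. w (fst p, x)) (snd p)) \<in> borel_measurable (borel :: (real \<times> real) measure)"
  proof -
    have "(\<lambda>q. ?e (fst (fst q)) (snd (fst q)) (snd q)) \<in> borel_measurable ((borel :: (real \<times> real) measure) \<Otimes>\<^sub>M borel)"
    proof -
      have w1: "(\<lambda>q. w (fst (fst q), snd (fst q))) \<in> borel_measurable (borel :: ((real \<times> real) \<times> real) measure)"
        by (rule measurable_compose[OF _ wm], rule borel_measurable_continuous_onI) (intro continuous_intros)
      have w2: "(\<lambda>q. w (fst (fst q), snd q)) \<in> borel_measurable (borel :: ((real \<times> real) \<times> real) measure)"
        by (rule measurable_compose[OF _ wm], rule borel_measurable_continuous_onI) (intro continuous_intros)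
      have d: "(\<lambda>q. circle_dist (snd (fst q)) (snd q)) \<in> borel_measurable (borel :: ((real \<times> real) \<times> real) measure)"
        unfolding circle_dist_def by (rule borel_measurable_continuous_onI) (intro continuous_intros, auto)
      show ?thesis unfolding borel_prod using w1 w2 d by measurable
    qed
    from borel_measurable_circle_integral[OF this]
    have "(\<lambda>p. LINT y|circle. ?e (fst p) (snd p) y) \<in> borel_measurable (borel :: (real \<times> real) measure)" by simp
    then show ?thesis unfolding half_gradient_sq_def by simp
  qed
  have hg: "half_gradient_sq (u t) x = half_gradient_sq (\<lambda>x. w (t, x)) x"
    if "AE x in circle. u t x = w (t, x)" "u t \<in> borel_measurable circle" "u t x = w (t, x)" for t x
  proof -
    have xb: "(\<lambda>y. circle_dist x y) \<in> borel_measurable circle" unfolding circle_dist_def by measurable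
    have "(LINT y|circle. (norm (u t x - u t y))\<^sup>2 / (circle_dist x y)\<^sup>2) = (LINT y|circle. ?e t x y)"
    proof (rule integral_cong_AE)
      show "AE y in circle. (norm (u t x - u t y))\<^sup>2 / (circle_dist x y)\<^sup>2 = ?e t x y"
        using that(1) by eventually_elim (simp add: that(3))
      show "(\<lambda>y. (norm (u t x - u t y))\<^sup>2 / (circle_dist x y)\<^sup>2) \<in> borel_measurable circle"
        using that(2) xb by measurable
      show "(\<lambda>y. ?e t x y) \<in> borel_measurable circle" using wtm[of t] xb by measurable
    qed
    then show ?thesis by (simp add: half_gradient_sq_def)
  qed
  \<comment> \<open>One mode and one component at a time: the two sides are functions of
    \<open>t\<close> with equal integrals against every bump.\<close>
  have equation: "AE t in half_line. (LINT x|circle. ut t x $ i * c x) + \<bar>of_int k\<bar> * (LINT x|circle. u t x $ i * c x)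
      = (LINT x|circle. half_gradient_sq (u t) x * (u t x $ i * c x))"
    if c: "mode k c" for i k c
  proof -
    define p where "p t = (LINT x|circle. ut t x $ i * c x) + \<bar>of_int k\<bar> * (LINT x|circle. u t x $ i * c x)" for t
    define r where "r t = (LINT x|circle. half_gradient_sq (u t) x * (u t x $ i * c x))" for t
    define X where "X t = (LINT x|circle. (norm (ut t x))\<^sup>2)" for t
    have cb: "c \<in> borel_measurable borel" by (rule borel_measurable_continuous_onI[OF mode_continuous[OF c]])
    have cs: "(\<lambda>p. c (snd p)) \<in> borel_measurable (borel :: (real \<times> real) measure)"
      by (rule measurable_compose[OF borel_measurable_continuous_onI cb]) (intro continuous_intros)
    have cm: "c \<in> borel_measurable circle" by (rule mode_measurable[OF c])
    have wi: "(\<lambda>p. w p $ i) \<in> borel_measurable borel" and zi: "(\<lambda>p. z p $ i) \<in> borel_measurable borel"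
      by (rule borel_measurable_component, rule wm, rule borel_measurable_component, rule z(1))
    have p_meas: "p \<in> borel_measurable half_line"
    proof (rule measurable_half_line_AE_cong)
      have m1: "(\<lambda>t. LINT x|circle. z (t, x) $ i * c x) \<in> borel_measurable borel"
        by (rule borel_measurable_circle_integral[where h = "\<lambda>p. z p $ i * c (snd p)", simplified])
           (use zi cs in \<open>simp add: borel_prod\<close>)
      have m2: "(\<lambda>t. LINT x|circle. w (t, x) $ i * c x) \<in> borel_measurable borel"
        by (rule borel_measurable_circle_integral[where h = "\<lambda>p. w p $ i * c (snd p)", simplified])
           (use wi cs in \<open>simp add: borel_prod\<close>)
      show "(\<lambda>t. (LINT x|circle. z (t, x) $ i * c x) + \<bar>of_int k\<bar> * (LINT x|circle. w (t, x) $ i * c x)) \<in> borel_measurable half_line"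
        by (rule borel_measurable_half_line) (use m1 m2 in simp)
      show "AE t in half_line. (LINT x|circle. z (t, x) $ i * c x) + \<bar>of_int k\<bar> * (LINT x|circle. w (t, x) $ i * c x) = p t"
        using z(2) uw utm' utL
      proof eventually_elim
        case (elim t)
        have ztm: "(\<lambda>x. z (t, x) $ i) \<in> borel_measurable circle"
          by (rule borel_measurable_circle) (use zi in measurable)
        have wtm: "(\<lambda>x. w (t, x) $ i) \<in> borel_measurable circle"
          by (rule borel_measurable_circle) (use wi in measurable)
        have um: "(\<lambda>x. u t x $ i) \<in> borel_measurable circle" "(\<lambda>x. ut t x $ i) \<in> borel_measurable circle"
          using elim by (auto intro!: borel_measurable_component simp: L2_circle_def)
        have "(LINT x|circle. z (t, x) $ i * c x) = (LINT x|circle. ut t x $ i * c x)"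
          by (rule integral_cong_AE) (use ztm um cm elim(1) in \<open>auto elim: eventually_mono\<close>)
        moreover have "(LINT x|circle. w (t, x) $ i * c x) = (LINT x|circle. u t x $ i * c x)"
          by (rule integral_cong_AE) (use wtm um cm elim(2) in \<open>auto elim: eventually_mono\<close>)
        ultimately show ?case by (simp add: p_def)
      qed
    qed
    have r_meas: "r \<in> borel_measurable half_line"
    proof (rule measurable_half_line_AE_cong)
      have m1: "(\<lambda>t. LINT x|circle. half_gradient_sq (\<lambda>x. w (t, x)) x * (w (t, x) $ i * c x)) \<in> borel_measurable borel"
        by (rule borel_measurable_circle_integral[where h = "\<lambda>p. half_gradient_sq (\<lambda>x. w (fst p, x)) (snd p) * (w p $ i * c (snd p))", simplified])
           (use Gm wi cs in \<open>simp add: borel_prod\<close>)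
      then show "(\<lambda>t. LINT x|circle. half_gradient_sq (\<lambda>x. w (t, x)) x * (w (t, x) $ i * c x)) \<in> borel_measurable half_line"
        by (rule borel_measurable_half_line)
      show "AE t in half_line. (LINT x|circle. half_gradient_sq (\<lambda>x. w (t, x)) x * (w (t, x) $ i * c x)) = r t"
        using uw utm' uC
      proof eventually_elim
        case (elim t)
        have wtm: "(\<lambda>x. w (t, x) $ i) \<in> borel_measurable circle"
          by (rule borel_measurable_circle) (use wi in measurable)
        have um: "(\<lambda>x. u t x $ i) \<in> borel_measurable circle" using elim by (auto intro!: borel_measurable_component)
        have gw: "(\<lambda>x. half_gradient_sq (\<lambda>x. w (t, x)) x) \<in> borel_measurable circle"
          by (rule borel_measurable_circle) (use measurable_compose[OF _ Gm, of "\<lambda>x. (t, x)" borel] in simp)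
        have gu: "half_gradient_sq (u t) \<in> borel_measurable circle"
          using half_gradient_sq_integrable(1)[of "u t"] elim by auto
        have "(LINT x|circle. half_gradient_sq (\<lambda>x. w (t, x)) x * (w (t, x) $ i * c x)) = (LINT x|circle. half_gradient_sq (u t) x * (u t x $ i * c x))"
        proof (rule integral_cong_AE)
          show "AE x in circle. half_gradient_sq (\<lambda>x. w (t, x)) x * (w (t, x) $ i * c x) = half_gradient_sq (u t) x * (u t x $ i * c x)"
            using elim(1) by eventually_elim (simp add: hg[OF elim(1,2)])
        qed (use gw gu wtm um cm in auto)
        then show ?case by (simp add: r_def)
      qed
    qed
    \<comment> \<open>\<open>u\<close> has length 1 and bounded energy, so it contributes constants;
      the time derivative contributes the integrable \<open>X\<close>, through a <= 1 + a^2.\<close>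
    have bounds: "AE t in half_line. \<bar>p t\<bar> \<le> (2 * pi + \<bar>of_int k\<bar> * (2 * pi)) + X t \<and> \<bar>r t\<bar> \<le> 2 * pi * CARD('n) * C\<^sup>2 + X t"
      using uw utm' utL uC
    proof eventually_elim
      case (elim t)
      have um: "(\<lambda>x. u t x $ i) \<in> borel_measurable circle" "(\<lambda>x. ut t x $ i) \<in> borel_measurable circle"
        using elim by (auto intro!: borel_measurable_component simp: L2_circle_def)
      have sq: "integrable circle (\<lambda>x. (norm (ut t x))\<^sup>2)" using elim by (simp add: L2_circle_def)
      have X0: "0 \<le> X t" by (simp add: X_def)
      have u1: "AE x in circle. \<bar>u t x $ i * c x\<bar> \<le> 1"
        using elim(1)
      proof eventually_elim
        case (elim x)
        have "\<bar>u t x $ i\<bar> \<le> 1" using component_le_norm_cart[of "w (t, x)" i] w_unit elim by simp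
        then have "\<bar>u t x $ i\<bar> * \<bar>c x\<bar> \<le> 1" using mode_le[OF c, of x] by (intro mult_le_one) auto
        then show ?case by (simp add: abs_mult)
      qed
      have "\<bar>LINT x|circle. u t x $ i * c x\<bar> \<le> (LINT x|circle. 1)"
        by (rule order_trans[OF integral_abs_bound integral_mono_AE'])
           (use u1 in auto)
      then have b1: "\<bar>LINT x|circle. u t x $ i * c x\<bar> \<le> 2 * pi" using measure_circle by simp
      have "\<bar>LINT x|circle. ut t x $ i * c x\<bar> \<le> (LINT x|circle. 1 + (norm (ut t x))\<^sup>2)"
      proof (rule order_trans[OF integral_abs_bound integral_mono_AE'])
        show "AE x in circle. \<bar>ut t x $ i * c x\<bar> \<le> 1 + (norm (ut t x))\<^sup>2"
        proof (rule AE_I2)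
          fix x
          have "\<bar>ut t x $ i\<bar> * \<bar>c x\<bar> \<le> norm (ut t x) * 1"
            by (intro mult_mono component_le_norm_cart mode_le[OF c]) auto
          also have "\<dots> \<le> 1 + (norm (ut t x))\<^sup>2"
            using sum_squares_bound[of 1 "norm (ut t x)"] norm_ge_zero[of "ut t x"]
            unfolding power2_eq_square by linarith
          finally show "\<bar>ut t x $ i * c x\<bar> \<le> 1 + (norm (ut t x))\<^sup>2" by (simp add: abs_mult)
        qed
      qed (use sq in auto)
      also have "\<dots> = 2 * pi + X t" using sq measure_circle by (simp add: X_def)
      finally have b2: "\<bar>LINT x|circle. ut t x $ i * c x\<bar> \<le> 2 * pi + X t" .
      have "\<bar>of_int k\<bar> * \<bar>LINT x|circle. u t x $ i * c x\<bar> \<le> \<bar>of_int k\<bar> * (2 * pi)"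
        by (intro mult_left_mono b1) simp
      then have pb: "\<bar>p t\<bar> \<le> (2 * pi + \<bar>of_int k\<bar> * (2 * pi)) + X t"
        unfolding p_def using b2 abs_triangle_ineq[of "LINT x|circle. ut t x $ i * c x" "\<bar>of_int k\<bar> * (LINT x|circle. u t x $ i * c x)"]
        by (simp add: abs_mult)
      have "\<bar>r t\<bar> \<le> (LINT x|circle. half_gradient_sq (u t) x)"
        unfolding r_def
      proof (rule order_trans[OF integral_abs_bound integral_mono_AE'])
        show "integrable circle (half_gradient_sq (u t))" using elim by (intro half_gradient_sq_integrable) auto
        have nn: "0 \<le> half_gradient_sq (u t) x" for x by (simp add: half_gradient_sq_def)
        show "AE x in circle. \<bar>half_gradient_sq (u t) x * (u t x $ i * c x)\<bar> \<le> half_gradient_sq (u t) x"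
          using u1 by eventually_elim (simp add: abs_mult[of "half_gradient_sq _ _"] nn mult_right_le_one_le)
      qed (auto simp: half_gradient_sq_def)
      also have "\<dots> \<le> 2 * pi * CARD('n) * (sobolev_norm (1/2) (u t))\<^sup>2"
        using elim by (intro half_gradient_sq_integrable) auto
      also have "\<dots> \<le> 2 * pi * CARD('n) * C\<^sup>2"
        using elim by (intro mult_left_mono power_mono) (auto simp: sobolev_norm_def intro!: infsum_nonneg)
      finally show ?case using pb X0 by linarith
    qed
    have X: "integrable half_line X" unfolding X_def[abs_def] by (rule uti)
    have pi: "integrable half_line (\<lambda>t. indicator {a<..<b} t * p t)" for a b
      by (rule integrable_half_line_indicator[OF p_meas X, of "2 * pi + \<bar>of_int k\<bar> * (2 * pi)"]) (use bounds in eventually_elim, simp)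
    have ri: "integrable half_line (\<lambda>t. indicator {a<..<b} t * r t)" for a b
      by (rule integrable_half_line_indicator[OF r_meas X, of "2 * pi * CARD('n) * C\<^sup>2"]) (use bounds in eventually_elim, simp)
    have bump_int: "integrable half_line (\<lambda>t. bump a b n t * g t)"
      if "integrable half_line (\<lambda>t. indicator {a<..<b} t * g t)" for a b n and g :: "real \<Rightarrow> real"
    proof -
      have eq: "bump a b n t * g t = bump a b n t * (indicator {a<..<b} t * g t)" for t
        by (cases "t \<in> {a<..<b}") (auto simp: bump_outside)
      show ?thesis
        unfolding eq
      proof (rule Bochner_Integration.integrable_bound[OF that])
        show "(\<lambda>t. bump a b n t * (indicator {a<..<b} t * g t)) \<in> borel_measurable half_line"
          using borel_measurable_half_line[OF borel_measurable_continuous_onI[OF continuous_bump]] borel_measurable_integrable[OF that] by simp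
        show "AE t in half_line. norm (bump a b n t * (indicator {a<..<b} t * g t)) \<le> norm (indicator {a<..<b} t * g t)"
          unfolding norm_mult using bump_bounds[of a b n] by (intro AE_I2 mult_left_le_one_le) auto
      qed
    qed
    have weak: "(LINT t|half_line. bump a b n t * p t) = (LINT t|half_line. bump a b n t * r t)" if ab: "0 < a" "a \<le> b" for a b n
    proof -
      let ?\<phi> = "\<lambda>t x. (bump a b n t * c x) *\<^sub>R axis i 1 :: real ^ 'n"
      have "test_function ?\<phi>"
        by (rule test_function_bump[OF mode_smooth[OF c] mode_periodic[OF c] ab])
      with assms(6) have flow: "(LINT t|half_line. LINT x|circle.
           ut t x \<bullet> ?\<phi> t x + frac_laplacian (1/4) (u t) x \<bullet> frac_laplacian (1/4) (?\<phi> t) x) =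
        (LINT t|half_line. LINT x|circle. half_gradient_sq (u t) x *\<^sub>R u t x \<bullet> ?\<phi> t x)"
        by (simp only: half_harmonic_flow_def)
      \<comment> \<open>Besides the value, this gives measurability in \<open>t\<close> of the right
        side, whose integrand contains representatives chosen separately at each time.\<close>
      have ae: "AE t in half_line. bump a b n t * p t = (LINT x|circle.
           ut t x \<bullet> ?\<phi> t x + frac_laplacian (1/4) (u t) x \<bullet> frac_laplacian (1/4) (?\<phi> t) x)"
        using uC utL by eventually_elim (subst weak_form_mode[OF c], auto simp: p_def)
      have m: "(\<lambda>t. bump a b n t * p t) \<in> borel_measurable half_line"
        using borel_measurable_half_line[OF borel_measurable_continuous_onI[OF continuous_bump]] p_meas by simp
      have "(LINT t|half_line. bump a b n t * p t) = (LINT t|half_line. LINT x|circle.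
           ut t x \<bullet> ?\<phi> t x + frac_laplacian (1/4) (u t) x \<bullet> frac_laplacian (1/4) (?\<phi> t) x)"
        by (rule integral_cong_AE[OF m measurable_half_line_AE_cong[OF m ae] ae])
      also have "\<dots> = (LINT t|half_line. bump a b n t * r t)"
        unfolding flow
      proof (intro Bochner_Integration.integral_cong refl)
        fix t
        have "(LINT x|circle. half_gradient_sq (u t) x *\<^sub>R u t x \<bullet> ?\<phi> t x)
          = (LINT x|circle. bump a b n t * (half_gradient_sq (u t) x * (u t x $ i * c x)))"
          by (intro Bochner_Integration.integral_cong) (auto simp: inner_axis)
        then show "(LINT x|circle. half_gradient_sq (u t) x *\<^sub>R u t x \<bullet> ?\<phi> t x) = bump a b n t * r t"
          by (simp add: r_def)
      qed
      finally show ?thesis .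
    qed
    have "AE t in half_line. p t - r t = 0"
    proof (rule AE_zero_if_bump_integrals_zero)
      fix a b :: real and n assume ab: "0 < a" "a \<le> b"
      show "integrable half_line (\<lambda>t. indicator {a<..<b} t * (p t - r t))"
        unfolding right_diff_distrib by (intro Bochner_Integration.integrable_diff pi ri)
      show "(LINT t|half_line. bump a b n t * (p t - r t)) = 0"
        unfolding right_diff_distrib
        by (subst Bochner_Integration.integral_diff[OF bump_int[OF pi] bump_int[OF ri]]) (simp add: weak[OF ab])
    qed
    then show ?thesis unfolding p_def r_def by eventually_elim simp
  qed
  \<comment> \<open>The exceptional null set depends on mode and component, of which there are
    countably many.\<close>
  have "AE t in half_line. \<forall>k. \<forall>i. (LINT x|circle. ut t x $ i * cos (of_int k * x)) + \<bar>of_int k\<bar> * (LINT x|circle. u t x $ i * cos (of_int k * x))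
      = (LINT x|circle. half_gradient_sq (u t) x * (u t x $ i * cos (of_int k * x)))
    \<and> (LINT x|circle. ut t x $ i * sin (of_int k * x)) + \<bar>of_int k\<bar> * (LINT x|circle. u t x $ i * sin (of_int k * x))
      = (LINT x|circle. half_gradient_sq (u t) x * (u t x $ i * sin (of_int k * x)))"
    unfolding AE_all_countable
    by (intro allI AE_conjI equation) (auto simp: mode_def)
  with uw uC utL show ?thesis
  proof eventually_elim
    case (elim t)
    show "u t \<in> sobolev 1"
    proof (rule H1_at_fixed_time)
      show "u t \<in> sobolev (1/2)" "ut t \<in> L2_circle" using elim by auto
      show "norm (w (t, x)) = 1" for x by (rule w_unit)
      show "AE x in circle. u t x = w (t, x)" by (rule elim)
      show "(\<lambda>x. w (t, x)) \<in> borel_measurable circle" by (rule wtm)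
      show "(LINT x|circle. ut t x $ i * c x) + \<bar>of_int k\<bar> * (LINT x|circle. u t x $ i * c x)
        = (LINT x|circle. half_gradient_sq (u t) x * (u t x $ i * c x))" if "mode k c" for k c i
        using that elim(4) by (auto simp: mode_def)
    qed
  qed
qed

end
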